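(* If the theory $\mathsf{ZFC}+\mathsf{GCH}+$ "there is a strongly compact cardinal" is consistent, then the theory $\mathsf{ZF}+$ "$\aleph_\omega$ is the least cardinal not in $\mathcal{U}$" $+$ "every singular cardinal $>\aleph_\omega$ with countable cofinality is in $\mathcal{U}$" is consistent, where $\mathcal{U}$ is the class of all infinite cardinals which carry a uniform ultrafilter.
   Context: The ambient theory of the conclusion is $\mathsf{ZF}$ (no Axiom of Choice). "Cardinal" here means an infinite initial ordinal (an aleph). A proper ultrafilter $U$ over an infinite cardinal $\kappa$ is uniform if every element of $U$ has cardinality $\kappa$. $\mathcal{U}$ denotes the class of all infinite cardinals $\kappa$ such that there is a uniform ultrafilter over $\kappa$. Strongly compact cardinals are taken to be uncountable. *)

theory Defs
  imports Main
begin

section \<open>First-order logic over the signature with equality and membership\<close>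

text \<open>Formulas use de Bruijn indices; as the signature has no function symbols, the only terms are
  variables. The remaining connectives are the usual classical abbreviations, see below.\<close>

datatype fm =
    Falsum
  | Memb nat nat
  | Equal nat nat
  | Imp fm fm
  | Forall fm

fun lift_ren :: "(nat \<Rightarrow> nat) \<Rightarrow> nat \<Rightarrow> nat" where
  "lift_ren r 0 = 0"
| "lift_ren r (Suc i) = Suc (r i)"

fun rename :: "(nat \<Rightarrow> nat) \<Rightarrow> fm \<Rightarrow> fm" where
  "rename r Falsum = Falsum"
| "rename r (Memb i j) = Memb (r i) (r j)"
| "rename r (Equal i j) = Equal (r i) (r j)"
| "rename r (Imp A B) = Imp (rename r A) (rename r B)"
| "rename r (Forall A) = Forall (rename (lift_ren r) A)"

fun fv :: "fm \<Rightarrow> nat set" where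
  "fv Falsum = {}"
| "fv (Memb i j) = {i, j}"
| "fv (Equal i j) = {i, j}"
| "fv (Imp A B) = fv A \<union> fv B"
| "fv (Forall A) = {i. Suc i \<in> fv A}"

text \<open>Replace variable 0 by the term \<open>t\<close> and lower the other free variables by one.\<close>

definition subst0 :: "nat \<Rightarrow> fm \<Rightarrow> fm" where
  "subst0 t A = rename (case_nat t id) A"

text \<open>Natural deduction for classical first-order logic with equality. In \<open>AllI\<close>, shifting the
  hypotheses makes 0 the eigenvariable.\<close>

inductive derives :: "fm set \<Rightarrow> fm \<Rightarrow> bool" (infix "\<turnstile>" 50) where
  Assm: "A \<in> \<Gamma> \<Longrightarrow> \<Gamma> \<turnstile> A"
| ImpI: "insert A \<Gamma> \<turnstile> B \<Longrightarrow> \<Gamma> \<turnstile> Imp A B"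
| ImpE: "\<Gamma> \<turnstile> Imp A B \<Longrightarrow> \<Gamma> \<turnstile> A \<Longrightarrow> \<Gamma> \<turnstile> B"
| RAA: "insert (Imp A Falsum) \<Gamma> \<turnstile> Falsum \<Longrightarrow> \<Gamma> \<turnstile> A"
| AllI: "rename Suc ` \<Gamma> \<turnstile> A \<Longrightarrow> \<Gamma> \<turnstile> Forall A"
| AllE: "\<Gamma> \<turnstile> Forall A \<Longrightarrow> \<Gamma> \<turnstile> subst0 t A"
| EqRefl: "\<Gamma> \<turnstile> Equal t t"
| EqSubst: "\<Gamma> \<turnstile> Equal s t \<Longrightarrow> \<Gamma> \<turnstile> subst0 s A \<Longrightarrow> \<Gamma> \<turnstile> subst0 t A"

definition consistent :: "fm set \<Rightarrow> bool" where
  "consistent T \<longleftrightarrow> \<not> T \<turnstile> Falsum"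


section \<open>Notation for writing formulas with bound variables\<close>

text \<open>To write concrete formulas with named bound variables, a variable is represented by its
  de Bruijn \<^emph>\<open>level\<close> (the number of quantifiers enclosing its binder), and an expression of type
  \<open>form\<close> yields a formula when given the number of quantifiers enclosing that expression.
  Levels are turned into indices at the atoms. An expression without free variables denotes
  a sentence, obtained at depth 0.\<close>

type_synonym var = nat
type_synonym form = "nat \<Rightarrow> fm"

definition mem :: "var \<Rightarrow> var \<Rightarrow> form" (infix "\<^bold>\<in>" 50) where
  "x \<^bold>\<in> y = (\<lambda>n. Memb (n - Suc x) (n - Suc y))"

definition equ :: "var \<Rightarrow> var \<Rightarrow> form" (infix "\<^bold>=" 50) where
  "x \<^bold>= y = (\<lambda>n. Equal (n - Suc x) (n - Suc y))"

definition neg :: "form \<Rightarrow> form" ("\<^bold>\<not> _" [40] 40) where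
  "(\<^bold>\<not> A) = (\<lambda>n. Imp (A n) Falsum)"

definition imp :: "form \<Rightarrow> form \<Rightarrow> form" (infixr "\<^bold>\<longrightarrow>" 25) where
  "(A \<^bold>\<longrightarrow> B) = (\<lambda>n. Imp (A n) (B n))"

definition conj :: "form \<Rightarrow> form \<Rightarrow> form" (infixr "\<^bold>\<and>" 35) where
  "(A \<^bold>\<and> B) = (\<^bold>\<not> (A \<^bold>\<longrightarrow> \<^bold>\<not> B))"

definition disj :: "form \<Rightarrow> form \<Rightarrow> form" (infixr "\<^bold>\<or>" 30) where
  "(A \<^bold>\<or> B) = (\<^bold>\<not> A \<^bold>\<longrightarrow> B)"

definition iff :: "form \<Rightarrow> form \<Rightarrow> form" (infix "\<^bold>\<longleftrightarrow>" 25) where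
  "(A \<^bold>\<longleftrightarrow> B) = ((A \<^bold>\<longrightarrow> B) \<^bold>\<and> (B \<^bold>\<longrightarrow> A))"

definition all :: "(var \<Rightarrow> form) \<Rightarrow> form" (binder "\<^bold>\<forall>" 10) where
  "all F = (\<lambda>n. Forall (F n (Suc n)))"

definition ex :: "(var \<Rightarrow> form) \<Rightarrow> form" (binder "\<^bold>\<exists>" 10) where
  "ex F = (\<^bold>\<not> (\<^bold>\<forall>x. \<^bold>\<not> F x))"

definition sentence :: "form \<Rightarrow> fm" where
  "sentence F = F 0"

text \<open>For the axiom schemas: \<open>alls k F\<close> quantifies universally over a list of \<open>k\<close> parameters, and
  \<open>ap \<phi> vs\<close> is the formula \<open>\<phi>\<close> with its free variable \<open>i\<close> taken to be the \<open>i\<close>-th entry of \<open>vs\<close>.\<close>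

fun alls :: "nat \<Rightarrow> (var list \<Rightarrow> form) \<Rightarrow> form" where
  "alls 0 F = F []"
| "alls (Suc k) F = (\<^bold>\<forall>p. alls k (\<lambda>ps. F (p # ps)))"

definition ap :: "fm \<Rightarrow> var list \<Rightarrow> form" where
  "ap \<phi> vs = (\<lambda>n. rename (\<lambda>i. n - Suc (vs ! i)) \<phi>)"


section \<open>Basic set-theoretic vocabulary\<close>

definition Subset :: "var \<Rightarrow> var \<Rightarrow> form" (infix "\<^bold>\<subseteq>" 50) where
  "x \<^bold>\<subseteq> y = (\<^bold>\<forall>z. z \<^bold>\<in> x \<^bold>\<longrightarrow> z \<^bold>\<in> y)"

definition Nonempty :: "var \<Rightarrow> form" where
  "Nonempty x = (\<^bold>\<exists>z. z \<^bold>\<in> x)"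

text \<open>\<open>p = {x, y}\<close>\<close>
definition UPair :: "var \<Rightarrow> var \<Rightarrow> var \<Rightarrow> form" where
  "UPair p x y = (\<^bold>\<forall>z. z \<^bold>\<in> p \<^bold>\<longleftrightarrow> z \<^bold>= x \<^bold>\<or> z \<^bold>= y)"

text \<open>\<open>p = {{x}, {x, y}}\<close>\<close>
definition OPair :: "var \<Rightarrow> var \<Rightarrow> var \<Rightarrow> form" where
  "OPair p x y = (\<^bold>\<exists>s. \<^bold>\<exists>t. UPair s x x \<^bold>\<and> UPair t x y \<^bold>\<and> UPair p s t)"

text \<open>\<open>u = \<Union>a\<close>\<close>
definition BigUnion :: "var \<Rightarrow> var \<Rightarrow> form" where
  "BigUnion u a = (\<^bold>\<forall>z. z \<^bold>\<in> u \<^bold>\<longleftrightarrow> (\<^bold>\<exists>x. x \<^bold>\<in> a \<^bold>\<and> z \<^bold>\<in> x))"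

text \<open>\<open>i = \<Inter>a\<close>; used only for nonempty \<open>a\<close>\<close>
definition BigInter :: "var \<Rightarrow> var \<Rightarrow> form" where
  "BigInter i a = (\<^bold>\<forall>z. z \<^bold>\<in> i \<^bold>\<longleftrightarrow> (\<^bold>\<forall>x. x \<^bold>\<in> a \<^bold>\<longrightarrow> z \<^bold>\<in> x))"

text \<open>\<open>i = x \<inter> y\<close>\<close>
definition Inter2 :: "var \<Rightarrow> var \<Rightarrow> var \<Rightarrow> form" where
  "Inter2 i x y = (\<^bold>\<forall>z. z \<^bold>\<in> i \<^bold>\<longleftrightarrow> z \<^bold>\<in> x \<^bold>\<and> z \<^bold>\<in> y)"

text \<open>\<open>d = x - y\<close>\<close>
definition SetDiff :: "var \<Rightarrow> var \<Rightarrow> var \<Rightarrow> form" where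
  "SetDiff d x y = (\<^bold>\<forall>z. z \<^bold>\<in> d \<^bold>\<longleftrightarrow> z \<^bold>\<in> x \<^bold>\<and> \<^bold>\<not> z \<^bold>\<in> y)"

text \<open>\<open>p\<close> is the power set of \<open>a\<close>\<close>
definition PowerSet :: "var \<Rightarrow> var \<Rightarrow> form" where
  "PowerSet p a = (\<^bold>\<forall>z. z \<^bold>\<in> p \<^bold>\<longleftrightarrow> z \<^bold>\<subseteq> a)"

text \<open>\<open>s = x \<union> {x}\<close>\<close>
definition Succ :: "var \<Rightarrow> var \<Rightarrow> form" where
  "Succ s x = (\<^bold>\<forall>z. z \<^bold>\<in> s \<^bold>\<longleftrightarrow> z \<^bold>\<in> x \<^bold>\<or> z \<^bold>= x)"

text \<open>\<open>f(x) = y\<close>, that is, \<open>(x, y) \<in> f\<close>\<close>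
definition Maps :: "var \<Rightarrow> var \<Rightarrow> var \<Rightarrow> form" where
  "Maps f x y = (\<^bold>\<exists>p. OPair p x y \<^bold>\<and> p \<^bold>\<in> f)"

text \<open>\<open>f\<close> is a function with domain \<open>a\<close>\<close>
definition FunOn :: "var \<Rightarrow> var \<Rightarrow> form" where
  "FunOn f a =
     ((\<^bold>\<forall>p. p \<^bold>\<in> f \<^bold>\<longrightarrow> (\<^bold>\<exists>x. \<^bold>\<exists>y. x \<^bold>\<in> a \<^bold>\<and> OPair p x y)) \<^bold>\<and>
      (\<^bold>\<forall>x. x \<^bold>\<in> a \<^bold>\<longrightarrow> (\<^bold>\<exists>y. Maps f x y)) \<^bold>\<and>
      (\<^bold>\<forall>x. \<^bold>\<forall>y. \<^bold>\<forall>z. Maps f x y \<^bold>\<and> Maps f x z \<^bold>\<longrightarrow> y \<^bold>= z))"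

definition FunTo :: "var \<Rightarrow> var \<Rightarrow> var \<Rightarrow> form" where
  "FunTo f a b = (FunOn f a \<^bold>\<and> (\<^bold>\<forall>x. \<^bold>\<forall>y. Maps f x y \<^bold>\<longrightarrow> y \<^bold>\<in> b))"

definition Bijection :: "var \<Rightarrow> var \<Rightarrow> var \<Rightarrow> form" where
  "Bijection f a b =
     (FunTo f a b \<^bold>\<and>
      (\<^bold>\<forall>x. \<^bold>\<forall>y. \<^bold>\<forall>z. Maps f x z \<^bold>\<and> Maps f y z \<^bold>\<longrightarrow> x \<^bold>= y) \<^bold>\<and>
      (\<^bold>\<forall>y. y \<^bold>\<in> b \<^bold>\<longrightarrow> (\<^bold>\<exists>x. Maps f x y)))"

definition Equinumerous :: "var \<Rightarrow> var \<Rightarrow> form" where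
  "Equinumerous a b = (\<^bold>\<exists>f. Bijection f a b)"


section \<open>The theories ZF and ZFC\<close>

definition Extensionality :: form where
  "Extensionality = (\<^bold>\<forall>x. \<^bold>\<forall>y. (\<^bold>\<forall>z. z \<^bold>\<in> x \<^bold>\<longleftrightarrow> z \<^bold>\<in> y) \<^bold>\<longrightarrow> x \<^bold>= y)"

definition Foundation :: form where
  "Foundation = (\<^bold>\<forall>x. Nonempty x \<^bold>\<longrightarrow> (\<^bold>\<exists>y. y \<^bold>\<in> x \<^bold>\<and> \<^bold>\<not> (\<^bold>\<exists>z. z \<^bold>\<in> y \<^bold>\<and> z \<^bold>\<in> x)))"

definition Pairing :: form where
  "Pairing = (\<^bold>\<forall>x. \<^bold>\<forall>y. \<^bold>\<exists>p. UPair p x y)"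

definition Union_Axiom :: form where
  "Union_Axiom = (\<^bold>\<forall>a. \<^bold>\<exists>u. BigUnion u a)"

definition Power_Set_Axiom :: form where
  "Power_Set_Axiom = (\<^bold>\<forall>a. \<^bold>\<exists>p. PowerSet p a)"

definition Inductive :: "var \<Rightarrow> form" where
  "Inductive w =
     ((\<^bold>\<exists>e. \<^bold>\<not> Nonempty e \<^bold>\<and> e \<^bold>\<in> w) \<^bold>\<and>
      (\<^bold>\<forall>x. x \<^bold>\<in> w \<^bold>\<longrightarrow> (\<^bold>\<exists>s. Succ s x \<^bold>\<and> s \<^bold>\<in> w)))"

definition Infinity :: form where
  "Infinity = (\<^bold>\<exists>w. Inductive w)"

definition Separation :: "nat \<Rightarrow> fm \<Rightarrow> form" where
  "Separation k \<phi> = alls k (\<lambda>ps. \<^bold>\<forall>a. \<^bold>\<exists>b. \<^bold>\<forall>x. x \<^bold>\<in> b \<^bold>\<longleftrightarrow> x \<^bold>\<in> a \<^bold>\<and> ap \<phi> (x # a # ps))"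

definition Replacement :: "nat \<Rightarrow> fm \<Rightarrow> form" where
  "Replacement k \<phi> = alls k (\<lambda>ps. \<^bold>\<forall>a.
     (\<^bold>\<forall>x. x \<^bold>\<in> a \<^bold>\<longrightarrow>
        (\<^bold>\<forall>y. \<^bold>\<forall>z. ap \<phi> (x # y # a # ps) \<^bold>\<and> ap \<phi> (x # z # a # ps) \<^bold>\<longrightarrow> y \<^bold>= z)) \<^bold>\<longrightarrow>
     (\<^bold>\<exists>b. \<^bold>\<forall>y. y \<^bold>\<in> b \<^bold>\<longleftrightarrow> (\<^bold>\<exists>x. x \<^bold>\<in> a \<^bold>\<and> ap \<phi> (x # y # a # ps))))"

definition ZF :: "fm set" where
  "ZF = sentence ` {Extensionality, Foundation, Pairing, Union_Axiom, Power_Set_Axiom, Infinity}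
      \<union> {sentence (Separation k \<phi>) | k \<phi>. fv \<phi> \<subseteq> {..<k + 2}}
      \<union> {sentence (Replacement k \<phi>) | k \<phi>. fv \<phi> \<subseteq> {..<k + 3}}"

definition Choice :: form where
  "Choice = (\<^bold>\<forall>a. (\<^bold>\<forall>x. x \<^bold>\<in> a \<^bold>\<longrightarrow> Nonempty x) \<^bold>\<longrightarrow>
     (\<^bold>\<exists>f. FunOn f a \<^bold>\<and> (\<^bold>\<forall>x. \<^bold>\<forall>y. Maps f x y \<^bold>\<longrightarrow> y \<^bold>\<in> x)))"

definition ZFC :: "fm set" where
  "ZFC = insert (sentence Choice) ZF"


section \<open>Ordinals and cardinals\<close>

definition Transitive :: "var \<Rightarrow> form" where
  "Transitive x = (\<^bold>\<forall>y. y \<^bold>\<in> x \<^bold>\<longrightarrow> y \<^bold>\<subseteq> x)"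

text \<open>By Foundation, an ordinal is a transitive set of transitive sets.\<close>
definition Ordinal :: "var \<Rightarrow> form" where
  "Ordinal x = (Transitive x \<^bold>\<and> (\<^bold>\<forall>y. y \<^bold>\<in> x \<^bold>\<longrightarrow> Transitive y))"

text \<open>\<open>w = \<omega>\<close>\<close>
definition Omega :: "var \<Rightarrow> form" where
  "Omega w = (Inductive w \<^bold>\<and> (\<^bold>\<forall>v. Inductive v \<^bold>\<longrightarrow> w \<^bold>\<subseteq> v))"

definition InitialOrdinal :: "var \<Rightarrow> form" where
  "InitialOrdinal \<kappa> = (Ordinal \<kappa> \<^bold>\<and> (\<^bold>\<forall>\<alpha>. \<alpha> \<^bold>\<in> \<kappa> \<^bold>\<longrightarrow> \<^bold>\<not> Equinumerous \<alpha> \<kappa>))"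

text \<open>Throughout, cardinals are infinite initial ordinals (alephs).\<close>
definition Cardinal :: "var \<Rightarrow> form" where
  "Cardinal \<kappa> = (InitialOrdinal \<kappa> \<^bold>\<and> (\<^bold>\<exists>w. Omega w \<^bold>\<and> (w \<^bold>= \<kappa> \<^bold>\<or> w \<^bold>\<in> \<kappa>)))"

definition UncountableCardinal :: "var \<Rightarrow> form" where
  "UncountableCardinal \<kappa> = (Cardinal \<kappa> \<^bold>\<and> (\<^bold>\<exists>w. Omega w \<^bold>\<and> w \<^bold>\<in> \<kappa>))"

text \<open>\<open>\<mu> = \<kappa>\<^sup>+\<close>\<close>
definition SuccCardinal :: "var \<Rightarrow> var \<Rightarrow> form" where
  "SuccCardinal \<mu> \<kappa> =
     (Cardinal \<mu> \<^bold>\<and> \<kappa> \<^bold>\<in> \<mu> \<^bold>\<and> (\<^bold>\<forall>\<nu>. Cardinal \<nu> \<^bold>\<and> \<kappa> \<^bold>\<in> \<nu> \<^bold>\<longrightarrow> \<mu> \<^bold>= \<nu> \<^bold>\<or> \<mu> \<^bold>\<in> \<nu>))"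

text \<open>\<open>a = \<aleph>\<^sub>\<omega>\<close>: the supremum of the sequence with \<open>f(0) = \<omega>\<close> and \<open>f(n + 1) = f(n)\<^sup>+\<close>.\<close>
definition AlephOmega :: "var \<Rightarrow> form" where
  "AlephOmega a = (\<^bold>\<exists>w. \<^bold>\<exists>f. Omega w \<^bold>\<and> FunOn f w \<^bold>\<and>
     (\<^bold>\<forall>e. \<^bold>\<not> Nonempty e \<^bold>\<longrightarrow> Maps f e w) \<^bold>\<and>
     (\<^bold>\<forall>n. \<^bold>\<forall>s. \<^bold>\<forall>x. \<^bold>\<forall>y. n \<^bold>\<in> w \<^bold>\<and> Succ s n \<^bold>\<and> Maps f n x \<^bold>\<and> Maps f s y \<^bold>\<longrightarrow> SuccCardinal y x) \<^bold>\<and>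
     (\<^bold>\<forall>z. z \<^bold>\<in> a \<^bold>\<longleftrightarrow> (\<^bold>\<exists>n. \<^bold>\<exists>x. Maps f n x \<^bold>\<and> z \<^bold>\<in> x)))"

definition CofinalMap :: "var \<Rightarrow> var \<Rightarrow> var \<Rightarrow> form" where
  "CofinalMap f \<theta> \<kappa> = (FunTo f \<theta> \<kappa> \<^bold>\<and>
     (\<^bold>\<forall>\<alpha>. \<alpha> \<^bold>\<in> \<kappa> \<^bold>\<longrightarrow> (\<^bold>\<exists>\<xi>. \<^bold>\<exists>\<beta>. Maps f \<xi> \<beta> \<^bold>\<and> (\<alpha> \<^bold>= \<beta> \<^bold>\<or> \<alpha> \<^bold>\<in> \<beta>))))"

text \<open>\<open>\<theta> = cf(\<kappa>)\<close>\<close>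
definition Cofinality :: "var \<Rightarrow> var \<Rightarrow> form" where
  "Cofinality \<theta> \<kappa> = (Ordinal \<theta> \<^bold>\<and> (\<^bold>\<exists>f. CofinalMap f \<theta> \<kappa>) \<^bold>\<and>
     (\<^bold>\<forall>\<eta>. Ordinal \<eta> \<^bold>\<and> (\<^bold>\<exists>f. CofinalMap f \<eta> \<kappa>) \<^bold>\<longrightarrow> \<theta> \<^bold>= \<eta> \<^bold>\<or> \<theta> \<^bold>\<in> \<eta>))"

definition SingularCardinal :: "var \<Rightarrow> form" where
  "SingularCardinal \<kappa> = (Cardinal \<kappa> \<^bold>\<and> (\<^bold>\<exists>\<theta>. Cofinality \<theta> \<kappa> \<^bold>\<and> \<theta> \<^bold>\<in> \<kappa>))"

definition CountableCofinality :: "var \<Rightarrow> form" where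
  "CountableCofinality \<kappa> = (\<^bold>\<exists>w. Omega w \<^bold>\<and> Cofinality w \<kappa>)"

definition GCH :: form where
  "GCH = (\<^bold>\<forall>\<kappa>. Cardinal \<kappa> \<^bold>\<longrightarrow>
     (\<^bold>\<exists>\<mu>. \<^bold>\<exists>p. SuccCardinal \<mu> \<kappa> \<^bold>\<and> PowerSet p \<kappa> \<^bold>\<and> Equinumerous p \<mu>))"


section \<open>Filters, strongly compact cardinals and uniform ultrafilters\<close>

text \<open>\<open>F\<close> is a proper filter over \<open>S\<close>\<close>
definition ProperFilter :: "var \<Rightarrow> var \<Rightarrow> form" where
  "ProperFilter F S =
     ((\<^bold>\<forall>x. x \<^bold>\<in> F \<^bold>\<longrightarrow> x \<^bold>\<subseteq> S) \<^bold>\<and> S \<^bold>\<in> F \<^bold>\<and> (\<^bold>\<forall>x. x \<^bold>\<in> F \<^bold>\<longrightarrow> Nonempty x) \<^bold>\<and>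
      (\<^bold>\<forall>x. \<^bold>\<forall>y. \<^bold>\<forall>i. x \<^bold>\<in> F \<^bold>\<and> y \<^bold>\<in> F \<^bold>\<and> Inter2 i x y \<^bold>\<longrightarrow> i \<^bold>\<in> F) \<^bold>\<and>
      (\<^bold>\<forall>x. \<^bold>\<forall>y. x \<^bold>\<in> F \<^bold>\<and> x \<^bold>\<subseteq> y \<^bold>\<and> y \<^bold>\<subseteq> S \<^bold>\<longrightarrow> y \<^bold>\<in> F))"

definition ProperUltrafilter :: "var \<Rightarrow> var \<Rightarrow> form" where
  "ProperUltrafilter U S = (ProperFilter U S \<^bold>\<and>
     (\<^bold>\<forall>x. \<^bold>\<forall>d. x \<^bold>\<subseteq> S \<^bold>\<and> SetDiff d S x \<^bold>\<longrightarrow> x \<^bold>\<in> U \<^bold>\<or> d \<^bold>\<in> U))"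

text \<open>\<open>F\<close> is \<open>\<kappa>\<close>-complete: closed under intersections of fewer than \<open>\<kappa>\<close> members\<close>
definition Complete :: "var \<Rightarrow> var \<Rightarrow> form" where
  "Complete \<kappa> F = (\<^bold>\<forall>A. \<^bold>\<forall>i.
     A \<^bold>\<subseteq> F \<^bold>\<and> Nonempty A \<^bold>\<and> (\<^bold>\<exists>\<alpha>. \<alpha> \<^bold>\<in> \<kappa> \<^bold>\<and> Equinumerous \<alpha> A) \<^bold>\<and> BigInter i A \<^bold>\<longrightarrow> i \<^bold>\<in> F)"

definition StronglyCompact :: "var \<Rightarrow> form" where
  "StronglyCompact \<kappa> = (UncountableCardinal \<kappa> \<^bold>\<and>
     (\<^bold>\<forall>S. \<^bold>\<forall>F. ProperFilter F S \<^bold>\<and> Complete \<kappa> F \<^bold>\<longrightarrow>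
        (\<^bold>\<exists>U. F \<^bold>\<subseteq> U \<^bold>\<and> ProperUltrafilter U S \<^bold>\<and> Complete \<kappa> U)))"

definition UniformUltrafilter :: "var \<Rightarrow> var \<Rightarrow> form" where
  "UniformUltrafilter U \<kappa> =
     (ProperUltrafilter U \<kappa> \<^bold>\<and> (\<^bold>\<forall>x. x \<^bold>\<in> U \<^bold>\<longrightarrow> Equinumerous x \<kappa>))"

text \<open>\<open>\<kappa>\<close> belongs to the class \<open>\<U>\<close> of cardinals carrying a uniform ultrafilter\<close>
definition InU :: "var \<Rightarrow> form" where
  "InU \<kappa> = (Cardinal \<kappa> \<^bold>\<and> (\<^bold>\<exists>U. UniformUltrafilter U \<kappa>))"

definition LeastCardinalNotInU :: "var \<Rightarrow> form" where
  "LeastCardinalNotInU a =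
     (Cardinal a \<^bold>\<and> \<^bold>\<not> InU a \<^bold>\<and> (\<^bold>\<forall>\<kappa>. Cardinal \<kappa> \<^bold>\<and> \<kappa> \<^bold>\<in> a \<^bold>\<longrightarrow> InU \<kappa>))"


section \<open>The sentences of the theorem\<close>

definition ExistsStronglyCompact :: form where
  "ExistsStronglyCompact = (\<^bold>\<exists>\<kappa>. StronglyCompact \<kappa>)"

definition AlephOmegaLeastNotInU :: form where
  "AlephOmegaLeastNotInU = (\<^bold>\<exists>a. AlephOmega a \<^bold>\<and> LeastCardinalNotInU a)"

definition SingularsAboveAlephOmegaInU :: form where
  "SingularsAboveAlephOmegaInU = (\<^bold>\<forall>a. \<^bold>\<forall>\<kappa>.
     AlephOmega a \<^bold>\<and> SingularCardinal \<kappa> \<^bold>\<and> a \<^bold>\<in> \<kappa> \<^bold>\<and> CountableCofinality \<kappa> \<^bold>\<longrightarrow> InU \<kappa>)"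

end

theory Submission
  imports Defs "HOL-Library.Countable_Set"
begin

text \<open>Let \<open>M\<close> be a countable model of ZFC, GCH and "\<open>\<kappa>\<close> is strongly compact"; it is a Henkin model, so its
  membership relation \<open>E\<close> need not be well-founded. Conditions are partial functions on coordinates arranged in
  levels \<open>l \<le> \<omega>\<close>, with at most \<open>\<aleph>\<^sub>l\<close> coordinates of level \<open>l\<close>. A level \<open>l < \<omega>\<close> adds a subset of \<open>\<aleph>\<^sub>\<omega>\<close>, and level
  \<open>\<omega>\<close> adds maps from \<open>\<aleph>\<^sub>\<omega>\<^sub>+\<^sub>1\<close> onto all ordinals below \<open>\<kappa>\<close>. The group of pointwise flips (symmetric differences) acts
  on the conditions. The symmetric extension \<open>N\<close> keeps the names that are hereditarily invariant under the flips
  vanishing below some level \<open>n < \<omega>\<close> and on the collapses of the ordinals below some \<open>\<gamma> < \<kappa>\<close>.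

  If an ultrafilter in \<open>N\<close> over \<open>\<aleph>\<^sub>\<omega>\<close> is invariant under the flips of level \<open>n\<close>, then it contains a generic subset of level
  \<open>n\<close> iff it contains its flip outside the domain of some condition. That domain has size \<open>\<aleph>\<^sub>n\<close>, so the
  ultrafilter has a member of this size and is not uniform. By an Easton argument, every subset of \<open>\<aleph>\<^sub>n\<close> in \<open>N\<close> is obtained
  from a set in \<open>M\<close> and the restriction of the generic filter to the levels below \<open>n\<close>. So the \<open>\<aleph>\<^sub>n\<close> are preserved, the
  power set of \<open>\<aleph>\<^sub>n\<close> is well-orderable in \<open>N\<close>, and \<open>\<aleph>\<^sub>n\<close> carries a uniform ultrafilter. Every set of ordinals in \<open>N\<close> is
  determined by fewer than \<open>\<kappa>\<close> conditions. Hence \<open>\<kappa>\<close>-complete ultrafilters over successor cardinals above \<open>\<kappa>\<close>, which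
  exist in \<open>M\<close>, generate ultrafilters in \<open>N\<close>, and their sum along an ultrafilter over \<open>\<omega>\<close> is uniform over a
  singular cardinal of countable cofinality. The cardinals between \<open>\<aleph>\<^sub>\<omega>\<^sub>+\<^sub>1\<close> and \<open>\<kappa>\<close> are collapsed.\<close>

section \<open>Soundness and completeness of first-order logic\<close>

text \<open>The classes of a possibly ill-founded model can be used only through the axiom schemas.
  So recursion, ranks, names and forcing are developed inside the model, for predicates and
  functions certified as definable with parameters (\<open>D\<close>, \<open>DF\<close>), and forced
  equality is a greatest bisimulation instead of a recursion. Flips are convenient because they form
  an abelian group of exponent two that acts coordinatewise; the algebra of translated names becomes
  trivial. The bounds \<open>\<aleph>\<^sub>l\<close> balance two demands: under GCH the levels
  below \<open>n\<close> satisfy the \<open>\<aleph>\<^sub>n\<^sub>+\<^sub>1\<close> chain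
  condition, while the other levels are closed under increasing sequences of length
  \<open>\<aleph>\<^sub>n\<close>. The collapse is there because the measures say nothing about
  cardinals between \<open>\<aleph>\<^sub>\<omega>\<close> and \<kappa>; it may stop below \<kappa>,
  whose cofinality is uncountable. Choice fails in the extension, so the measures to be summed
  cannot be picked there: they are picked in the ground model, which contains every
  \<omega>-sequence of ordinals of the extension.\<close>

lemma rename_cong: "(!!i. i \<in> fv A ==> r i = s i) ==> rename r A = rename s A"
proof (induction A arbitrary: r s)
  case (Forall A)
  have "rename (lift_ren r) A = rename (lift_ren s) A"
  proof (rule Forall.IH)
    fix i assume "i \<in> fv A" then show "lift_ren r i = lift_ren s i" using Forall.prems by (cases i) auto
  qed
  then show ?case by simp
next
  case (Imp A B)
  have "rename r A = rename s A" by (rule Imp.IH) (simp add: Imp.prems)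
  moreover have "rename r B = rename s B" by (rule Imp.IH) (simp add: Imp.prems)
  ultimately show ?case by simp
qed simp_all

lemma lift_ren_comp: "lift_ren r \<circ> lift_ren s = lift_ren (r \<circ> s)"
proof
  fix i show "(lift_ren r \<circ> lift_ren s) i = lift_ren (r \<circ> s) i" by (cases i) auto
qed

lemma rename_rename: "rename r (rename s A) = rename (r \<circ> s) A"
  by (induction A arbitrary: r s) (auto simp: lift_ren_comp)

lemma lift_ren_id: "lift_ren id = id"
proof
  fix i show "lift_ren id i = id i" by (cases i) auto
qed

lemma rename_id [simp]: "rename id A = A"
proof (induction A)
  case (Forall A) then show ?case by (simp only: rename.simps lift_ren_id)
qed (auto simp: id_def)

lemma fv_rename: "fv (rename r A) = r ` fv A"
proof (induction A arbitrary: r)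
  case (Forall A)
  have "{i. Suc i \<in> lift_ren r ` fv A} = r ` {i. Suc i \<in> fv A}"
  proof (intro equalityI subsetI; clarsimp)
    fix i x assume "x \<in> fv A" "Suc i = lift_ren r x"
    then show "i \<in> r ` {i. Suc i \<in> fv A}" by (cases x) auto
  next
    fix x assume "Suc x \<in> fv A" then show "Suc (r x) \<in> lift_ren r ` fv A" by (metis image_eqI lift_ren.simps(2))
  qed
  then show ?case using Forall by simp
qed auto

lemma finite_fv: "finite (fv A)"
proof (induction A)
  case (Forall A) then show ?case using finite_vimageI[of "fv A" Suc] by (simp add: vimage_def)
qed auto

lemma rename_subst0: "rename r (subst0 t A) = subst0 (r t) (rename (lift_ren r) A)"
proof -
  have "r \<circ> case_nat t id = case_nat (r t) id \<circ> lift_ren r"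
  proof
    fix i show "(r \<circ> case_nat t id) i = (case_nat (r t) id \<circ> lift_ren r) i" by (cases i) auto
  qed
  then show ?thesis by (simp only: subst0_def rename_rename)
qed

lemma rename_Suc_lift: "rename (lift_ren r) ` rename Suc ` \<Gamma> = rename Suc ` rename r ` \<Gamma>"
  by (auto simp: image_iff rename_rename comp_def)

lemma derives_rename: "\<Gamma> \<turnstile> A ==> rename r ` \<Gamma> \<turnstile> rename r A"
proof (induction arbitrary: r rule: derives.induct)
  case (AllI \<Gamma> A) then show ?case using derives.AllI[of "rename r ` \<Gamma>"] by (simp flip: rename_Suc_lift)
next
  case (EqSubst \<Gamma> s t A) then show ?case using derives.EqSubst by (simp add: rename_subst0) blast
next
  case (AllE \<Gamma> A t) then show ?case using derives.AllE by (simp add: rename_subst0)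
next
  case (ImpE \<Gamma> A B) then show ?case using derives.ImpE by simp blast
next
  case (ImpI A \<Gamma> B) then show ?case using derives.ImpI by simp
next
  case (RAA A \<Gamma>) then show ?case using derives.RAA by simp
qed (auto intro: derives.Assm derives.EqRefl)

lemma derives_weaken: "\<Gamma> \<turnstile> A ==> \<Gamma> \<subseteq> \<Delta> ==> \<Delta> \<turnstile> A"
proof (induction arbitrary: \<Delta> rule: derives.induct)
  case (ImpI A \<Gamma> B) then show ?case by (meson derives.ImpI insert_mono)
next
  case (RAA A \<Gamma>) then show ?case by (meson derives.RAA insert_mono)
next
  case (AllI \<Gamma> A) then show ?case by (meson derives.AllI image_mono)
next
  case (EqSubst \<Gamma> s t A) then show ?case by (meson derives.EqSubst)
next
  case (ImpE \<Gamma> A B) then show ?case by (meson derives.ImpE)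
qed (auto intro: derives.Assm derives.AllE derives.EqRefl)

lemma derives_compact: "\<Gamma> \<turnstile> A ==> \<exists>F. finite F & F \<subseteq> \<Gamma> & F \<turnstile> A"
proof (induction rule: derives.induct)
  case (Assm A \<Gamma>) then show ?case by (intro exI[of _ "{A}"]) (auto intro: derives.intros)
next
  case (ImpI A \<Gamma> B)
  then obtain F where "finite F" "F \<subseteq> insert A \<Gamma>" "F \<turnstile> B" by blast
  moreover have "insert A (F - {A}) \<turnstile> B" by (rule derives_weaken[OF \<open>F \<turnstile> B\<close>]) auto
  ultimately show ?case by (intro exI[of _ "F - {A}"]) (auto intro: derives.ImpI)
next
  case (RAA A \<Gamma>)
  then obtain F where "finite F" "F \<subseteq> insert (Imp A Falsum) \<Gamma>" "F \<turnstile> Falsum" by blast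
  moreover have "insert (Imp A Falsum) (F - {Imp A Falsum}) \<turnstile> Falsum"
    by (rule derives_weaken[OF \<open>F \<turnstile> Falsum\<close>]) auto
  ultimately show ?case by (intro exI[of _ "F - {Imp A Falsum}"]) (auto intro: derives.RAA)
next
  case (ImpE \<Gamma> A B)
  then obtain F G where "finite F" "F \<subseteq> \<Gamma>" "F \<turnstile> Imp A B" "finite G" "G \<subseteq> \<Gamma>" "G \<turnstile> A" by blast
  then show ?case by (intro exI[of _ "F \<union> G"]) (auto intro: derives.ImpE derives_weaken)
next
  case (EqSubst \<Gamma> s t A)
  then obtain F G where "finite F" "F \<subseteq> \<Gamma>" "F \<turnstile> Equal s t" "finite G" "G \<subseteq> \<Gamma>" "G \<turnstile> subst0 s A" by blast
  then show ?case by (intro exI[of _ "F \<union> G"]) (auto intro: derives.EqSubst derives_weaken)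
next
  case (AllI \<Gamma> A)
  then obtain F where F: "finite F" "F \<subseteq> rename Suc ` \<Gamma>" "F \<turnstile> A" by blast
  then obtain G where "finite G" "G \<subseteq> \<Gamma>" "F = rename Suc ` G" by (meson finite_subset_image)
  then show ?case using F by (auto intro: derives.AllI)
next
  case (EqRefl \<Gamma> t) show ?case by (intro exI[of _ "{}"]) (auto intro: derives.intros)
next
  case (AllE \<Gamma> A t) then show ?case by (blast intro: derives.AllE)
qed

section \<open>Satisfaction and soundness\<close>

fun sat :: "('a => 'a => bool) => (nat => 'a) => fm => bool" where
  "sat E e Falsum = False"
| "sat E e (Memb i j) = E (e i) (e j)"
| "sat E e (Equal i j) = (e i = e j)"
| "sat E e (Imp A B) = (sat E e A --> sat E e B)"
| "sat E e (Forall A) = (\<forall>x. sat E (case_nat x e) A)"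

lemma case_nat_lift: "case_nat x e \<circ> lift_ren r = case_nat x (e \<circ> r)"
proof
  fix i show "(case_nat x e \<circ> lift_ren r) i = case_nat x (e \<circ> r) i" by (cases i) auto
qed

lemma sat_rename: "sat E e (rename r A) = sat E (e \<circ> r) A"
  by (induction A arbitrary: e r) (auto simp: case_nat_lift)

lemma sat_cong: "(!!i. i \<in> fv A ==> e i = e' i) ==> sat E e A = sat E e' A"
proof (induction A arbitrary: e e')
  case (Forall A)
  have "sat E (case_nat x e) A = sat E (case_nat x e') A" for x
    by (rule Forall.IH) (use Forall.prems in \<open>auto split: nat.split\<close>)
  then show ?case by simp
next
  case (Imp A B)
  have "sat E e A = sat E e' A" by (rule Imp.IH) (simp add: Imp.prems)
  moreover have "sat E e B = sat E e' B" by (rule Imp.IH) (simp add: Imp.prems)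
  ultimately show ?case by simp
qed simp_all

lemma sat_subst0: "sat E e (subst0 t A) = sat E (case_nat (e t) e) A"
proof -
  have "e \<circ> case_nat t id = case_nat (e t) e" by (auto split: nat.split)
  then show ?thesis by (simp add: subst0_def sat_rename)
qed

lemma soundness: "\<Gamma> \<turnstile> A ==> (!!B. B \<in> \<Gamma> ==> sat E e B) ==> sat E e A"
proof (induction arbitrary: e rule: derives.induct)
  case (AllI \<Gamma> A)
  have "sat E (case_nat x e) A" for x
  proof (rule AllI.IH)
    fix B assume "B \<in> rename Suc ` \<Gamma>"
    then show "sat E (case_nat x e) B" using AllI.prems by (auto simp: sat_rename comp_def)
  qed
  then show ?case by simp
next
  case (RAA A \<Gamma>) then show ?case by fastforce
next
  case (EqSubst \<Gamma> s t A)
  have "e s = e t" "sat E (case_nat (e s) e) A" using EqSubst.IH[of e] EqSubst.prems by (simp_all add: sat_subst0)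
  then show ?case by (simp add: sat_subst0)
qed (auto simp: sat_subst0)

lemma modelD_consistent: "(!!B. B \<in> T ==> sat E e B) ==> consistent T"
  unfolding consistent_def using soundness[of T Falsum E e] by auto

lemma derives_cut: "insert A \<Gamma> \<turnstile> B ==> \<Gamma> \<turnstile> A ==> \<Gamma> \<turnstile> B"
  by (meson derives.ImpI derives.ImpE)

lemma derives_exfalso: "\<Gamma> \<turnstile> Falsum ==> \<Gamma> \<turnstile> A"
  by (meson derives.RAA derives_weaken subset_insertI)

text \<open>Renaming \<open>t\<close> to 0 and shifting all other variables agrees with
  \<open>Suc\<close> on the hypotheses, because \<open>t\<close> does not occur in them, and undoes
  the substitution in \<open>A\<close>. This gives exactly the premise of
  \<open>AllI\<close>.\<close>

lemma derives_generalize: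
  assumes "\<Gamma> \<turnstile> subst0 t A" "t \<notin> fv (Forall A)" "!!B. B \<in> \<Gamma> ==> t \<notin> fv B"
  shows "\<Gamma> \<turnstile> Forall A"
proof -
  let ?r = "%j. if j = t then 0 else Suc j"
  have "rename ?r ` \<Gamma> = rename Suc ` \<Gamma>"
    by (rule image_cong[OF refl], rule rename_cong) (use assms(3) in auto)
  moreover have "rename ?r (subst0 t A) = rename id A"
    unfolding subst0_def rename_rename
    by (rule rename_cong) (use assms(2) in \<open>auto split: nat.split\<close>)
  ultimately show ?thesis using derives_rename[OF assms(1), of ?r] by (auto intro: derives.AllI)
qed

section \<open>Henkin completion of a consistent theory\<close>

instance fm :: countable by countable_datatype

lemma consistent_insert_or:
  assumes "consistent \<Gamma>" shows "consistent (insert A \<Gamma>) \<or> consistent (insert (Imp A Falsum) \<Gamma>)"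
  using assms unfolding consistent_def by (meson derives.RAA derives_cut)

lemma consistent_witness:
  assumes "consistent \<Gamma>" "Imp (Forall A) Falsum \<in> \<Gamma>" "t \<notin> fv (Forall A)" "!!B. B \<in> \<Gamma> ==> t \<notin> fv B"
  shows "consistent (insert (Imp (subst0 t A) Falsum) \<Gamma>)"
  using assms unfolding consistent_def by (meson derives.Assm derives.ImpE derives.RAA derives_generalize)

definition fresh :: "fm set => nat" where "fresh \<Gamma> = (SOME t. \<forall>B\<in>\<Gamma>. t \<notin> fv B)"

fun wit :: "nat => fm => fm set" where
  "wit t (Imp (Forall A) Falsum) = {Imp (subst0 t A) Falsum}"
| "wit t _ = {}"

text \<open>Stage \<open>Suc n\<close> treats the formula with code \<open>n\<close>. A negated
  universal statement receives its counterexample in the same step in which it is accepted, so one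
  pass through the codes yields both maximality and witnesses.\<close>

fun henkin :: "fm set => nat => fm set" where
  "henkin T 0 = T"
| "henkin T (Suc n) = (let A = from_nat n; \<Gamma> = insert A (henkin T n) in
     if consistent \<Gamma> then wit (fresh \<Gamma>) A \<union> \<Gamma> else henkin T n)"

lemma wit_cases: "wit t A = {} \<or> (\<exists>B. A = Imp (Forall B) Falsum & wit t A = {Imp (subst0 t B) Falsum})"
  by (induct t A rule: wit.induct) simp_all

lemma henkin_finite_new: "finite (henkin T n - T)"
proof (induction n)
  case (Suc n)
  let ?W = "wit (fresh (insert (from_nat n) (henkin T n))) (from_nat n)"
  have "finite ?W" by (metis wit_cases finite.emptyI finite.insertI)
  moreover have "henkin T (Suc n) - T \<subseteq> ?W \<union> insert (from_nat n) (henkin T n - T)" by (auto simp: Let_def)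
  ultimately show ?case using Suc by (meson finite_Un finite_insert finite_subset)
qed auto

text \<open>The theory \<open>T\<close> mentions even variables only and a stage differs from it by
  finitely many formulas, so a large odd variable is still free.\<close>

lemma fresh:
  assumes "!!B. B \<in> T ==> fv B \<subseteq> {i. even i}" "finite (\<Gamma> - T)" "B \<in> \<Gamma>" shows "fresh \<Gamma> \<notin> fv B"
proof -
  let ?X = "\<Union>(fv ` (\<Gamma> - T))"
  have "finite ?X" using assms(2) finite_fv by blast
  then obtain m where m: "!!i. i \<in> ?X ==> i < m" using finite_nat_set_iff_bounded by meson
  have "\<forall>B\<in>\<Gamma>. 2 * m + 1 \<notin> fv B"
  proof
    fix B assume "B \<in> \<Gamma>" then show "2 * m + 1 \<notin> fv B"
      using assms(1)[of B] m[of "2 * m + 1"] by (cases "B \<in> T") auto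
  qed
  then show ?thesis unfolding fresh_def using assms(3) someI[of "%t. \<forall>B\<in>\<Gamma>. t \<notin> fv B"] by blast
qed

lemma henkin_consistent:
  assumes "!!B. B \<in> T ==> fv B \<subseteq> {i. even i}" "consistent T"
  shows "consistent (henkin T n)"
proof (induction n)
  case (Suc n)
  let ?A = "from_nat n :: fm" let ?\<Gamma> = "insert ?A (henkin T n)"
  have fin: "finite (?\<Gamma> - T)" using henkin_finite_new[of T n] by (simp add: insert_Diff_if)
  have "consistent (wit (fresh ?\<Gamma>) ?A \<union> ?\<Gamma>)" if "consistent ?\<Gamma>"
    using wit_cases[of "fresh ?\<Gamma>" ?A]
  proof
    assume "\<exists>B. ?A = Imp (Forall B) Falsum & wit (fresh ?\<Gamma>) ?A = {Imp (subst0 (fresh ?\<Gamma>) B) Falsum}"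
    then obtain B where B: "?A = Imp (Forall B) Falsum" "wit (fresh ?\<Gamma>) ?A = {Imp (subst0 (fresh ?\<Gamma>) B) Falsum}" by blast
    have "fresh ?\<Gamma> \<notin> fv ?A" by (rule fresh[OF assms(1) fin]) auto
    then have "fresh ?\<Gamma> \<notin> fv (Forall B)" using B by simp
    then have "consistent (insert (Imp (subst0 (fresh ?\<Gamma>) B) Falsum) ?\<Gamma>)"
      by (intro consistent_witness[OF that]) (use fresh[OF assms(1) fin] B in auto)
    then show ?thesis using B(2) by (simp add: insert_commute)
  qed (use that in auto)
  then show ?case using Suc by (simp add: Let_def)
qed (use assms in auto)

lemma henkin_mono: "m \<le> n ==> henkin T m \<subseteq> henkin T n"
  by (rule lift_Suc_mono_le[of "henkin T"]) (auto simp: Let_def)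

lemma maximal_consistent_extension:
  assumes ev: "!!B. B \<in> T ==> fv B \<subseteq> {i. even i}" and con: "consistent T"
  obtains \<Delta> where "T \<subseteq> \<Delta>" "!!A. \<Delta> \<turnstile> A \<longleftrightarrow> A \<in> \<Delta>" "Falsum \<notin> \<Delta>" "!!A. A \<in> \<Delta> \<or> Imp A Falsum \<in> \<Delta>"
    "!!A. Imp (Forall A) Falsum \<in> \<Delta> ==> \<exists>t. Imp (subst0 t A) Falsum \<in> \<Delta>"
proof -
  define \<Delta> where "\<Delta> = (\<Union>n. henkin T n)"
  have sub: "\<exists>n. F \<subseteq> henkin T n" if "finite F" "F \<subseteq> \<Delta>" for F
    using that
  proof (induction F)
    case (insert x F)
    then obtain n m where "F \<subseteq> henkin T n" "x \<in> henkin T m" unfolding \<Delta>_def by blast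
    then have "insert x F \<subseteq> henkin T (max m n)"
      using henkin_mono[of m "max m n" T] henkin_mono[of n "max m n" T] by auto
    then show ?case by blast
  qed auto
  have cD: "consistent \<Delta>"
    unfolding consistent_def
  proof
    assume "\<Delta> \<turnstile> Falsum"
    then obtain F n where "F \<turnstile> Falsum" "F \<subseteq> henkin T n" using derives_compact sub by metis
    then show False using henkin_consistent[OF ev con, of n] derives_weaken unfolding consistent_def by blast
  qed
  \<comment> \<open>What is consistent with the limit was consistent with the stage at its own code,
    hence was accepted there together with its witness.\<close>
  have add: "A \<in> \<Delta> & wit (fresh (insert A (henkin T (to_nat A)))) A \<subseteq> \<Delta>" if "consistent (insert A \<Delta>)" for A
  proof -
    have "consistent (insert A (henkin T (to_nat A)))"
      using that derives_weaken[of "insert A (henkin T (to_nat A))" Falsum "insert A \<Delta>"]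
      unfolding consistent_def \<Delta>_def by blast
    then have "henkin T (Suc (to_nat A)) = wit (fresh (insert A (henkin T (to_nat A)))) A \<union> insert A (henkin T (to_nat A))"
      by (simp add: Let_def)
    then show ?thesis unfolding \<Delta>_def by blast
  qed
  have max: "A \<in> \<Delta> \<or> Imp A Falsum \<in> \<Delta>" for A
    using consistent_insert_or[OF cD, of A] add by blast
  have ded: "\<Delta> \<turnstile> A \<longleftrightarrow> A \<in> \<Delta>" for A
    using cD max[of A] unfolding consistent_def by (meson derives.Assm derives.ImpE)
  have hen: "\<exists>t. Imp (subst0 t A) Falsum \<in> \<Delta>" if "Imp (Forall A) Falsum \<in> \<Delta>" for A
  proof -
    have "consistent (insert (Imp (Forall A) Falsum) \<Delta>)" using that cD by (simp add: insert_absorb)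
    from add[OF this] show ?thesis by auto
  qed
  have "T \<subseteq> \<Delta>" unfolding \<Delta>_def using henkin.simps(1)[of T] by blast
  moreover have "Falsum \<notin> \<Delta>" using ded[of Falsum] cD by (auto simp: consistent_def)
  ultimately show thesis using that ded max hen by blast
qed

section \<open>The term model and its quotient by provable equality\<close>

locale maximal =
  fixes \<Delta> :: "fm set"
  assumes ded: "!!A. \<Delta> \<turnstile> A \<longleftrightarrow> A \<in> \<Delta>" and con: "Falsum \<notin> \<Delta>"
    and max: "!!A. A \<in> \<Delta> \<or> Imp A Falsum \<in> \<Delta>"
    and hen: "!!A. Imp (Forall A) Falsum \<in> \<Delta> ==> \<exists>t. Imp (subst0 t A) Falsum \<in> \<Delta>"
begin

lemma not_in: "Imp A Falsum \<in> \<Delta> \<longleftrightarrow> A \<notin> \<Delta>"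
  using max con ded by (metis derives.ImpE)

lemma imp_in: "Imp A B \<in> \<Delta> \<longleftrightarrow> (A \<in> \<Delta> --> B \<in> \<Delta>)"
proof
  assume "A \<in> \<Delta> --> B \<in> \<Delta>"
  then consider "Imp A Falsum \<in> \<Delta>" | "B \<in> \<Delta>" using not_in by blast
  then have "\<Delta> \<turnstile> Imp A B"
  proof cases
    case 1
    then have "insert A \<Delta> \<turnstile> Imp A Falsum" "insert A \<Delta> \<turnstile> A" by (auto intro: derives.Assm)
    then have "insert A \<Delta> \<turnstile> B" by (meson derives.ImpE derives_exfalso)
    then show ?thesis by (rule derives.ImpI)
  qed (auto intro: derives.ImpI derives.Assm)
  then show "Imp A B \<in> \<Delta>" using ded by blast
qed (use ded derives.ImpE in metis)

lemma all_in: "Forall A \<in> \<Delta> \<longleftrightarrow> (\<forall>t. subst0 t A \<in> \<Delta>)"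
  using ded derives.AllE hen not_in by metis

lemma eq_subst: "Equal s t \<in> \<Delta> ==> subst0 s A \<in> \<Delta> ==> subst0 t A \<in> \<Delta>"
  using ded derives.EqSubst by metis

lemma eq_refl: "Equal s s \<in> \<Delta>" using ded derives.EqRefl by metis

lemma eq_sym: "Equal s t \<in> \<Delta> ==> Equal t s \<in> \<Delta>"
  using eq_subst[of s t "Equal 0 (Suc s)"] eq_refl by (simp add: subst0_def)

lemma eq_trans: "Equal s t \<in> \<Delta> ==> Equal t u \<in> \<Delta> ==> Equal s u \<in> \<Delta>"
  using eq_subst[of t u "Equal (Suc s) 0"] by (simp add: subst0_def)

lemma mem_cong: "Equal s s' \<in> \<Delta> ==> Equal t t' \<in> \<Delta> ==> Memb s t \<in> \<Delta> ==> Memb s' t' \<in> \<Delta>"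
  using eq_subst[of s s' "Memb 0 (Suc t)"] eq_subst[of t t' "Memb (Suc s') 0"] by (simp add: subst0_def)

definition rep :: "nat => nat" where "rep i = (LEAST j. Equal i j \<in> \<Delta>)"

lemma rep: "Equal i (rep i) \<in> \<Delta>" unfolding rep_def by (rule LeastI[of _ i]) (rule eq_refl)

lemma rep_eq: "rep i = rep j \<longleftrightarrow> Equal i j \<in> \<Delta>"
proof
  assume "rep i = rep j" then show "Equal i j \<in> \<Delta>" by (metis rep eq_sym eq_trans)
next
  assume "Equal i j \<in> \<Delta>"
  then have "(%k. Equal i k \<in> \<Delta>) = (%k. Equal j k \<in> \<Delta>)" by (metis eq_sym eq_trans)
  then show "rep i = rep j" by (simp add: rep_def)
qed

end

text \<open>Satisfaction in a prestructure: a domain \<open>X\<close> together with a congruence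
  \<open>Q\<close> that interprets equality. It serves both the term model and the names modulo a
  generic filter.\<close>

fun presat :: "'a set => ('a => 'a => bool) => ('a => 'a => bool) => (nat => 'a) => fm => bool" where
  "presat X Q E e Falsum = False"
| "presat X Q E e (Memb i j) = E (e i) (e j)"
| "presat X Q E e (Equal i j) = Q (e i) (e j)"
| "presat X Q E e (Imp A B) = (presat X Q E e A --> presat X Q E e B)"
| "presat X Q E e (Forall A) = (\<forall>x\<in>X. presat X Q E (case_nat x e) A)"

lemma (in maximal) truth: "presat UNIV (%i j. Equal i j \<in> \<Delta>) (%i j. Memb i j \<in> \<Delta>) e A \<longleftrightarrow> rename e A \<in> \<Delta>"
proof (induction A arbitrary: e)
  case (Forall A)
  have *: "subst0 t (rename (lift_ren e) A) = rename (case_nat t e) A" for t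
  proof -
    have "case_nat t id \<circ> lift_ren e = case_nat t e"
    proof
      fix i show "(case_nat t id \<circ> lift_ren e) i = case_nat t e i" by (cases i) auto
    qed
    then show ?thesis by (simp add: subst0_def rename_rename)
  qed
  show ?case using Forall by (simp add: all_in *)
qed (auto simp: con imp_in)

text \<open>The function \<open>f\<close> merely labels the classes of \<open>Q\<close>. As
  \<open>sat\<close> quantifies over a whole type, the classes have to be matched with all natural
  numbers, and for this there must be infinitely many.\<close>

lemma quotient_on_nat:
  fixes X :: "'a::countable set"
  assumes Q: "!!x y. x \<in> X ==> y \<in> X ==> Q x y \<longleftrightarrow> f x = (f y :: 'b)"
    and E: "!!x y x' y'. x \<in> X ==> y \<in> X ==> x' \<in> X ==> y' \<in> X ==> Q x x' ==> Q y y' ==> E x y ==> E x' y'"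
    and inf: "infinite (f ` X)"
  obtains v :: "'a => nat" and F where "v ` X = UNIV" "!!x y. x \<in> X ==> y \<in> X ==> Q x y \<longleftrightarrow> v x = v y"
    "!!x y. x \<in> X ==> y \<in> X ==> E x y \<longleftrightarrow> F (v x) (v y)"
    "!!A e. (!!i. e i \<in> X) ==> presat X Q E e A \<longleftrightarrow> sat F (v \<circ> e) A"
proof -
  have "countable (f ` X)" by auto
  then obtain g :: "'b => nat" where g: "bij_betw g (f ` X) UNIV" using inf countableE_infinite by blast
  define v where "v = g \<circ> f"
  define F where "F = (%m n. \<exists>x\<in>X. \<exists>y\<in>X. v x = m & v y = n & E x y)"
  have 1: "v ` X = UNIV" using g unfolding v_def bij_betw_def by (metis image_comp)
  have 2: "Q x y \<longleftrightarrow> v x = v y" if "x \<in> X" "y \<in> X" for x y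
    using Q[OF that] g that unfolding v_def bij_betw_def inj_on_def by auto
  have 3: "E x y \<longleftrightarrow> F (v x) (v y)" if "x \<in> X" "y \<in> X" for x y
    unfolding F_def using E 2 that by metis
  have 4: "presat X Q E e A \<longleftrightarrow> sat F (v \<circ> e) A" if "!!i. e i \<in> X" for A e
    using that
  proof (induction A arbitrary: e)
    case (Forall A)
    have *: "v \<circ> case_nat x e = case_nat (v x) (v \<circ> e)" for x by (auto split: nat.split)
    have "presat X Q E (case_nat x e) A \<longleftrightarrow> sat F (case_nat (v x) (v \<circ> e)) A" if "x \<in> X" for x
      unfolding *[symmetric] by (rule Forall.IH) (use that Forall.prems in \<open>auto split: nat.split\<close>)
    moreover have "(\<forall>y. R y) \<longleftrightarrow> (\<forall>x\<in>X. R (v x))" for R using 1 by (metis UNIV_I imageE)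
    ultimately show ?case by (simp add: comp_def)
  qed (simp_all add: 2 3)
  show thesis by (rule that[OF 1 2 3 4])
qed

text \<open>With finitely many classes, pairing and union would build a set that has a
  representative of every class as a member, in particular one of its own class. It would then be a
  member of itself, against foundation for its singleton.\<close>

lemma infinite_quotient:
  assumes ne: "a \<in> X"
    and Q: "!!x y. x \<in> X ==> y \<in> X ==> Q x y \<longleftrightarrow> f x = f y"
    and E: "!!x y x' y'. x \<in> X ==> y \<in> X ==> x' \<in> X ==> y' \<in> X ==> Q x x' ==> Q y y' ==> E x y ==> E x' y'"
    and pair: "!!x y. x \<in> X ==> y \<in> X ==> \<exists>p\<in>X. \<forall>z\<in>X. E z p \<longleftrightarrow> Q z x \<or> Q z y"
    and union: "!!x. x \<in> X ==> \<exists>u\<in>X. \<forall>z\<in>X. E z u \<longleftrightarrow> (\<exists>y\<in>X. E y x & E z y)"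
    and found: "!!x z. x \<in> X ==> z \<in> X ==> E z x ==> \<exists>y\<in>X. E y x & \<not> (\<exists>z\<in>X. E z y & E z x)"
  shows "infinite (f ` X)"
proof
  assume "finite (f ` X)"
  then obtain Y where Y: "Y \<subseteq> X" "finite Y" "f ` X = f ` Y" by (meson finite_subset_image subset_refl)
  have "\<exists>s\<in>X. \<forall>y\<in>Y. E y s" using Y(2,1)
  proof (induction Y)
    case (insert y Y)
    then obtain s where s: "s \<in> X" "\<forall>y\<in>Y. E y s" by auto
    have yY: "y \<in> X" "Y \<subseteq> X" using insert by auto
    obtain p where p: "p \<in> X" "\<forall>z\<in>X. E z p \<longleftrightarrow> Q z y \<or> Q z y" using pair[OF yY(1) yY(1)] by blast
    obtain q where q: "q \<in> X" "\<forall>z\<in>X. E z q \<longleftrightarrow> Q z s \<or> Q z p" using pair[OF s(1) p(1)] by blast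
    obtain u where u: "u \<in> X" "\<forall>z\<in>X. E z u \<longleftrightarrow> (\<exists>y\<in>X. E y q & E z y)" using union[OF q(1)] by blast
    have "Q y y" "Q s s" "Q p p" using Q s(1) p(1) yY(1) by simp_all
    then have "E y p" "E p q" "E s q" using p(2) q(2) s(1) p(1) yY(1) by simp_all
    then have "E z u" if "z \<in> insert y Y" for z
      using u(2) s p(1) that yY by blast
    then show ?case using u(1) by blast
  qed (use ne in auto)
  then obtain s where s: "s \<in> X" "!!y. y \<in> Y ==> E y s" by blast
  obtain t where t: "t \<in> Y" "f t = f s" using s Y by (metis image_iff)
  have tX: "t \<in> X" using t Y by auto
  have Qs: "Q s s" "Q t s" using Q s(1) tX t(2) by simp_all
  have "E s s" using E[OF tX s(1) s(1) s(1) Qs(2,1) s(2)[OF t(1)]] .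
  obtain p where p: "p \<in> X" "\<forall>z\<in>X. E z p \<longleftrightarrow> Q z s \<or> Q z s" using pair[OF s(1) s(1)] by blast
  then have "E s p" using Qs s(1) by blast
  then obtain y where y: "y \<in> X" "E y p" "\<not> (\<exists>z\<in>X. E z y & E z p)" using found[OF p(1) s(1)] by blast
  then have "Q s y" using p(2) Q[OF y(1) s(1)] Q[OF s(1) y(1)] by metis
  then have "E s y" using E[OF s(1) s(1) s(1) y(1) Qs(1) _ \<open>E s s\<close>] by blast
  then show False using y \<open>E s p\<close> s by blast
qed

text \<open>Formulated for prestructures, since the infinitude must be known before the quotient can
  be moved to the natural numbers.\<close>

definition infinite_theory :: "fm set => bool" where
  "infinite_theory T \<longleftrightarrow> (\<forall>(X::nat set) Q E f e.
     (\<forall>x\<in>X. \<forall>y\<in>X. Q x y \<longleftrightarrow> f x = (f y :: nat)) -->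
     (\<forall>x\<in>X. \<forall>y\<in>X. \<forall>x'\<in>X. \<forall>y'\<in>X. Q x x' --> Q y y' --> E x y --> E x' y') -->
     (\<forall>i. e i \<in> X) --> (\<forall>A\<in>T. presat X Q E e A) --> infinite (f ` X))"

theorem model_existence:
  assumes "consistent T" "infinite_theory T"
  obtains E :: "nat => nat => bool" and e where "!!A. A \<in> T ==> sat E e A"
proof -
  \<comment> \<open>Doubling all variables reserves the odd ones as Henkin constants; halving
    recovers the theory, so consistency is not affected.\<close>
  let ?T = "rename (%i. 2 * i) ` T"
  have "consistent ?T"
    unfolding consistent_def
  proof
    assume "?T \<turnstile> Falsum"
    from derives_rename[OF this, of "%i. i div 2"] have "T \<turnstile> Falsum"
      by (simp add: image_image rename_rename comp_def flip: id_def)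
    then show False using assms by (simp add: consistent_def)
  qed
  moreover have "!!B. B \<in> ?T ==> fv B \<subseteq> {i. even i}" by (auto simp: fv_rename)
  ultimately obtain \<Delta> where D: "?T \<subseteq> \<Delta>" "!!A. \<Delta> \<turnstile> A \<longleftrightarrow> A \<in> \<Delta>" "Falsum \<notin> \<Delta>"
     "!!A. A \<in> \<Delta> \<or> Imp A Falsum \<in> \<Delta>" "!!A. Imp (Forall A) Falsum \<in> \<Delta> ==> \<exists>t. Imp (subst0 t A) Falsum \<in> \<Delta>"
    using maximal_consistent_extension by metis
  interpret maximal \<Delta> using D by unfold_locales auto
  let ?Q = "%i j. Equal i j \<in> \<Delta>" and ?E = "%i j. Memb i j \<in> \<Delta>"
  have sat: "presat UNIV ?Q ?E (%i. 2 * i) A" if "A \<in> T" for A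
    using D(1) that by (auto simp: truth)
  have "infinite (rep ` UNIV)"
    using assms(2)[unfolded infinite_theory_def, rule_format, of UNIV ?Q rep ?E "%i. 2 * i"] sat
      rep_eq mem_cong by blast
  note inf = this
  show thesis
  proof (rule quotient_on_nat[of UNIV ?Q rep ?E])
    show "Equal x y \<in> \<Delta> \<longleftrightarrow> rep x = rep y" for x y using rep_eq by simp
    show "Memb x y \<in> \<Delta> ==> Memb x' y' \<in> \<Delta>" if "Equal x x' \<in> \<Delta>" "Equal y y' \<in> \<Delta>" for x y x' y'
      using mem_cong that by blast
    show "infinite (rep ` UNIV)" by (rule inf)
    fix v :: "nat => nat" and F
    assume "!!A e. (!!i. e i \<in> UNIV) ==> presat UNIV ?Q ?E e A \<longleftrightarrow> sat F (v \<circ> e) A"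
    then show thesis by (intro that[of F "v \<circ> (%i. 2 * i)"]) (use sat in simp)
  qed
qed

section \<open>Semantics of the formula notation\<close>

text \<open>\<open>n\<close> is the number of enclosing quantifiers, \<open>e\<close> assigns values to the variables (which are levels).\<close>

definition S :: "('a => 'a => bool) => (nat => 'a) => nat => (nat => 'a) => form => bool" where
  "S E d n e F = sat E (%i. if i < n then e (n - Suc i) else d (i - n)) (F n)"

lemma S_mem: "x < n ==> y < n ==> S E d n e (x \<^bold>\<in> y) = E (e x) (e y)"
  and S_equ: "x < n ==> y < n ==> S E d n e (x \<^bold>= y) = (e x = e y)"
  and S_neg: "S E d n e (\<^bold>\<not> A) = (\<not> S E d n e A)"
  and S_imp: "S E d n e (A \<^bold>\<longrightarrow> B) = (S E d n e A --> S E d n e B)"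
  by (auto simp: S_def mem_def equ_def neg_def imp_def Suc_diff_Suc)

lemma S_conj: "S E d n e (A \<^bold>\<and> B) = (S E d n e A & S E d n e B)"
  and S_disj: "S E d n e (A \<^bold>\<or> B) = (S E d n e A \<or> S E d n e B)"
  and S_iff: "S E d n e (A \<^bold>\<longleftrightarrow> B) = (S E d n e A \<longleftrightarrow> S E d n e B)"
  by (auto simp: conj_def disj_def iff_def S_neg S_imp)

lemma S_all: "S E d n e (\<^bold>\<forall>x. F x) = (\<forall>a. S E d (Suc n) (e(n := a)) (F n))"
proof -
  have "case_nat a (%i. if i < n then e (n - Suc i) else d (i - n))
      = (%i. if i < Suc n then (e(n := a)) (Suc n - Suc i) else d (i - Suc n))" for a
    by (rule ext) (auto split: nat.split)
  then show ?thesis by (simp add: S_def all_def)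
qed

lemma S_ex: "S E d n e (\<^bold>\<exists>x. F x) = (\<exists>a. S E d (Suc n) (e(n := a)) (F n))"
  by (simp add: ex_def S_neg S_all)

lemmas S_simps = S_mem S_equ S_neg S_imp S_conj S_disj S_iff S_all S_ex

lemma all_length_Suc: "(\<forall>a as. length as = k --> P (a # as)) \<longleftrightarrow> (\<forall>as. length as = Suc k --> P as)"
  by (auto simp: length_Suc_conv)

lemma S_alls:
  "S E d n e (alls k F) \<longleftrightarrow>
    (\<forall>as. length as = k --> S E d (n + k) (%i. if n \<le> i & i < n + k then as ! (i - n) else e i) (F [n..<n + k]))"
proof (induction k arbitrary: n e F)
  case (Suc k)
  let ?f = "%as i. if n \<le> i & i < n + Suc k then as ! (i - n) else e i"
  have *: "(%i. if Suc n \<le> i & i < Suc n + k then as ! (i - Suc n) else (e(n := a)) i) = ?f (a # as)" for a as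
  proof
    fix i show "(if Suc n \<le> i & i < Suc n + k then as ! (i - Suc n) else (e(n := a)) i) = ?f (a # as) i"
      by (cases "i - n") (auto simp: diff_Suc)
  qed
  have 1: "[n..<n + Suc k] = n # [Suc n..<Suc n + k]" by (simp add: upt_rec)
  have "S E d n e (alls (Suc k) F) \<longleftrightarrow>
      (\<forall>a as. length as = k --> S E d (n + Suc k) (?f (a # as)) (F [n..<n + Suc k]))"
    unfolding 1 alls.simps S_all Suc.IH * by simp
  also have "\<dots> \<longleftrightarrow> (\<forall>as. length as = Suc k --> S E d (n + Suc k) (?f as) (F [n..<n + Suc k]))"
    by (rule all_length_Suc)
  finally show ?case .
next
  case 0
  have "(%i. if n \<le> i & i < n + 0 then as ! (i - n) else e i) = e" for as by (rule ext) auto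
  then show ?case by simp
qed

lemma S_ap:
  assumes "!!i. i < length vs ==> vs ! i < n" "fv \<phi> \<subseteq> {..<length vs}"
  shows "S E d n e (ap \<phi> vs) \<longleftrightarrow> sat E (%i. e (vs ! i)) \<phi>"
  unfolding S_def ap_def sat_rename
proof (rule sat_cong)
  fix i assume "i \<in> fv \<phi>"
  then have "vs ! i < n" using assms by auto
  then show "((%i. if i < n then e (n - Suc i) else d (i - n)) \<circ> (%i. n - Suc (vs ! i))) i = e (vs ! i)"
    by (simp add: Suc_diff_Suc)
qed

section \<open>Definable predicates\<close>

named_theorems D_intros

locale mstruct =
  fixes E :: "'a => 'a => bool" (infix "\<E>" 50)
begin

definition tm :: "((nat => 'a) => 'a) => bool" where
  "tm t \<longleftrightarrow> (\<exists>i. t = (%e. e i)) \<or> (\<exists>c. t = (%_. c))"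

lemma tmI [intro, simp]: "tm (%e. e i)" "tm (%_. c)" by (auto simp: tm_def)

text \<open>Predicates definable with parameters; their argument is an assignment for de Bruijn indices.\<close>

inductive D :: "((nat => 'a) => bool) => bool" where
  mem: "tm s ==> tm t ==> D (%e. s e \<E> t e)"
| eq: "tm s ==> tm t ==> D (%e. s e = t e)"
| false: "D (%_. False)"
| imp: "D A ==> D B ==> D (%e. A e --> B e)"
| all: "D A ==> D (%e. \<forall>x. A (case_nat x e))"

lemma tm_subst: "tm t ==> (!!i. tm (s i)) ==> tm (%e. t (%i. s i e))"
  by (auto simp: tm_def)

lemma D_subst: "D A ==> (!!i. tm (s i)) ==> D (%e. A (%i. s i e))"
proof (induction arbitrary: s rule: D.induct)
  case (all A)
  let ?s = "%i. case i of 0 => (%e. e 0) | Suc i => (%e. s i (%j. e (Suc j)))"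
  have "tm (?s i)" for i using tm_subst[OF all.prems, of "%j e. e (Suc j)"] by (cases i) auto
  from all.IH[OF this] have "D (%e. A (%i. ?s i e))" .
  from D.all[OF this]
  have "D (%e. \<forall>x. A (%i. ?s i (case_nat x e)))" .
  moreover have "(%i. ?s i (case_nat x e)) = case_nat x (%i. s i e)" for x e
    by (auto split: nat.split)
  ultimately show ?case by simp
qed (auto intro!: D.intros intro: tm_subst)

lemma D_all [D_intros]: "D (%e. P (e 0) (%i. e (Suc i))) ==> D (%e. \<forall>x. P x e)"
  using D.all[of "%e. P (e 0) (%i. e (Suc i))"] by simp

lemma D_imp [D_intros]: "D A ==> D B ==> D (%e. A e --> B e)" by (rule D.imp)

lemma D_not [D_intros]: "D A ==> D (%e. \<not> A e)"
  using D.imp[of A, OF _ D.false] by simp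

lemma D_const [D_intros]: "D (%_. b)"
  using D.false D_not[OF D.false] by (cases b) auto

lemma D_conj [D_intros]: "D A ==> D B ==> D (%e. A e & B e)"
  using D_not[OF D_imp[of A, OF _ D_not[of B]]] by simp

lemma D_disj [D_intros]: "D A ==> D B ==> D (%e. A e \<or> B e)"
  using D_imp[OF D_not[of A], of B] by (simp add: disj_imp)

lemma D_iff [D_intros]: "D A ==> D B ==> D (%e. A e \<longleftrightarrow> B e)"
  using D_conj[OF D_imp[of A B] D_imp[of B A]] by (simp add: iff_conv_conj_imp)

lemma D_ex [D_intros]: "D (%e. P (e 0) (%i. e (Suc i))) ==> D (%e. \<exists>x. P x e)"
  using D_not[OF D_all[of "%x e. \<not> P x e"]] D_not by simp

definition DF :: "((nat => 'a) => 'a) => bool" where "DF f \<longleftrightarrow> D (%e. e 0 = f (%i. e (Suc i)))"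

lemma DF_var [D_intros]: "DF (%e. e i)" unfolding DF_def by (intro D.eq) auto
lemma DF_const [D_intros]: "DF (%_. c)" unfolding DF_def by (intro D.eq) auto

lemma D_rename: "D A ==> D (%e. A (%i. e (r i)))" by (rule D_subst) auto

lemma DF_shift: "DF f ==> DF (%e. f (%i. e (r i)))"
  using D_rename[of "%e. e 0 = f (%i. e (Suc i))" "case_nat 0 (Suc \<circ> r)"]
  by (simp add: DF_def comp_def)

text \<open>A defined function disappears from a predicate by quantifying over its value. All rules
  for composed definable functions reduce to this elimination.\<close>

lemma D_let: "DF f ==> D (%e. P (e 0) (%i. e (Suc i))) ==> D (%e. P (f e) e)"
  using D_ex[of "%x e. x = f e & P x e"] D_conj unfolding DF_def by simp

lemma D_app1: "D (%e. R (e 0)) ==> DF f ==> D (%e. R (f e))"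
  by (rule D_let[of f "%x e. R x"])

lemma D_app2:
  assumes "D (%e. R (e 0) (e 1))" "DF f" "DF g" shows "D (%e. R (f e) (g e))"
proof -
  have "D (%e. R (e 0) (g (%i. e (Suc i))))"
    by (rule D_let[of "%e. g (%i. e (Suc i))" "%y e. R (e 0) y"])
      (use DF_shift[OF assms(3)] D_rename[OF assms(1), of "case_nat 1 (%_. 0)"] in auto)
  from D_let[OF assms(2) this] show ?thesis .
qed

lemma D_app3:
  assumes "D (%e. R (e 0) (e 1) (e 2))" "DF f" "DF g" "DF h" shows "D (%e. R (f e) (g e) (h e))"
proof -
  have 1: "D (%e. R (e 0) (e 1) (h (%i. e (Suc (Suc i)))))"
    by (rule D_let[of "%e. h (%i. e (Suc (Suc i)))" "%y e. R (e 0) (e 1) y"])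
      (use DF_shift[OF assms(4)] D_rename[OF assms(1), of "case_nat 1 (case_nat 2 (%_. 0))"] in \<open>auto simp: numeral_2_eq_2\<close>)
  have "D (%e. R (e 0) (g (%i. e (Suc i))) (h (%i. e (Suc i))))"
    by (rule D_let[of "%e. g (%i. e (Suc i))" "%y e. R (e 0) y (h (%i. e (Suc i)))"])
      (use DF_shift[OF assms(3)] D_rename[OF 1, of "case_nat 1 (case_nat 0 (%i. Suc (Suc i)))"] in auto)
  from D_let[OF assms(2) this] show ?thesis .
qed

lemma D_mem [D_intros]: "DF f ==> DF g ==> D (%e. f e \<E> g e)"
  by (rule D_app2[where R="(\<E>)"]) (auto intro: D.mem)
lemma D_eq [D_intros]: "DF f ==> DF g ==> D (%e. f e = g e)"
  by (rule D_app2[where R="(=)"]) (auto intro: D.eq)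

lemma DF_app1: "DF (%e. c (e 0)) ==> DF f ==> DF (%e. c (f e))"
  unfolding DF_def[of "%e. c (f e)"]
  by (rule D_app2[where R="%y x. y = c x" and f="%e. e 0" and g="%e. f (%i. e (Suc i))"])
    (auto simp: DF_def[of "%e. c (e 0)"] intro: DF_var DF_shift)

lemma DF_app2: "DF (%e. c (e 0) (e 1)) ==> DF f ==> DF g ==> DF (%e. c (f e) (g e))"
  unfolding DF_def[of "%e. c (f e) (g e)"]
  by (rule D_app3[where R="%y x z. y = c x z" and f="%e. e 0" and g="%e. f (%i. e (Suc i))" and h="%e. g (%i. e (Suc i))"])
    (auto simp: DF_def[of "%e. c (e 0) (e (Suc 0))"] numeral_2_eq_2 intro: DF_var DF_shift)

text \<open>Arguments occupy the even variables and parameters the odd ones, so that one assignment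
  has room for infinitely many of both.\<close>

definition mix :: "(nat => 'a) => (nat => 'a) => nat => 'a" where
  "mix c e i = (if even i then e (i div 2) else c (i div 2))"

lemma tm_mix:
  assumes "tm s" "tm t" shows "\<exists>i j c. \<forall>e. s e = mix c e i & t e = mix c e j"
proof -
  \<comment> \<open>Slot \<open>k\<close> is reserved for the possible parameter of this term,
    whatever stands in the other slots. The two terms are given the slots 0 and 1.\<close>
  have *: "\<exists>i c. \<forall>e c'. s e = mix (%n. if n = k then c else c' n) e i & (even i \<or> i = 2 * k + 1)" if "tm s" for s k
    using that unfolding tm_def
  proof
    assume "\<exists>i. s = (%e. e i)"
    then obtain i where "s = (%e. e i)" by blast
    then show ?thesis by (intro exI[of _ "2 * i"]) (auto simp: mix_def)
  next
    assume "\<exists>c. s = (%_. c)"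
    then obtain c where "s = (%_. c)" by blast
    then show ?thesis by (intro exI[of _ "2 * k + 1"] exI[of _ c]) (auto simp: mix_def)
  qed
  obtain i c where 1: "!!e c'. s e = mix (%n. if n = 0 then c else c' n) e i" using *[OF assms(1), of 0] by blast
  obtain j d where 2: "!!e c'. t e = mix (%n. if n = 1 then d else c' n) e j" using *[OF assms(2), of 1] by blast
  let ?c = "%n::nat. if n = 1 then d else c"
  have e: "(%n. if n = 0 then c else ?c n) = ?c" "(%n. if n = 1 then d else ?c n) = ?c" by auto
  have "\<forall>e. s e = mix ?c e i & t e = mix ?c e j" using 1[of _ ?c] 2[of _ ?c] unfolding e by simp
  then show ?thesis by blast
qed

text \<open>Leads from the semantic notion back to a single formula with a parameter assignment,
  which is the form in which the schemas of ZF hold in the model. For an implication the two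
  parameter assignments are interleaved by \<open>mix\<close> itself.\<close>

lemma D_formula: "D A ==> \<exists>\<phi> c. \<forall>e. A e \<longleftrightarrow> sat E (mix c e) \<phi>"
proof (induction rule: D.induct)
  case (mem s t)
  then obtain i j c where "\<forall>e. s e = mix c e i & t e = mix c e j" using tm_mix by metis
  then show ?case by (intro exI[of _ "Memb i j"] exI[of _ c]) auto
next
  case (eq s t)
  then obtain i j c where "\<forall>e. s e = mix c e i & t e = mix c e j" using tm_mix by metis
  then show ?case by (intro exI[of _ "Equal i j"] exI[of _ c]) auto
next
  case false show ?case by (intro exI[of _ Falsum]) auto
next
  case (imp A B)
  then obtain \<phi> c \<psi> d where *: "!!e. A e \<longleftrightarrow> sat E (mix c e) \<phi>" "!!e. B e \<longleftrightarrow> sat E (mix d e) \<psi>" by blast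
  have a: "mix (mix c d) e \<circ> (%i. if even i then i else 2 * (2 * (i div 2) + 1) + 1) = mix c e" for e
    by (rule ext) (auto simp: mix_def elim!: oddE)
  have b: "mix (mix c d) e \<circ> (%i. if even i then i else 2 * (2 * (i div 2)) + 1) = mix d e" for e
    by (rule ext) (auto simp: mix_def elim!: oddE)
  show ?case
    by (intro exI[of _ "Imp (rename (%i. if even i then i else 2 * (2 * (i div 2) + 1) + 1) \<phi>)
          (rename (%i. if even i then i else 2 * (2 * (i div 2)) + 1) \<psi>)"] exI[of _ "mix c d"])
      (simp add: sat_rename a b * del: comp_apply o_apply)
next
  case (all A)
  then obtain \<phi> c where *: "!!e. A e \<longleftrightarrow> sat E (mix c e) \<phi>" by blast
  \<comment> \<open>A new bound variable moves every slot by one in the assignment under the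
    quantifier, whereas \<open>mix\<close> expects the argument slots to move by two and the
    parameter slots to stay. The renaming mediates between the two layouts.\<close>
  let ?r = "%i. if i = 0 then 0 else if even i then i - 1 else Suc i"
  have a: "case_nat x (mix c e) \<circ> ?r = mix c (case_nat x e)" for x e
  proof
    fix i show "(case_nat x (mix c e) \<circ> ?r) i = mix c (case_nat x e) i"
    proof (cases "even i")
      case True
      then obtain j where "i = 2 * j" by blast
      then show ?thesis by (cases j) (auto simp: mix_def)
    next
      case False
      then show ?thesis by (cases i) (auto simp: mix_def)
    qed
  qed
  have "(\<forall>x. A (case_nat x e)) \<longleftrightarrow> sat E (mix c e) (Forall (rename ?r \<phi>))" for e
    unfolding sat.simps sat_rename a * by (rule refl)
  then show ?case by blast
qed

end

section \<open>Set theory in a first-order structure\<close>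

text \<open>The schemas range over definable semantic predicates. Set constructions can then use
  ordinary abstraction, with definability as a side condition for the simplifier, instead of codes
  of formulas.\<close>

locale zf = mstruct E for E :: "'a => 'a => bool" (infix "\<E>" 50) +
  assumes extensional: "(!!z. z \<E> x \<longleftrightarrow> z \<E> y) ==> x = y"
    and founded: "z \<E> x ==> \<exists>y. y \<E> x & \<not> (\<exists>z. z \<E> y & z \<E> x)"
    and ax_pairing: "\<exists>p. \<forall>z. z \<E> p \<longleftrightarrow> z = x \<or> z = y"
    and ax_union: "\<exists>u. \<forall>z. z \<E> u \<longleftrightarrow> (\<exists>y. y \<E> x & z \<E> y)"
    and ax_power: "\<exists>p. \<forall>z. z \<E> p \<longleftrightarrow> (\<forall>y. y \<E> z --> y \<E> x)"
    and ax_infinity: "\<exists>w. (\<exists>v. (\<forall>z. \<not> z \<E> v) & v \<E> w) &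
        (\<forall>x. x \<E> w --> (\<exists>s. (\<forall>z. z \<E> s \<longleftrightarrow> z \<E> x \<or> z = x) & s \<E> w))"
    and ax_separation: "D (%e. P (e 0)) ==> \<exists>b. \<forall>x. x \<E> b \<longleftrightarrow> x \<E> a & P x"
    and ax_replacement: "D (%e. R (e 0) (e 1)) ==> (!!x y z. x \<E> a ==> R x y ==> R x z ==> y = z) ==>
        \<exists>b. \<forall>y. y \<E> b \<longleftrightarrow> (\<exists>x. x \<E> a & R x y)"

section \<open>From satisfaction of ZF to the axioms in semantic form\<close>

lemma S_sentence: "sat E d (sentence F) = S E d 0 e F"
  by (simp add: S_def sentence_def)

lemma S_Separation:
  assumes "fv \<phi> \<subseteq> {..<k + 2}"
  shows "S E d 0 e (Separation k \<phi>) \<longleftrightarrow> (\<forall>ps. length ps = k -->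
    (\<forall>a. \<exists>b. \<forall>x. E x b \<longleftrightarrow> E x a & sat E (%i. (x # a # ps) ! i) \<phi>))"
proof -
  have *: "S E d (k + 3) (f(k := a, Suc k := b, Suc (Suc k) := x)) (ap \<phi> (Suc (Suc k) # k # [0..<k])) \<longleftrightarrow>
       sat E (%i. (x # a # ps) ! i) \<phi>"
    if "length ps = k" "!!i. i < k ==> f i = ps ! i" for f ps a b x
  proof (subst S_ap)
    show "(Suc (Suc k) # k # [0..<k]) ! i < k + 3" if "i < length (Suc (Suc k) # k # [0..<k])" for i
      using that by (auto simp: nth_Cons split: nat.split)
    show "fv \<phi> \<subseteq> {..<length (Suc (Suc k) # k # [0..<k])}" using assms by simp
    show "sat E (%i. (f(k := a, Suc k := b, Suc (Suc k) := x)) ((Suc (Suc k) # k # [0..<k]) ! i)) \<phi> =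
      sat E ((!) (x # a # ps)) \<phi>"
      by (rule sat_cong) (use assms that in \<open>auto simp: nth_Cons split: nat.split\<close>)
  qed
  show ?thesis
    unfolding Separation_def S_alls
  proof (intro iff_allI imp_cong refl)
    fix ps :: "'a list" assume ps: "length ps = k"
    let ?f = "%i. if 0 \<le> i & i < 0 + k then ps ! (i - 0) else e i"
    have "S E d (Suc (Suc (Suc k))) (?f(k := a, Suc k := b, Suc (Suc k) := x)) (ap \<phi> (Suc (Suc k) # k # [0..<k])) \<longleftrightarrow>
       sat E (%i. (x # a # ps) ! i) \<phi>" for a b x
      using *[OF ps, of ?f a b x] by (simp add: numeral_3_eq_3)
    then show "S E d (0 + k) ?f (\<^bold>\<forall>a. \<^bold>\<exists>b. \<^bold>\<forall>x. x \<^bold>\<in> b \<^bold>\<longleftrightarrow> x \<^bold>\<in> a \<^bold>\<and> ap \<phi> (x # a # [0..<0 + k])) \<longleftrightarrow>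
       (\<forall>a. \<exists>b. \<forall>x. E x b \<longleftrightarrow> E x a & sat E (%i. (x # a # ps) ! i) \<phi>)"
      by (simp add: S_simps)
  qed
qed

lemma S_Replacement:
  assumes "fv \<phi> \<subseteq> {..<k + 3}"
  shows "S E d 0 e (Replacement k \<phi>) \<longleftrightarrow> (\<forall>ps. length ps = k -->
    (\<forall>a. (\<forall>x. E x a --> (\<forall>y z. sat E (%i. (x # y # a # ps) ! i) \<phi> & sat E (%i. (x # z # a # ps) ! i) \<phi> --> y = z)) -->
      (\<exists>b. \<forall>y. E y b \<longleftrightarrow> (\<exists>x. E x a & sat E (%i. (x # y # a # ps) ! i) \<phi>))))"
proof -
  have *: "S E d n f (ap \<phi> (u # v # k # [0..<k])) \<longleftrightarrow> sat E (%i. (f u # f v # f k # ps) ! i) \<phi>"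
    if "length ps = k" "!!i. i < k ==> f i = ps ! i" "u < n" "v < n" "k < n" for f ps n u v
  proof (subst S_ap)
    show "(u # v # k # [0..<k]) ! i < n" if "i < length (u # v # k # [0..<k])" for i
      using that \<open>u < n\<close> \<open>v < n\<close> \<open>k < n\<close> by (auto simp: nth_Cons split: nat.split)
    show "fv \<phi> \<subseteq> {..<length (u # v # k # [0..<k])}" using assms by (simp add: numeral_3_eq_3)
    show "sat E (%i. f ((u # v # k # [0..<k]) ! i)) \<phi> = sat E ((!) (f u # f v # f k # ps)) \<phi>"
      by (rule sat_cong) (use assms that in \<open>auto simp: nth_Cons split: nat.split\<close>)
  qed
  show ?thesis
    unfolding Replacement_def S_alls
  proof (intro iff_allI imp_cong refl)
    fix ps :: "'a list" assume ps: "length ps = k"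
    let ?f = "%i. if 0 \<le> i & i < 0 + k then ps ! (i - 0) else e i"
    show "S E d (0 + k) ?f (\<^bold>\<forall>a. (\<^bold>\<forall>x. x \<^bold>\<in> a \<^bold>\<longrightarrow>
        (\<^bold>\<forall>y. \<^bold>\<forall>z. ap \<phi> (x # y # a # [0..<0 + k]) \<^bold>\<and> ap \<phi> (x # z # a # [0..<0 + k]) \<^bold>\<longrightarrow> y \<^bold>= z)) \<^bold>\<longrightarrow>
        (\<^bold>\<exists>b. \<^bold>\<forall>y. y \<^bold>\<in> b \<^bold>\<longleftrightarrow> (\<^bold>\<exists>x. x \<^bold>\<in> a \<^bold>\<and> ap \<phi> (x # y # a # [0..<0 + k])))) \<longleftrightarrow>
       (\<forall>a. (\<forall>x. E x a --> (\<forall>y z. sat E (%i. (x # y # a # ps) ! i) \<phi> & sat E (%i. (x # z # a # ps) ! i) \<phi> --> y = z)) -->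
      (\<exists>b. \<forall>y. E y b \<longleftrightarrow> (\<exists>x. E x a & sat E (%i. (x # y # a # ps) ! i) \<phi>)))"
      by (simp add: S_simps *[OF ps])
  qed
qed

lemma finite_fv_bound: "\<exists>k. fv \<phi> \<subseteq> {..<k}"
  using finite_fv[of \<phi>] finite_nat_iff_bounded by blast

theorem zf_of_model:
  assumes "!!A. A \<in> ZF ==> sat E d A"
  shows "zf E"
proof -
  interpret mstruct E .
  have ax: "S E d 0 d F" if "sentence F \<in> ZF" for F using assms[OF that] S_sentence by metis
  have ax': "S E d 0 d F" if "F \<in> {Extensionality, Foundation, Pairing, Union_Axiom, Power_Set_Axiom, Infinity}" for F
    using ax that unfolding ZF_def by blast
  show ?thesis
  proof
    show "x = y" if "!!z. E z x \<longleftrightarrow> E z y" for x y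
      using ax'[of Extensionality] that unfolding Extensionality_def by (simp add: S_simps)
    show "\<exists>y. E y x & \<not> (\<exists>z. E z y & E z x)" if "E z x" for z x
      using ax'[of Foundation] that unfolding Foundation_def Nonempty_def by (simp add: S_simps) blast
    show "\<exists>p. \<forall>z. E z p \<longleftrightarrow> z = x \<or> z = y" for x y
      using ax'[of Pairing] unfolding Pairing_def UPair_def by (simp add: S_simps)
    show "\<exists>u. \<forall>z. E z u \<longleftrightarrow> (\<exists>y. E y x & E z y)" for x
      using ax'[of Union_Axiom] unfolding Union_Axiom_def BigUnion_def by (simp add: S_simps)
    show "\<exists>p. \<forall>z. E z p \<longleftrightarrow> (\<forall>y. E y z --> E y x)" for x
      using ax'[of Power_Set_Axiom] unfolding Power_Set_Axiom_def PowerSet_def Subset_def by (simp add: S_simps)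
    show "\<exists>w. (\<exists>v. (\<forall>z. \<not> E z v) & E v w) & (\<forall>x. E x w --> (\<exists>s. (\<forall>z. E z s \<longleftrightarrow> E z x \<or> z = x) & E s w))"
      using ax'[of Infinity] unfolding Infinity_def Inductive_def Succ_def Nonempty_def by (simp add: S_simps)
  next
    fix P a assume P: "D (%e. P (e 0))"
    obtain \<phi> c where \<phi>: "!!e. P (e 0) \<longleftrightarrow> sat E (mix c e) \<phi>" using D_formula[OF P] by blast
    obtain k where k: "fv \<phi> \<subseteq> {..<k}" using finite_fv_bound by blast
    \<comment> \<open>The layout of the separation schema: the element is variable 0, the ambient
      set is variable 1 and the parameters follow from 2 on.\<close>
    define r where "r = (%i::nat. if even i then 0 else 2 + i div 2)"
    have fv: "fv (rename r \<phi>) \<subseteq> {..<k + 2}" using k by (auto simp: fv_rename r_def)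
    have "S E d 0 d (Separation k (rename r \<phi>))" using ax fv unfolding ZF_def by blast
    from this[unfolded S_Separation[OF fv], rule_format, of "map c [0..<k]" a]
    obtain b where b: "!!x. E x b \<longleftrightarrow> E x a & sat E (%i. (x # a # map c [0..<k]) ! i) (rename r \<phi>)" by auto
    have "sat E (%i. (x # a # map c [0..<k]) ! i) (rename r \<phi>) \<longleftrightarrow> sat E (mix c (%_. x)) \<phi>" for x
      unfolding sat_rename by (rule sat_cong) (use k in \<open>auto simp: r_def mix_def\<close>)
    then show "\<exists>b. \<forall>x. E x b \<longleftrightarrow> E x a & P x" using b \<phi>[of "%_. _"] by auto
  next
    fix R a assume R: "D (%e. R (e 0) (e 1))" and fn: "!!x y z. E x a ==> R x y ==> R x z ==> y = z"
    obtain \<phi> c where \<phi>: "!!e. R (e 0) (e 1) \<longleftrightarrow> sat E (mix c e) \<phi>" using D_formula[OF R] by blast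
    obtain k where k: "fv \<phi> \<subseteq> {..<k}" using finite_fv_bound by blast
    \<comment> \<open>The layout of the replacement schema: argument 0, value 1, ambient set 2,
      parameters from 3 on.\<close>
    define r where "r = (%i::nat. if even i then if i = 0 then 0 else 1 else 3 + i div 2)"
    have fv: "fv (rename r \<phi>) \<subseteq> {..<k + 3}" using k by (auto simp: fv_rename r_def)
    have sat: "sat E (%i. (x # y # a # map c [0..<k]) ! i) (rename r \<phi>) \<longleftrightarrow> R x y" for x y
    proof -
      have "sat E (%i. (x # y # a # map c [0..<k]) ! i) (rename r \<phi>) \<longleftrightarrow> sat E (mix c (%i. if i = 0 then x else y)) \<phi>"
        unfolding sat_rename by (rule sat_cong) (use k in \<open>auto simp: r_def mix_def elim!: evenE\<close>)
      then show ?thesis using \<phi>[of "%i. if i = 0 then x else y"] by simp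
    qed
    have "S E d 0 d (Replacement k (rename r \<phi>))" using ax fv unfolding ZF_def by blast
    from this[unfolded S_Replacement[OF fv], rule_format, of "map c [0..<k]" a]
    show "\<exists>b. \<forall>y. E y b \<longleftrightarrow> (\<exists>x. E x a & R x y)" using fn by (simp add: sat)
  qed
qed

section \<open>Prestructures of ZF have infinitely many classes\<close>

definition PS :: "'a set => ('a => 'a => bool) => ('a => 'a => bool) => (nat => 'a) => nat => (nat => 'a) => form => bool" where
  "PS X Q E d n e F = presat X Q E (%i. if i < n then e (n - Suc i) else d (i - n)) (F n)"

lemma PS_basic: "x < n ==> y < n ==> PS X Q E d n e (x \<^bold>\<in> y) = E (e x) (e y)"
  "x < n ==> y < n ==> PS X Q E d n e (x \<^bold>= y) = Q (e x) (e y)"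
  "PS X Q E d n e (\<^bold>\<not> A) = (\<not> PS X Q E d n e A)"
  "PS X Q E d n e (A \<^bold>\<longrightarrow> B) = (PS X Q E d n e A --> PS X Q E d n e B)"
  by (auto simp: PS_def mem_def equ_def neg_def imp_def Suc_diff_Suc)

lemma PS_connectives: "PS X Q E d n e (A \<^bold>\<and> B) = (PS X Q E d n e A & PS X Q E d n e B)"
  "PS X Q E d n e (A \<^bold>\<or> B) = (PS X Q E d n e A \<or> PS X Q E d n e B)"
  "PS X Q E d n e (A \<^bold>\<longleftrightarrow> B) = (PS X Q E d n e A \<longleftrightarrow> PS X Q E d n e B)"
  by (auto simp: conj_def disj_def iff_def PS_basic)

lemma PS_all: "PS X Q E d n e (\<^bold>\<forall>x. F x) = (\<forall>a\<in>X. PS X Q E d (Suc n) (e(n := a)) (F n))"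
proof -
  have "case_nat a (%i. if i < n then e (n - Suc i) else d (i - n))
      = (%i. if i < Suc n then (e(n := a)) (Suc n - Suc i) else d (i - Suc n))" for a
    by (rule ext) (auto split: nat.split)
  then show ?thesis by (simp add: PS_def all_def)
qed

lemma PS_ex: "PS X Q E d n e (\<^bold>\<exists>x. F x) = (\<exists>a\<in>X. PS X Q E d (Suc n) (e(n := a)) (F n))"
  by (simp add: ex_def PS_basic PS_all)

lemmas PS_simps = PS_basic PS_connectives PS_all PS_ex

lemma infinite_theory_ZF:
  assumes "ZF \<subseteq> T" shows "infinite_theory T"
  unfolding infinite_theory_def
proof (intro allI impI)
  fix X Q E and f e :: "nat => nat"
  assume Q: "\<forall>x\<in>X. \<forall>y\<in>X. Q x y \<longleftrightarrow> f x = f y"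
    and E: "\<forall>x\<in>X. \<forall>y\<in>X. \<forall>x'\<in>X. \<forall>y'\<in>X. Q x x' --> Q y y' --> E x y --> E x' y'"
    and e: "\<forall>i. e i \<in> X" and T: "\<forall>A\<in>T. presat X Q E e A"
  have ax: "PS X Q E e 0 e F" if "F \<in> {Foundation, Pairing, Union_Axiom}" for F
    using T assms that unfolding ZF_def sentence_def by (auto simp: PS_def)
  show "infinite (f ` X)"
  proof (rule infinite_quotient[of "e 0" X Q f E])
    show "\<exists>p\<in>X. \<forall>z\<in>X. E z p \<longleftrightarrow> Q z x \<or> Q z y" if "x \<in> X" "y \<in> X" for x y
      using ax[of Pairing] that unfolding Pairing_def UPair_def
      by (simp add: PS_simps)
    show "\<exists>u\<in>X. \<forall>z\<in>X. E z u \<longleftrightarrow> (\<exists>y\<in>X. E y x & E z y)" if "x \<in> X" for x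
      using ax[of Union_Axiom] that unfolding Union_Axiom_def BigUnion_def
      by (simp add: PS_simps)
    show "\<exists>y\<in>X. E y x & \<not> (\<exists>z\<in>X. E z y & E z x)" if "x \<in> X" "z \<in> X" "E z x" for x z
      using ax[of Foundation] that unfolding Foundation_def Nonempty_def
      by (simp add: PS_simps) blast
    show "E x' y'" if "x \<in> X" "y \<in> X" "x' \<in> X" "y' \<in> X" "Q x x'" "Q y y'" "E x y" for x y x' y'
      using E that by blast
  qed (use e Q in auto)
qed

context zf
begin

subsection \<open>Set formation\<close>

lemma ex_zero: "\<exists>b. \<forall>x. \<not> x \<E> b"
  using ax_separation[of "%_. False", OF D_const] by blast

definition zero where "zero = (THE b. \<forall>x. \<not> x \<E> b)"

lemma not_zero [simp]: "\<not> x \<E> zero"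
proof -
  obtain b where b: "\<forall>x. \<not> x \<E> b" using ex_zero by blast
  then have "\<forall>x. \<not> x \<E> zero" unfolding zero_def by (rule theI) (use b extensional in blast)
  then show ?thesis by blast
qed

lemma eq_zero: "x = zero \<longleftrightarrow> (\<forall>y. \<not> y \<E> x)"
  using extensional[of x zero] by auto

text \<open>Both operators return \<open>zero\<close> where the described object does not exist or is not unique.\<close>

definition the_set :: "('a => bool) => 'a" where
  "the_set P = (if \<exists>b. \<forall>x. x \<E> b \<longleftrightarrow> P x then THE b. \<forall>x. x \<E> b \<longleftrightarrow> P x else zero)"

definition the_el :: "('a => bool) => 'a" where
  "the_el P = (if \<exists>!x. P x then THE x. P x else zero)"

lemma the_set_eq: "(!!x. x \<E> b \<longleftrightarrow> P x) ==> the_set P = b"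
  unfolding the_set_def using extensional by (subst if_P, blast) (rule the_equality, blast+)

lemma the_set_iff: "\<exists>b. \<forall>x. x \<E> b \<longleftrightarrow> P x ==> x \<E> the_set P \<longleftrightarrow> P x"
  using the_set_eq by blast

lemma the_el_eq: "P x ==> (!!y. P y ==> y = x) ==> the_el P = x"
  unfolding the_el_def by (subst if_P, blast) (rule the_equality, blast+)

lemma eq_the_set: "b = the_set P \<longleftrightarrow> (\<forall>x. x \<E> b \<longleftrightarrow> P x) \<or> (\<not> (\<exists>b. \<forall>x. x \<E> b \<longleftrightarrow> P x)) & b = zero"
proof (cases "\<exists>b. \<forall>x. x \<E> b \<longleftrightarrow> P x")
  case True
  then show ?thesis using the_set_eq[of b P] the_set_iff[of P] by blast
next
  case False
  then have "the_set P = zero" unfolding the_set_def by (rule if_not_P)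
  moreover have "\<not> (\<forall>x. x \<E> b \<longleftrightarrow> P x)" using False by blast
  ultimately show ?thesis using False by (simp only:) simp
qed

lemma eq_the_el: "b = the_el P \<longleftrightarrow> P b & (\<forall>y. P y --> y = b) \<or> (\<not> (\<exists>x. P x & (\<forall>y. P y --> y = x))) & b = zero"
proof (cases "\<exists>!x. P x")
  case True
  then obtain x where x: "P x" "!!y. P y ==> y = x" by blast
  then have "the_el P = x" by (rule the_el_eq)
  then show ?thesis using x by blast
next
  case False
  then show ?thesis unfolding the_el_def Ex1_def by simp blast
qed

lemma DF_the_set [D_intros]:
  assumes "D (%e. P (e 0) (%i. e (Suc i)))" shows "DF (%e. the_set (%x. P x e))"
proof -
  have 1: "D (%e. P (e 0) (%i. e (Suc (Suc i))))"
    using D_rename[OF assms, of "case_nat 0 (%i. Suc (Suc i))"] by simp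
  have 2: "D (%e. P (e 0) (%i. e (Suc (Suc (Suc i)))))"
    using D_rename[OF assms, of "case_nat 0 (%i. Suc (Suc (Suc i)))"] by simp
  show ?thesis unfolding DF_def eq_the_set by (intro D_intros 1 2)
qed

lemma DF_the_el [D_intros]:
  assumes "D (%e. P (e 0) (%i. e (Suc i)))" shows "DF (%e. the_el (%x. P x e))"
proof -
  have 1: "D (%e. P (e 0) (%i. e (Suc (Suc i))))"
    using D_rename[OF assms, of "case_nat 0 (%i. Suc (Suc i))"] by simp
  have 2: "D (%e. P (e 0) (%i. e (Suc (Suc (Suc i)))))"
    using D_rename[OF assms, of "case_nat 0 (%i. Suc (Suc (Suc i)))"] by simp
  show ?thesis unfolding DF_def eq_the_el by (intro D_intros 1 2 assms)
qed

definition sub (infix "\<sqsubseteq>" 50) where "x \<sqsubseteq> y \<longleftrightarrow> (\<forall>z. z \<E> x --> z \<E> y)"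
definition upair where "upair x y = the_set (%z. z = x \<or> z = y)"
definition Un2 where "Un2 x y = the_set (%z. z \<E> x \<or> z \<E> y)"
definition BU where "BU x = the_set (%z. \<exists>y. y \<E> x & z \<E> y)"
definition Pw where "Pw x = the_set (%z. z \<sqsubseteq> x)"
definition Sep where "Sep a P = the_set (%x. x \<E> a & P x)"
definition Rep where "Rep a F = the_set (%y. \<exists>x. x \<E> a & y = F x)"
definition pair where "pair x y = upair (upair x x) (upair x y)"
definition fs where "fs p = the_el (%x. \<exists>y. p = pair x y)"
definition sn where "sn p = the_el (%y. \<exists>x. p = pair x y)"
definition succ where "succ x = Un2 x (upair x x)"
definition prod where "prod a b = the_set (%p. \<exists>x y. x \<E> a & y \<E> b & p = pair x y)"
definition app where "app f x = the_el (%y. pair x y \<E> f)"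
definition lam where "lam a F = the_set (%p. \<exists>x. x \<E> a & p = pair x (F x))"
definition dom where "dom f = the_set (%x. \<exists>y. pair x y \<E> f)"
definition ran where "ran f = the_set (%y. \<exists>x. pair x y \<E> f)"
definition restr where "restr f a = Sep f (%p. fs p \<E> a)"
definition fn where "fn f a \<longleftrightarrow> (\<forall>p. p \<E> f --> (\<exists>x y. x \<E> a & p = pair x y)) &
   (\<forall>x. x \<E> a --> (\<exists>y. pair x y \<E> f & (\<forall>z. pair x z \<E> f --> z = y)))"

lemma D_sub [D_intros]: "DF f ==> DF g ==> D (%e. f e \<sqsubseteq> g e)"
  by (rule D_app2[where R=sub]) (unfold sub_def, intro D_intros)
lemma DF_upair [D_intros]: "DF f ==> DF g ==> DF (%e. upair (f e) (g e))"
  by (rule DF_app2[where c=upair]) (unfold upair_def, intro D_intros)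
lemma DF_Un2 [D_intros]: "DF f ==> DF g ==> DF (%e. Un2 (f e) (g e))"
  by (rule DF_app2[where c=Un2]) (unfold Un2_def, intro D_intros)
lemma DF_BU [D_intros]: "DF f ==> DF (%e. BU (f e))"
  by (rule DF_app1[where c=BU]) (unfold BU_def, intro D_intros)
lemma DF_Pw [D_intros]: "DF f ==> DF (%e. Pw (f e))"
  by (rule DF_app1[where c=Pw]) (unfold Pw_def, intro D_intros)
lemma DF_pair [D_intros]: "DF f ==> DF g ==> DF (%e. pair (f e) (g e))"
  by (rule DF_app2[where c=pair]) (unfold pair_def, intro D_intros)
lemma DF_fs [D_intros]: "DF f ==> DF (%e. fs (f e))"
  by (rule DF_app1[where c=fs]) (unfold fs_def, intro D_intros)
lemma DF_sn [D_intros]: "DF f ==> DF (%e. sn (f e))"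
  by (rule DF_app1[where c=sn]) (unfold sn_def, intro D_intros)
lemma DF_succ [D_intros]: "DF f ==> DF (%e. succ (f e))"
  by (rule DF_app1[where c=succ]) (unfold succ_def, intro D_intros)
lemma DF_prod [D_intros]: "DF f ==> DF g ==> DF (%e. prod (f e) (g e))"
  by (rule DF_app2[where c=prod]) (unfold prod_def, intro D_intros)
lemma DF_app [D_intros]: "DF f ==> DF g ==> DF (%e. app (f e) (g e))"
  by (rule DF_app2[where c=app]) (unfold app_def, intro D_intros)
lemma DF_dom [D_intros]: "DF f ==> DF (%e. dom (f e))"
  by (rule DF_app1[where c=dom]) (unfold dom_def, intro D_intros)
lemma DF_ran [D_intros]: "DF f ==> DF (%e. ran (f e))"
  by (rule DF_app1[where c=ran]) (unfold ran_def, intro D_intros)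
lemma D_fn [D_intros]: "DF f ==> DF g ==> D (%e. fn (f e) (g e))"
  by (rule D_app2[where R=fn]) (unfold fn_def, intro D_intros)

lemma DF_Sep [D_intros]:
  assumes "DF f" "D (%e. P (e 0) (%i. e (Suc i)))" shows "DF (%e. Sep (f e) (%x. P x e))"
  unfolding Sep_def by (intro D_intros assms DF_shift[OF assms(1)])
lemma DF_Rep [D_intros]:
  assumes "DF f" "DF (%e. F (e 0) (%i. e (Suc i)))" shows "DF (%e. Rep (f e) (%x. F x e))"
  unfolding Rep_def
  by (intro D_intros DF_shift[OF assms(1)])
    (use DF_shift[OF assms(2), of "case_nat 0 (%i. Suc (Suc i))"] in simp)
lemma DF_lam [D_intros]:
  assumes "DF f" "DF (%e. F (e 0) (%i. e (Suc i)))" shows "DF (%e. lam (f e) (%x. F x e))"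
  unfolding lam_def
  by (intro D_intros DF_shift[OF assms(1)])
    (use DF_shift[OF assms(2), of "case_nat 0 (%i. Suc (Suc i))"] in simp)
lemma DF_restr [D_intros]: "DF f ==> DF g ==> DF (%e. restr (f e) (g e))"
  by (rule DF_app2[where c=restr]) (unfold restr_def, intro D_intros)

declare D_intros [simp]

lemma subI: "(!!z. z \<E> x ==> z \<E> y) ==> x \<sqsubseteq> y" by (simp add: sub_def)
lemma subD: "x \<sqsubseteq> y ==> z \<E> x ==> z \<E> y" by (simp add: sub_def)
lemma sub_refl [simp]: "x \<sqsubseteq> x" by (simp add: sub_def)
lemma sub_trans: "x \<sqsubseteq> y ==> y \<sqsubseteq> z ==> x \<sqsubseteq> z" by (simp add: sub_def)
lemma sub_antisym: "x \<sqsubseteq> y ==> y \<sqsubseteq> x ==> x = y" unfolding sub_def by (rule extensional) blast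

lemma upair_iff [simp]: "z \<E> upair x y \<longleftrightarrow> z = x \<or> z = y"
  unfolding upair_def by (rule the_set_iff) (rule ax_pairing)

lemma BU_iff [simp]: "z \<E> BU x \<longleftrightarrow> (\<exists>y. y \<E> x & z \<E> y)"
  unfolding BU_def by (rule the_set_iff) (rule ax_union)

lemma Un2_iff [simp]: "z \<E> Un2 x y \<longleftrightarrow> z \<E> x \<or> z \<E> y"
  unfolding Un2_def by (rule the_set_iff, rule exI[of _ "BU (upair x y)"]) auto

lemma Pw_iff [simp]: "z \<E> Pw x \<longleftrightarrow> z \<sqsubseteq> x"
  unfolding Pw_def sub_def by (rule the_set_iff) (rule ax_power)

lemma Sep_iff [simp]: "D (%e. P (e 0)) ==> x \<E> Sep a P \<longleftrightarrow> x \<E> a & P x"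
  unfolding Sep_def by (rule the_set_iff) (rule ax_separation)

lemma Rep_iff [simp]: "DF (%e. F (e 0)) ==> y \<E> Rep a F \<longleftrightarrow> (\<exists>x. x \<E> a & y = F x)"
  unfolding Rep_def
proof (rule the_set_iff, rule ax_replacement)
  assume "DF (%e. F (e 0))" then show "D (%e. e 1 = F (e 0))"
    by (intro D_eq DF_var)
qed simp

lemma the_set_bounded: "D (%e. P (e 0)) ==> (!!x. P x ==> x \<E> a) ==> x \<E> the_set P \<longleftrightarrow> P x"
  by (rule the_set_iff, rule exI[of _ "Sep a P"]) auto

lemma succ_iff [simp]: "z \<E> succ x \<longleftrightarrow> z \<E> x \<or> z = x" by (simp add: succ_def)

lemma upair_eq: "upair x y = upair u v \<longleftrightarrow> x = u & y = v \<or> x = v & y = u"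
proof
  assume "upair x y = upair u v"
  then have "z = x \<or> z = y \<longleftrightarrow> z = u \<or> z = v" for z by (metis upair_iff)
  then show "x = u & y = v \<or> x = v & y = u" by metis
qed (auto intro: extensional)

lemma pair_eq [simp]: "pair x y = pair u v \<longleftrightarrow> x = u & y = v"
  by (auto simp: pair_def upair_eq)

lemma fs_pair [simp]: "fs (pair x y) = x" unfolding fs_def by (rule the_el_eq) auto
lemma sn_pair [simp]: "sn (pair x y) = y" unfolding sn_def by (rule the_el_eq) auto

lemma prod_iff: "p \<E> prod a b \<longleftrightarrow> (\<exists>x y. x \<E> a & y \<E> b & p = pair x y)"
  unfolding prod_def
  by (rule the_set_bounded[of _ "Pw (Pw (Un2 a b))"]) (auto simp: pair_def sub_def)

lemma pair_prod [simp]: "pair x y \<E> prod a b \<longleftrightarrow> x \<E> a & y \<E> b" by (auto simp: prod_iff)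

lemma lam_iff: "DF (%e. F (e 0)) ==> p \<E> lam a F \<longleftrightarrow> (\<exists>x. x \<E> a & p = pair x (F x))"
proof -
  assume *: "DF (%e. F (e 0))"
  have **: "DF (%e. F (e i))" for i using DF_shift[OF *, of "%_. i"] by simp
  show ?thesis unfolding lam_def
    by (rule the_set_bounded[of _ "prod a (Rep a F)"]) (use * in \<open>auto intro!: D_intros simp: **\<close>)
qed

lemma dom_iff: "x \<E> dom f \<longleftrightarrow> (\<exists>y. pair x y \<E> f)"
  unfolding dom_def
proof (rule the_set_bounded)
  show "\<exists>y. pair z y \<E> f ==> z \<E> Rep f fs" for z by simp (metis fs_pair)
qed simp

lemma ran_iff: "y \<E> ran f \<longleftrightarrow> (\<exists>x. pair x y \<E> f)"
  unfolding ran_def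
proof (rule the_set_bounded)
  show "\<exists>y. pair y z \<E> f ==> z \<E> Rep f sn" for z by simp (metis sn_pair)
qed simp

lemma restr_iff: "p \<E> restr f a \<longleftrightarrow> p \<E> f & fs p \<E> a" by (simp add: restr_def)

lemma fn_app: "fn f a ==> x \<E> a ==> pair x y \<E> f \<longleftrightarrow> app f x = y"
proof -
  assume f: "fn f a" "x \<E> a"
  then obtain y' where y': "pair x y' \<E> f" "!!z. pair x z \<E> f ==> z = y'" unfolding fn_def by blast
  then have "app f x = y'" unfolding app_def by (intro the_el_eq)
  then show ?thesis using y'(1) y'(2)[of y] by blast
qed

lemma fn_pair: "fn f a ==> pair x y \<E> f \<longleftrightarrow> x \<E> a & app f x = y"
  using fn_app[of f a x y] unfolding fn_def by auto

lemma fn_mem: "fn f a ==> p \<E> f \<longleftrightarrow> (\<exists>x. x \<E> a & p = pair x (app f x))"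
proof -
  assume f: "fn f a"
  then have "p \<E> f ==> \<exists>x y. x \<E> a & p = pair x y" unfolding fn_def by blast
  then show ?thesis using fn_pair[OF f] by auto
qed

lemma fn_ext: "fn f a ==> fn g a ==> (!!x. x \<E> a ==> app f x = app g x) ==> f = g"
  by (rule extensional) (auto simp: fn_mem)

lemma fn_dom: "fn f a ==> dom f = a" by (rule extensional) (auto simp: dom_iff fn_pair)

lemma fn_ran: "fn f a ==> y \<E> ran f \<longleftrightarrow> (\<exists>x. x \<E> a & app f x = y)" by (auto simp: ran_iff fn_pair)

lemma fn_lam: "DF (%e. F (e 0)) ==> fn (lam a F) a" unfolding fn_def by (auto simp: lam_iff)

lemma app_lam [simp]: "DF (%e. F (e 0)) ==> x \<E> a ==> app (lam a F) x = F x"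
  using fn_app[OF fn_lam, of F x a "F x"] by (auto simp: lam_iff)

lemma fn_restr: "fn f a ==> b \<sqsubseteq> a ==> fn (restr f b) b"
  by (auto simp: fn_def restr_iff sub_def)

lemma app_restr: "fn f a ==> b \<sqsubseteq> a ==> x \<E> b ==> app (restr f b) x = app f x"
  using fn_app[OF fn_restr, of f a b x "app f x"] fn_app[of f a x "app f x"]
  by (auto simp: restr_iff sub_def)

subsection \<open>Foundation, transitive sets and recursion\<close>

lemma set_min: "D (%e. P (e 0)) ==> x \<E> a ==> P x ==> \<exists>y. y \<E> a & P y & (\<forall>z. z \<E> y --> z \<E> a --> \<not> P z)"
  using founded[of x "Sep a P"] by auto

lemma mem_irrefl [simp]: "\<not> x \<E> x" using founded[of x "upair x x"] by auto
lemma mem_asym: "x \<E> y ==> \<not> y \<E> x" using founded[of x "upair x y"] by auto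

definition trans where "trans x \<longleftrightarrow> (\<forall>y. y \<E> x --> y \<sqsubseteq> x)"
lemma D_trans [D_intros, simp]: "DF f ==> D (%e. trans (f e))"
  by (rule D_app1[where R=trans]) (unfold trans_def, intro D_intros)

lemma transD: "trans x ==> y \<E> x ==> z \<E> y ==> z \<E> x" by (auto simp: trans_def sub_def)

text \<open>Partial solutions of a recursion along membership, with transitive domains.
  \<open>rec\<close> collects their values.\<close>

definition attempt where
  "attempt G f \<longleftrightarrow> fn f (dom f) & trans (dom f) & (\<forall>y. y \<E> dom f --> app f y = G y (restr f y))"

definition rec where "rec G x = the_el (%v. \<exists>f. attempt G f & pair x v \<E> f)"

lemma D_attempt:
  assumes "DF (%e. G (e 0) (e 1))" "DF f" shows "D (%e. attempt G (f e))"
proof -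
  have G: "DF f ==> DF g ==> DF (%e. G (f e) (g e))" for f g by (rule DF_app2[OF assms(1)])
  show ?thesis by (rule D_app1[where R="attempt G", OF _ assms(2)]) (unfold attempt_def, intro D_intros G)
qed

lemma DF_rec [D_intros]: "DF (%e. G (e 0) (e 1)) ==> DF f ==> DF (%e. rec G (f e))"
  by (rule DF_app1[where c="rec G"]) (unfold rec_def, intro D_intros D_attempt)

lemma attempt_unique:
  assumes G: "DF (%e. G (e 0) (e 1))" and f: "attempt G f" and g: "attempt G g"
    and x: "x \<E> dom f" "x \<E> dom g"
  shows "app f x = app g x"
proof (rule ccontr)
  assume "app f x \<noteq> app g x"
  then obtain y where y: "y \<E> dom f" "y \<E> dom g & app f y \<noteq> app g y"
    "!!z. z \<E> y ==> z \<E> dom f ==> \<not> (z \<E> dom g & app f z \<noteq> app g z)"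
    using set_min[of "%y. y \<E> dom g & app f y \<noteq> app g y" x "dom f"] x by auto
  have sub: "y \<sqsubseteq> dom f" "y \<sqsubseteq> dom g" using f g y unfolding attempt_def trans_def by blast+
  have fg: "fn f (dom f)" "fn g (dom g)" using f g unfolding attempt_def by blast+
  have "restr f y = restr g y"
    by (rule fn_ext[of _ y]) (use sub fg y in \<open>auto simp: fn_restr app_restr sub_def\<close>)
  then show False using f g y unfolding attempt_def by metis
qed

lemma rec_val:
  assumes G: "DF (%e. G (e 0) (e 1))" and f: "attempt G f" "x \<E> dom f" shows "rec G x = app f x"
  unfolding rec_def
proof (rule the_el_eq)
  have "fn f (dom f)" using f by (simp add: attempt_def)
  then show "\<exists>f'. attempt G f' & pair x (app f x) \<E> f'" using f fn_pair by blast
  fix v assume "\<exists>f. attempt G f & pair x v \<E> f"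
  then obtain g where g: "attempt G g" "pair x v \<E> g" by blast
  then have "fn g (dom g)" by (simp add: attempt_def)
  then have "x \<E> dom g" "app g x = v" using g(2) fn_pair by blast+
  then show "v = app f x" using attempt_unique[OF G f(1) g(1) f(2)] by simp
qed

text \<open>At a minimal argument \<open>y\<close> without a partial solution, \<open>rec\<close>
  already has the right values on everything below \<open>y\<close>. Adding one pair at
  \<open>y\<close> to the function \<open>rec\<close> on a transitive part of \<open>t\<close> gives
  the missing solution.\<close>

lemma attempt_exists:
  assumes G: "DF (%e. G (e 0) (e 1))" and x: "trans t" "x \<E> t"
  shows "\<exists>f. attempt G f & x \<E> dom f"
proof (rule ccontr)
  note [simp] = DF_app2[OF G] D_attempt[OF G] DF_rec[OF G]
  assume *: "\<not> ?thesis"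
  obtain y where y: "y \<E> t" "\<not> (\<exists>f. attempt G f & y \<E> dom f)"
    "!!z. z \<E> y ==> z \<E> t ==> \<exists>f. attempt G f & z \<E> dom f"
    using set_min[of "%y. \<not> (\<exists>f. attempt G f & y \<E> dom f)", OF _ x(2) *] by auto
  have sub: "!!z. z \<E> y ==> \<exists>f. attempt G f & z \<E> dom f" using y x transD by blast
  let ?A = "%z. \<exists>f. attempt G f & z \<E> dom f"
  have Aup: "?A w" if "?A z" "w \<E> z" for z w using that transD unfolding attempt_def by blast
  have recA: "rec G z = G z (lam z (rec G))" if A: "?A z" for z
  proof -
    obtain f where f: "attempt G f" "z \<E> dom f" using A by blast
    then have fd: "fn f (dom f)" and zs: "z \<sqsubseteq> dom f" unfolding attempt_def trans_def by blast+
    have "restr f z = lam z (rec G)"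
      by (rule fn_ext[of _ z]) (use fd zs f in \<open>auto simp: fn_restr app_restr fn_lam rec_val[OF G f(1)] sub_def\<close>)
    then show ?thesis using rec_val[OF G f] f unfolding attempt_def by simp
  qed
  define d where "d = Sep t ?A"
  have d: "z \<E> d \<longleftrightarrow> z \<E> t & ?A z" for z unfolding d_def by simp
  have dt: "trans d" unfolding trans_def sub_def d using Aup x transD by blast
  have yd: "y \<sqsubseteq> d" unfolding sub_def d using sub transD[OF x(1) y(1)] by blast
  define c where "c = Un2 d (upair y y)"
  have c: "z \<E> c \<longleftrightarrow> z \<E> d \<or> z = y" for z by (simp add: c_def)
  have ct: "trans c" using dt yd by (auto simp: trans_def sub_def c)
  define h where "h = (%z. if z = y then G y (lam y (rec G)) else rec G z)"
  have h: "DF (%e. h (e 0))"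
  proof -
    have "h z = the_el (%v. z = y & v = G y (lam y (rec G)) \<or> z \<noteq> y & v = rec G z)" for z
      unfolding h_def by (rule sym, rule the_el_eq) auto
    then show ?thesis by simp
  qed
  have rs: "restr (lam c h) z = lam z (rec G)" if "z \<E> c" for z
  proof (rule fn_ext[of _ z])
    have zc: "z \<sqsubseteq> c" using ct that by (simp add: trans_def)
    show "fn (restr (lam c h) z) z" using fn_restr[OF fn_lam[OF h] zc] .
    show "fn (lam z (rec G)) z" by (rule fn_lam) simp
    fix w assume w: "w \<E> z"
    have "w \<noteq> y" using w that mem_asym mem_irrefl c d y(2) Aup by blast
    then show "app (restr (lam c h) z) w = app (lam z (rec G)) w"
      using w app_restr[OF fn_lam[OF h] zc w] subD[OF zc w] by (simp add: app_lam[OF h]) (simp add: h_def)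
  qed
  have "attempt G (lam c h)"
    unfolding attempt_def fn_dom[OF fn_lam[OF h]]
  proof (intro conjI allI impI)
    fix z assume z: "z \<E> c"
    show "app (lam c h) z = G z (restr (lam c h) z)"
      unfolding rs[OF z] app_lam[OF h z] using z recA[of z] d[of z] c[of z] by (auto simp: h_def)
  qed (use ct fn_lam[OF h] in auto)
  moreover have "y \<E> dom (lam c h)" unfolding fn_dom[OF fn_lam[OF h]] by (simp add: c)
  ultimately show False using y by blast
qed

lemma rec_eq_trans:
  assumes G: "DF (%e. G (e 0) (e 1))" and x: "trans t" "x \<E> t"
  shows "rec G x = G x (lam x (rec G))"
proof -
  obtain f where f: "attempt G f" "x \<E> dom f" using attempt_exists[OF G x] by blast
  then have fd: "fn f (dom f)" and zs: "x \<sqsubseteq> dom f" unfolding attempt_def trans_def by blast+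
  have "restr f x = lam x (rec G)"
    by (rule fn_ext[of _ x])
      (use fd zs f DF_rec[OF G] in \<open>auto simp: fn_restr app_restr fn_lam rec_val[OF G f(1)] sub_def\<close>)
  then show ?thesis using rec_val[OF G f] f unfolding attempt_def by simp
qed

subsection \<open>Ordinals\<close>

definition Ord where "Ord x \<longleftrightarrow> trans x & (\<forall>y. y \<E> x --> trans y)"
lemma D_Ord [D_intros, simp]: "DF f ==> D (%e. Ord (f e))"
  by (rule D_app1[where R=Ord]) (unfold Ord_def, intro D_intros)

lemma Ord_mem: "Ord a ==> b \<E> a ==> Ord b" unfolding Ord_def using transD by blast
lemma Ord_trans: "Ord a ==> b \<E> a ==> c \<E> b ==> c \<E> a" unfolding Ord_def using transD by blast
lemma Ord_memsub: "Ord a ==> b \<E> a ==> b \<sqsubseteq> a" unfolding Ord_def trans_def by blast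

lemma Ord_zero [simp]: "Ord zero" by (simp add: Ord_def trans_def)
lemma Ord_succ: "Ord a ==> Ord (succ a)" unfolding Ord_def trans_def sub_def succ_iff by blast
lemma trans_succ: "trans a ==> trans (succ a)" unfolding trans_def sub_def succ_iff by blast

lemma Ord_least: "D (%e. P (e 0)) ==> Ord a ==> P a ==> \<exists>b. Ord b & P b & (\<forall>c. c \<E> b --> \<not> P c)"
proof -
  assume *: "D (%e. P (e 0))" "Ord a" "P a"
  obtain b where b: "b \<E> succ a" "P b" "!!z. z \<E> b ==> z \<E> succ a ==> \<not> P z"
    using set_min[OF *(1), of a "succ a"] * by auto
  then show ?thesis using Ord_succ[OF *(2)] Ord_mem Ord_trans by blast
qed

lemma Ord_induct:
  assumes "D (%e. P (e 0))" "!!a. Ord a ==> (!!b. b \<E> a ==> P b) ==> P a" "Ord a"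
  shows "P a"
proof (rule ccontr)
  assume "\<not> P a"
  then obtain b where "Ord b" "\<not> P b" "\<forall>c. c \<E> b --> \<not> \<not> P c"
    using Ord_least[of "%x. \<not> P x", OF D_not[OF assms(1)] assms(3)] by blast
  then show False using assms(2) by blast
qed

lemma Ord_linear: assumes "Ord a" "Ord b" shows "a \<E> b \<or> a = b \<or> b \<E> a"
proof (rule ccontr)
  assume "\<not> ?thesis"
  then obtain a where a: "Ord a" "\<exists>b. Ord b & \<not> (a \<E> b \<or> a = b \<or> b \<E> a)"
    "!!c. c \<E> a ==> \<not> (\<exists>b. Ord b & \<not> (c \<E> b \<or> c = b \<or> b \<E> c))"
    using Ord_least[of "%a. \<exists>b. Ord b & \<not> (a \<E> b \<or> a = b \<or> b \<E> a)" a] assms by auto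
  obtain b where b: "Ord b" "\<not> (a \<E> b \<or> a = b \<or> b \<E> a)" "!!c. c \<E> b ==> a \<E> c \<or> a = c \<or> c \<E> a"
    using a(2) Ord_least[of "%b. \<not> (a \<E> b \<or> a = b \<or> b \<E> a)"] by auto
  have "a = b"
  proof (rule extensional)
    fix z show "z \<E> a \<longleftrightarrow> z \<E> b"
      using a(3)[of z] b Ord_trans[OF a(1)] Ord_trans[OF b(1)] by blast
  qed
  then show False using b by blast
qed

lemma Ord_sub_iff: "Ord a ==> Ord b ==> a \<sqsubseteq> b \<longleftrightarrow> a \<E> b \<or> a = b"
  using Ord_linear[of a b] Ord_memsub[of b a] by (auto simp: sub_def)

lemma Ord_not_mem: "Ord a ==> Ord b ==> \<not> a \<E> b \<longleftrightarrow> b \<sqsubseteq> a"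
  using Ord_linear[of a b] Ord_sub_iff[of b a] mem_asym[of a b] by auto

lemma trans_Ords: "trans x ==> (!!y. y \<E> x ==> Ord y) ==> Ord x" by (simp add: Ord_def)

lemma Ord_BU: "(!!y. y \<E> x ==> Ord y) ==> Ord (BU x)"
  by (rule trans_Ords) (auto simp: trans_def sub_def dest: Ord_trans intro: Ord_mem)

lemma Un2_absorb: "a \<sqsubseteq> b ==> Un2 a b = b" "b \<sqsubseteq> a ==> Un2 a b = a"
  by (rule extensional; auto simp: sub_def)+

lemma Ord_Un2_cases: "Ord a ==> Ord b ==> Un2 a b = a \<or> Un2 a b = b"
  using Ord_linear[of a b] Ord_memsub[of a b] Ord_memsub[of b a] Un2_absorb(1)[of a b] Un2_absorb(2)[of b a] by auto

lemma rec_Ord: "DF (%e. G (e 0) (e 1)) ==> Ord a ==> rec G a = G a (lam a (rec G))"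
  using rec_eq_trans[of G "succ a" a] by (simp add: Ord_def trans_succ)

lemma no_set_of_Ords: "\<not> (\<forall>a. Ord a --> a \<E> x)"
proof
  assume *: "\<forall>a. Ord a --> a \<E> x"
  have o: "!!z. z \<E> Sep x Ord \<longleftrightarrow> Ord z" using * by auto
  have "Ord (Sep x Ord)" by (rule trans_Ords) (use o Ord_mem in \<open>auto simp: trans_def sub_def\<close>)
  then show False using o mem_irrefl by blast
qed

subsection \<open>Natural numbers\<close>

definition inductv where
  "inductv w \<longleftrightarrow> zero \<E> w & (\<forall>x. x \<E> w --> succ x \<E> w)"
lemma D_inductv [D_intros, simp]: "DF f ==> D (%e. inductv (f e))"
  by (rule D_app1[where R=inductv]) (unfold inductv_def, intro D_intros)

lemma ex_inductive: "\<exists>w. inductv w"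
proof -
  obtain w where w: "\<exists>v. (\<forall>z. \<not> z \<E> v) & v \<E> w"
      "\<forall>x. x \<E> w --> (\<exists>s. (\<forall>z. z \<E> s \<longleftrightarrow> z \<E> x \<or> z = x) & s \<E> w)" using ax_infinity by blast
  obtain v where v: "\<forall>z. \<not> z \<E> v" "v \<E> w" using w(1) by blast
  then have "v = zero" by (simp add: eq_zero)
  then have "zero \<E> w" using v by simp
  moreover have "succ x \<E> w" if x: "x \<E> w" for x
  proof -
    obtain s where s: "!!z. z \<E> s \<longleftrightarrow> z \<E> x \<or> z = x" "s \<E> w" using w(2) x by blast
    then have "s = succ x" by (intro extensional) simp
    then show ?thesis using s by simp
  qed
  ultimately show ?thesis unfolding inductv_def by blast
qed

definition omega where "omega = the_set (%x. \<forall>w. inductv w --> x \<E> w)"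

lemma omega_iff: "x \<E> omega \<longleftrightarrow> (\<forall>w. inductv w --> x \<E> w)"
proof -
  obtain w where "inductv w" using ex_inductive by blast
  then show ?thesis unfolding omega_def by (intro the_set_bounded[of _ w]) auto
qed

lemma zero_omega [simp]: "zero \<E> omega" and succ_omega [simp]: "n \<E> omega ==> succ n \<E> omega"
  unfolding omega_iff inductv_def by auto

lemma omega_induct:
  assumes "D (%e. P (e 0))" "P zero" "!!n. n \<E> omega ==> P n ==> P (succ n)" "n \<E> omega"
  shows "P n"
proof -
  have "inductv (Sep omega P)" unfolding inductv_def using assms by simp
  then show ?thesis using assms(1,4) omega_iff by (metis Sep_iff)
qed

lemma omega_Ord_mem: "n \<E> omega ==> Ord n"
  by (rule omega_induct[of Ord n]) (auto intro: Ord_succ)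

lemma omega_trans: "n \<E> omega ==> n \<sqsubseteq> omega"
  by (rule omega_induct[of "%n. n \<sqsubseteq> omega" n]) (auto simp: sub_def)

lemma Ord_omega [simp]: "Ord omega"
  by (rule trans_Ords) (auto simp: trans_def omega_trans omega_Ord_mem)

lemma omega_cases: "n \<E> omega ==> n = zero \<or> (\<exists>m. m \<E> omega & n = succ m)"
  by (rule omega_induct[of "%n. n = zero \<or> (\<exists>m. m \<E> omega & n = succ m)" n]) auto

lemma succ_neq_zero [simp]: "succ n \<noteq> zero" "zero \<noteq> succ n" using succ_iff[of n n] not_zero by metis+

lemma succ_inj [simp]: "succ a = succ b \<longleftrightarrow> a = b"
  using succ_iff[of a a] succ_iff[of b b] mem_asym[of a b] by (metis succ_iff)

lemma Ord_succ_sub: "Ord b ==> a \<E> b ==> succ a \<E> b \<or> succ a = b"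
  using Ord_sub_iff[of "succ a" b] Ord_succ[of a] Ord_mem[of b a] Ord_memsub[of b a] by (simp add: sub_def)

subsection \<open>Transitive closure and membership induction\<close>

text \<open>The unions are iterated along \<open>omega\<close>. Recursion on ordinals is available
  at this point because \<open>succ a\<close> is a transitive set containing \<open>a\<close>;
  recursion at arbitrary sets rests on the present lemma.\<close>

lemma ex_trans_superset: "\<exists>t. trans t & x \<E> t"
proof -
  define G where "G = (%(n::'a) f. Un2 (upair x x) (BU (BU (ran f))))"
  have G: "DF (%e. G (e 0) (e 1))" unfolding G_def by (intro D_intros)
  note [simp] = DF_rec[OF G]
  have r: "rec G a = Un2 (upair x x) (BU (BU (Rep a (rec G))))" if "Ord a" for a
  proof -
    have "ran (lam a (rec G)) = Rep a (rec G)"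
      by (rule extensional) (auto simp: fn_ran[OF fn_lam])
    then show ?thesis using rec_Ord[OF G that] by (simp add: G_def)
  qed
  have ri: "z \<E> rec G a \<longleftrightarrow> z = x \<or> (\<exists>n u. n \<E> a & u \<E> rec G n & z \<E> u)" if "Ord a" for a z
    by (subst r[OF that]) auto
  have 1: "x \<E> rec G omega" by (simp add: ri)
  have "y \<E> rec G omega" if zy: "z \<E> rec G omega" "y \<E> z" for y z
  proof -
    consider "z = x" | n u where "n \<E> omega" "u \<E> rec G n" "z \<E> u"
      using zy(1) unfolding ri[OF Ord_omega] by blast
    then show ?thesis
    proof cases
      case 1
      then have "z \<E> rec G zero" by (simp add: ri)
      then show ?thesis unfolding ri[OF Ord_omega] using zy(2) zero_omega by blast
    next
      case 2
      have "Ord (succ n)" using 2(1) omega_Ord_mem Ord_succ by blast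
      then have "z \<E> rec G (succ n)" using 2 by (auto simp: ri)
      then show ?thesis unfolding ri[OF Ord_omega] using zy(2) succ_omega[OF 2(1)] by blast
    qed
  qed
  then have "trans (rec G omega)" by (auto simp: trans_def sub_def)
  then show ?thesis using 1 by blast
qed

lemma class_min:
  assumes P: "D (%e. P (e 0))" and x: "P x" shows "\<exists>y. P y & (\<forall>z. z \<E> y --> \<not> P z)"
proof -
  obtain t where t: "trans t" "x \<E> t" using ex_trans_superset by blast
  then obtain y where "y \<E> t" "P y" "!!z. z \<E> y ==> z \<E> t ==> \<not> P z" using set_min[OF P t(2) x] by blast
  then show ?thesis using transD[OF t(1)] by blast
qed

lemma mem_induct:
  assumes P: "D (%e. P (e 0))" and step: "!!x. (!!y. y \<E> x ==> P y) ==> P x" shows "P x"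
  using class_min[of "%x. \<not> P x" x, OF D_not[OF P]] step by blast

lemma rec_eq: "DF (%e. G (e 0) (e 1)) ==> rec G x = G x (lam x (rec G))"
  using rec_eq_trans ex_trans_superset by blast

subsection \<open>Injections and bijections\<close>

definition inj where "inj f a b \<longleftrightarrow> fn f a & (\<forall>x. x \<E> a --> app f x \<E> b) &
  (\<forall>x y. x \<E> a --> y \<E> a --> app f x = app f y --> x = y)"
definition bij where "bij f a b \<longleftrightarrow> inj f a b & (\<forall>y. y \<E> b --> (\<exists>x. x \<E> a & app f x = y))"
definition le (infix "\<lesssim>" 50) where "a \<lesssim> b \<longleftrightarrow> (\<exists>f. inj f a b)"
definition eqv (infix "\<approx>" 50) where "a \<approx> b \<longleftrightarrow> (\<exists>f. bij f a b)"

lemma D_inj [D_intros, simp]: "DF f ==> DF g ==> DF h ==> D (%e. inj (f e) (g e) (h e))"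
  by (rule D_app3[where R=inj]) (unfold inj_def, intro D_intros)
lemma D_bij [D_intros, simp]: "DF f ==> DF g ==> DF h ==> D (%e. bij (f e) (g e) (h e))"
  by (rule D_app3[where R=bij]) (unfold bij_def, intro D_intros)
lemma D_le [D_intros, simp]: "DF f ==> DF g ==> D (%e. f e \<lesssim> g e)"
  by (rule D_app2[where R=le]) (unfold le_def, intro D_intros)
lemma D_eqv [D_intros, simp]: "DF f ==> DF g ==> D (%e. f e \<approx> g e)"
  by (rule D_app2[where R=eqv]) (unfold eqv_def, intro D_intros)

lemma leI: "DF (%e. F (e 0)) ==> (!!x. x \<E> a ==> F x \<E> b) ==>
    (!!x y. x \<E> a ==> y \<E> a ==> F x = F y ==> x = y) ==> a \<lesssim> b"
  unfolding le_def inj_def by (rule exI[of _ "lam a F"]) (simp add: fn_lam)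

lemma eqvI: "DF (%e. F (e 0)) ==> (!!x. x \<E> a ==> F x \<E> b) ==>
    (!!x y. x \<E> a ==> y \<E> a ==> F x = F y ==> x = y) ==>
    (!!y. y \<E> b ==> \<exists>x. x \<E> a & F x = y) ==> a \<approx> b"
  unfolding eqv_def bij_def inj_def by (rule exI[of _ "lam a F"]) (simp add: fn_lam, metis app_lam)

lemma leE: "a \<lesssim> b ==> (!!f. fn f a ==> (!!x. x \<E> a ==> app f x \<E> b) ==>
    (!!x y. x \<E> a ==> y \<E> a ==> app f x = app f y ==> x = y) ==> P) ==> P"
  unfolding le_def inj_def by blast

lemma eqvE: "a \<approx> b ==> (!!f. fn f a ==> (!!x. x \<E> a ==> app f x \<E> b) ==>
    (!!x y. x \<E> a ==> y \<E> a ==> app f x = app f y ==> x = y) ==>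
    (!!y. y \<E> b ==> \<exists>x. x \<E> a & app f x = y) ==> P) ==> P"
  unfolding eqv_def bij_def inj_def by blast

lemma le_sub: "a \<sqsubseteq> b ==> a \<lesssim> b" by (rule leI[of "%x. x"]) (auto simp: sub_def)
lemma le_refl [simp]: "a \<lesssim> a" by (simp add: le_sub)
lemma eqv_le: "a \<approx> b ==> a \<lesssim> b" by (auto simp: eqv_def bij_def le_def)

lemma le_trans: "a \<lesssim> b ==> b \<lesssim> c ==> a \<lesssim> c"
proof (elim leE)
  fix f g assume *: "!!x. x \<E> a ==> app f x \<E> b" "!!x y. x \<E> a ==> y \<E> a ==> app f x = app f y ==> x = y"
    "!!x. x \<E> b ==> app g x \<E> c" "!!x y. x \<E> b ==> y \<E> b ==> app g x = app g y ==> x = y"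
  show ?thesis by (rule leI[of "%x. app g (app f x)"]) (use * in \<open>simp, blast, blast\<close>)
qed

lemma eqv_sym: "a \<approx> b ==> b \<approx> a"
proof (elim eqvE)
  fix f assume *: "!!x. x \<E> a ==> app f x \<E> b" "!!x y. x \<E> a ==> y \<E> a ==> app f x = app f y ==> x = y"
    "!!y. y \<E> b ==> \<exists>x. x \<E> a & app f x = y"
  define g where "g = (%y. the_el (%x. x \<E> a & app f x = y))"
  have g: "g (app f x) = x" if "x \<E> a" for x unfolding g_def by (rule the_el_eq) (use * that in blast)+
  have D: "DF (%e. g (e 0))" unfolding g_def by (intro D_intros)
  show ?thesis
  proof (rule eqvI[OF D])
    show "y \<E> b ==> g y \<E> a" for y using *(3)[of y] g by auto
    show "x \<E> b ==> y \<E> b ==> g x = g y ==> x = y" for x y using *(3)[of x] *(3)[of y] g by auto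
    show "y \<E> a ==> \<exists>x. x \<E> b & g x = y" for y using *(1)[of y] g by auto
  qed
qed

lemma eqv_trans: "a \<approx> b ==> b \<approx> c ==> a \<approx> c"
proof (elim eqvE)
  fix f g assume *: "!!x. x \<E> a ==> app f x \<E> b" "!!x y. x \<E> a ==> y \<E> a ==> app f x = app f y ==> x = y"
    "!!y. y \<E> b ==> \<exists>x. x \<E> a & app f x = y"
    "!!x. x \<E> b ==> app g x \<E> c" "!!x y. x \<E> b ==> y \<E> b ==> app g x = app g y ==> x = y"
    "!!y. y \<E> c ==> \<exists>x. x \<E> b & app g x = y"
  show ?thesis
  proof (rule eqvI[of "%x. app g (app f x)"])
    fix z assume "z \<E> c"
    then obtain y where y: "y \<E> b" "app g y = z" using *(6) by blast
    then obtain x where "x \<E> a" "app f x = y" using *(3) by blast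
    then show "\<exists>x. x \<E> a & app g (app f x) = z" using y by blast
  qed (use *(1,2,4,5) in \<open>simp, blast, blast\<close>)
qed

text \<open>Least preimages replace choice, which is why the domain is an ordinal. In this form the
  lemma can be applied in the symmetric extension.\<close>

lemma surj_le:
  assumes F: "DF (%e. F (e 0))" and a: "Ord a" and s: "!!y. y \<E> b ==> \<exists>x. x \<E> a & F x = y"
  shows "b \<lesssim> a"
proof -
  define g where "g = (%y. the_el (%x. x \<E> a & F x = y & (\<forall>z. z \<E> x --> F z \<noteq> y)))"
  note [simp] = DF_app1[OF F]
  have D: "DF (%e. g (e 0))" unfolding g_def by simp
  have g: "g y \<E> a & F (g y) = y" if y: "y \<E> b" for y
  proof -
    obtain x where "x \<E> a" "F x = y" using s y by blast
    then obtain x where x: "x \<E> a" "F x = y" "!!z. z \<E> x ==> z \<E> a ==> F z \<noteq> y"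
      using set_min[of "%x. F x = y" x a] by auto
    have "g y = x" unfolding g_def
    proof (rule the_el_eq)
      show "x \<E> a & F x = y & (\<forall>z. z \<E> x --> F z \<noteq> y)" using x Ord_trans[OF a] by blast
      fix x' assume "x' \<E> a & F x' = y & (\<forall>z. z \<E> x' --> F z \<noteq> y)"
      then show "x' = x" using x Ord_linear[of x x'] Ord_mem[OF a] by blast
    qed
    then show ?thesis using x by simp
  qed
  show ?thesis by (rule leI[OF D]) (use g in blast, metis g)
qed

lemma Rep_le: "DF (%e. F (e 0)) ==> Ord a ==> Rep a F \<lesssim> a"
  by (rule surj_le) auto

text \<open>\<open>C\<close> is the greatest fixed point of a monotone operator: its points either
  are outside the range of \<open>g\<close> or come from the image of \<open>C\<close> under
  \<open>f\<close>. The bijection is \<open>f\<close> on \<open>C\<close> and the inverse of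
  \<open>g\<close> elsewhere.\<close>

lemma cantor_bernstein:
  assumes "a \<lesssim> b" "b \<lesssim> a" shows "a \<approx> b"
  using assms
proof (elim leE)
  fix f g assume f: "fn f a" "!!x. x \<E> a ==> app f x \<E> b"
      "!!x y. x \<E> a ==> y \<E> a ==> app f x = app f y ==> x = y"
    and g: "fn g b" "!!x. x \<E> b ==> app g x \<E> a"
      "!!x y. x \<E> b ==> y \<E> b ==> app g x = app g y ==> x = y"
  define \<Phi> where "\<Phi> = (%X z. z \<E> a & \<not> (\<exists>y. y \<E> b & z = app g y & \<not> (\<exists>x. x \<E> X & y = app f x)))"
  define C where "C = BU (Sep (Pw a) (%X. \<forall>z. z \<E> X --> \<Phi> X z))"
  have C: "z \<E> C \<longleftrightarrow> (\<exists>X. X \<sqsubseteq> a & (\<forall>z. z \<E> X --> \<Phi> X z) & z \<E> X)" for z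
    unfolding C_def \<Phi>_def by auto
  have mono: "\<Phi> X z ==> X \<sqsubseteq> Y ==> \<Phi> Y z" for X Y z unfolding \<Phi>_def sub_def by blast
  have "X \<sqsubseteq> C" if "X \<sqsubseteq> a" "\<forall>z. z \<E> X --> \<Phi> X z" for X using that unfolding C sub_def by blast
  then have C1: "z \<E> C ==> \<Phi> C z" for z using C mono by blast
  have Ca: "z \<E> C ==> z \<E> a" for z using C1 \<Phi>_def by blast
  have C2: "\<Phi> C z ==> z \<E> C" for z
  proof -
    assume z: "\<Phi> C z"
    let ?X = "Un2 C (upair z z)"
    have "C \<sqsubseteq> ?X" by (simp add: sub_def)
    then have "\<forall>w. w \<E> ?X --> \<Phi> ?X w" using C1 z mono by auto
    moreover have "?X \<sqsubseteq> a" using Ca z by (auto simp: sub_def \<Phi>_def)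
    ultimately show "z \<E> C" using C[of z] by (metis Un2_iff upair_iff)
  qed
  have off: "z \<E> a ==> \<not> z \<E> C ==> \<exists>y. y \<E> b & z = app g y & \<not> (\<exists>x. x \<E> C & y = app f x)" for z
    using C2[of z] unfolding \<Phi>_def by blast
  have on: "y \<E> b ==> app g y \<E> C ==> \<exists>x. x \<E> C & y = app f x" for y using C1[of "app g y"] unfolding \<Phi>_def by blast
  define h where "h = (%z. the_el (%y. z \<E> C & y = app f z \<or> \<not> z \<E> C & y \<E> b & z = app g y))"
  have h1: "z \<E> C ==> h z = app f z" for z unfolding h_def by (rule the_el_eq) auto
  have h2: "y \<E> b ==> \<not> app g y \<E> C ==> h (app g y) = y" for y unfolding h_def by (rule the_el_eq) (use g in auto)
  have D: "DF (%e. h (e 0))" unfolding h_def by simp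
  show ?thesis
  proof (rule eqvI[OF D])
    fix x assume x: "x \<E> a"
    show "h x \<E> b" using off[OF x] h1[of x] h2 f(2)[OF x] by (cases "x \<E> C") auto
    fix y assume y: "y \<E> a" and e: "h x = h y"
    show "x = y"
    proof (cases "x \<E> C"; cases "y \<E> C")
      assume "x \<E> C" "y \<E> C" then show ?thesis using e h1 f(3)[OF x y] by simp
    next
      assume c: "x \<E> C" "\<not> y \<E> C" then show ?thesis using off[OF y] h1[of x] h2 e by auto
    next
      assume c: "\<not> x \<E> C" "y \<E> C" then show ?thesis using off[OF x] h1[of y] h2 e by auto
    next
      assume c: "\<not> x \<E> C" "\<not> y \<E> C"
      obtain u v where "u \<E> b" "x = app g u" "v \<E> b" "y = app g v" using off x y c by blast
      then show ?thesis using h2 c e by auto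
    qed
  next
    fix y assume y: "y \<E> b"
    show "\<exists>x. x \<E> a & h x = y"
    proof (cases "app g y \<E> C")
      case True
      then obtain x where "x \<E> C" "y = app f x" using on y by blast
      then show ?thesis using h1 Ca by blast
    qed (use h2 y g in blast)
  qed
qed

subsection \<open>Cardinals\<close>

lemma DF_If [D_intros, simp]:
  assumes "D P" "DF f" "DF g" shows "DF (%e. if P e then f e else g e)"
proof -
  have "D (%e. P (%i. e (Suc i)) & e 0 = f (%i. e (Suc i)) \<or> \<not> P (%i. e (Suc i)) & e 0 = g (%i. e (Suc i)))"
    using D_disj[OF D_conj[OF D_rename[OF assms(1), of Suc] assms(2)[unfolded DF_def]]
        D_conj[OF D_not[OF D_rename[OF assms(1), of Suc]] assms(3)[unfolded DF_def]]] .
  moreover have "(e 0 = (if P (%i. e (Suc i)) then f (%i. e (Suc i)) else g (%i. e (Suc i)))) \<longleftrightarrow>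
      P (%i. e (Suc i)) & e 0 = f (%i. e (Suc i)) \<or> \<not> P (%i. e (Suc i)) & e 0 = g (%i. e (Suc i))" for e
    by auto
  ultimately show ?thesis unfolding DF_def by simp
qed

definition Card where "Card k \<longleftrightarrow> Ord k & (\<forall>a. a \<E> k --> \<not> k \<lesssim> a)"
definition InfCard where "InfCard k \<longleftrightarrow> Card k & omega \<sqsubseteq> k"
lemma D_Card [D_intros, simp]: "DF f ==> D (%e. Card (f e))"
  by (rule D_app1[where R=Card]) (unfold Card_def, intro D_intros)
lemma D_InfCard [D_intros, simp]: "DF f ==> D (%e. InfCard (f e))"
  by (rule D_app1[where R=InfCard]) (unfold InfCard_def, intro D_intros)

lemma Card_Ord: "Card k ==> Ord k" by (simp add: Card_def)
lemma InfCard_Card: "InfCard k ==> Card k" by (simp add: InfCard_def)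
lemma InfCard_Ord: "InfCard k ==> Ord k" by (simp add: InfCard_def Card_def)
lemma InfCard_omega_sub: "InfCard k ==> omega \<sqsubseteq> k" by (simp add: InfCard_def)

lemma ex_Card: assumes "Ord a" shows "\<exists>k. Card k & k \<sqsubseteq> a & k \<approx> a"
proof -
  obtain k where k: "Ord k" "a \<lesssim> k" "!!b. b \<E> k ==> \<not> a \<lesssim> b"
    using Ord_least[of "%b. a \<lesssim> b" a] assms by auto
  have "Card k" unfolding Card_def using k le_trans by blast
  moreover have ka: "k \<sqsubseteq> a" using Ord_linear[OF k(1) assms] k(3)[of a] Ord_memsub[OF assms, of k] by auto
  moreover have "k \<approx> a" using cantor_bernstein le_sub[OF ka] k(2) by blast
  ultimately show ?thesis by blast
qed

lemma Card_le_sub: "Card k ==> Ord a ==> k \<lesssim> a \<longleftrightarrow> k \<sqsubseteq> a"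
  unfolding Card_def using Ord_linear[of k a] Ord_memsub[of a k] le_sub[of k a] by auto

lemma Card_mem_le: "Card k ==> a \<E> k ==> k \<lesssim> a ==> False" unfolding Card_def by blast

lemma Card_sup:
  assumes "!!k. k \<E> x ==> Card k" shows "Card (BU x)"
  unfolding Card_def
proof (intro conjI allI impI notI)
  show "Ord (BU x)" by (rule Ord_BU) (use assms Card_Ord in blast)
  fix a assume a: "a \<E> BU x" "BU x \<lesssim> a"
  then obtain k where k: "k \<E> x" "a \<E> k" by auto
  have "k \<lesssim> BU x" by (rule le_sub) (use k in \<open>auto simp: sub_def\<close>)
  then show False using Card_mem_le[OF assms[OF k(1)] k(2)] le_trans a(2) by blast
qed

text \<open>\<open>h x\<close> is the Mostowski collapse of the part of \<open>X\<close> below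
  \<open>x\<close>, that is, its order type; it never exceeds \<open>x\<close>.\<close>

lemma collapse_sub:
  assumes a: "Ord a" and X: "X \<sqsubseteq> a" shows "\<exists>b. Ord b & b \<sqsubseteq> a & X \<approx> b"
proof -
  define G where "G = (%x f. Rep (Sep x (%y. y \<E> X)) (app f))"
  have G: "DF (%e. G (e 0) (e 1))" unfolding G_def by (intro D_intros)
  note [simp] = DF_rec[OF G]
  define h where "h = rec G"
  have [simp]: "DF f ==> DF (%e. h (f e))" for f unfolding h_def by simp
  have h: "z \<E> h x \<longleftrightarrow> (\<exists>y. y \<E> x & y \<E> X & z = h y)" for x z
  proof -
    have "h x = G x (lam x h)" unfolding h_def by (rule rec_eq[OF G])
    then show ?thesis by (auto simp: G_def)
  qed
  have Oh: "Ord (h x) & h x \<sqsubseteq> x" if "Ord x" for x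
  proof (rule Ord_induct[OF _ _ that])
    show "D (%e. Ord (h (e 0)) & h (e 0) \<sqsubseteq> e 0)" by simp
    fix x assume x: "Ord x" and IH: "!!y. y \<E> x ==> Ord (h y) & h y \<sqsubseteq> y"
    have 1: "Ord (h x)"
    proof (rule trans_Ords)
      show "trans (h x)" unfolding trans_def sub_def using Ord_trans[OF x] by (auto simp: h) blast
      show "Ord y" if "y \<E> h x" for y using that IH unfolding h by blast
    qed
    have "z \<E> x" if zh: "z \<E> h x" for z
    proof -
      obtain y where y: "y \<E> x" "z = h y" using zh unfolding h by blast
      then have "z \<E> y \<or> z = y" using IH[of y] Ord_sub_iff[of z y] Ord_mem[OF x] by blast
      then show ?thesis using y(1) Ord_trans[OF x] by blast
    qed
    then show "Ord (h x) & h x \<sqsubseteq> x" using 1 by (simp add: sub_def)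
  qed
  have OX: "x \<E> X ==> Ord x" for x using a X Ord_mem subD by blast
  let ?b = "Rep X h"
  have b: "z \<E> ?b \<longleftrightarrow> (\<exists>y. y \<E> X & z = h y)" for z by auto
  have "Ord ?b"
  proof (rule trans_Ords)
    show "trans ?b" unfolding trans_def sub_def b by (auto simp: h)
    show "Ord y" if "y \<E> ?b" for y using that Oh OX unfolding b by blast
  qed
  moreover have "?b \<sqsubseteq> a"
  proof (rule subI)
    fix z assume "z \<E> ?b"
    then obtain y where y: "y \<E> X" "z = h y" using b by blast
    then have "z \<E> y \<or> z = y" using Oh[OF OX[OF y(1)]] Ord_sub_iff[of z y] OX by blast
    then show "z \<E> a" using Ord_trans[OF a] subD[OF X y(1)] by blast
  qed
  moreover have "X \<approx> ?b"
  proof (rule eqvI[of h])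
    fix x y assume xy: "x \<E> X" "y \<E> X" "h x = h y"
    then show "x = y" using Ord_linear[OF OX OX, of x y] h[of "h x" y] h[of "h y" x] mem_irrefl by metis
  qed auto
  ultimately show ?thesis by blast
qed

lemma le_Ord_Card: assumes "Ord a" "X \<lesssim> a" shows "\<exists>k. Card k & k \<sqsubseteq> a & X \<approx> k"
proof -
  obtain f where f: "fn f X" "!!x. x \<E> X ==> app f x \<E> a" "!!x y. x \<E> X ==> y \<E> X ==> app f x = app f y ==> x = y"
    using assms(2) leE by metis
  let ?Y = "Rep X (app f)"
  have "X \<approx> ?Y" by (rule eqvI[of "app f"]) (use f in auto)
  moreover have "?Y \<sqsubseteq> a" using f by (auto simp: sub_def)
  ultimately obtain b where b: "Ord b" "b \<sqsubseteq> a" "X \<approx> b" using collapse_sub[OF assms(1), of ?Y] eqv_trans by blast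
  obtain k where "Card k" "k \<sqsubseteq> b" "k \<approx> b" using ex_Card[OF b(1)] by blast
  then show ?thesis using b eqv_trans eqv_sym sub_trans by blast
qed

text \<open>The selector \<open>c\<close> is repeatedly applied to what is left of \<open>W\<close>.
  The value \<open>W\<close>, which is not a member of \<open>W\<close>, marks exhaustion, and this
  must occur, since otherwise replacement would turn \<open>W\<close> into a set of all ordinals.
  The selector may come from choice or from a definable well-ordering.\<close>

lemma enumerate:
  assumes c: "DF (%e. c (e 0))" and pick: "!!X. X \<sqsubseteq> W ==> X \<noteq> zero ==> c X \<E> X"
  obtains t F where "Ord t" "DF (%e. F (e 0))" "!!x. x \<E> t ==> F x \<E> W"
    "!!x. x \<E> t ==> F x = c (Sep W (%w. \<not> (\<exists>y. y \<E> x & F y = w)))"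
    "!!x y. x \<E> t ==> y \<E> t ==> F x = F y ==> x = y" "!!w. w \<E> W ==> \<exists>x. x \<E> t & F x = w"
proof -
  note [simp] = DF_app1[OF c]
  define G where "G = (%x f. let R = Sep W (%w. \<not> (\<exists>y. y \<E> x & app f y = w)) in if R = zero then W else c R)"
  have G: "DF (%e. G (e 0) (e 1))" unfolding G_def Let_def by simp
  define F where "F = rec G"
  have [simp]: "DF f ==> DF (%e. F (f e))" for f unfolding F_def by (simp add: DF_rec[OF G])
  define R where "R = (%x. Sep W (%w. \<not> (\<exists>y. y \<E> x & F y = w)))"
  have R: "w \<E> R x \<longleftrightarrow> w \<E> W & \<not> (\<exists>y. y \<E> x & F y = w)" for w x unfolding R_def by simp
  have [simp]: "DF f ==> DF (%e. R (f e))" for f unfolding R_def by (rule DF_app1) simp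
  have F: "F x = (if R x = zero then W else c (R x))" for x
  proof -
    have "Sep W (%w. \<not> (\<exists>y. y \<E> x & app (lam x F) y = w)) = R x"
      by (rule extensional) (auto simp: R)
    moreover have "F x = G x (lam x F)" unfolding F_def by (rule rec_eq[OF G])
    ultimately show ?thesis by (simp add: G_def Let_def)
  qed
  have FR: "R x \<noteq> zero ==> F x \<E> R x" for x
  proof -
    assume "R x \<noteq> zero"
    moreover have "R x \<sqsubseteq> W" using R by (simp add: sub_def)
    ultimately show "F x \<E> R x" using pick[of "R x"] F[of x] by simp
  qed
  have "\<exists>a. Ord a & R a = zero"
  proof (rule ccontr)
    assume *: "\<not> ?thesis"
    let ?g = "%w. the_el (%a. Ord a & F a = w)"
    have "a \<E> Rep W ?g" if a: "Ord a" for a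
    proof -
      have Fa: "F a \<E> R a" using FR a * by blast
      have "?g (F a) = a"
      proof (rule the_el_eq)
        fix b assume b: "Ord b & F b = F a"
        have Fb: "F b \<E> R b" using FR b * by blast
        then show "b = a" using Ord_linear[of a b] a b Fa unfolding R by metis
      qed (use a in simp)
      then show ?thesis using Fa R by auto
    qed
    then show False using no_set_of_Ords by blast
  qed
  then obtain t where t: "Ord t" "R t = zero" "!!x. x \<E> t ==> R x \<noteq> zero"
    using Ord_least[of "%a. R a = zero"] by auto
  have tF: "x \<E> t ==> F x \<E> R x" for x using FR t by blast
  show thesis
  proof (rule that[of t F])
    show "F x = F y ==> x = y" if "x \<E> t" "y \<E> t" for x y
      using Ord_linear[of x y] Ord_mem[OF t(1)] that tF[of x] tF[of y] unfolding R by metis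
    show "\<exists>x. x \<E> t & F x = w" if "w \<E> W" for w
    proof -
      have "\<not> w \<E> R t" using t(2) by simp
      then show ?thesis using that R by blast
    qed
    show "x \<E> t ==> F x \<E> W" for x using tF R by blast
    show "x \<E> t ==> F x = c (Sep W (%w. \<not> (\<exists>y. y \<E> x & F y = w)))" for x
      using F[of x] t(3)[of x] unfolding R_def by simp
  qed (use t in simp_all)
qed

lemma leD: "a \<lesssim> b ==> \<exists>f. fn f a & (\<forall>x. x \<E> a --> app f x \<E> b) &
    (\<forall>x y. x \<E> a --> y \<E> a --> app f x = app f y --> x = y)"
  unfolding le_def inj_def by blast

subsection \<open>Finite sets and squares of infinite cardinals\<close>

lemma succ_not_le: "n \<E> omega ==> \<not> succ n \<lesssim> n"
proof (rule omega_induct[of "%n. \<not> succ n \<lesssim> n"])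
  show "\<not> succ zero \<lesssim> zero" by (auto simp: le_def inj_def)
  fix n assume n: "n \<E> omega" and IH: "\<not> succ n \<lesssim> n"
  show "\<not> succ (succ n) \<lesssim> succ n"
  proof
    assume "succ (succ n) \<lesssim> succ n"
    from leD[OF this] obtain f where f': "fn f (succ (succ n))" and f: "!!x. x \<E> succ (succ n) ==> app f x \<E> succ n"
      "!!x y. x \<E> succ (succ n) ==> y \<E> succ (succ n) ==> app f x = app f y ==> x = y" by blast
    let ?g = "%x. if app f x = n then app f (succ n) else app f x"
    have ne: "x \<E> succ n ==> x \<noteq> succ n" for x using mem_irrefl by blast
    have "succ n \<lesssim> n"
    proof (rule leI[of ?g])
      fix x assume x: "x \<E> succ n"
      show "?g x \<E> n" using f(1)[of x] f(1)[of "succ n"] f(2)[of x "succ n"] x ne[OF x] by auto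
      fix y assume y: "y \<E> succ n" and e: "?g x = ?g y"
      show "x = y"
        using e f(2)[of x y] f(2)[of x "succ n"] f(2)[of "succ n" y] x y ne[OF x] ne[OF y]
        by (auto split: if_splits)
    qed simp
    then show False using IH by simp
  qed
qed simp

lemma omega_not_le: "n \<E> omega ==> \<not> omega \<lesssim> n"
  using succ_not_le le_trans[of "succ n" omega n] le_sub[OF omega_trans[OF succ_omega]] by blast

lemma Card_omega: "InfCard omega" unfolding InfCard_def Card_def by (simp add: omega_not_le)

definition Fin where "Fin x \<longleftrightarrow> (\<exists>n. n \<E> omega & x \<lesssim> n)"
lemma D_Fin [D_intros, simp]: "DF f ==> D (%e. Fin (f e))"
  by (rule D_app1[where R=Fin]) (unfold Fin_def, intro D_intros)

lemma Fin_le: "Fin y ==> x \<lesssim> y ==> Fin x" unfolding Fin_def using le_trans by blast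

lemma Fin_insert: "Fin x ==> Fin (Un2 x (upair y y))"
proof -
  assume "Fin x"
  then obtain n where n: "n \<E> omega" "x \<lesssim> n" unfolding Fin_def by blast
  obtain f where f': "fn f x" and f: "!!z. z \<E> x ==> app f z \<E> n" "!!z w. z \<E> x ==> w \<E> x ==> app f z = app f w ==> z = w"
    using leD[OF n(2)] by blast
  have "Un2 x (upair y y) \<lesssim> succ n"
  proof (rule leI[of "%z. if z \<E> x then app f z else n"])
    fix z w assume "z \<E> Un2 x (upair y y)" "w \<E> Un2 x (upair y y)"
      and e: "(if z \<E> x then app f z else n) = (if w \<E> x then app f w else n)"
    then have zw: "z \<E> x \<or> z = y" "w \<E> x \<or> w = y" by auto
    have "u \<E> x ==> app f u \<noteq> n" for u using f(1)[of u] by auto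
    then show "z = w" using e zw f(2)[of z w] by (auto split: if_splits)
  qed (use f in auto)
  then show ?thesis unfolding Fin_def using succ_omega[OF n(1)] by blast
qed

lemma Fin_Un2:
  assumes x: "Fin x" and y: "Fin y" shows "Fin (Un2 x y)"
proof -
  obtain n where n: "n \<E> omega" "y \<lesssim> n" using y unfolding Fin_def by blast
  have "\<forall>y. y \<lesssim> n --> Fin (Un2 x y)"
  proof (rule omega_induct[of "%n. \<forall>y. y \<lesssim> n --> Fin (Un2 x y)", OF _ _ _ n(1)])
    show "\<forall>y. y \<lesssim> zero --> Fin (Un2 x y)"
    proof (intro allI impI)
      fix y assume "y \<lesssim> zero"
      then have "Un2 x y = x" by (intro extensional) (auto simp: le_def inj_def)
      then show "Fin (Un2 x y)" using x by simp
    qed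
    fix n assume n: "n \<E> omega" and IH: "\<forall>y. y \<lesssim> n --> Fin (Un2 x y)"
    show "\<forall>y. y \<lesssim> succ n --> Fin (Un2 x y)"
    proof (intro allI impI)
      fix y assume "y \<lesssim> succ n"
      from leD[OF this] obtain f where f': "fn f y" and f: "!!z. z \<E> y ==> app f z \<E> succ n"
        "!!z w. z \<E> y ==> w \<E> y ==> app f z = app f w ==> z = w" by blast
      let ?y = "Sep y (%z. app f z \<E> n)"
      have "?y \<lesssim> n" by (rule leI[of "app f"]) (use f in auto)
      then have fin: "Fin (Un2 x ?y)" using IH by blast
      show "Fin (Un2 x y)"
      proof (cases "\<exists>w. w \<E> y & app f w = n")
        case True
        then obtain w where w: "w \<E> y" "app f w = n" by blast
        have "z \<E> y ==> app f z \<E> n \<or> z = w" for z using f(1)[of z] f(2)[of z w] w by auto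
        then have "Un2 x y = Un2 (Un2 x ?y) (upair w w)"
          by (intro extensional) (use w(1) in \<open>simp, blast\<close>)
        then show ?thesis using Fin_insert[OF fin] by simp
      next
        case False
        then have "z \<E> y ==> app f z \<E> n" for z using f(1)[of z] by auto
        then have "Un2 x y = Un2 x ?y" by (intro extensional) (simp, blast)
        then show ?thesis using fin by simp
      qed
    qed
  qed simp
  then show ?thesis using n by blast
qed

lemma prod_le: "a \<lesssim> a' ==> b \<lesssim> b' ==> prod a b \<lesssim> prod a' b'"
proof (elim leE)
  fix f g assume *: "!!x. x \<E> a ==> app f x \<E> a'" "!!x y. x \<E> a ==> y \<E> a ==> app f x = app f y ==> x = y"
    "!!x. x \<E> b ==> app g x \<E> b'" "!!x y. x \<E> b ==> y \<E> b ==> app g x = app g y ==> x = y"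
  show ?thesis
    by (rule leI[of "%p. pair (app f (fs p)) (app g (sn p))"]) (use * in \<open>auto simp: prod_iff\<close>)
qed

lemma Fin_prod:
  assumes "n \<E> omega" "m \<E> omega" shows "Fin (prod n m)"
proof (rule omega_induct[of "%n. Fin (prod n m)", OF _ _ _ assms(1)])
  have "prod zero m = zero" by (rule extensional) (auto simp: prod_iff)
  then show "Fin (prod zero m)" unfolding Fin_def using le_refl zero_omega by metis
  fix n assume n: "n \<E> omega" and IH: "Fin (prod n m)"
  have e: "prod (succ n) m = Un2 (prod n m) (prod (upair n n) m)" by (rule extensional) (auto simp: prod_iff)
  have "prod (upair n n) m \<lesssim> m" by (rule leI[of sn]) (auto simp: prod_iff)
  then have "Fin (prod (upair n n) m)" unfolding Fin_def using assms(2) by blast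
  then show "Fin (prod (succ n) m)" unfolding e using Fin_Un2 IH by blast
qed simp

text \<open>Hilbert's hotel: the natural numbers move up by one and \<open>m\<close> takes the place
  of \<open>zero\<close>.\<close>

lemma infinite_succ_le: "omega \<sqsubseteq> m ==> succ m \<lesssim> m"
proof (rule leI[of "%x. if x = m then zero else if x \<E> omega then succ x else x"])
  assume m: "omega \<sqsubseteq> m"
  have mo: "\<not> m \<E> omega" using subD[OF m, of m] by auto
  fix x assume x: "x \<E> succ m"
  then show "(if x = m then zero else if x \<E> omega then succ x else x) \<E> m"
    using subD[OF m zero_omega] subD[OF m succ_omega] by auto
  fix y assume y: "y \<E> succ m"
    and e: "(if x = m then zero else if x \<E> omega then succ x else x) = (if y = m then zero else if y \<E> omega then succ y else y)"
  show "x = y"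
    using e mo zero_omega succ_omega[of x] succ_omega[of y] by (auto split: if_splits)
qed simp

lemma InfCard_succ: assumes "InfCard k" "a \<E> k" shows "succ a \<E> k"
proof (rule ccontr)
  assume *: "\<not> succ a \<E> k"
  have Ok: "Ord k" using assms InfCard_Ord by blast
  then have k: "succ a = k" using Ord_succ_sub assms(2) * by blast
  then have "omega \<sqsubseteq> succ a" using assms InfCard_omega_sub by blast
  moreover have "\<not> omega = succ a"
  proof
    assume "omega = succ a"
    then have "a \<E> omega" by simp
    then show False using succ_omega \<open>omega = succ a\<close> mem_irrefl by metis
  qed
  ultimately have "omega \<E> succ a" using Ord_sub_iff[of omega "succ a"] k Ok by simp
  then have "omega \<sqsubseteq> a" using Ord_memsub[of a omega] Ord_mem[OF Ok assms(2)] by auto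
  then have "k \<lesssim> a" using infinite_succ_le k by blast
  then show False using Card_mem_le assms InfCard_Card by blast
qed

text \<open>Goedel's well-ordering of pairs by maximum, then first, then second component. If its
  length exceeded \<open>k\<close>, the first \<open>k\<close> pairs would lie in the square of an
  ordinal below \<open>k\<close>, whose cardinal is finite or covered by the induction hypothesis.
  No choice is involved.\<close>

lemma InfCard_square: assumes "InfCard k" shows "prod k k \<lesssim> k"
proof -
  have "InfCard k --> prod k k \<lesssim> k"
  proof (rule Ord_induct[of "%k. InfCard k --> prod k k \<lesssim> k"])
    fix k assume IH: "!!b. b \<E> k ==> InfCard b --> prod b b \<lesssim> b"
    show "InfCard k --> prod k k \<lesssim> k"
    proof
      assume k: "InfCard k"
      have Ok: "Ord k" using k InfCard_Ord by blast
      define m where "m = (%p. Un2 (fs p) (sn p))"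
      have [simp]: "DF f ==> DF (%e. m (f e))" for f unfolding m_def by (rule DF_app1) simp
      define R where "R = (%p q. m p \<E> m q \<or> m p = m q & (fs p \<E> fs q \<or> fs p = fs q & (sn p \<E> sn q \<or> sn p = sn q)))"
      define c where "c = (%X. the_el (%p. p \<E> X & (\<forall>q. q \<E> X --> R p q)))"
      have c: "DF (%e. c (e 0))" unfolding c_def R_def by simp
      have Om: "Ord (m p) & m p \<E> k & Ord (fs p) & Ord (sn p)" if "p \<E> prod k k" for p
        using that Ord_mem[OF Ok] Ord_Un2_cases unfolding m_def prod_iff by (metis fs_pair sn_pair)
      have cX: "c X \<E> X & (\<forall>q. q \<E> X --> R (c X) q)" if X: "X \<sqsubseteq> prod k k" "X \<noteq> zero" for X
      proof -
        have O: "Ord (m p) & Ord (fs p) & Ord (sn p)" if "p \<E> X" for p using Om X subD that by blast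
        obtain p where p: "p \<E> X" using X eq_zero by blast
        obtain u where u: "Ord u" "\<exists>p. p \<E> X & m p = u" "!!v. v \<E> u ==> \<not> (\<exists>p. p \<E> X & m p = v)"
          using Ord_least[of "%u. \<exists>p. p \<E> X & m p = u" "m p"] O p by auto
        obtain p1 where p1: "p1 \<E> X" "m p1 = u" using u by blast
        obtain v where v: "Ord v" "\<exists>p. p \<E> X & m p = u & fs p = v"
          "!!w. w \<E> v ==> \<not> (\<exists>p. p \<E> X & m p = u & fs p = w)"
          using Ord_least[of "%v. \<exists>p. p \<E> X & m p = u & fs p = v" "fs p1"] O p1 by auto
        obtain p2 where p2: "p2 \<E> X" "m p2 = u" "fs p2 = v" using v by blast
        obtain w where w: "Ord w" "\<exists>p. p \<E> X & m p = u & fs p = v & sn p = w"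
          "!!w'. w' \<E> w ==> \<not> (\<exists>p. p \<E> X & m p = u & fs p = v & sn p = w')"
          using Ord_least[of "%w. \<exists>p. p \<E> X & m p = u & fs p = v & sn p = w" "sn p2"] O p2 by auto
        obtain p3 where p3: "p3 \<E> X" "m p3 = u" "fs p3 = v" "sn p3 = w" using w by blast
        have R3: "R p3 q" if "q \<E> X" for q
        proof -
          have "u \<E> m q \<or> u = m q" using u(3)[of "m q"] Ord_linear[OF u(1), of "m q"] O[OF that] that by blast
          moreover have "m q = u ==> v \<E> fs q \<or> v = fs q"
            using v(3)[of "fs q"] Ord_linear[OF v(1), of "fs q"] O[OF that] that by blast
          moreover have "m q = u ==> fs q = v ==> w \<E> sn q \<or> w = sn q"
            using w(3)[of "sn q"] Ord_linear[OF w(1), of "sn q"] O[OF that] that by blast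
          ultimately show ?thesis unfolding R_def p3 by blast
        qed
        have "c X = p3" unfolding c_def
        proof (rule the_el_eq)
          fix q assume q: "q \<E> X & (\<forall>p. p \<E> X --> R q p)"
          have 1: "R p3 q" "R q p3" using R3 q p3(1) by blast+
          then have "fs q = fs p3 & sn q = sn p3" unfolding R_def using mem_asym mem_irrefl by metis
          moreover have "\<exists>a b. q = pair a b" "\<exists>a b. p3 = pair a b"
            using q p3(1) X(1) unfolding sub_def prod_iff by blast+
          ultimately show "q = p3" by auto
        qed (use p3 R3 in blast)
        then show ?thesis using p3 R3 by blast
      qed
      obtain t F where tF: "Ord t" "DF (%e. F (e 0))" "!!x. x \<E> t ==> F x \<E> prod k k"
        "!!x. x \<E> t ==> F x = c (Sep (prod k k) (%w. \<not> (\<exists>y. y \<E> x & F y = w)))"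
        "!!x y. x \<E> t ==> y \<E> t ==> F x = F y ==> x = y" "!!w. w \<E> prod k k ==> \<exists>x. x \<E> t & F x = w"
        using enumerate[OF c, of "prod k k"] cX by blast
      note [simp] = DF_app1[OF tF(2)]
      have "\<not> k \<E> t"
      proof
        assume kt: "k \<E> t"
        let ?M = "succ (m (F k))"
        have M: "?M \<E> k" using InfCard_succ[OF k] Om[OF tF(3)[OF kt]] by blast
        have OM: "Ord ?M" using Ord_mem[OF Ok M] .
        have "k \<lesssim> prod ?M ?M"
        proof (rule leI[OF tF(2)])
          fix x assume x: "x \<E> k"
          have xt: "x \<E> t" using Ord_trans[OF tF(1) kt x] .
          let ?X = "Sep (prod k k) (%w. \<not> (\<exists>y. y \<E> x & F y = w))"
          have Fk: "F k \<E> ?X" using tF(3)[OF kt] tF(5)[OF _ kt] Ord_trans[OF tF(1) xt] x mem_asym by auto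
          have sX: "?X \<sqsubseteq> prod k k" by (auto simp: sub_def)
          have "?X \<noteq> zero" unfolding eq_zero using Fk by blast
          then have "R (c ?X) (F k)" using cX[OF sX] Fk by blast
          then have "R (F x) (F k)" using tF(4)[OF xt] by simp
          then have "m (F x) \<E> ?M" unfolding R_def by auto
          moreover have "fs (F x) \<sqsubseteq> m (F x)" "sn (F x) \<sqsubseteq> m (F x)" unfolding m_def by (auto simp: sub_def)
          moreover have "Ord (fs (F x))" "Ord (sn (F x))" "Ord (m (F x))" using Om[OF tF(3)[OF xt]] by blast+
          ultimately have "fs (F x) \<E> ?M" "sn (F x) \<E> ?M"
            using Ord_sub_iff Ord_trans[OF OM] by metis+
          moreover have "\<exists>a b. F x = pair a b" using tF(3)[OF xt] unfolding prod_iff by blast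
          ultimately show "F x \<E> prod ?M ?M" by auto
        next
          fix x y assume "x \<E> k" "y \<E> k" "F x = F y"
          then show "x = y" using tF(5) Ord_trans[OF tF(1) kt] by blast
        qed
        moreover obtain l where l: "Card l" "l \<sqsubseteq> ?M" "l \<approx> ?M" using ex_Card[OF OM] by blast
        ultimately have kl: "k \<lesssim> prod l l" using prod_le[of ?M l ?M l] eqv_le[OF eqv_sym] le_trans by blast
        have Ol: "Ord l" using l Card_Ord by blast
        have lk: "l \<E> k" using l(2) Ord_sub_iff[OF Ol OM] M Ord_trans[OF Ok M] by blast
        show False
        proof (cases "l \<E> omega")
          case True
          then have "Fin k" using Fin_prod kl Fin_le by blast
          then show False unfolding Fin_def
            using omega_not_le le_trans[OF le_sub[OF InfCard_omega_sub[OF k]]] by blast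
        next
          case False
          then have "InfCard l" unfolding InfCard_def using l(1) Ord_not_mem[OF Ol Ord_omega] by blast
          then have "k \<lesssim> l" using IH[OF lk] kl le_trans by blast
          then show False using Card_mem_le[OF InfCard_Card[OF k] lk] by blast
        qed
      qed
      then have "t \<lesssim> k" using Ord_not_mem[OF Ok tF(1)] le_sub by blast
      moreover have "prod k k \<lesssim> t" by (rule surj_le[OF tF(2,1,6)])
      ultimately show "prod k k \<lesssim> k" using le_trans by blast
    qed
  qed (use assms InfCard_Ord in simp_all)
  then show ?thesis using assms by blast
qed

lemma BU_Rep: "DF (%e. F (e 0)) ==> z \<E> BU (Rep a F) \<longleftrightarrow> (\<exists>x. x \<E> a & z \<E> F x)" by auto

lemma Un2_le: assumes k: "InfCard k" and x: "x \<lesssim> k" and y: "y \<lesssim> k" shows "Un2 x y \<lesssim> k"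
proof -
  obtain f where f: "\<forall>z. z \<E> x --> app f z \<E> k" "\<forall>z w. z \<E> x --> w \<E> x --> app f z = app f w --> z = w" using leD[OF x] by blast
  obtain g where g: "\<forall>z. z \<E> y --> app g z \<E> k" "\<forall>z w. z \<E> y --> w \<E> y --> app g z = app g w --> z = w" using leD[OF y] by blast
  have k01: "zero \<E> k" "succ zero \<E> k" using subD[OF InfCard_omega_sub[OF k]] by simp_all
  have "Un2 x y \<lesssim> prod k k"
  proof (rule leI[of "%z. if z \<E> x then pair (app f z) zero else pair (app g z) (succ zero)"])
    show "DF (%e. if e 0 \<E> x then pair (app f (e 0)) zero else pair (app g (e 0)) (succ zero))" by (intro DF_If) simp_all
  qed (use f g k01 in \<open>auto split: if_splits\<close>)
  then show ?thesis using InfCard_square[OF k] le_trans by blast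
qed

lemma sub_one: assumes z: "z \<sqsubseteq> succ zero" shows "z = zero \<or> z = succ zero"
proof (cases "zero \<E> z")
  case True
  have "w \<E> z \<longleftrightarrow> w \<E> succ zero" for w using True subD[OF z, of w] by auto
  then show ?thesis using extensional by blast
next
  case False
  then have "\<not> w \<E> z" for w using subD[OF z, of w] by auto
  then show ?thesis using eq_zero by blast
qed

end

section \<open>Choice and cardinal arithmetic\<close>

locale zfc = zf E for E :: "'a => 'a => bool" (infix "\<E>" 50) +
  assumes choice: "(!!x. x \<E> a ==> \<exists>z. z \<E> x) ==> \<exists>f. fn f a & (\<forall>x. x \<E> a --> app f x \<E> x)"
begin

lemma choice_fun:
  assumes X: "DF (%e. X (e 0))" and ne: "!!x. x \<E> a ==> \<exists>z. z \<E> X x"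
  shows "\<exists>f. fn f a & (\<forall>x. x \<E> a --> app f x \<E> X x)"
proof -
  obtain g where g: "fn g (Rep a X)" "!!y. y \<E> Rep a X ==> app g y \<E> y"
    using choice[of "Rep a X"] ne X by auto
  have D: "DF (%e. app g (X (e 0)))" using X by (intro D_intros)
  show ?thesis by (rule exI[of _ "lam a (%x. app g (X x))"]) (use g X in \<open>auto simp: fn_lam[OF D] app_lam[OF D]\<close>)
qed

lemma choice_set: "\<exists>f. \<forall>x. x \<sqsubseteq> a --> x \<noteq> zero --> app f x \<E> x"
proof -
  have "\<exists>f. fn f (Sep (Pw a) (%x. x \<noteq> zero)) & (\<forall>x. x \<E> Sep (Pw a) (%x. x \<noteq> zero) --> app f x \<E> x)"
    by (rule choice) (auto simp: eq_zero)
  then show ?thesis by auto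
qed

lemma ex_card_eqv: "\<exists>k. Card k & x \<approx> k"
proof -
  obtain f where f: "!!y. y \<sqsubseteq> x ==> y \<noteq> zero ==> app f y \<E> y" using choice_set by blast
  have c: "DF (%e. app f (e 0))" by simp
  have "\<exists>t. Ord t & t \<approx> x"
  proof (rule enumerate[OF c, of x])
    fix t F assume tF: "Ord t" "DF (%e. F (e 0))" "!!z. z \<E> t ==> F z \<E> x"
      "!!y z. y \<E> t ==> z \<E> t ==> F y = F z ==> y = z" "!!w. w \<E> x ==> \<exists>z. z \<E> t & F z = w"
    have "t \<approx> x" by (rule eqvI[OF tF(2)]) (use tF in auto)
    then show ?thesis using tF(1) by blast
  qed (use f in blast)
  then obtain t where t: "Ord t" "t \<approx> x" by blast
  moreover obtain k where "Card k" "k \<approx> t" using ex_Card[OF t(1)] by blast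
  ultimately show ?thesis using eqv_trans eqv_sym by blast
qed

lemma surj_le_any:
  assumes F: "DF (%e. F (e 0))" and s: "!!y. y \<E> b ==> \<exists>x. x \<E> a & F x = y"
  shows "b \<lesssim> a"
proof -
  note [simp] = DF_app1[OF F]
  obtain f where f: "!!y. y \<E> b ==> app f y \<E> Sep a (%x. F x = y)"
    using choice_fun[of "%y. Sep a (%x. F x = y)" b] s by auto
  then have f': "!!y. y \<E> b ==> app f y \<E> a & F (app f y) = y" by simp
  show ?thesis by (rule leI[of "app f"]) (use f' in \<open>simp, blast, metis f'\<close>)
qed

lemma Rep_le_any: "DF (%e. F (e 0)) ==> Rep a F \<lesssim> a" by (rule surj_le_any) auto

text \<open>The condition \<open>B\<close> receives the whole history \<open>h\<close>, so that a
  step can react to all earlier choices at once. A choice function for subsets of \<open>X\<close>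
  turns the construction into a recursion.\<close>

lemma dependent_choice:
  assumes B: "D (%e. B (e 0) (e 1) (e 2))" and t: "Ord t"
    and step: "!!x h. x \<E> t ==> fn h x ==> (!!y. y \<E> x ==> app h y \<E> X & B y (restr h y) (app h y)) ==> \<exists>z. z \<E> X & B x h z"
  shows "\<exists>F. fn F t & (\<forall>x. x \<E> t --> app F x \<E> X & B x (restr F x) (app F x))"
proof -
  note [simp] = D_app3[OF B]
  obtain f where f: "!!y. y \<sqsubseteq> X ==> y \<noteq> zero ==> app f y \<E> y" using choice_set by blast
  define G where "G = (%x h. app f (Sep X (B x h)))"
  have G: "DF (%e. G (e 0) (e 1))" unfolding G_def by simp
  define F where "F = rec G"
  have [simp]: "DF g ==> DF (%e. F (g e))" for g unfolding F_def by (rule DF_rec[OF G])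
  have F: "F x = app f (Sep X (B x (lam x F)))" for x
    unfolding F_def using rec_eq[OF G, of x] by (simp add: G_def)
  have rs: "restr (lam x F) y = lam y F" if "y \<sqsubseteq> x" for x y
    by (rule fn_ext[OF fn_restr[OF fn_lam that] fn_lam]) (use that in \<open>auto simp: app_restr[OF fn_lam that] sub_def\<close>)
  have *: "x \<E> t --> F x \<E> X & B x (lam x F) (F x)" if "Ord x" for x
  proof (rule Ord_induct[OF _ _ that])
    fix x assume x: "Ord x" and IH: "!!y. y \<E> x ==> y \<E> t --> F y \<E> X & B y (lam y F) (F y)"
    show "x \<E> t --> F x \<E> X & B x (lam x F) (F x)"
    proof
      assume xt: "x \<E> t"
      have "\<exists>z. z \<E> X & B x (lam x F) z"
      proof (rule step[OF xt])
        show "fn (lam x F) x" by (rule fn_lam) simp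
        fix y assume y: "y \<E> x"
        show "app (lam x F) y \<E> X & B y (restr (lam x F) y) (app (lam x F) y)"
          using IH[OF y] Ord_trans[OF t xt y] y rs[OF Ord_memsub[OF x y]] by simp
      qed
      then obtain z where z: "z \<E> Sep X (B x (lam x F))" by auto
      have "Sep X (B x (lam x F)) \<sqsubseteq> X" by (auto simp: sub_def)
      moreover have "Sep X (B x (lam x F)) \<noteq> zero" unfolding eq_zero using z by blast
      ultimately have "app f (Sep X (B x (lam x F))) \<E> Sep X (B x (lam x F))" using f by blast
      then show "F x \<E> X & B x (lam x F) (F x)" unfolding F[of x, symmetric] by simp
    qed
  qed simp
  show ?thesis
    by (rule exI[of _ "lam t F"]) (use * Ord_mem[OF t] rs Ord_memsub[OF t] in \<open>auto simp: fn_lam\<close>)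
qed

lemma union_le:
  assumes k: "InfCard k" and I: "I \<lesssim> k" and X: "DF (%e. X (e 0))" and Xk: "!!i. i \<E> I ==> X i \<lesssim> k"
  shows "BU (Rep I X) \<lesssim> k"
proof -
  note [simp] = DF_app1[OF X]
  obtain u where u: "!!i. i \<E> I ==> app u i \<E> k" "!!i j. i \<E> I ==> j \<E> I ==> app u i = app u j ==> i = j"
    using leD[OF I] by blast
  have "\<exists>z. z \<E> Sep (Pw (prod (X i) k)) (%g. inj g (X i) k)" if i: "i \<E> I" for i
  proof -
    obtain g where g: "inj g (X i) k" using Xk[OF i] unfolding le_def by blast
    then have "g \<sqsubseteq> prod (X i) k" unfolding sub_def inj_def by (auto simp: fn_mem)
    then show ?thesis using g by auto
  qed
  then have "\<exists>f. fn f I & (\<forall>i. i \<E> I --> app f i \<E> Sep (Pw (prod (X i) k)) (%g. inj g (X i) k))"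
    by (intro choice_fun) simp_all
  then obtain g where "!!i. i \<E> I ==> app g i \<E> Sep (Pw (prod (X i) k)) (%g. inj g (X i) k)" by blast
  then have g: "!!i. i \<E> I ==> inj (app g i) (X i) k" by simp
  have "BU (Rep I X) \<lesssim> prod I k"
  proof (rule surj_le_any[of "%p. the_el (%z. z \<E> X (fs p) & app (app g (fs p)) z = sn p)"])
    fix z assume "z \<E> BU (Rep I X)"
    then obtain i where i: "i \<E> I" "z \<E> X i" by auto
    let ?p = "pair i (app (app g i) z)"
    have "?p \<E> prod I k" using g[OF i(1)] i unfolding inj_def by simp
    moreover have "the_el (%z. z \<E> X (fs ?p) & app (app g (fs ?p)) z = sn ?p) = z"
      by (rule the_el_eq) (use g[OF i(1)] i in \<open>auto simp: inj_def\<close>)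
    ultimately show "\<exists>p. p \<E> prod I k & the_el (%z. z \<E> X (fs p) & app (app g (fs p)) z = sn p) = z" by blast
  qed simp
  then show ?thesis using prod_le[OF I le_refl] InfCard_square[OF k] le_trans by blast
qed

lemma Pw_le: "a \<lesssim> b ==> Pw a \<lesssim> Pw b"
proof -
  assume "a \<lesssim> b"
  then obtain f where f: "!!x. x \<E> a ==> app f x \<E> b" "!!x y. x \<E> a ==> y \<E> a ==> app f x = app f y ==> x = y"
    using leD by blast
  show ?thesis
  proof (rule leI[of "%X. Rep X (app f)"])
    show "X \<E> Pw a ==> Rep X (app f) \<E> Pw b" for X using f(1) by (auto simp: sub_def)
    fix X Y assume XY: "X \<E> Pw a" "Y \<E> Pw a" "Rep X (app f) = Rep Y (app f)"
    have m: "x \<E> Z \<longleftrightarrow> app f x \<E> Rep Z (app f)" if "x \<E> a" "Z \<E> Pw a" for x Z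
      using that f(2)[of x] unfolding Pw_iff sub_def by auto
    show "X = Y" by (rule extensional) (use XY m in \<open>metis Pw_iff subD\<close>)
  qed simp
qed

lemma cantor: "\<not> Pw a \<lesssim> a"
proof
  assume "Pw a \<lesssim> a"
  then obtain f where f: "!!X. X \<sqsubseteq> a ==> app f X \<E> a"
    "!!X Z. X \<sqsubseteq> a ==> Z \<sqsubseteq> a ==> app f X = app f Z ==> X = Z" using leD[of "Pw a" a] by auto
  define R where "R = Sep a (%y. \<exists>X. X \<sqsubseteq> a & app f X = y & \<not> y \<E> X)"
  have R: "y \<E> R \<longleftrightarrow> y \<E> a & (\<exists>X. X \<sqsubseteq> a & app f X = y & \<not> y \<E> X)" for y unfolding R_def by simp
  have s: "R \<sqsubseteq> a" using R by (simp add: sub_def)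
  have "X = R" if "X \<sqsubseteq> a" "app f X = app f R" for X using f(2)[OF that(1) s that(2)] .
  then show False using R[of "app f R"] f(1)[OF s] s by blast
qed

text \<open>Via \<open>X \<lesssim> Pw a\<close>, a subset of size at most \<open>a\<close> is coded
  by a set of indices in \<open>a\<close> and a relation on \<open>a\<close> that lists the subset
  of \<open>a\<close> belonging to each index. There are \<open>2^a\<close> such codes.\<close>

lemma small_subsets_le:
  assumes a: "InfCard a" and b: "InfCard b" and ab: "Pw a \<approx> b" and X: "X \<lesssim> b"
  shows "Sep (Pw X) (%s. s \<lesssim> a) \<lesssim> b"
proof -
  obtain j where j: "!!x. x \<E> X ==> app j x \<E> Pw a" "!!x y. x \<E> X ==> y \<E> X ==> app j x = app j y ==> x = y"
    using leD[OF le_trans[OF X eqv_le[OF eqv_sym[OF ab]]]] by blast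
  have "Sep (Pw X) (%s. s \<lesssim> a) \<lesssim> prod (Pw a) (Pw (prod a a))"
  proof (rule surj_le_any[of "%p. Sep X (%x. \<exists>u. u \<E> fs p & (\<forall>t. t \<E> app j x \<longleftrightarrow> pair u t \<E> sn p))"])
    fix s assume "s \<E> Sep (Pw X) (%s. s \<lesssim> a)"
    then have s: "s \<sqsubseteq> X" "s \<lesssim> a" by auto
    obtain f where f: "!!x. x \<E> s ==> app f x \<E> a" "!!x y. x \<E> s ==> y \<E> s ==> app f x = app f y ==> x = y"
      using leD[OF s(2)] by blast
    let ?c = "Sep (prod a a) (%q. \<exists>x. x \<E> s & fs q = app f x & sn q \<E> app j x)"
    let ?p = "pair (Rep s (app f)) ?c"
    have c: "pair (app f x) t \<E> ?c \<longleftrightarrow> t \<E> app j x" if x: "x \<E> s" for x t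
    proof -
      have "t \<E> app j x ==> t \<E> a" using j(1)[OF subD[OF s(1) x]] by (simp add: sub_def)
      moreover have "x' \<E> s ==> app f x = app f x' ==> x' = x" for x' using f(2) x by blast
      ultimately show ?thesis using f(1)[OF x] x by auto
    qed
    have "?p \<E> prod (Pw a) (Pw (prod a a))" using f(1) by (auto simp: sub_def)
    moreover have "Sep X (%x. \<exists>u. u \<E> fs ?p & (\<forall>t. t \<E> app j x \<longleftrightarrow> pair u t \<E> sn ?p)) = s"
    proof (rule extensional)
      fix x
      show "x \<E> Sep X (%x. \<exists>u. u \<E> fs ?p & (\<forall>t. t \<E> app j x \<longleftrightarrow> pair u t \<E> sn ?p)) \<longleftrightarrow> x \<E> s"
      proof
        assume "x \<E> Sep X (%x. \<exists>u. u \<E> fs ?p & (\<forall>t. t \<E> app j x \<longleftrightarrow> pair u t \<E> sn ?p))"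
        then obtain y where y: "x \<E> X" "y \<E> s" "\<forall>t. t \<E> app j x \<longleftrightarrow> pair (app f y) t \<E> ?c" by auto
        then have "app j x = app j y" using c[OF y(2)] by (intro extensional) blast
        then show "x \<E> s" using j(2)[OF y(1) subD[OF s(1) y(2)]] y(2) by simp
      next
        assume x: "x \<E> s"
        then have "\<forall>t. t \<E> app j x \<longleftrightarrow> pair (app f x) t \<E> ?c" using c by blast
        moreover have "app f x \<E> Rep s (app f)" using x by auto
        ultimately have "\<exists>u. u \<E> fs ?p & (\<forall>t. t \<E> app j x \<longleftrightarrow> pair u t \<E> sn ?p)" unfolding fs_pair sn_pair by blast
        moreover have "x \<E> X" using subD[OF s(1) x] .
        ultimately show "x \<E> Sep X (%x. \<exists>u. u \<E> fs ?p & (\<forall>t. t \<E> app j x \<longleftrightarrow> pair u t \<E> sn ?p))"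
          by (subst Sep_iff) (simp, blast)
      qed
    qed
    ultimately show "\<exists>p. p \<E> prod (Pw a) (Pw (prod a a)) &
        Sep X (%x. \<exists>u. u \<E> fs p & (\<forall>t. t \<E> app j x \<longleftrightarrow> pair u t \<E> sn p)) = s" by blast
  qed simp
  note 1 = this
  have "Pw (prod a a) \<lesssim> b" using Pw_le[OF InfCard_square[OF a]] eqv_le[OF ab] le_trans by blast
  then have "prod (Pw a) (Pw (prod a a)) \<lesssim> prod b b" using prod_le eqv_le[OF ab] by blast
  then show ?thesis using 1 InfCard_square[OF b] le_trans by blast
qed

definition isfn where "isfn p \<longleftrightarrow> (\<forall>x y z. pair x y \<E> p --> pair x z \<E> p --> y = z)"
lemma D_isfn [D_intros, simp]: "DF f ==> D (%e. isfn (f e))"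
  by (rule D_app1[where R=isfn]) (unfold isfn_def, intro D_intros)

text \<open>Instead of a \<open>\<Delta>\<close>-system, the proof closes off below an ordinal of cofinality \<open>a\<^sup>+\<close>.\<close>

lemma chain_condition:
  assumes a: "InfCard a" and b: "InfCard b" and c: "InfCard c" and ab: "Pw a \<approx> b"
    and sb: "!!x. x \<E> b ==> x \<lesssim> a" and sc: "!!x. x \<E> c ==> x \<lesssim> b" and bc: "b \<E> c"
    and p: "DF (%e. p (e 0))" and pf: "!!x. x \<E> c ==> p x \<sqsubseteq> prod Y V" "!!x. x \<E> c ==> p x \<lesssim> a" and V: "V \<lesssim> b"
  shows "\<exists>x y. x \<E> c & y \<E> c & x \<noteq> y & (\<forall>u v w. pair u v \<E> p x --> pair u w \<E> p y --> pair u v \<E> p y)"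
proof -
  note [simp] = DF_app1[OF p]
  have Ob: "Ord b" and Oc: "Ord c" using b c InfCard_Ord by blast+
  have a_b: "a \<lesssim> b" if "x \<E> c" for x
  proof -
    have "Ord a" using a InfCard_Ord by blast
    then show ?thesis using Ord_linear[OF _ Ob, of a] sb[of a] le_sub[OF Ord_memsub[OF Ob, of a]]
        le_sub[OF Ord_memsub[of a b]] Card_mem_le[OF InfCard_Card[OF a], of b] eqv_le[OF ab]
        le_trans[of a "Pw a" b] leI[of "%x. upair x x" a "Pw a"]
      by (auto simp: sub_def upair_eq)
  qed
  have ab': "a \<lesssim> b" using a_b bc by blast
  have small_b: "x \<E> b" if "Ord x" "x \<lesssim> a" for x
  proof (rule ccontr)
    assume "\<not> x \<E> b"
    then have "b \<lesssim> a" using Ord_not_mem[OF that(1) Ob] le_sub that(2) le_trans by blast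
    then have "Pw a \<lesssim> a" using eqv_le[OF ab] le_trans by blast
    then show False using cantor by blast
  qed
  have small_c: "x \<E> c" if "Ord x" "x \<lesssim> b" for x
    using Ord_not_mem[OF that(1) Oc] Card_mem_le[OF InfCard_Card[OF c] bc] le_sub le_trans that(2) by blast
  define Do where "Do = (%x. BU (Rep x (%y. dom (p y))))"
  have [simp]: "DF f ==> DF (%e. Do (f e))" for f unfolding Do_def by (rule DF_app1) simp
  have Do: "u \<E> Do x \<longleftrightarrow> (\<exists>y v. y \<E> x & pair u v \<E> p y)" for u x
    unfolding Do_def by (subst BU_Rep) (simp, simp add: dom_iff)
  have dom_le: "dom (p x) \<lesssim> a" if "x \<E> c" for x
  proof -
    have "dom (p x) \<lesssim> p x"
    proof (rule surj_le_any[of fs])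
      fix y assume "y \<E> dom (p x)"
      then obtain v where "pair y v \<E> p x" unfolding dom_iff by blast
      then show "\<exists>q. q \<E> p x & fs q = y" using fs_pair by blast
    qed simp
    then show ?thesis using pf(2)[OF that] le_trans by blast
  qed
  have Do_le: "Do x \<lesssim> b" if "x \<E> c" for x
    unfolding Do_def
    by (rule union_le[OF b sc[OF that]]) (use le_trans[OF dom_le ab'] Ord_trans[OF Oc that] in auto)
  define q where "q = (%y x. restr (p y) (Do x))"
  have [simp]: "DF f ==> DF g ==> DF (%e. q (f e) (g e))" for f g unfolding q_def by (rule DF_app2) simp_all
  \<comment> \<open>\<open>L x y\<close> says that \<open>y\<close> is the least index with its
    trace on \<open>Do x\<close>. Traces number at most \<open>b\<close>, so the bound
    \<open>g x\<close> below which every trace already occurs stays below \<open>c\<close>.\<close>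
  define L where "L = (%x y. y \<E> c & (\<forall>z. z \<E> y --> q z x \<noteq> q y x))"
  have [simp]: "DF f ==> DF g ==> D (%e. L (f e) (g e))" for f g unfolding L_def by (rule D_app2) simp_all
  define g where "g = (%x. BU (Rep (Sep c (L x)) succ))"
  have [simp]: "DF f ==> DF (%e. g (f e))" for f unfolding g_def by (rule DF_app1) simp
  have g_prop: "\<exists>z. z \<E> g x & z \<E> c & q z x = q y x" if y: "y \<E> c" for x y
  proof -
    obtain z where z: "z \<E> succ y" "q z x = q y x" "!!w. w \<E> z ==> w \<E> succ y ==> q w x \<noteq> q y x"
      using set_min[of "%z. q z x = q y x" y "succ y"] by auto
    have zc: "z \<E> c" using z(1) y Ord_trans[OF Oc] by auto
    have "w \<E> z ==> w \<E> succ y" for w using z(1) Ord_trans[OF Ord_mem[OF Oc y]] by auto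
    then have "L x z" unfolding L_def using z zc by metis
    then have "z \<E> g x" unfolding g_def using zc by (subst BU_Rep) (simp, auto)
    then show ?thesis using zc z by blast
  qed
  have gO: "Ord (g x)" for x unfolding g_def by (rule Ord_BU) (use Ord_mem[OF Oc] Ord_succ in auto)
  have g_le: "g x \<E> c" if x: "x \<E> c" for x
  proof (rule small_c[OF gO])
    have "Sep c (L x) \<lesssim> Sep (Pw (prod (Do x) V)) (%s. s \<lesssim> a)"
    proof (rule leI[of "%y. q y x"])
      fix y assume "y \<E> Sep c (L x)"
      then have y: "y \<E> c" by simp
      have "q y x \<sqsubseteq> p y" by (auto simp: q_def restr_iff sub_def)
      then have "q y x \<lesssim> a" using le_sub le_trans pf(2)[OF y] by blast
      moreover have "q y x \<sqsubseteq> prod (Do x) V"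
      proof (rule subI)
        fix z assume "z \<E> q y x"
        then have z: "z \<E> p y" "fs z \<E> Do x" by (auto simp: q_def restr_iff)
        then obtain u v where "v \<E> V" "z = pair u v" using subD[OF pf(1)[OF y]] prod_iff by blast
        then show "z \<E> prod (Do x) V" using z by simp
      qed
      ultimately show "q y x \<E> Sep (Pw (prod (Do x) V)) (%s. s \<lesssim> a)" by simp
      fix y' assume "y' \<E> Sep c (L x)" "q y x = q y' x"
      then show "y = y'" using \<open>y \<E> Sep c (L x)\<close> Ord_linear[OF Ord_mem[OF Oc] Ord_mem[OF Oc], of y y']
        unfolding L_def by auto
    qed simp
    moreover have "prod (Do x) V \<lesssim> b" using prod_le[OF Do_le[OF x] V] InfCard_square[OF b] le_trans by blast
    ultimately have Lb: "Sep c (L x) \<lesssim> b" using small_subsets_le[OF a b ab] le_trans by blast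
    have "succ y \<lesssim> b" if "y \<E> Sep c (L x)" for y using sc[OF InfCard_succ[OF c]] that by auto
    then show "g x \<lesssim> b" unfolding g_def by (intro union_le[OF b Lb]) simp_all
  qed
  \<comment> \<open>An increasing sequence of indices closed under \<open>g\<close>: each value
    exceeds both the previous ones and their images under \<open>g\<close>.\<close>
  define G where "G = (%z f. BU (Rep z (%x. succ (Un2 (g (app f x)) (app f x)))))"
  have G: "DF (%e. G (e 0) (e 1))" unfolding G_def by simp
  define d where "d = rec G"
  have [simp]: "DF f ==> DF (%e. d (f e))" for f unfolding d_def by (rule DF_rec[OF G])
  have d: "y \<E> d z \<longleftrightarrow> (\<exists>x. x \<E> z & y \<E> succ (Un2 (g (d x)) (d x)))" for y z
  proof -
    have "d z = G z (lam z d)" unfolding d_def by (rule rec_eq[OF G])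
    then show ?thesis unfolding G_def by (simp only:, subst BU_Rep) (simp, auto)
  qed
  have dc: "z \<E> c --> d z \<E> c" if "Ord z" for z
  proof (rule Ord_induct[OF _ _ that])
    fix z assume z: "Ord z" and IH: "!!x. x \<E> z ==> x \<E> c --> d x \<E> c"
    show "z \<E> c --> d z \<E> c"
    proof
      assume zc: "z \<E> c"
      let ?f = "%x. succ (Un2 (g (d x)) (d x))"
      have e: "d z = BU (Rep z ?f)" by (rule extensional, subst BU_Rep, simp, simp only: d)
      have fc: "?f x \<E> c" if "x \<E> z" for x
      proof -
        have "d x \<E> c" using IH[OF that] Ord_trans[OF Oc zc that] by blast
        then have "Un2 (g (d x)) (d x) \<E> c" using g_le Ord_Un2_cases[OF gO Ord_mem[OF Oc]] by metis
        then show ?thesis using InfCard_succ[OF c] by blast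
      qed
      show "d z \<E> c" unfolding e
      proof (rule small_c)
        show "Ord (BU (Rep z ?f))" by (rule Ord_BU) (use fc Ord_mem[OF Oc] in auto)
        show "BU (Rep z ?f) \<lesssim> b" by (rule union_le[OF b sc[OF zc]]) (use fc sc in auto)
      qed
    qed
  qed simp
  have db: "d b \<E> c" using dc[OF Ob] bc by blast
  \<comment> \<open>The stage \<open>b\<close> is the closure point. A set of at most
    \<open>a\<close> coordinates captured by the union of the earlier stages is captured by one of
    them, because \<open>b\<close> is the successor of \<open>a\<close>.\<close>
  let ?y = "d b"
  have dmono: "x \<E> z ==> w \<E> d x ==> w \<E> d z" for x z w unfolding d[of w z] by auto
  have dOrd: "x \<E> b ==> d x \<E> c" for x using dc Ord_mem[OF Ob] Ord_trans[OF Oc bc] by blast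
  have db_el: "w \<E> ?y ==> \<exists>x. x \<E> b & w \<E> d x" for w
  proof -
    assume "w \<E> ?y"
    then obtain x where x: "x \<E> b" "w \<E> succ (Un2 (g (d x)) (d x))" unfolding d[of w b] by blast
    have "w \<E> d (succ x)" unfolding d[of w "succ x"] using x(2) by auto
    then show ?thesis using InfCard_succ[OF b x(1)] by blast
  qed
  define m where "m = (%u. the_el (%x. Ord x & u \<E> Do (d x) & (\<forall>z. z \<E> x --> \<not> u \<E> Do (d z))))"
  have [simp]: "DF f ==> DF (%e. m (f e))" for f unfolding m_def by (rule DF_app1) simp
  have m: "m u \<E> b & u \<E> Do (d (m u))" if u: "u \<E> Do ?y" for u
  proof -
    obtain w v where w: "w \<E> ?y" "pair u v \<E> p w" using u Do by blast
    then obtain x0 where x0: "x0 \<E> b" "w \<E> d x0" using db_el by blast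
    then have "u \<E> Do (d x0)" using w Do by blast
    then obtain x where x: "Ord x" "u \<E> Do (d x)" "\<forall>z. z \<E> x --> \<not> u \<E> Do (d z)"
      using Ord_least[of "%x. u \<E> Do (d x)" x0] Ord_mem[OF Ob x0(1)] by auto
    have "m u = x" unfolding m_def
    proof (rule the_el_eq)
      fix x' assume "Ord x' & u \<E> Do (d x') & (\<forall>z. z \<E> x' --> \<not> u \<E> Do (d z))"
      then show "x' = x" using Ord_linear[of x x'] x by blast
    qed (use x in blast)
    moreover have "x \<E> b"
      using Ord_linear[OF x(1) Ord_mem[OF Ob x0(1)]] x(3) \<open>u \<E> Do (d x0)\<close> x0(1) Ord_trans[OF Ob] by blast
    ultimately show ?thesis using x by simp
  qed
  let ?U = "Sep (dom (p ?y)) (%u. u \<E> Do ?y)"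
  let ?s = "BU (Rep ?U (%u. succ (m u)))"
  have Um: "succ (m u) \<E> b" if "u \<E> ?U" for u using m[of u] InfCard_succ[OF b] that by simp
  have "?U \<lesssim> a"
  proof -
    have "?U \<sqsubseteq> dom (p ?y)" by (auto simp: sub_def)
    then show ?thesis using le_sub dom_le[OF db] le_trans by blast
  qed
  then have "?s \<lesssim> a" by (intro union_le[OF a]) (use Um sb in auto)
  moreover have "Ord ?s" by (rule Ord_BU) (use Um Ord_mem[OF Ob] in auto)
  ultimately have sb': "?s \<E> b" using small_b by blast
  have UD: "u \<E> Do (d ?s)" if u: "u \<E> ?U" for u
  proof -
    have "m u \<E> ?s" by (subst BU_Rep) (simp, use u in auto)
    moreover have "u \<E> Do (d (m u))" using m u by simp
    ultimately show ?thesis unfolding Do using dmono by blast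
  qed
  \<comment> \<open>The condition with index \<open>x\<close> copies the trace of
    \<open>p ?y\<close> on \<open>Do (d ?s)\<close>, and \<open>x\<close> lies below
    \<open>?y\<close>. A coordinate common to both conditions is thus in \<open>Do ?y\<close>, hence
    in \<open>Do (d ?s)\<close>, where the two agree.\<close>
  obtain x where x: "x \<E> g (d ?s)" "x \<E> c" "q x (d ?s) = q ?y (d ?s)" using g_prop[OF db] by blast
  have xy: "x \<E> ?y" unfolding d[of x b] using sb' x(1) by auto
  have "x \<noteq> ?y" using xy mem_irrefl by metis
  moreover have "pair u v \<E> p ?y" if uv: "pair u v \<E> p x" "pair u w \<E> p ?y" for u v w
  proof -
    have "u \<E> ?U" using uv xy Do by (auto simp: dom_iff)
    then have "pair u v \<E> q x (d ?s)" using uv(1) UD by (simp add: q_def restr_iff)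
    then show ?thesis unfolding x(3) by (simp add: q_def restr_iff)
  qed
  ultimately show ?thesis using x(2) db by blast
qed

end

section \<open>Symmetric names and the forcing relation\<close>

text \<open>A name is a pair of a group element \<open>g\<close> and a set \<open>z\<close> of pairs of names and conditions, standing for
  the translate by \<open>g\<close> of the name \<open>z\<close>. Thus the group acts on names without any recursion.\<close>

locale forcing = zf E for E :: "'a => 'a => bool" (infix "\<E>" 50) +
  fixes P Gr Su pt one :: 'a and leq fixs :: "'a => 'a => bool" and mul act :: "'a => 'a => 'a"
  assumes D_leq: "D (%e. leq (e 0) (e 1))" and D_fixs: "D (%e. fixs (e 0) (e 1))"
    and DF_mul: "DF (%e. mul (e 0) (e 1))" and DF_act: "DF (%e. act (e 0) (e 1))"
    and leq_refl [simp]: "leq p p" and leq_trans: "leq p q ==> leq q r ==> leq p r"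
    and pt [simp]: "pt \<E> P" "p \<E> P ==> leq p pt"
    and one [simp]: "one \<E> Gr" "g \<E> Gr ==> mul one g = g"
    and mul [simp]: "g \<E> Gr ==> h \<E> Gr ==> mul g h \<E> Gr" "g \<E> Gr ==> mul g g = one"
    and mul_assoc: "g \<E> Gr ==> h \<E> Gr ==> k \<E> Gr ==> mul (mul g h) k = mul g (mul h k)"
    and mul_comm: "g \<E> Gr ==> h \<E> Gr ==> mul g h = mul h g"
    and act [simp]: "g \<E> Gr ==> p \<E> P ==> act g p \<E> P" "p \<E> P ==> act one p = p" "g \<E> Gr ==> act g pt = pt"
    and act_act: "g \<E> Gr ==> h \<E> Gr ==> p \<E> P ==> act g (act h p) = act (mul g h) p"
    and act_leq: "g \<E> Gr ==> p \<E> P ==> q \<E> P ==> leq q p ==> leq (act g q) (act g p)"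
    and Su_ne: "\<exists>s. s \<E> Su"
    and Su_dir: "s \<E> Su ==> t \<E> Su ==> \<exists>u. u \<E> Su & (\<forall>g. g \<E> Gr --> fixs u g --> fixs s g & fixs t g)"
begin

lemma D_leq' [D_intros, simp]: "DF f ==> DF g ==> D (%e. leq (f e) (g e))" by (rule D_app2[OF D_leq])
lemma D_fixs' [D_intros, simp]: "DF f ==> DF g ==> D (%e. fixs (f e) (g e))" by (rule D_app2[OF D_fixs])
lemma DF_mul' [D_intros, simp]: "DF f ==> DF g ==> DF (%e. mul (f e) (g e))" by (rule DF_app2[OF DF_mul])
lemma DF_act' [D_intros, simp]: "DF f ==> DF g ==> DF (%e. act (f e) (g e))" by (rule DF_app2[OF DF_act])

lemma mul_one [simp]: "g \<E> Gr ==> mul g one = g" using mul_comm[of g one] by simp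
lemma act_cancel [simp]: "g \<E> Gr ==> p \<E> P ==> act g (act g p) = p" by (simp add: act_act)

definition tw where "tw g a = pair (mul g (fs a)) (sn a)"
text \<open>The entries of the translated name: the tag of \<open>a\<close> multiplies the tag of
  each entry of \<open>sn a\<close> and acts on its condition.\<close>

definition el where "el a b p \<longleftrightarrow>
  (\<exists>t w q. pair (pair t w) q \<E> sn a & b = pair (mul (fs a) t) w & p = act (fs a) q)"
text \<open>A set containing, with each of its names, the names of all entries. Being a name is the
  existence of such a set around it, and hereditary symmetry is handled in the same way, so neither
  needs a recursion.\<close>

definition clo where "clo T \<longleftrightarrow> (\<forall>a. a \<E> T --> fs a \<E> Gr & a = pair (fs a) (sn a) &
  (\<forall>x. x \<E> sn a --> (\<exists>b q. b \<E> T & q \<E> P & x = pair b q)))"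
definition Nm where "Nm a \<longleftrightarrow> (\<exists>T. clo T & a \<E> T)"
lemma DF_tw [D_intros, simp]: "DF f ==> DF g ==> DF (%e. tw (f e) (g e))"
  by (rule DF_app2[where c=tw]) (unfold tw_def, intro D_intros)
lemma D_el [D_intros, simp]: "DF f ==> DF g ==> DF h ==> D (%e. el (f e) (g e) (h e))"
  by (rule D_app3[where R=el]) (unfold el_def, intro D_intros)
lemma D_clo [D_intros, simp]: "DF f ==> D (%e. clo (f e))"
  by (rule D_app1[where R=clo]) (unfold clo_def, intro D_intros)
lemma D_Nm [D_intros, simp]: "DF f ==> D (%e. Nm (f e))"
  by (rule D_app1[where R=Nm]) (unfold Nm_def, intro D_intros)

lemma Nm_pair: "Nm a ==> fs a \<E> Gr & a = pair (fs a) (sn a)" unfolding Nm_def clo_def by blast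

lemma Nm_mem: "Nm a ==> x \<E> sn a ==> \<exists>b q. Nm b & q \<E> P & x = pair b q" unfolding Nm_def clo_def by blast

lemma Nm_retag: "Nm (pair t w) ==> g \<E> Gr ==> Nm (pair g w)"
proof -
  assume "Nm (pair t w)" and g: "g \<E> Gr"
  then obtain T where T: "clo T" "pair t w \<E> T" unfolding Nm_def by blast
  have "\<exists>b q. b \<E> Un2 T (upair (pair g w) (pair g w)) & q \<E> P & x = pair b q" if "x \<E> w" for x
    using T that unfolding clo_def by (metis Un2_iff sn_pair)
  moreover have "a \<E> T ==> fs a \<E> Gr & a = pair (fs a) (sn a) & (\<forall>x. x \<E> sn a --> (\<exists>b q. b \<E> Un2 T (upair (pair g w) (pair g w)) & q \<E> P & x = pair b q))" for a
    using T(1) unfolding clo_def Un2_iff by blast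
  ultimately have "clo (Un2 T (upair (pair g w) (pair g w)))" unfolding clo_def using g by auto
  then show ?thesis unfolding Nm_def by (intro exI[of _ "Un2 T (upair (pair g w) (pair g w))"]) auto
qed

lemma Nm_tw: "Nm a ==> g \<E> Gr ==> Nm (tw g a)"
  using Nm_retag[of "fs a" "sn a" "mul g (fs a)"] Nm_pair[of a] unfolding tw_def by simp

lemma tw_tw: "Nm a ==> g \<E> Gr ==> h \<E> Gr ==> tw g (tw h a) = tw (mul g h) a"
  using Nm_pair[of a] by (simp add: tw_def mul_assoc)
lemma tw_one: "Nm a ==> tw one a = a" using Nm_pair[of a] by (simp add: tw_def)
lemma tw_cancel: "Nm a ==> g \<E> Gr ==> tw g (tw g a) = a" by (simp add: tw_tw tw_one)

lemma Nm_el: "Nm a ==> el a b p ==> Nm b & p \<E> P"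
proof -
  assume a: "Nm a" "el a b p"
  then obtain t w q where *: "pair (pair t w) q \<E> sn a" "b = pair (mul (fs a) t) w" "p = act (fs a) q"
    unfolding el_def by blast
  have "Nm (pair t w)" "q \<E> P" using Nm_mem[OF a(1) *(1)] by auto
  moreover have "t \<E> Gr" using Nm_pair[OF \<open>Nm (pair t w)\<close>] by simp
  ultimately show ?thesis using * Nm_retag Nm_pair[OF a(1)] by simp
qed

lemma el_tw: assumes "Nm a" "g \<E> Gr" "el a b p" shows "el (tw g a) (tw g b) (act g p)"
proof -
  obtain t w q where *: "pair (pair t w) q \<E> sn a" "b = pair (mul (fs a) t) w" "p = act (fs a) q"
    using assms unfolding el_def by blast
  have n: "Nm (pair t w)" "q \<E> P" using Nm_mem[OF assms(1) *(1)] by auto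
  have t: "t \<E> Gr" using Nm_pair[OF n(1)] by simp
  show ?thesis unfolding el_def
    by (intro exI[of _ t] exI[of _ w] exI[of _ q]) (use * n t assms Nm_pair[OF assms(1)] in \<open>simp add: tw_def mul_assoc act_act\<close>)
qed

lemma el_tw_iff: assumes "Nm a" "g \<E> Gr"
  shows "el (tw g a) b p \<longleftrightarrow> (\<exists>c q. el a c q & b = tw g c & p = act g q)"
proof
  assume b: "el (tw g a) b p"
  from el_tw[OF Nm_tw[OF assms] assms(2) this]
  have "el a (tw g b) (act g p)" by (simp add: tw_cancel assms)
  moreover have "b = tw g (tw g b)" "p = act g (act g p)"
    using Nm_el[OF Nm_tw[OF assms] b] tw_cancel assms by simp_all
  ultimately show "\<exists>c q. el a c q & b = tw g c & p = act g q" by blast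
qed (use el_tw assms in blast)

subsection \<open>Forced equality as the greatest bisimulation\<close>

definition trip where "trip a b p = pair a (pair b p)"
lemma DF_trip [D_intros, simp]: "DF f ==> DF g ==> DF h ==> DF (%e. trip (f e) (g e) (h e))"
  unfolding trip_def by (intro D_intros)

text \<open>One direction of the back-and-forth: whenever an entry of \<open>a\<close> is active
  below \<open>p\<close>, some stronger condition activates an entry of \<open>b\<close> that is
  related to it by \<Phi>.\<close>

definition half :: "('a => 'a => 'a => bool) => 'a => 'a => 'a => bool" where
  "half \<Phi> a b p \<longleftrightarrow> (\<forall>c r q. el a c r --> q \<E> P --> leq q p --> leq q r -->
     (\<exists>d t q'. el b d t & q' \<E> P & leq q' q & leq q' t & \<Phi> c d q'))"

definition bis where "bis R \<longleftrightarrow> (\<forall>a b p. trip a b p \<E> R -->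
    half (%a b p. trip a b p \<E> R) a b p & half (%a b p. trip b a p \<E> R) b a p)"
definition Eq where "Eq a b p \<longleftrightarrow> (\<exists>R. bis R & trip a b p \<E> R)"

lemma D_bis [D_intros, simp]: "DF f ==> D (%e. bis (f e))"
  by (rule D_app1[where R=bis]) (unfold bis_def half_def, intro D_intros)
lemma D_Eq [D_intros, simp]: "DF f ==> DF g ==> DF h ==> D (%e. Eq (f e) (g e) (h e))"
  by (rule D_app3[where R=Eq]) (unfold Eq_def, intro D_intros)

lemma half_mono: "half \<Phi> a b p ==> (!!c d q r t. el a c r ==> el b d t ==> q \<E> P ==> \<Phi> c d q ==> \<Psi> c d q) ==> half \<Psi> a b p"
  unfolding half_def by metis

lemma halfE: "half \<Phi> a b p ==> el a c r ==> q \<E> P ==> leq q p ==> leq q r ==>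
     \<exists>d t q'. el b d t & q' \<E> P & leq q' q & leq q' t & \<Phi> c d q'"
  unfolding half_def by blast

lemma Eq_half: "Eq a b p ==> half Eq a b p & half (%a b p. Eq b a p) b a p"
proof -
  assume "Eq a b p"
  then obtain R where R: "bis R" "trip a b p \<E> R" unfolding Eq_def by blast
  then have "half (%a b p. trip a b p \<E> R) a b p" "half (%a b p. trip b a p \<E> R) b a p" unfolding bis_def by blast+
  moreover have "trip c d q \<E> R ==> Eq c d q" for c d q unfolding Eq_def using R(1) by blast
  ultimately show ?thesis by (auto intro: half_mono)
qed

text \<open>Translation changes tags along the way, so the second components of a closed set are
  combined with all tags in \<open>Gr\<close> to make it closed under \<open>el\<close>.\<close>

lemma Nm_closed_set: "Nm a ==> \<exists>T. a \<E> T & (\<forall>x c r. x \<E> T --> el x c r --> c \<E> T) & (\<forall>x. x \<E> T --> Nm x)"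
proof -
  assume "Nm a"
  then obtain T where T: "clo T" "a \<E> T" unfolding Nm_def by blast
  have TN: "x \<E> T ==> Nm x" for x unfolding Nm_def using T(1) by blast
  define T' where "T' = prod Gr (Rep T sn)"
  have T': "x \<E> T' \<longleftrightarrow> (\<exists>g b. g \<E> Gr & b \<E> T & x = pair g (sn b))" for x unfolding T'_def prod_iff by auto
  have "c \<E> T'" if x: "x \<E> T'" and c: "el x c r" for x c r
  proof -
    obtain g b where gb: "g \<E> Gr" "b \<E> T" "x = pair g (sn b)" using x unfolding T' by blast
    obtain t w q where *: "pair (pair t w) q \<E> sn b" "c = pair (mul g t) w" using c gb unfolding el_def by auto
    obtain b' q' where b': "b' \<E> T" "pair (pair t w) q = pair b' q'" using T(1) gb(2) *(1) unfolding clo_def by blast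
    then have b'e: "b' = pair t w" by simp
    have "t \<E> Gr" using Nm_pair[OF TN[OF b'(1)]] b'e by simp
    then show ?thesis unfolding T' using * gb b'(1) b'e by (intro exI[of _ "mul g t"] exI[of _ b']) simp
  qed
  moreover have "Nm x" if "x \<E> T'" for x
    using that Nm_retag[of "fs _" "sn _"] Nm_pair[OF TN] TN unfolding T' by metis
  moreover have "a \<E> T'" unfolding T' using T(2) Nm_pair[OF TN[OF T(2)]] by blast
  ultimately show ?thesis by blast
qed

text \<open>Coinduction up to \<open>Eq\<close>: matched entries may satisfy the invariant again or
  be equal already. Confining the invariant to entry-closed sets around the two names makes it a
  set, as the definition of \<open>Eq\<close> demands.\<close>

lemma Eq_coinduct:
  assumes \<Phi>: "D (%e. \<Phi> (e 0) (e 1) (e 2))" and ab: "Nm a" "Nm b" and p: "p \<E> P" "\<Phi> a b p"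
    and step: "!!a b p. Nm a ==> Nm b ==> p \<E> P ==> \<Phi> a b p ==>
      half (%a b p. \<Phi> a b p \<or> Eq a b p) a b p & half (%a b p. \<Phi> b a p \<or> Eq b a p) b a p"
  shows "Eq a b p"
proof -
  note [simp] = D_app3[OF \<Phi>]
  obtain T1 where T1: "a \<E> T1" "!!x c r. x \<E> T1 ==> el x c r ==> c \<E> T1" "!!x. x \<E> T1 ==> Nm x"
    using Nm_closed_set[OF ab(1)] by blast
  obtain T2 where T2: "b \<E> T2" "!!x c r. x \<E> T2 ==> el x c r ==> c \<E> T2" "!!x. x \<E> T2 ==> Nm x"
    using Nm_closed_set[OF ab(2)] by blast
  define R where "R = Sep (prod T1 (prod T2 P)) (%z. \<Phi> (fs z) (fs (sn z)) (sn (sn z)) \<or> Eq (fs z) (fs (sn z)) (sn (sn z)))"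
  have R: "trip x y q \<E> R \<longleftrightarrow> x \<E> T1 & y \<E> T2 & q \<E> P & (\<Phi> x y q \<or> Eq x y q)" for x y q
    unfolding R_def trip_def by auto
  have "bis R"
    unfolding bis_def
  proof (intro allI impI)
    fix x y q assume "trip x y q \<E> R"
    then have x: "x \<E> T1" "y \<E> T2" "q \<E> P" and o: "\<Phi> x y q \<or> Eq x y q" unfolding R by blast+
    have h: "half (%a b p. \<Phi> a b p \<or> Eq a b p) x y q & half (%a b p. \<Phi> b a p \<or> Eq b a p) y x q"
      using o
    proof
      assume "Eq x y q"
      then show ?thesis using Eq_half by (blast intro: half_mono)
    qed (use step T1(3) T2(3) x in blast)
    show "half (%a b p. trip a b p \<E> R) x y q & half (%a b p. trip b a p \<E> R) y x q"
      unfolding R using h T1(2)[OF x(1)] T2(2)[OF x(2)] by (blast intro: half_mono)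
  qed
  moreover have "trip a b p \<E> R" unfolding R using T1(1) T2(1) p by blast
  ultimately show ?thesis unfolding Eq_def by blast
qed

lemma D_halfEq [D_intros, simp]: "DF f ==> DF g ==> DF h ==> D (%e. half Eq (f e) (g e) (h e))"
  by (rule D_app3[where R="half Eq"]) (unfold half_def, intro D_intros)
lemma D_halfEq' [D_intros, simp]: "DF f ==> DF g ==> DF h ==> D (%e. half (%a b p. Eq b a p) (f e) (g e) (h e))"
  by (rule D_app3[where R="half (%a b p. Eq b a p)"]) (unfold half_def, intro D_intros)

lemma Eq_iff: "Nm a ==> Nm b ==> p \<E> P ==> Eq a b p \<longleftrightarrow> half Eq a b p & half (%a b p. Eq b a p) b a p"
proof
  assume *: "Nm a" "Nm b" "p \<E> P" "half Eq a b p & half (%a b p. Eq b a p) b a p"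
  show "Eq a b p"
    by (rule Eq_coinduct[of "%a b p. half Eq a b p & half (%a b p. Eq b a p) b a p"])
      (use * in \<open>auto intro: half_mono\<close>)
qed (rule Eq_half)

lemma half_refl: "(!!c q. Nm c ==> q \<E> P ==> \<Phi> c c q) ==> Nm a ==> (!!c r. el a c r ==> el b c r) ==> half \<Phi> a b p"
  unfolding half_def using Nm_el leq_refl by blast

lemma Eq_refl: "Nm a ==> p \<E> P ==> Eq a a p"
  by (rule Eq_coinduct[of "%a b p. a = b"]) (auto intro!: half_refl)

lemma Eq_ext: "Nm a ==> Nm b ==> p \<E> P ==> (!!c r. el a c r \<longleftrightarrow> el b c r) ==> Eq a b p"
  unfolding Eq_iff by (auto intro!: half_refl Eq_refl)

lemma Eq_sym: "Nm a ==> Nm b ==> p \<E> P ==> Eq a b p ==> Eq b a p"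
  by (rule Eq_coinduct[of "%a b p. Eq b a p"]) (auto intro: half_mono dest: Eq_half)

lemma half_down: "half \<Phi> a b p ==> leq q p ==> half \<Phi> a b q"
  unfolding half_def using leq_trans by blast

lemma Eq_mono: "Nm a ==> Nm b ==> p \<E> P ==> q \<E> P ==> leq q p ==> Eq a b p ==> Eq a b q"
  unfolding Eq_iff using half_down by blast

lemma half_comp:
  assumes "half \<Phi> a b p" "half \<Psi> b c p" "Nm a" "Nm b" "Nm c"
    and mono: "!!x y q q'. Nm x ==> Nm y ==> q \<E> P ==> q' \<E> P ==> leq q' q ==> \<Phi> x y q ==> \<Phi> x y q'"
  shows "half (%x z q. \<exists>y. Nm y & \<Phi> x y q & \<Psi> y z q) a c p"
  unfolding half_def
proof (intro allI impI)
  fix x r q assume x: "el a x r" "q \<E> P" "leq q p" "leq q r"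
  obtain y t q1 where y: "el b y t" "q1 \<E> P" "leq q1 q" "leq q1 t" "\<Phi> x y q1" using halfE[OF assms(1) x] by blast
  obtain z u q2 where z: "el c z u" "q2 \<E> P" "leq q2 q1" "leq q2 u" "\<Psi> y z q2"
    using halfE[OF assms(2) y(1,2) leq_trans[OF y(3) x(3)] y(4)] by blast
  have "Nm x" "Nm y" using Nm_el assms(3,4) x(1) y(1) by blast+
  then show "\<exists>z t q'. el c z t & q' \<E> P & leq q' q & leq q' t & (\<exists>y. Nm y & \<Phi> x y q' & \<Psi> y z q')"
    using z mono[OF _ _ y(2) z(2,3) y(5)] leq_trans[OF z(3) y(3)] by blast
qed

lemma Eq_trans:
  assumes "Nm a" "Nm b" "Nm c" "p \<E> P" "Eq a b p" "Eq b c p" shows "Eq a c p"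
proof (rule Eq_coinduct[of "%a c p. \<exists>b. Nm b & Eq a b p & Eq b c p"])
  fix a c p assume n: "Nm a" "Nm c" "p \<E> P" and "\<exists>b. Nm b & Eq a b p & Eq b c p"
  then obtain b where b: "Nm b" "Eq a b p" "Eq b c p" by blast
  have 1: "half (%a c p. \<exists>b. Nm b & Eq a b p & Eq b c p) a c p"
    by (rule half_comp) (use Eq_half b n Eq_mono in blast)+
  have 2: "half (%x z q. \<exists>y. Nm y & Eq y x q & Eq z y q) c a p"
    by (rule half_comp) (use Eq_half b n Eq_mono in blast)+
  show "half (%a c p. (\<exists>b. Nm b & Eq a b p & Eq b c p) \<or> Eq a c p) a c p &
        half (%a c p. (\<exists>b. Nm b & Eq c b p & Eq b a p) \<or> Eq c a p) c a p"
    by (rule conjI, rule half_mono[OF 1], blast, rule half_mono[OF 2], blast)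
qed (use assms in auto)

lemma half_dense:
  assumes "!!q. q \<E> P ==> leq q p ==> \<exists>q'. q' \<E> P & leq q' q & half \<Phi> a b q'"
  shows "half \<Phi> a b p"
  unfolding half_def
proof (intro allI impI)
  fix c r q assume c: "el a c r" "q \<E> P" "leq q p" "leq q r"
  obtain q1 where q1: "q1 \<E> P" "leq q1 q" "half \<Phi> a b q1" using assms c by blast
  then show "\<exists>d t q'. el b d t & q' \<E> P & leq q' q & leq q' t & \<Phi> c d q'"
    using halfE[OF q1(3) c(1) q1(1) leq_refl leq_trans[OF q1(2) c(4)]] leq_trans[OF _ q1(2)] by blast
qed

lemma Eq_dense:
  assumes "Nm a" "Nm b" "p \<E> P" "!!q. q \<E> P ==> leq q p ==> \<exists>q'. q' \<E> P & leq q' q & Eq a b q'"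
  shows "Eq a b p"
  unfolding Eq_iff[OF assms(1-3)]
  by (rule conjI; rule half_dense) (use assms(4) Eq_half in blast)+

lemma half_act:
  assumes "half \<Phi> a b p" "Nm a" "Nm b" "p \<E> P" "g \<E> Gr"
    and "!!c d q. Nm c ==> Nm d ==> q \<E> P ==> \<Phi> c d q ==> \<Psi> (tw g c) (tw g d) (act g q)"
  shows "half \<Psi> (tw g a) (tw g b) (act g p)"
  unfolding half_def
proof (intro allI impI)
  fix c r q assume c: "el (tw g a) c r" "q \<E> P" "leq q (act g p)" "leq q r"
  obtain c' r' where c': "el a c' r'" "c = tw g c'" "r = act g r'" using c(1) el_tw_iff assms by blast
  have r': "Nm c'" "r' \<E> P" using Nm_el[OF assms(2) c'(1)] by blast+
  have q: "act g q \<E> P" "leq (act g q) p" "leq (act g q) r'"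
    using act_leq[OF assms(5) _ c(2) c(3)] act_leq[OF assms(5) _ c(2) c(4)] assms c(2) c'(3) r' by auto
  obtain d t q' where d: "el b d t" "q' \<E> P" "leq q' (act g q)" "leq q' t" "\<Phi> c' d q'"
    using halfE[OF assms(1) c'(1) q] by blast
  have d': "Nm d" "t \<E> P" using Nm_el[OF assms(3) d(1)] by blast+
  have "leq (act g q') q" using act_leq[OF assms(5) q(1) d(2,3)] assms(5) c(2) by simp
  moreover have "leq (act g q') (act g t)" using act_leq[OF assms(5) d'(2) d(2,4)] .
  ultimately show "\<exists>d t q'. el (tw g b) d t & q' \<E> P & leq q' q & leq q' t & \<Psi> c d q'"
    using el_tw[OF assms(3,5) d(1)] assms(6)[OF r'(1) d'(1) d(2) d(5)] act(1)[OF assms(5) d(2)] c'(2) by blast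
qed

text \<open>Translation by \<open>g\<close> is an involution, so the equality pulled back along
  \<open>g\<close> can serve as the invariant of a coinduction.\<close>

lemma Eq_act: assumes "Nm a" "Nm b" "p \<E> P" "g \<E> Gr" "Eq a b p" shows "Eq (tw g a) (tw g b) (act g p)"
proof (rule Eq_coinduct[of "%a b p. Eq (tw g a) (tw g b) (act g p)"])
  show "Eq (tw g (tw g a)) (tw g (tw g b)) (act g (act g p))" using assms by (simp add: tw_cancel)
  fix a b p assume *: "Nm a" "Nm b" "p \<E> P" "Eq (tw g a) (tw g b) (act g p)"
  note n = Nm_tw[OF *(1) assms(4)] Nm_tw[OF *(2) assms(4)] act(1)[OF assms(4) *(3)] assms(4)
  have "half (%a b p. Eq (tw g a) (tw g b) (act g p)) (tw g (tw g a)) (tw g (tw g b)) (act g (act g p))"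
    by (rule half_act[OF conjunct1[OF Eq_half[OF *(4)]] n]) (simp add: tw_cancel assms(4))
  moreover have "half (%a b p. Eq (tw g b) (tw g a) (act g p)) (tw g (tw g b)) (tw g (tw g a)) (act g (act g p))"
    by (rule half_act[OF conjunct2[OF Eq_half[OF *(4)]] n(2,1,3,4)]) (simp add: tw_cancel assms(4))
  ultimately show "half (%a b p. Eq (tw g a) (tw g b) (act g p) \<or> Eq a b p) a b p &
       half (%a b p. Eq (tw g b) (tw g a) (act g p) \<or> Eq b a p) b a p"
    using * assms(4) by (auto simp: tw_cancel intro: half_mono)
qed (use assms Nm_tw in auto)

subsection \<open>Membership, symmetric names, forcing\<close>

definition In where "In a b p \<longleftrightarrow> (\<forall>q. q \<E> P --> leq q p -->
  (\<exists>q' c r. q' \<E> P & leq q' q & el b c r & leq q' r & Eq a c q'))"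
text \<open>Invariance is required only up to forced equality, as the translate of a name is
  literally the same name only if the tag is unchanged.\<close>

definition symm where "symm a \<longleftrightarrow> (\<exists>s. s \<E> Su & (\<forall>g. g \<E> Gr --> fixs s g --> Eq (tw g a) a pt))"
definition HS where "HS a \<longleftrightarrow> (\<exists>T. clo T & a \<E> T & (\<forall>x. x \<E> T --> symm x))"
lemma D_In [D_intros, simp]: "DF f ==> DF g ==> DF h ==> D (%e. In (f e) (g e) (h e))"
  by (rule D_app3[where R=In]) (unfold In_def, intro D_intros)
lemma D_symm [D_intros, simp]: "DF f ==> D (%e. symm (f e))"
  by (rule D_app1[where R=symm]) (unfold symm_def, intro D_intros)
lemma D_HS [D_intros, simp]: "DF f ==> D (%e. HS (f e))"
  by (rule D_app1[where R=HS]) (unfold HS_def, intro D_intros)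

lemma HS_Nm: "HS a ==> Nm a" and HS_symm: "HS a ==> symm a" unfolding HS_def Nm_def by blast+

lemma In_mono: "In a b p ==> leq q p ==> In a b q" unfolding In_def using leq_trans by blast

lemma In_dense: "(!!q. q \<E> P ==> leq q p ==> \<exists>q'. q' \<E> P & leq q' q & In a b q') ==> In a b p"
  unfolding In_def using leq_trans leq_refl by meson

lemma In_cong:
  assumes n: "Nm a" "Nm a'" "Nm b" "Nm b'" "p \<E> P" and e: "Eq a a' p" "Eq b b' p" and i: "In a b p"
  shows "In a' b' p"
  unfolding In_def
proof (intro allI impI)
  fix q assume q: "q \<E> P" "leq q p"
  obtain q1 c r where c: "q1 \<E> P" "leq q1 q" "el b c r" "leq q1 r" "Eq a c q1" using i q unfolding In_def by blast
  have nc: "Nm c" using Nm_el[OF n(3) c(3)] by blast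
  obtain d t q2 where d: "el b' d t" "q2 \<E> P" "leq q2 q1" "leq q2 t" "Eq c d q2"
    using halfE[OF conjunct1[OF Eq_half[OF e(2)]] c(3,1) leq_trans[OF c(2) q(2)] c(4)] by blast
  have nd: "Nm d" using Nm_el[OF n(4) d(1)] by blast
  have 1: "leq q2 q" "leq q2 p" using leq_trans d(3) c(2) q(2) by blast+
  have "Eq a' a q2" using Eq_sym[OF n(1,2) d(2)] Eq_mono[OF n(1,2,5) d(2) 1(2) e(1)] by blast
  moreover have "Eq a c q2" using Eq_mono[OF n(1) nc c(1) d(2,3) c(5)] .
  ultimately have "Eq a' d q2" using Eq_trans[OF n(2,1) nc d(2)] Eq_trans[OF n(2) nc nd d(2) _ d(5)] by blast
  then show "\<exists>q' c r. q' \<E> P & leq q' q & el b' c r & leq q' r & Eq a' c q'" using d 1 by blast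
qed

lemma In_act:
  assumes n: "Nm a" "Nm b" "p \<E> P" "g \<E> Gr" and i: "In a b p" shows "In (tw g a) (tw g b) (act g p)"
  unfolding In_def
proof (intro allI impI)
  fix q assume q: "q \<E> P" "leq q (act g p)"
  have q': "act g q \<E> P" "leq (act g q) p" using act_leq[OF n(4) _ q(1,2)] n q by auto
  obtain q1 c r where c: "q1 \<E> P" "leq q1 (act g q)" "el b c r" "leq q1 r" "Eq a c q1" using i q' unfolding In_def by blast
  have nc: "Nm c" "r \<E> P" using Nm_el[OF n(2) c(3)] by blast+
  have "leq (act g q1) q" using act_leq[OF n(4) q'(1) c(1,2)] n q by simp
  then show "\<exists>q' c r. q' \<E> P & leq q' q & el (tw g b) c r & leq q' r & Eq (tw g a) c q'"
    using el_tw[OF n(2,4) c(3)] act(1)[OF n(4) c(1)] act_leq[OF n(4) nc(2) c(1,4)] Eq_act[OF n(1) nc(1) c(1) n(4) c(5)] by blast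
qed

lemma el_In: "Nm b ==> el b c r ==> In c b r"
  unfolding In_def using Nm_el Eq_refl leq_refl by blast

lemma symm_tw: assumes "Nm a" "g \<E> Gr" "symm a" shows "symm (tw g a)"
proof -
  obtain s where s: "s \<E> Su" "!!h. h \<E> Gr ==> fixs s h ==> Eq (tw h a) a pt" using assms unfolding symm_def by blast
  have "Eq (tw h (tw g a)) (tw g a) pt" if h: "h \<E> Gr" "fixs s h" for h
  proof -
    have "Eq (tw g (tw h a)) (tw g a) (act g pt)" by (rule Eq_act) (use Nm_tw assms h s in auto)
    moreover have "tw g (tw h a) = tw h (tw g a)" using tw_tw assms h mul_comm by simp
    ultimately show ?thesis using assms by simp
  qed
  then show ?thesis unfolding symm_def using s(1) by blast
qed

lemma HS_retag: "HS (pair t w) ==> g \<E> Gr ==> HS (pair g w)"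
proof -
  assume h: "HS (pair t w)" and g: "g \<E> Gr"
  then obtain T where T: "clo T" "pair t w \<E> T" "!!x. x \<E> T ==> symm x" unfolding HS_def by blast
  have t: "t \<E> Gr" using Nm_pair[OF HS_Nm[OF h]] by simp
  have "pair g w = tw (mul g t) (pair t w)" using g t by (simp add: tw_def mul_assoc)
  then have s: "symm (pair g w)" using symm_tw[OF HS_Nm[OF h] _ HS_symm[OF h]] g t by simp
  let ?T = "Un2 T (upair (pair g w) (pair g w))"
  have "\<exists>b q. b \<E> ?T & q \<E> P & x = pair b q" if "x \<E> w" for x
    using T(1,2) that unfolding clo_def by (metis Un2_iff sn_pair)
  moreover have "a \<E> T ==> fs a \<E> Gr & a = pair (fs a) (sn a) & (\<forall>x. x \<E> sn a --> (\<exists>b q. b \<E> ?T & q \<E> P & x = pair b q))" for a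
    using T(1) unfolding clo_def Un2_iff by blast
  ultimately have "clo ?T" unfolding clo_def using g by auto
  then show ?thesis unfolding HS_def using s T(3) by (intro exI[of _ ?T]) auto
qed

lemma HS_tw: "HS a ==> g \<E> Gr ==> HS (tw g a)"
  using HS_retag[of "fs a" "sn a" "mul g (fs a)"] Nm_pair[OF HS_Nm, of a] unfolding tw_def by simp

lemma HS_mem: "HS a ==> pair b q \<E> sn a ==> HS b" unfolding HS_def clo_def by (metis pair_eq)

lemma HS_el: "HS a ==> el a b p ==> HS b"
proof -
  assume a: "HS a" "el a b p"
  then obtain t w q where *: "pair (pair t w) q \<E> sn a" "b = pair (mul (fs a) t) w" unfolding el_def by blast
  have h: "HS (pair t w)" using HS_mem a(1) *(1) by blast
  then have "t \<E> Gr" using Nm_pair[OF HS_Nm] by fastforce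
  then show ?thesis using HS_retag[OF h] * Nm_pair[OF HS_Nm[OF a(1)]] by simp
qed

section \<open>The forcing relation\<close>

fun forces :: "fm => (nat => 'a) => 'a => bool" where
  "forces Falsum e p = False"
| "forces (Memb i j) e p = In (e i) (e j) p"
| "forces (Equal i j) e p = Eq (e i) (e j) p"
| "forces (Imp A B) e p = (\<forall>q. q \<E> P --> leq q p --> forces A e q --> forces B e q)"
| "forces (Forall A) e p = (\<forall>x. HS x --> forces A (case_nat x e) p)"

text \<open>An outer induction on the formula, hence one definition for each formula. The names are
  allowed to be definable functions of the assignment so that the induction passes a
  quantifier.\<close>

lemma D_forces: "(!!i. DF (f i)) ==> DF g ==> D (%e. forces A (%i. f i e) (g e))"
proof (induction A arbitrary: f g)
  case (Imp A B)
  have f: "DF (%e. f i (%j. e (Suc j)))" for i using DF_shift[OF Imp.prems(1), of i Suc] .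
  have g: "DF (%e. g (%j. e (Suc j)))" using DF_shift[OF Imp.prems(2), of Suc] .
  have "D (%e. forces A (%i. f i (%j. e (Suc j))) (e 0))" "D (%e. forces B (%i. f i (%j. e (Suc j))) (e 0))"
    using Imp.IH(1)[OF f, of "%e. e 0"] Imp.IH(2)[OF f, of "%e. e 0"] by simp_all
  then show ?case using g by simp
next
  case (Forall A)
  let ?f = "%i. case i of 0 => (%e. e 0) | Suc i => (%e. f i (%j. e (Suc j)))"
  have f: "DF (?f i)" for i using DF_shift[OF Forall.prems(1), of _ Suc] by (cases i) auto
  have g: "DF (%e. g (%j. e (Suc j)))" using DF_shift[OF Forall.prems(2), of Suc] .
  have "(%i. ?f i e) = case_nat (e 0) (%i. f i (%j. e (Suc j)))" for e :: "nat => 'a"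
    by (auto split: nat.split)
  then have "D (%e. forces A (case_nat (e 0) (%i. f i (%j. e (Suc j)))) (g (%j. e (Suc j))))"
    using Forall.IH[of ?f, OF f g] by simp
  then show ?case by simp
qed simp_all

lemma case_nat_HS: "(!!i. HS (e i)) ==> HS x ==> HS (case_nat x e i)" by (cases i) auto

lemma forces_mono: "(!!i. HS (e i)) ==> p \<E> P ==> q \<E> P ==> leq q p ==> forces A e p ==> forces A e q"
proof (induction A arbitrary: e)
  case (Imp A B)
  have "!!r. leq r q ==> leq r p" using leq_trans[OF _ Imp.prems(4)] .
  then show ?case using Imp.prems(5) unfolding forces.simps by blast
next
  case (Forall A)
  show ?case unfolding forces.simps
  proof (intro allI impI)
    fix x assume x: "HS x"
    show "forces A (case_nat x e) q"
      by (rule Forall.IH[of "case_nat x e", OF case_nat_HS[OF Forall.prems(1) x] Forall.prems(2-4)]) (use Forall.prems(5) x in simp)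
  qed
qed (auto intro: Eq_mono In_mono HS_Nm)

text \<open>The atomic clauses are closed under density and the others inherit this. Therefore the
  clause for implication, intuitionistic in form, yields classical forcing without double
  negations.\<close>

lemma forces_dense:
  "(!!i. HS (e i)) ==> p \<E> P ==> (!!q. q \<E> P ==> leq q p ==> \<exists>q'. q' \<E> P & leq q' q & forces A e q') ==> forces A e p"
proof (induction A arbitrary: e p)
  case Falsum then show ?case using leq_refl by (metis forces.simps(1))
next
  case (Memb i j) then show ?case by (auto intro: In_dense)
next
  case (Equal i j) then show ?case using Eq_dense[OF HS_Nm HS_Nm, of "e i" "e j" p] by simp
next
  case (Imp A B)
  show ?case unfolding forces.simps
  proof (intro allI impI)
    fix q assume q: "q \<E> P" "leq q p" "forces A e q"
    show "forces B e q"
    proof (rule Imp.IH(2)[OF Imp.prems(1) q(1)])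
      fix r assume r: "r \<E> P" "leq r q"
      obtain r' where r': "r' \<E> P" "leq r' r" "forces (Imp A B) e r'" using Imp.prems(3)[OF r(1)] leq_trans[OF r(2) q(2)] by blast
      then have "forces A e r'" using forces_mono[OF Imp.prems(1) q(1) r'(1) leq_trans[OF r'(2) r(2)] q(3)] by blast
      then show "\<exists>q'. q' \<E> P & leq q' r & forces B e q'" using r' leq_refl by auto
    qed
  qed
next
  case (Forall A)
  show ?case unfolding forces.simps
  proof (intro allI impI)
    fix x assume x: "HS x"
    show "forces A (case_nat x e) p"
      by (rule Forall.IH[of "case_nat x e", OF case_nat_HS[OF Forall.prems(1) x] Forall.prems(2)]) (use Forall.prems(3) x in auto)
  qed
qed

lemma forces_act:
  "(!!i. HS (e i)) ==> p \<E> P ==> g \<E> Gr ==> forces A e p ==> forces A (%i. tw g (e i)) (act g p)"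
proof (induction A arbitrary: e p)
  case (Imp A B)
  have h: "HS (tw g (e i))" for i using HS_tw Imp.prems by blast
  have c: "(%i. tw g (tw g (e i))) = e" using tw_cancel HS_Nm Imp.prems by auto
  show ?case unfolding forces.simps
  proof (intro allI impI)
    fix q assume q: "q \<E> P" "leq q (act g p)" "forces A (%i. tw g (e i)) q"
    have 1: "act g q \<E> P" "leq (act g q) p" using act_leq[OF Imp.prems(3) _ q(1,2)] q Imp.prems by auto
    have "forces A e (act g q)" using Imp.IH(1)[OF h q(1) Imp.prems(3) q(3)] c by simp
    then have "forces B e (act g q)" using Imp.prems(4) 1 by simp
    from Imp.IH(2)[OF Imp.prems(1) 1(1) Imp.prems(3) this] show "forces B (%i. tw g (e i)) q"
      using q Imp.prems by simp
  qed
next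
  case (Forall A)
  show ?case unfolding forces.simps
  proof (intro allI impI)
    fix x assume x: "HS x"
    let ?e = "case_nat (tw g x) e"
    have h: "HS (?e i)" for i using case_nat_HS[OF Forall.prems(1) HS_tw[OF x Forall.prems(3)]] .
    have "(%i. tw g (?e i)) = case_nat x (%i. tw g (e i))"
      using tw_cancel[OF HS_Nm[OF x]] Forall.prems by (auto split: nat.split)
    moreover have "forces A ?e p" using Forall.prems HS_tw[OF x Forall.prems(3)] by simp
    ultimately show "forces A (case_nat x (%i. tw g (e i))) (act g p)"
      using Forall.IH[of ?e, OF h Forall.prems(2,3)] by simp
  qed
qed (auto intro: In_act Eq_act HS_Nm)

lemma forces_cong:
  "(!!i. HS (e i)) ==> (!!i. HS (e' i)) ==> p \<E> P ==> (!!i. i \<in> fv A ==> Eq (e i) (e' i) p) ==> forces A e p ==> forces A e' p"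
proof (induction A arbitrary: e e' p)
  case (Memb i j)
  then show ?case using In_cong[of "e i" "e' i" "e j" "e' j" p] HS_Nm by simp
next
  case (Equal i j)
  then have n: "Nm (e i)" "Nm (e j)" "Nm (e' i)" "Nm (e' j)" using HS_Nm by blast+
  have "Eq (e' i) (e i) p" using Eq_sym[OF n(1,3)] Equal.prems by simp
  then have "Eq (e' i) (e j) p" using Eq_trans[OF n(3,1,2)] Equal.prems by simp
  then show ?case using Eq_trans[OF n(3,2,4)] Equal.prems by simp
next
  case (Imp A B)
  have s: "Eq (e i) (e' i) q" if "i \<in> fv (Imp A B)" "q \<E> P" "leq q p" for i q
    using Eq_mono[OF HS_Nm HS_Nm Imp.prems(3) that(2,3)] Imp.prems that by blast
  have s': "Eq (e' i) (e i) q" if "i \<in> fv (Imp A B)" "q \<E> P" "leq q p" for i q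
    using Eq_sym[OF HS_Nm HS_Nm that(2) s[OF that]] Imp.prems by blast
  show ?case unfolding forces.simps
  proof (intro allI impI)
    fix q assume q: "q \<E> P" "leq q p" "forces A e' q"
    have "forces A e q" by (rule Imp.IH(1)[OF Imp.prems(2,1) q(1) _ q(3)]) (use s' q in simp)
    then have "forces B e q" using Imp.prems(5) q by simp
    then show "forces B e' q" by (rule Imp.IH(2)[OF Imp.prems(1,2) q(1), rotated]) (use s q in simp)
  qed
next
  case (Forall A)
  show ?case unfolding forces.simps
  proof (intro allI impI)
    fix x assume x: "HS x"
    show "forces A (case_nat x e') p"
    proof (rule Forall.IH[of "case_nat x e" "case_nat x e'", OF case_nat_HS[OF Forall.prems(1) x] case_nat_HS[OF Forall.prems(2) x] Forall.prems(3)])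
      fix i assume "i \<in> fv A"
      then show "Eq (case_nat x e i) (case_nat x e' i) p"
        using Forall.prems(4)[of "i - 1"] Eq_refl[OF HS_Nm[OF x] Forall.prems(3)] by (cases i) auto
    qed (use Forall.prems(5) x in simp)
  qed
qed simp

end

context zf
begin

subsection \<open>Ranks and collection\<close>

text \<open>Rank and cumulative hierarchy, both by recursion along membership on arbitrary sets; on
  ordinals \<open>Vs\<close> gives the usual stages.\<close>

definition rk where "rk = rec (%x f. BU (Rep x (%y. succ (app f y))))"
definition Vs where "Vs = rec (%x f. BU (Rep x (%y. Pw (app f y))))"

lemma DF_rk [D_intros, simp]: "DF f ==> DF (%e. rk (f e))" unfolding rk_def by (rule DF_rec) simp_all
lemma DF_Vs [D_intros, simp]: "DF f ==> DF (%e. Vs (f e))" unfolding Vs_def by (rule DF_rec) simp_all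

lemma rk_iff: "z \<E> rk x \<longleftrightarrow> (\<exists>y. y \<E> x & z \<E> succ (rk y))"
proof -
  have "rk x = (%x f. BU (Rep x (%y. succ (app f y)))) x (lam x rk)"
    unfolding rk_def by (rule rec_eq) simp
  then show ?thesis by (simp only:, subst BU_Rep) (simp, auto)
qed

lemma Vs_iff: "z \<E> Vs x \<longleftrightarrow> (\<exists>y. y \<E> x & z \<sqsubseteq> Vs y)"
proof -
  have "Vs x = (%x f. BU (Rep x (%y. Pw (app f y)))) x (lam x Vs)"
    unfolding Vs_def by (rule rec_eq) simp
  then show ?thesis by (simp only:, subst BU_Rep) (simp, auto)
qed

lemma Ord_rk [simp]: "Ord (rk x)"
proof (rule mem_induct[of "%x. Ord (rk x)"])
  fix x assume IH: "!!y. y \<E> x ==> Ord (rk y)"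
  have "rk x = BU (Rep x (%y. succ (rk y)))" by (rule extensional, subst BU_Rep, simp, rule rk_iff)
  moreover have "Ord (BU (Rep x (%y. succ (rk y))))" by (rule Ord_BU) (use IH Ord_succ in auto)
  ultimately show "Ord (rk x)" by simp
qed simp

lemma rk_mem: "y \<E> x ==> rk y \<E> rk x" by (subst rk_iff) auto

lemma rk_mem_trans: "y \<E> x ==> rk x \<E> rk z ==> rk y \<E> rk z" using rk_mem Ord_trans[OF Ord_rk] by blast

lemma rk_Vs: "Ord a ==> rk x \<E> a ==> x \<E> Vs a"
proof -
  have "\<forall>a. Ord a --> rk x \<E> a --> x \<E> Vs a"
  proof (rule mem_induct[of "%x. \<forall>a. Ord a --> rk x \<E> a --> x \<E> Vs a"])
    fix x assume IH: "!!y. y \<E> x ==> \<forall>a. Ord a --> rk y \<E> a --> y \<E> Vs a"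
    show "\<forall>a. Ord a --> rk x \<E> a --> x \<E> Vs a"
    proof (intro allI impI)
      fix a assume a: "Ord a" "rk x \<E> a"
      have "x \<sqsubseteq> Vs (rk x)" using IH rk_mem by (simp add: sub_def)
      then show "x \<E> Vs a" unfolding Vs_iff[of x a] using a(2) by blast
    qed
  qed simp
  then show "Ord a ==> rk x \<E> a ==> x \<E> Vs a" by blast
qed

text \<open>Scott's trick: \<open>r x\<close> is the least rank of a witness for \<open>x\<close>,
  and one stage of the hierarchy above it contains such a witness.\<close>

lemma collection:
  assumes R: "D (%e. R (e 0) (e 1))"
  shows "\<exists>B. \<forall>x. x \<E> A --> (\<exists>y. R x y) --> (\<exists>y. y \<E> B & R x y)"
proof -
  note [simp] = D_app2[OF R]
  define r where "r = (%x. the_el (%a. Ord a & (\<exists>y. R x y & rk y = a) & (\<forall>b. b \<E> a --> \<not> (\<exists>y. R x y & rk y = b))))"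
  have [simp]: "DF f ==> DF (%e. r (f e))" for f unfolding r_def by (rule DF_app1) simp
  have "\<exists>y. y \<E> BU (Rep A (%x. Vs (succ (r x)))) & R x y" if x: "x \<E> A" "\<exists>y. R x y" for x
  proof -
    obtain y0 where "R x y0" using x by blast
    then obtain a where a: "Ord a" "\<exists>y. R x y & rk y = a" "\<forall>b. b \<E> a --> \<not> (\<exists>y. R x y & rk y = b)"
      using Ord_least[of "%a. \<exists>y. R x y & rk y = a" "rk y0"] by auto
    have "r x = a" unfolding r_def
    proof (rule the_el_eq)
      fix b assume "Ord b & (\<exists>y. R x y & rk y = b) & (\<forall>c. c \<E> b --> \<not> (\<exists>y. R x y & rk y = c))"
      then show "b = a" using Ord_linear[of b a] a by blast
    qed (use a in blast)
    then obtain y where y: "R x y" "rk y = r x" using a by blast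
    then have "y \<E> Vs (succ (r x))" using rk_Vs[OF Ord_succ[OF Ord_rk[of y]], of y] by simp
    then have "y \<E> BU (Rep A (%x. Vs (succ (r x))))" by (subst BU_Rep) (simp, use x in blast)
    then show ?thesis using y by blast
  qed
  then show ?thesis by blast
qed

end

context forcing
begin

subsection \<open>Canonical names\<close>

definition chk where "chk = rec (%x f. pair one (Rep x (%y. pair (app f y) pt)))"
lemma DF_chk [D_intros, simp]: "DF f ==> DF (%e. chk (f e))" unfolding chk_def by (rule DF_rec) simp_all

lemma chk_eq: "chk x = pair one (Rep x (%y. pair (chk y) pt))"
proof -
  have "chk x = (%x f. pair one (Rep x (%y. pair (app f y) pt))) x (lam x chk)"
    unfolding chk_def by (rule rec_eq) simp
  moreover have "Rep x (%y. pair (app (lam x chk) y) pt) = Rep x (%y. pair (chk y) pt)"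
    by (rule extensional) auto
  ultimately show ?thesis by simp
qed

lemma fs_chk: "fs (chk x) = one" by (subst chk_eq) simp
lemma sn_chk: "z \<E> sn (chk x) \<longleftrightarrow> (\<exists>y. y \<E> x & z = pair (chk y) pt)" by (subst chk_eq) simp
lemma chk_pair: "chk x = pair one (sn (chk x))" by (subst (1 2) chk_eq) simp

lemma el_chk: "el (chk x) b p \<longleftrightarrow> (\<exists>y. y \<E> x & b = chk y & p = pt)"
proof
  assume "el (chk x) b p"
  then obtain t w q y where *: "y \<E> x" "pair (pair t w) q = pair (chk y) pt" "b = pair (mul one t) w" "p = act one q"
    unfolding el_def sn_chk fs_chk by blast
  then have "pair t w = chk y" "q = pt" by simp_all
  then have "t = one" using fs_chk[of y] by (metis fs_pair)
  then show "\<exists>y. y \<E> x & b = chk y & p = pt" using * by auto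
next
  assume "\<exists>y. y \<E> x & b = chk y & p = pt"
  then obtain y where y: "y \<E> x" "b = chk y" "p = pt" by blast
  show "el (chk x) b p" unfolding el_def sn_chk fs_chk
    by (rule exI[of _ one], rule exI[of _ "sn (chk y)"], rule exI[of _ pt]) (use y chk_pair[of y] in auto)
qed

lemma clo_chk: "trans t ==> clo (Rep t chk)"
  unfolding clo_def by (auto simp: fs_chk sn_chk chk_pair[symmetric] trans_def sub_def) blast

lemma Nm_chk: "Nm (chk x)"
proof -
  obtain t where t: "trans t" "x \<E> t" using ex_trans_superset by blast
  have "chk x \<E> Rep t chk" using t by auto
  then show ?thesis unfolding Nm_def using clo_chk t by blast
qed

text \<open>All conditions in a canonical name are trivial and hence fixed by the group. Only tags
  change under translation, and the entries still correspond one by one.\<close>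

lemma Eq_tw_chk: "g \<E> Gr ==> p \<E> P ==> Eq (tw g (chk x)) (chk x) p"
proof (rule Eq_coinduct[of "%a b p. \<exists>g x. g \<E> Gr & a = tw g (chk x) & b = chk x"])
  fix a b p assume "Nm a" "Nm b" "p \<E> P" and "\<exists>g x. g \<E> Gr & a = tw g (chk x) & b = chk x"
  then obtain g x where g: "g \<E> Gr" "a = tw g (chk x)" "b = chk x" by blast
  have ea: "el a c r \<longleftrightarrow> (\<exists>y. y \<E> x & c = tw g (chk y) & r = pt)" for c r
    unfolding g el_tw_iff[OF Nm_chk g(1)] el_chk using act(3)[OF g(1)] by metis
  have eb: "el b c r \<longleftrightarrow> (\<exists>y. y \<E> x & c = chk y & r = pt)" for c r unfolding g el_chk by simp
  show "half (%a b p. (\<exists>g x. g \<E> Gr & a = tw g (chk x) & b = chk x) \<or> Eq a b p) a b p &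
        half (%a b p. (\<exists>g x. g \<E> Gr & b = tw g (chk x) & a = chk x) \<or> Eq b a p) b a p"
    unfolding half_def ea eb using g(1) leq_refl by blast
qed (use Nm_chk Nm_tw in auto)

lemma HS_chk: "HS (chk x)"
proof -
  obtain t where t: "trans t" "x \<E> t" using ex_trans_superset by blast
  have "symm (chk y)" for y unfolding symm_def using Su_ne Eq_tw_chk pt(1) by blast
  moreover have "chk x \<E> Rep t chk" using t by auto
  ultimately show ?thesis unfolding HS_def using clo_chk[OF t(1)] by (intro exI[of _ "Rep t chk"]) auto
qed

lemma Eq_chk: assumes "p \<E> P" "Eq (chk x) (chk y) p" shows "x = y"
proof -
  have "\<forall>y p. p \<E> P --> Eq (chk x) (chk y) p --> x = y"
  proof (rule mem_induct[of "%x. \<forall>y p. p \<E> P --> Eq (chk x) (chk y) p --> x = y"])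
    fix x assume IH: "!!z. z \<E> x ==> \<forall>y p. p \<E> P --> Eq (chk z) (chk y) p --> z = y"
    show "\<forall>y p. p \<E> P --> Eq (chk x) (chk y) p --> x = y"
    proof (intro allI impI)
      fix y p assume p: "p \<E> P" "Eq (chk x) (chk y) p"
      note h = Eq_half[OF p(2)]
      show "x = y"
      proof (rule extensional)
        fix z
        have "z \<E> y" if "z \<E> x"
        proof -
          have "el (chk x) (chk z) pt" unfolding el_chk using that by blast
          from halfE[OF conjunct1[OF h] this p(1) leq_refl pt(2)[OF p(1)]]
          show ?thesis unfolding el_chk using IH[OF that] by blast
        qed
        moreover have "z \<E> x" if "z \<E> y"
        proof -
          have "el (chk y) (chk z) pt" unfolding el_chk using that by blast
          from halfE[OF conjunct2[OF h] this p(1) leq_refl pt(2)[OF p(1)]]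
          show ?thesis unfolding el_chk using IH by blast
        qed
        ultimately show "z \<E> x \<longleftrightarrow> z \<E> y" by blast
      qed
    qed
  qed simp
  then show ?thesis using assms by blast
qed

subsection \<open>Generic filters and the truth lemma\<close>

definition generic :: "'a set => bool" where
  "generic G \<longleftrightarrow> (\<forall>p\<in>G. p \<E> P) & G \<noteq> {} & (\<forall>p\<in>G. \<forall>q. q \<E> P --> leq p q --> q \<in> G) &
    (\<forall>p\<in>G. \<forall>q\<in>G. \<exists>r\<in>G. leq r p & leq r q) &
    (\<forall>d. (\<forall>p. p \<E> P --> (\<exists>q. q \<E> d & q \<E> P & leq q p)) --> (\<exists>q\<in>G. q \<E> d))"

end

lemma (in forcing) generic_exists:
  fixes enum :: "nat => 'a"
  assumes "range enum = UNIV" shows "\<exists>G. generic G"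
proof -
  define nxt where "nxt = (%d p. if \<exists>q. q \<E> d & q \<E> P & leq q p then SOME q. q \<E> d & q \<E> P & leq q p else p)"
  have nxt: "(q \<E> d & q \<E> P & leq q p) ==> nxt d p \<E> d & nxt d p \<E> P & leq (nxt d p) p" for q d p
    unfolding nxt_def using someI[of "%q. q \<E> d & q \<E> P & leq q p" q] by (subst (1 2 3) if_P) auto
  have nxt': "p \<E> P ==> nxt d p \<E> P & leq (nxt d p) p" for d p
  proof (cases "\<exists>q. q \<E> d & q \<E> P & leq q p")
    case False
    then have "nxt d p = p" unfolding nxt_def by (rule if_not_P)
    then show "p \<E> P ==> ?thesis" by simp
  qed (use nxt in blast)
  define r where "r = rec_nat pt (%n p. nxt (enum n) p)"
  have r0: "r 0 = pt" and rS: "r (Suc n) = nxt (enum n) (r n)" for n by (simp_all add: r_def)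
  have rP: "r n \<E> P" for n by (induction n) (use r0 rS nxt' in auto)
  have rm: "m \<le> n ==> leq (r n) (r m)" for m n
  proof (induction n rule: dec_induct)
    case (step n)
    have "leq (r (Suc n)) (r n)" unfolding rS using nxt' rP by blast
    then show ?case using leq_trans step.IH by blast
  qed simp
  define G where "G = {q. q \<E> P & (\<exists>n. leq (r n) q)}"
  have "generic G"
    unfolding generic_def
  proof (intro conjI ballI allI impI)
    show "G \<noteq> {}" unfolding G_def using rP[of 0] leq_refl[of "r 0"] by blast
    show "q \<in> G" if "p \<in> G" "q \<E> P" "leq p q" for p q using that leq_trans unfolding G_def by blast
    show "\<exists>s\<in>G. leq s p & leq s q" if "p \<in> G" "q \<in> G" for p q
    proof -
      obtain m n where mn: "leq (r m) p" "leq (r n) q" using \<open>p \<in> G\<close> \<open>q \<in> G\<close> unfolding G_def by blast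
      have "leq (r (max m n)) p" "leq (r (max m n)) q"
        using leq_trans[OF rm[of m "max m n"] mn(1)] leq_trans[OF rm[of n "max m n"] mn(2)] by auto
      moreover have "r (max m n) \<in> G" unfolding G_def using rP leq_refl by blast
      ultimately show ?thesis by blast
    qed
    show "\<exists>q\<in>G. q \<E> d" if d: "\<forall>p. p \<E> P --> (\<exists>q. q \<E> d & q \<E> P & leq q p)" for d
    proof -
      obtain n where n: "d = enum n" using assms by (metis UNIV_I imageE)
      obtain q where "q \<E> d & q \<E> P & leq q (r n)" using d rP by blast
      then have "r (Suc n) \<E> d" using nxt[of q d "r n"] rS n by simp
      then show ?thesis unfolding G_def using rP leq_refl by blast
    qed
  qed (auto simp: G_def)
  then show ?thesis by blast
qed

locale generic_filter = forcing E P Gr Su pt one leq fixs mul act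
  for E :: "'a => 'a => bool" (infix "\<E>" 50) and P Gr Su pt one leq fixs mul act +
  fixes G :: "'a set"
  assumes gen: "generic G"
begin

lemma G_P: "p \<in> G ==> p \<E> P" using gen unfolding generic_def by blast
lemma G_up: "p \<in> G ==> q \<E> P ==> leq p q ==> q \<in> G" using gen unfolding generic_def by blast
lemma G_dir: "p \<in> G ==> q \<in> G ==> \<exists>r\<in>G. leq r p & leq r q" using gen unfolding generic_def by blast
lemma G_ne: "\<exists>p. p \<in> G" using gen unfolding generic_def by blast
lemma pt_G: "pt \<in> G" using G_ne G_up G_P pt by blast

text \<open>Adding the conditions incompatible with \<open>p\<close> turns a set that is dense below
  \<open>p\<close> into a dense one; in a filter containing \<open>p\<close>, the incompatible ones
  cannot be met.\<close>

lemma G_dense: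
  assumes "D (%e. \<Phi> (e 0))" "p \<in> G" "!!q. q \<E> P ==> leq q p ==> \<exists>q'. q' \<E> P & leq q' q & \<Phi> q'"
  shows "\<exists>q\<in>G. leq q p & \<Phi> q"
proof -
  note [simp] = D_app1[OF assms(1)]
  let ?d = "Sep P (%q. leq q p & \<Phi> q \<or> \<not> (\<exists>r. r \<E> P & leq r q & leq r p))"
  have d: "q \<E> ?d \<longleftrightarrow> q \<E> P & (leq q p & \<Phi> q \<or> \<not> (\<exists>r. r \<E> P & leq r q & leq r p))" for q by simp
  have "\<exists>q. q \<E> ?d & q \<E> P & leq q s" if s: "s \<E> P" for s
  proof (cases "\<exists>r. r \<E> P & leq r s & leq r p")
    case True
    then obtain r where r: "r \<E> P" "leq r s" "leq r p" by blast
    then obtain q where "q \<E> P" "leq q r" "\<Phi> q" using assms(3) by blast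
    then show ?thesis unfolding d using r leq_trans by blast
  qed (use s leq_refl in \<open>unfold d, blast\<close>)
  then have "\<exists>q\<in>G. q \<E> ?d" using gen unfolding generic_def by blast
  then obtain q where q: "q \<in> G" "q \<E> P" "leq q p & \<Phi> q \<or> \<not> (\<exists>r. r \<E> P & leq r q & leq r p)" unfolding d by blast
  then show ?thesis using G_dir[OF q(1) assms(2)] G_P by blast
qed

abbreviation nQ where "nQ a b \<equiv> \<exists>p\<in>G. Eq a b p"
abbreviation nE where "nE a b \<equiv> \<exists>p\<in>G. In a b p"

lemma D_forces0 [simp]: "DF g ==> D (%e. forces A c (g e))"
  using D_forces[of "%i e. c i"] by simp
lemma D_forces1 [simp]: "DF f ==> DF g ==> D (%e. forces A (case_nat (f e) c) (g e))"
proof -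
  assume *: "DF f" "DF g"
  have "DF (%e. case_nat (f e) c i)" for i using * by (cases i) auto
  then show ?thesis using D_forces[of "%i e. case_nat (f e) c i"] * by simp
qed
lemma D_forces2 [simp]: "DF f ==> DF f' ==> DF g ==> D (%e. forces A (case_nat (f e) (case_nat (f' e) c)) (g e))"
proof -
  assume *: "DF f" "DF f'" "DF g"
  have "DF (%e. case_nat (f' e) c i)" for i using * by (cases i) auto
  then have "DF (%e. case_nat (f e) (case_nat (f' e) c) i)" for i using * by (cases i) auto
  then show ?thesis using D_forces[of "%i e. case_nat (f e) (case_nat (f' e) c) i"] * by simp
qed

lemma forces_or_not:
  assumes h: "!!i. HS (e i)" and q: "q \<E> P" "\<not> forces A e q"
  shows "\<exists>r. r \<E> P & leq r q & (\<forall>s. s \<E> P --> leq s r --> \<not> forces A e s)"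
  using forces_dense[of e q A, OF h q(1)] q(2) by blast

theorem truth:
  "(!!i. HS (e i)) ==> presat {a. HS a} nQ nE e A \<longleftrightarrow> (\<exists>p\<in>G. forces A e p)"
proof (induction A arbitrary: e)
  case (Imp A B)
  note IH = Imp.IH(1)[OF Imp.prems] Imp.IH(2)[OF Imp.prems]
  note mono = forces_mono[of e, OF Imp.prems]
  show ?case
  proof
    assume "\<exists>p\<in>G. forces (Imp A B) e p"
    then obtain p where p: "p \<in> G" "forces (Imp A B) e p" by blast
    have "\<exists>p\<in>G. forces B e p" if q: "\<exists>p\<in>G. forces A e p"
    proof -
      obtain q r where "q \<in> G" "forces A e q" "r \<in> G" "leq r p" "leq r q" using q G_dir[OF p(1)] by blast
      then show ?thesis using p(2) mono[of q r A] G_P by auto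
    qed
    then show "presat {a. HS a} nQ nE e (Imp A B)" using IH by simp
  next
    assume *: "presat {a. HS a} nQ nE e (Imp A B)"
    let ?\<Phi> = "%r. forces (Imp A B) e r \<or> forces A e r & (\<forall>s. s \<E> P --> leq s r --> \<not> forces B e s)"
    have "\<exists>q\<in>G. leq q pt & ?\<Phi> q"
    proof (rule G_dense[OF _ pt_G])
      fix q assume q: "q \<E> P"
      show "\<exists>q'. q' \<E> P & leq q' q & ?\<Phi> q'"
      proof (cases "forces (Imp A B) e q")
        case False
        then obtain r where r: "r \<E> P" "leq r q" "forces A e r" "\<not> forces B e r" by auto
        obtain s where s: "s \<E> P" "leq s r" "\<forall>t. t \<E> P --> leq t s --> \<not> forces B e t"
          using forces_or_not[of e r B, OF Imp.prems r(1,4)] by blast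
        then show ?thesis using mono[OF r(1) s(1,2) r(3)] leq_trans[OF s(2) r(2)] by blast
      qed (use q leq_refl in blast)
    qed (simp del: forces.simps)
    then obtain q where q: "q \<in> G" "?\<Phi> q" by blast
    show "\<exists>p\<in>G. forces (Imp A B) e p"
    proof (rule disjE[OF q(2)])
      assume f: "forces A e q & (\<forall>s. s \<E> P --> leq s q --> \<not> forces B e s)"
      then obtain p where p: "p \<in> G" "forces B e p" using * IH q(1) by auto
      obtain r where "r \<in> G" "leq r p" "leq r q" using G_dir[OF p(1) q(1)] by blast
      then show ?thesis using f mono[of p r B] p G_P by blast
    qed (use q in blast)
  qed
next
  case (Forall A)
  have h: "HS x ==> HS (case_nat x e i)" for x i using case_nat_HS[OF Forall.prems] .
  have IH: "HS x ==> presat {a. HS a} nQ nE (case_nat x e) A \<longleftrightarrow> (\<exists>p\<in>G. forces A (case_nat x e) p)" for x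
    using Forall.IH[of "case_nat x e", OF h] .
  show ?case
  proof
    assume "\<exists>p\<in>G. forces (Forall A) e p"
    then show "presat {a. HS a} nQ nE e (Forall A)" using IH by auto
  next
    assume *: "presat {a. HS a} nQ nE e (Forall A)"
    let ?\<Phi> = "%r. forces (Forall A) e r \<or> (\<exists>x. HS x & (\<forall>s. s \<E> P --> leq s r --> \<not> forces A (case_nat x e) s))"
    have "\<exists>q\<in>G. leq q pt & ?\<Phi> q"
    proof (rule G_dense[OF _ pt_G])
      fix q assume q: "q \<E> P"
      show "\<exists>q'. q' \<E> P & leq q' q & ?\<Phi> q'"
      proof (cases "forces (Forall A) e q")
        case False
        then obtain x where x: "HS x" "\<not> forces A (case_nat x e) q" by auto
        then show ?thesis using forces_or_not[of "case_nat x e" q A, OF h[OF x(1)] q x(2)] by blast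
      qed (use q leq_refl in blast)
    qed (simp del: forces.simps)
    then obtain q where q: "q \<in> G" "?\<Phi> q" by blast
    show "\<exists>p\<in>G. forces (Forall A) e p"
    proof (rule disjE[OF q(2)])
      assume "\<exists>x. HS x & (\<forall>s. s \<E> P --> leq s q --> \<not> forces A (case_nat x e) s)"
      then obtain x where x: "HS x" "\<forall>s. s \<E> P --> leq s q --> \<not> forces A (case_nat x e) s" by blast
      then obtain p where p: "p \<in> G" "forces A (case_nat x e) p" using * IH by auto
      obtain r where "r \<in> G" "leq r p" "leq r q" using G_dir[OF p(1) q(1)] by blast
      then show ?thesis using x(2) forces_mono[of "case_nat x e" p r A, OF h[OF x(1)]] p G_P by blast
    qed (use q in blast)
  qed
qed auto

lemma nQ_refl: "HS a ==> nQ a a" using Eq_refl[OF HS_Nm] G_ne G_P by blast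
lemma nQ_sym: "HS a ==> HS b ==> nQ a b ==> nQ b a" using Eq_sym[OF HS_Nm HS_Nm] G_P by blast
lemma nQ_trans: assumes "HS a" "HS b" "HS c" "nQ a b" "nQ b c" shows "nQ a c"
proof -
  obtain p q r where "Eq a b p" "Eq b c q" "p \<in> G" "q \<in> G" "r \<in> G" "leq r p" "leq r q" using assms G_dir by blast
  then show ?thesis using Eq_trans[of a b c r] Eq_mono[of a b p r] Eq_mono[of b c q r] HS_Nm assms(1-3) G_P by blast
qed
lemma nE_cong: assumes "HS a" "HS b" "HS a'" "HS b'" "nQ a a'" "nQ b b'" "nE a b" shows "nE a' b'"
proof -
  obtain p q s where *: "Eq a a' p" "Eq b b' q" "In a b s" "p \<in> G" "q \<in> G" "s \<in> G" using assms by blast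
  obtain r0 where r0: "r0 \<in> G" "leq r0 p" "leq r0 q" using G_dir * by blast
  obtain r where r: "r \<in> G" "leq r r0" "leq r s" using G_dir * r0 by blast
  have l: "leq r p" "leq r q" using leq_trans r r0 by blast+
  have "In a' b' r"
    by (rule In_cong[of a a' b b']) (use HS_Nm assms(1-4) G_P r l * Eq_mono[of a a' p r] Eq_mono[of b b' q r] In_mono in auto)
  then show ?thesis using r by blast
qed

end

text \<open>\<open>v\<close> evaluates the names; the quotient of the names by the generic filter is transported to the natural numbers.\<close>

locale symext = generic_filter E P Gr Su pt one leq fixs mul act G
  for E :: "'a => 'a => bool" (infix "\<E>" 50) and P Gr Su pt one leq fixs mul act G +
  fixes v :: "'a => nat" and N :: "nat => nat => bool"
  assumes v_surj: "v ` {a. HS a} = UNIV"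
    and v_eq: "HS a ==> HS b ==> v a = v b \<longleftrightarrow> (\<exists>p\<in>G. Eq a b p)"
    and v_mem: "HS a ==> HS b ==> N (v a) (v b) \<longleftrightarrow> (\<exists>p\<in>G. In a b p)"
    and v_sat: "(!!i. HS (e i)) ==> sat N (v \<circ> e) A \<longleftrightarrow> (\<exists>p\<in>G. forces A e p)"

text \<open>Distinct sets have canonical names that are never forced equal, so there are infinitely
  many classes of names and they can be numbered by all natural numbers.\<close>

lemma (in forcing) symext_exists:
  fixes enum :: "nat => 'a"
  assumes "bij_betw enum UNIV UNIV" shows "\<exists>G v N. symext E P Gr Su pt one leq fixs mul act G v N"
proof -
  obtain G where "generic G" using generic_exists[of enum] assms bij_is_surj by blast
  then interpret generic_filter E P Gr Su pt one leq fixs mul act G by unfold_locales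
  define d where "d = inv enum"
  \<comment> \<open>A label for the class of a name: the position of its first equivalent symmetric
    name in the enumeration.\<close>
  define f where "f = (%a. LEAST n. HS (enum n) & nQ a (enum n))"
  have f: "HS (enum (f a)) & nQ a (enum (f a))" if a: "HS a" for a
    unfolding f_def
  proof (rule LeastI[of "%n. HS (enum n) & nQ a (enum n)" "d a"])
    have "enum (d a) = a" unfolding d_def using assms by (simp add: bij_is_surj surj_f_inv_f)
    then show "HS (enum (d a)) & nQ a (enum (d a))" using a nQ_refl by simp
  qed
  have feq: "nQ a b \<longleftrightarrow> f a = f b" if "HS a" "HS b" for a b
  proof
    assume ab: "nQ a b"
    have "(%n. HS (enum n) & nQ a (enum n)) = (%n. HS (enum n) & nQ b (enum n))"
      by (rule ext) (use nQ_trans nQ_sym ab that in blast)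
    then show "f a = f b" unfolding f_def by simp
  next
    assume "f a = f b"
    then show "nQ a b" using f[OF that(1)] f[OF that(2)] nQ_sym nQ_trans that by metis
  qed
  have inf: "infinite (f ` {a. HS a})"
  proof
    assume "finite (f ` {a. HS a})"
    moreover have "(f \<circ> chk \<circ> enum) ` UNIV \<subseteq> f ` {a. HS a}" using HS_chk by auto
    ultimately have "finite (range (f \<circ> chk \<circ> enum))" using finite_subset by blast
    moreover have "inj_on (f \<circ> chk \<circ> enum) UNIV"
    proof (rule injI)
      fix m n assume "(f \<circ> chk \<circ> enum) m = (f \<circ> chk \<circ> enum) n"
      then have "nQ (chk (enum m)) (chk (enum n))" using feq HS_chk by simp
      then have "enum m = enum n" using Eq_chk G_P by blast
      then show "m = n" using assms by (simp add: bij_is_inj inj_eq)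
    qed
    ultimately show False using finite_imageD by blast
  qed
  let ?X = "d ` {a. HS a}" and ?Q = "%m n. nQ (enum m) (enum n)" and ?E = "%m n. nE (enum m) (enum n)"
  have ed: "enum (d a) = a" for a unfolding d_def using assms by (simp add: bij_is_surj surj_f_inv_f)
  have pres: "presat ?X ?Q ?E e A \<longleftrightarrow> presat {a. HS a} nQ nE (enum \<circ> e) A" for e A
  proof (induction A arbitrary: e)
    case (Forall A)
    have "enum \<circ> case_nat (d x) e = case_nat x (enum \<circ> e)" for x using ed by (auto split: nat.split)
    then show ?case unfolding presat.simps Forall.IH by simp
  qed auto
  have hx: "x \<in> ?X ==> HS (enum x)" for x using ed by auto
  show ?thesis
  proof (rule quotient_on_nat[of ?X ?Q "f \<circ> enum" ?E])
    show "?Q x y \<longleftrightarrow> (f \<circ> enum) x = (f \<circ> enum) y" if "x \<in> ?X" "y \<in> ?X" for x y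
      using feq[OF hx[OF that(1)] hx[OF that(2)]] by simp
    show "?E x' y'" if "x \<in> ?X" "y \<in> ?X" "x' \<in> ?X" "y' \<in> ?X" "?Q x x'" "?Q y y'" "?E x y" for x y x' y'
      using nE_cong[OF hx[OF that(1)] hx[OF that(2)] hx[OF that(3)] hx[OF that(4)] that(5-7)] .
    have "(f \<circ> enum) ` ?X = f ` {a. HS a}" using ed by (simp add: image_image)
    then show "infinite ((f \<circ> enum) ` ?X)" using inf by simp
    fix v :: "nat => nat" and F
    assume v: "v ` ?X = UNIV" "!!x y. x \<in> ?X ==> y \<in> ?X ==> ?Q x y \<longleftrightarrow> v x = v y"
      "!!x y. x \<in> ?X ==> y \<in> ?X ==> ?E x y \<longleftrightarrow> F (v x) (v y)"
      "!!A e. (!!i. e i \<in> ?X) ==> presat ?X ?Q ?E e A \<longleftrightarrow> sat F (v \<circ> e) A"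
    have "symext E P Gr Su pt one leq fixs mul act G (v \<circ> d) F"
    proof
      show "(v \<circ> d) ` {a. HS a} = UNIV" using v(1) by (simp add: image_image)
      show "(v \<circ> d) a = (v \<circ> d) b \<longleftrightarrow> nQ a b" if "HS a" "HS b" for a b
        using v(2)[of "d a" "d b"] that by (simp add: ed)
      show "F ((v \<circ> d) a) ((v \<circ> d) b) \<longleftrightarrow> nE a b" if "HS a" "HS b" for a b
        using v(3)[of "d a" "d b"] that by (simp add: ed)
      show "sat F (v \<circ> d \<circ> e) A \<longleftrightarrow> (\<exists>p\<in>G. forces A e p)" if h: "!!i. HS (e i)" for e A
      proof -
        have "enum \<circ> (d \<circ> e) = e" using ed by auto
        then show ?thesis using v(4)[of "d \<circ> e" A] pres[of "d \<circ> e" A] truth[of e A, OF h] h by (auto simp: comp_assoc)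
      qed
    qed
    then show ?thesis by blast
  qed
qed

context symext
begin

subsection \<open>The symmetric extension satisfies ZF\<close>

definition nm where "nm n = (SOME a. HS a & v a = n)"

lemma nm: "HS (nm n) & v (nm n) = n"
proof -
  have "\<exists>a. HS a & v a = n" using v_surj by (metis (mono_tags) UNIV_I imageE mem_Collect_eq)
  then show ?thesis unfolding nm_def by (rule someI_ex)
qed

lemma HS_nm [simp]: "HS (nm n)" and v_nm [simp]: "v (nm n) = n" using nm by blast+
lemma v_nm_comp [simp]: "v \<circ> (%i. nm (e i)) = e" by auto

lemma v_case [simp]: "v \<circ> case_nat x e = case_nat (v x) (v \<circ> e)"
proof
  fix i show "(v \<circ> case_nat x e) i = case_nat (v x) (v \<circ> e) i" by (cases i) auto
qed

lemma N_sat: "sat N e A \<longleftrightarrow> (\<exists>p\<in>G. forces A (%i. nm (e i)) p)"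
  using v_sat[of "%i. nm (e i)" A] by simp

lemma G_join: "p \<in> G ==> q \<in> G ==> \<exists>r. r \<in> G & r \<E> P & leq r p & leq r q" using G_dir G_P by blast

text \<open>Recovers the usual evaluation of names, although \<open>v\<close> comes from a quotient:
  genericity turns forced membership into equality with an entry whose condition lies in
  \<open>G\<close>.\<close>

lemma mem_v: assumes a: "HS a" shows "N x (v a) \<longleftrightarrow> (\<exists>b p. el a b p & p \<in> G & x = v b)"
proof
  assume "N x (v a)"
  then obtain p where p: "p \<in> G" "In (nm x) a p" using v_mem[OF HS_nm a, of x] by auto
  have "\<exists>q\<in>G. leq q p & (\<exists>c r. el a c r & leq q r & Eq (nm x) c q)"
    by (rule G_dense[OF _ p(1)]) (simp, use p(2) in \<open>unfold In_def, blast\<close>)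
  then obtain q c r where q: "q \<in> G" "el a c r" "leq q r" "Eq (nm x) c q" by blast
  have "r \<in> G" using G_up[OF q(1) _ q(3)] Nm_el[OF HS_Nm[OF a] q(2)] by blast
  moreover have "x = v c" using v_eq[OF HS_nm HS_el[OF a q(2)], of x] q(1,4) by auto
  ultimately show "\<exists>b p. el a b p & p \<in> G & x = v b" using q(2) by blast
next
  assume "\<exists>b p. el a b p & p \<in> G & x = v b"
  then show "N x (v a)" using v_mem[OF HS_el[OF a] a] el_In[OF HS_Nm[OF a]] by blast
qed

lemma common_support:
  assumes "finite F" "!!i. HS (e i)"
  shows "\<exists>s. s \<E> Su & (\<forall>g i. i \<in> F --> g \<E> Gr --> fixs s g --> Eq (tw g (e i)) (e i) pt)"
  using assms(1)
proof (induction F)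
  case (insert j F)
  then obtain s where s: "s \<E> Su" "\<forall>g i. i \<in> F --> g \<E> Gr --> fixs s g --> Eq (tw g (e i)) (e i) pt" by blast
  obtain t where t: "t \<E> Su" "\<forall>g. g \<E> Gr --> fixs t g --> Eq (tw g (e j)) (e j) pt"
    using HS_symm[OF assms(2)[of j]] unfolding symm_def by blast
  obtain u where "u \<E> Su" "\<forall>g. g \<E> Gr --> fixs u g --> fixs s g & fixs t g" using Su_dir[OF s(1) t(1)] by blast
  then show ?case using s(2) t(2) by (intro exI[of _ u]) blast
qed (use Su_ne in auto)

lemma forces_support:
  assumes e: "!!i. HS (e i)" and s: "!!i. i \<in> fv A ==> Eq (tw g (e i)) (e i) pt"
    and g: "g \<E> Gr" and p: "p \<E> P" and f: "forces A e p"
  shows "forces A e (act g p)"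
proof -
  have 1: "forces A (%i. tw g (e i)) (act g p)" by (rule forces_act[OF e p g f])
  have h: "HS (tw g (e i))" for i using HS_tw[OF e g] .
  show ?thesis
  proof (rule forces_cong[OF h e act(1)[OF g p] _ 1])
    fix i assume "i \<in> fv A"
    then show "Eq (tw g (e i)) (e i) (act g p)"
      using Eq_mono[OF HS_Nm[OF h] HS_Nm[OF e] pt(1) act(1)[OF g p] pt(2)[OF act(1)[OF g p]]] s by blast
  qed
qed

text \<open>The candidates for members carry every tag in \<open>Gr\<close>, not only
  \<open>one\<close>. The set of candidates is therefore invariant under the whole group, and the
  new name is as symmetric as the finitely many parameters that occur in \<open>A\<close>.\<close>

lemma comprehension_name:
  fixes A :: fm and e :: "nat => 'a" and W :: 'a
  assumes W: "!!w. w \<E> W ==> HS (pair one w)" and e: "!!i. HS (e i)"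
  defines "n \<equiv> pair one (Sep (prod (prod Gr W) P) (%z. forces A (case_nat (fs z) e) (sn z)))"
  shows "HS n" "N x (v n) \<longleftrightarrow> (\<exists>g w. g \<E> Gr & w \<E> W & x = v (pair g w) & sat N (case_nat x (v \<circ> e)) A)"
proof -
  let ?D = "prod Gr W"
  have D: "HS d" if "d \<E> ?D" for d using that W HS_retag unfolding prod_iff by blast
  have sn: "pair d q \<E> sn n \<longleftrightarrow> d \<E> ?D & q \<E> P & forces A (case_nat d e) q" for d q unfolding n_def by simp
  have Dpair: "d \<E> ?D ==> pair (fs d) (sn d) = d & fs d \<E> Gr" for d unfolding prod_iff by auto
  have eln: "el n b p \<longleftrightarrow> b \<E> ?D & p \<E> P & forces A (case_nat b e) p" for b p
  proof
    assume "el n b p"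
    then obtain t w q where *: "pair (pair t w) q \<E> sn n" "b = pair (mul one t) w" "p = act one q"
      unfolding el_def n_def fs_pair by blast
    then show "b \<E> ?D & p \<E> P & forces A (case_nat b e) p" using sn by simp
  next
    assume b: "b \<E> ?D & p \<E> P & forces A (case_nat b e) p"
    then show "el n b p" unfolding el_def using sn[of b p] Dpair[of b]
      by (intro exI[of _ "fs b"] exI[of _ "sn b"] exI[of _ p]) (simp add: n_def)
  qed
  \<comment> \<open>Each candidate comes with its own closed set of symmetric names; collection and
    a union merge them into one.\<close>
  have "\<exists>T. clo T & (\<forall>d. d \<E> ?D --> d \<E> T) & (\<forall>x. x \<E> T --> HS x)"
  proof -
    obtain B where B: "!!d. d \<E> ?D ==> \<exists>T. T \<E> B & clo T & d \<E> T & (\<forall>x. x \<E> T --> symm x)"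
      using collection[of "%d T. clo T & d \<E> T & (\<forall>x. x \<E> T --> symm x)" ?D] D unfolding HS_def by auto
    define U where "U = BU (Sep B (%T. clo T & (\<forall>x. x \<E> T --> symm x)))"
    have U: "x \<E> U \<longleftrightarrow> (\<exists>T. T \<E> B & clo T & (\<forall>x. x \<E> T --> symm x) & x \<E> T)" for x unfolding U_def by auto
    have "clo U" unfolding clo_def U unfolding clo_def by blast
    moreover have "HS x" if "x \<E> U" for x using that unfolding U HS_def by blast
    moreover have "d \<E> U" if "d \<E> ?D" for d unfolding U using B[OF that] by blast
    ultimately show ?thesis by blast
  qed
  then obtain T where T: "clo T" "!!d. d \<E> ?D ==> d \<E> T" "!!x. x \<E> T ==> HS x" by blast
  let ?T = "Un2 T (upair n n)"
  have "clo ?T"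
  proof -
    have "\<exists>b q. b \<E> ?T & q \<E> P & x = pair b q" if "x \<E> sn n" for x
    proof -
      have "x \<E> prod ?D P" using that unfolding n_def by simp
      then show ?thesis using T(2) unfolding prod_iff[of x] by auto
    qed
    moreover have "fs n \<E> Gr & n = pair (fs n) (sn n)" unfolding n_def by simp
    moreover have "a \<E> T ==> fs a \<E> Gr & a = pair (fs a) (sn a) & (\<forall>x. x \<E> sn a --> (\<exists>b q. b \<E> ?T & q \<E> P & x = pair b q))" for a
      using T(1) unfolding clo_def Un2_iff by blast
    ultimately show ?thesis unfolding clo_def[of ?T] by auto
  qed
  then have Nn: "Nm n" unfolding Nm_def by (intro exI[of _ ?T]) simp
  have "symm n"
  proof -
    obtain s where s: "s \<E> Su" "!!g i. i \<in> {i. Suc i \<in> fv A} ==> g \<E> Gr ==> fixs s g ==> Eq (tw g (e i)) (e i) pt"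
      using common_support[of "{i. Suc i \<in> fv A}" e, OF _ e] finite_fv[of "Forall A"] by auto
    have "Eq (tw g n) n pt" if g: "g \<E> Gr" "fixs s g" for g
    proof (rule Eq_ext[OF Nm_tw[OF Nn g(1)] Nn pt(1)])
      have step: "el n (tw g b) (act g p)" if "el n b p" for b p
      proof -
        have b: "b \<E> ?D" "p \<E> P" "forces A (case_nat b e) p" using that unfolding eln by blast+
        have tD: "tw g b \<E> ?D" using b(1) g(1) unfolding prod_iff by (auto simp: tw_def)
        have e1: "HS (case_nat b e i)" for i using case_nat_HS[OF e D[OF b(1)]] .
        have e2: "HS (case_nat (tw g b) e i)" for i using case_nat_HS[OF e D[OF tD]] .
        have 1: "forces A (%i. tw g (case_nat b e i)) (act g p)" by (rule forces_act[OF e1 b(2) g(1) b(3)])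
        have h: "HS (tw g (case_nat b e i))" for i using HS_tw[OF e1 g(1)] .
        have gp: "act g p \<E> P" using g b by simp
        have "forces A (case_nat (tw g b) e) (act g p)"
        proof (rule forces_cong[OF h e2 gp _ 1])
          fix i assume i: "i \<in> fv A"
          show "Eq (tw g (case_nat b e i)) (case_nat (tw g b) e i) (act g p)"
          proof (cases i)
            case 0 then show ?thesis using Eq_refl[OF HS_Nm[OF D[OF tD]] gp] by simp
          next
            case (Suc j)
            then have "Eq (tw g (e j)) (e j) pt" using s(2)[of j g] g i by simp
            then show ?thesis using Suc Eq_mono[OF HS_Nm[OF HS_tw[OF e g(1)]] HS_Nm[OF e] pt(1) gp pt(2)[OF gp], of j j] by simp
          qed
        qed
        then show ?thesis unfolding eln using tD gp by blast
      qed
      fix c r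
      show "el (tw g n) c r \<longleftrightarrow> el n c r"
      proof
        assume "el (tw g n) c r" then show "el n c r" unfolding el_tw_iff[OF Nn g(1)] using step by blast
      next
        assume c: "el n c r"
        have "c = tw g (tw g c)" "r = act g (act g r)" using Nm_el[OF Nn c] g(1) tw_cancel by auto
        then show "el (tw g n) c r" unfolding el_tw_iff[OF Nn g(1)] using step[OF c] by blast
      qed
    qed
    then show ?thesis unfolding symm_def using s(1) by blast
  qed
  then show hn: "HS n" unfolding HS_def using \<open>clo ?T\<close> T(3) HS_symm by (intro exI[of _ ?T]) auto
  show "N x (v n) \<longleftrightarrow> (\<exists>g w. g \<E> Gr & w \<E> W & x = v (pair g w) & sat N (case_nat x (v \<circ> e)) A)"
  proof -
    have sat: "sat N (case_nat (v d) (v \<circ> e)) A \<longleftrightarrow> (\<exists>p\<in>G. forces A (case_nat d e) p)" if "HS d" for d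
      using v_sat[of "case_nat d e" A, OF case_nat_HS[OF e that]] by simp
    have "N x (v n) \<longleftrightarrow> (\<exists>d. d \<E> ?D & x = v d & (\<exists>p\<in>G. forces A (case_nat d e) p))"
      unfolding mem_v[OF hn] eln using G_P by blast
    also have "\<dots> \<longleftrightarrow> (\<exists>d. d \<E> ?D & x = v d & sat N (case_nat x (v \<circ> e)) A)" using sat D by blast
    finally show ?thesis unfolding prod_iff by blast
  qed
qed

text \<open>The names occurring in a name, stripped of their tags. With all tags restored, these
  contain names for every member.\<close>

definition bs where "bs z = ran (dom z)"
lemma DF_bs [D_intros, simp]: "DF f ==> DF (%e. bs (f e))"
  by (rule DF_app1[where c=bs]) (unfold bs_def, intro D_intros)
lemma bs_iff: "w \<E> bs z \<longleftrightarrow> (\<exists>t q. pair (pair t w) q \<E> z)" unfolding bs_def ran_iff dom_iff by blast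

lemma HS_bs: "HS a ==> w \<E> bs (sn a) ==> HS (pair one w)"
  unfolding bs_iff using HS_mem HS_retag one(1) by blast

lemma el_bs: "HS a ==> el a b p ==> \<exists>g w. g \<E> Gr & w \<E> bs (sn a) & b = pair g w"
  using Nm_pair[OF HS_Nm[OF HS_el]] unfolding el_def bs_iff by (metis fs_pair sn_pair)

lemma N_elem: "HS a ==> N x (v a) ==> \<exists>g w. g \<E> Gr & w \<E> bs (sn a) & x = v (pair g w)"
  unfolding mem_v using el_bs by blast

lemma comprehension:
  assumes W: "!!w. w \<E> W ==> HS (pair one w)"
  shows "\<exists>b. \<forall>x. N x b \<longleftrightarrow> (\<exists>g w. g \<E> Gr & w \<E> W & x = v (pair g w)) & sat N (case_nat x e) A"
  using comprehension_name(2)[where W=W and e="%i. nm (e i)" and A=A, OF W HS_nm] by (simp only: v_nm_comp) blast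

lemma N_separation: "\<exists>b. \<forall>x. N x b \<longleftrightarrow> N x a & sat N (case_nat x e) A"
proof -
  let ?A = "Imp (Imp (rename (%i. if i = 0 then 0 else Suc i) A) (Imp (Memb 0 1) Falsum)) Falsum"
  obtain b where b: "!!x. N x b \<longleftrightarrow> (\<exists>g w. g \<E> Gr & w \<E> bs (sn (nm a)) & x = v (pair g w)) & sat N (case_nat x (case_nat a e)) ?A"
    using comprehension[of "bs (sn (nm a))" "case_nat a e" ?A] HS_bs[OF HS_nm] by auto
  have "case_nat x (case_nat a e) \<circ> (%i. if i = 0 then 0 else Suc i) = case_nat x e" for x
    by (auto split: nat.split)
  then have "sat N (case_nat x (case_nat a e)) ?A \<longleftrightarrow> sat N (case_nat x e) A & N x a" for x
    by (auto simp: sat_rename)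
  then show ?thesis using b N_elem[OF HS_nm, of _ a] by (intro exI[of _ b]) auto
qed

lemma N_extensional: assumes "!!z. N z x \<longleftrightarrow> N z y" shows "x = y"
proof -
  let ?e = "%i::nat. if i = 0 then x else y"
  let ?A = "Forall (Imp (Memb 0 1) (Memb 0 2))" and ?B = "Forall (Imp (Memb 0 2) (Memb 0 1))"
  have "sat N ?e ?A" "sat N ?e ?B" using assms by (auto simp: numeral_2_eq_2)
  then obtain p q where pq: "p \<in> G" "forces ?A (%i. nm (?e i)) p" "q \<in> G" "forces ?B (%i. nm (?e i)) q"
    unfolding N_sat by blast
  obtain r where r: "r \<in> G" "r \<E> P" "leq r p" "leq r q" using G_join pq by blast
  have f: "forces ?A (%i. nm (?e i)) r" "forces ?B (%i. nm (?e i)) r"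
    using forces_mono[of "%i. nm (?e i)", OF HS_nm G_P[OF pq(1)] r(2,3) pq(2)]
      forces_mono[of "%i. nm (?e i)", OF HS_nm G_P[OF pq(3)] r(2,4) pq(4)] .
  let ?a = "nm x" and ?b = "nm y"
  have n: "Nm ?a" "Nm ?b" using HS_Nm by simp_all
  have 1: "HS c ==> s \<E> P ==> leq s r ==> In c ?a s ==> In c ?b s" for c s
    using f(1) by (auto simp: numeral_2_eq_2)
  have 2: "HS c ==> s \<E> P ==> leq s r ==> In c ?b s ==> In c ?a s" for c s
    using f(2) by (auto simp: numeral_2_eq_2)
  have h1: "half Eq ?a ?b r"
    unfolding half_def
  proof (intro allI impI)
    fix c s q assume c: "el ?a c s" "q \<E> P" "leq q r" "leq q s"
    have "In c ?b q" using 1[OF HS_el[OF HS_nm c(1)] c(2,3)] In_mono[OF el_In[OF n(1) c(1)] c(4)] by blast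
    then show "\<exists>d t q'. el ?b d t & q' \<E> P & leq q' q & leq q' t & Eq c d q'"
      unfolding In_def using c(2) leq_refl by blast
  qed
  have h2: "half (%a b p. Eq b a p) ?b ?a r"
    unfolding half_def
  proof (intro allI impI)
    fix c s q assume c: "el ?b c s" "q \<E> P" "leq q r" "leq q s"
    have "In c ?a q" using 2[OF HS_el[OF HS_nm c(1)] c(2,3)] In_mono[OF el_In[OF n(2) c(1)] c(4)] by blast
    then obtain q' d t where *: "q' \<E> P" "leq q' q" "el ?a d t" "leq q' t" "Eq c d q'"
      unfolding In_def using c(2) leq_refl by blast
    have "Eq d c q'" using Eq_sym[OF _ _ *(1,5)] Nm_el[OF n(2) c(1)] Nm_el[OF n(1) *(3)] by blast
    then show "\<exists>d t q'. el ?a d t & q' \<E> P & leq q' q & leq q' t & Eq d c q'" using * by blast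
  qed
  have "Eq ?a ?b r" unfolding Eq_iff[OF n r(2)] using h1 h2 by blast
  then show ?thesis using v_eq[OF HS_nm HS_nm, of x y] r(1) by auto
qed

text \<open>Minimality is obtained inside the ground model: among the names forced into
  \<open>x\<close> below a condition that forbids minimal members, take one whose second component
  has least rank. A forced common member equals one of its entries, and the second component of that
  entry has smaller rank.\<close>

lemma N_founded: assumes "N z x" shows "\<exists>y. N y x & \<not> (\<exists>z. N z y & N z x)"
proof (rule ccontr)
  assume no: "\<not> ?thesis"
  let ?A = "Forall (Imp (Memb 0 1) (Imp (Forall (Imp (Memb 0 1) (Imp (Memb 0 2) Falsum))) Falsum))"
  let ?x = "nm x"
  have "sat N (%_. x) ?A" using no by (auto simp: numeral_2_eq_2)
  then obtain p0 where p0: "p0 \<in> G" "forces ?A (%_. ?x) p0" unfolding N_sat by blast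
  define C where "C = (%b. HS b & (\<exists>p. p \<E> P & leq p p0 & In b ?x p))"
  have [simp]: "DF f ==> D (%e. C (f e))" for f by (rule D_app1[where R=C]) (simp_all add: C_def)
  obtain q where q: "q \<in> G" "In (nm z) ?x q" using assms v_mem[OF HS_nm HS_nm, of z x] by auto
  obtain r where r: "r \<E> P" "leq r p0" "leq r q" using G_join[OF p0(1) q(1)] by blast
  have "C (nm z)" unfolding C_def using r In_mono[OF q(2) r(3)] HS_nm by blast
  then obtain a where a: "\<exists>b. C b & rk (sn b) = a" "!!c. c \<E> a ==> \<not> (\<exists>b. C b & rk (sn b) = c)"
    using Ord_least[of "%a. \<exists>b. C b & rk (sn b) = a", OF _ Ord_rk[of "sn (nm z)"]] by auto
  then obtain b p where b: "HS b" "p \<E> P" "leq p p0" "In b ?x p" "rk (sn b) = a" unfolding C_def by blast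
  have "forces (Imp (Memb 0 1) (Imp (Forall (Imp (Memb 0 1) (Imp (Memb 0 2) Falsum))) Falsum)) (case_nat b (%_. ?x)) p0"
    using p0(2) b(1) by simp
  then have nf: "\<not> forces (Forall (Imp (Memb 0 1) (Imp (Memb 0 2) Falsum))) (case_nat b (%_. ?x)) p"
    using b by auto
  then obtain c p1 where c: "HS c" "p1 \<E> P" "leq p1 p" "In c b p1" "\<not> (\<forall>q. q \<E> P --> leq q p1 --> \<not> In c ?x q)"
    by (auto simp: numeral_2_eq_2)
  then obtain p2 where p2: "p2 \<E> P" "leq p2 p1" "In c ?x p2" by blast
  obtain p3 d t where d: "p3 \<E> P" "leq p3 p2" "el b d t" "leq p3 t" "Eq c d p3"
    using In_mono[OF c(4) p2(2)] p2(1) leq_refl unfolding In_def by blast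
  have hd: "HS d" using HS_el[OF b(1) d(3)] .
  have "In d ?x p3"
    using In_cong[of c d ?x ?x p3] HS_Nm[OF c(1)] HS_Nm[OF hd] HS_Nm[OF HS_nm] d(1,5) Eq_refl In_mono[OF p2(3) d(2)] by blast
  moreover have "leq p3 p0" using leq_trans d(2) p2(2) c(3) b(3) by blast
  ultimately have "C d" unfolding C_def using hd d(1) by blast
  moreover have "rk (sn d) \<E> a"
  proof -
    obtain t w q where *: "pair (pair t w) q \<E> sn b" "d = pair (mul (fs b) t) w" using d(3) unfolding el_def by blast
    have "w \<E> upair t w" "upair t w \<E> pair t w" "pair t w \<E> upair (pair t w) (pair t w)"
      "upair (pair t w) (pair t w) \<E> pair (pair t w) q" by (simp_all add: pair_def)
    then show ?thesis using *(1) unfolding b(5)[symmetric] *(2) sn_pair by (meson rk_mem rk_mem_trans)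
  qed
  ultimately show False using a(2) by blast
qed

lemma N_pairing: "\<exists>p. \<forall>z. N z p \<longleftrightarrow> z = x \<or> z = y"
proof -
  let ?W = "upair (sn (nm x)) (sn (nm y))" and ?A = "Imp (Imp (Equal 0 1) Falsum) (Equal 0 2)"
  have hp: "HS (pair one (sn (nm u)))" for u using HS_retag[of "fs (nm u)"] Nm_pair[OF HS_Nm[OF HS_nm]] by (metis HS_nm one(1))
  have W: "!!w. w \<E> ?W ==> HS (pair one w)" using hp by auto
  obtain b where b: "!!z. N z b \<longleftrightarrow> (\<exists>g w. g \<E> Gr & w \<E> ?W & z = v (pair g w)) & sat N (case_nat z (case_nat x (case_nat y undefined))) ?A"
    using comprehension[of ?W "case_nat x (case_nat y undefined)" ?A, OF W] by blast
  have "\<exists>g w. g \<E> Gr & w \<E> ?W & u = v (pair g w)" if "u = x \<or> u = y" for u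
    using that Nm_pair[OF HS_Nm[OF HS_nm], of u] by (intro exI[of _ "fs (nm u)"] exI[of _ "sn (nm u)"]) auto
  then show ?thesis using b by (intro exI[of _ b]) (auto simp: numeral_2_eq_2)
qed

lemma N_union: "\<exists>u. \<forall>z. N z u \<longleftrightarrow> (\<exists>y. N y x & N z y)"
proof -
  let ?W = "BU (Rep (bs (sn (nm x))) bs)" and ?A = "Imp (Forall (Imp (Memb 0 2) (Imp (Memb 1 0) Falsum))) Falsum"
  have W: "w \<E> ?W \<longleftrightarrow> (\<exists>u. u \<E> bs (sn (nm x)) & w \<E> bs u)" for w by (rule BU_Rep) simp
  have "HS (pair one w)" if w: "w \<E> ?W" for w
  proof -
    obtain u where "u \<E> bs (sn (nm x))" "w \<E> bs u" using w unfolding W by blast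
    then show ?thesis using HS_bs[OF HS_bs[OF HS_nm]] by simp
  qed
  then obtain b where b: "!!z. N z b \<longleftrightarrow> (\<exists>g w. g \<E> Gr & w \<E> ?W & z = v (pair g w)) & sat N (case_nat z (%_. x)) ?A"
    using comprehension[of ?W "%_. x" ?A] by blast
  have sat: "sat N (case_nat z (%_. x)) ?A \<longleftrightarrow> (\<exists>y. N y x & N z y)" for z by (auto simp: numeral_2_eq_2)
  have "\<exists>g w. g \<E> Gr & w \<E> ?W & z = v (pair g w)" if y: "N y x" "N z y" for y z
  proof -
    obtain g u where u: "g \<E> Gr" "u \<E> bs (sn (nm x))" "y = v (pair g u)" using N_elem[OF HS_nm, of y x] y by auto
    have "HS (pair g u)" using HS_retag[OF HS_bs[OF HS_nm u(2)] u(1)] .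
    then obtain h w where "h \<E> Gr" "w \<E> bs u" "z = v (pair h w)" using N_elem[of "pair g u" z] y u by auto
    then show ?thesis unfolding W using u(2) by blast
  qed
  then show ?thesis using b unfolding sat by blast
qed

text \<open>Every subset of \<open>x\<close> has a nice name, a set of pairs of a candidate for a
  member of \<open>x\<close> and a condition. These names form a set in the ground model.\<close>

lemma N_power: "\<exists>p. \<forall>z. N z p \<longleftrightarrow> (\<forall>y. N y z --> N y x)"
proof -
  let ?B = "bs (sn (nm x))"
  let ?W = "Sep (Pw (prod (prod Gr ?B) P)) (%w. HS (pair one w))" and ?A = "Forall (Imp (Memb 0 1) (Memb 0 2))"
  have W: "!!w. w \<E> ?W ==> HS (pair one w)" by auto
  obtain b where b: "!!z. N z b \<longleftrightarrow> (\<exists>g w. g \<E> Gr & w \<E> ?W & z = v (pair g w)) & sat N (case_nat z (%_. x)) ?A"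
    using comprehension[of ?W "%_. x" ?A, OF W] by blast
  have sat: "sat N (case_nat z (%_. x)) ?A \<longleftrightarrow> (\<forall>y. N y z --> N y x)" for z by (auto simp: numeral_2_eq_2)
  have "\<exists>g w. g \<E> Gr & w \<E> ?W & z = v (pair g w)" if z: "\<forall>y. N y z --> N y x" for z
  proof -
    let ?w = "Sep (prod (prod Gr ?B) P) (%u. forces (Memb 0 1) (case_nat (fs u) (%_. nm z)) (sn u))"
    have WB: "!!w. w \<E> ?B ==> HS (pair one w)" using HS_bs[OF HS_nm] .
    have c1: "HS (pair one ?w)"
      by (rule comprehension_name(1)[where e="%_. nm z" and A="Memb 0 1"]) (use WB in auto)
    have "N y (v (pair one ?w)) \<longleftrightarrow> N y z" for y
      by (subst comprehension_name(2)[where e="%_. nm z" and A="Memb 0 1"])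
        (use WB N_elem[OF HS_nm, of y x] z in auto)
    then have "z = v (pair one ?w)" using N_extensional by blast
    moreover have "?w \<E> ?W" using c1 by (auto simp: sub_def)
    ultimately show ?thesis using one(1) by blast
  qed
  then show ?thesis using b unfolding sat by blast
qed

definition ck where "ck x = v (chk x)"

lemma N_ck: "N y (ck x) \<longleftrightarrow> (\<exists>z. z \<E> x & y = ck z)"
  unfolding ck_def mem_v[OF HS_chk] el_chk using pt_G by blast

lemma ck_inj [simp]: "ck x = ck y \<longleftrightarrow> x = y"
  unfolding ck_def v_eq[OF HS_chk HS_chk] using Eq_chk G_P pt_G Eq_refl[OF Nm_chk pt(1)] by blast

lemma N_ck_ck [simp]: "N (ck x) (ck y) \<longleftrightarrow> x \<E> y" unfolding N_ck by auto

lemma N_infinity: "\<exists>w. (\<exists>u. (\<forall>z. \<not> N z u) & N u w) & (\<forall>x. N x w --> (\<exists>s. (\<forall>z. N z s \<longleftrightarrow> N z x \<or> z = x) & N s w))"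
proof (rule exI[of _ "ck omega"], intro conjI allI impI)
  show "\<exists>u. (\<forall>z. \<not> N z u) & N u (ck omega)" by (rule exI[of _ "ck zero"]) (simp add: N_ck)
  fix x assume "N x (ck omega)"
  then obtain n where n: "n \<E> omega" "x = ck n" unfolding N_ck by blast
  show "\<exists>s. (\<forall>z. N z s \<longleftrightarrow> N z x \<or> z = x) & N s (ck omega)"
    by (rule exI[of _ "ck (succ n)"]) (use n in \<open>auto simp: N_ck\<close>)
qed

text \<open>Collection is applied to pairs of a candidate argument and a condition forcing some
  value. It bounds the names of values before the generic filter is consulted.\<close>

lemma N_replacement:
  assumes fun1: "!!x y z. N x a ==> sat N (case_nat x (case_nat y e)) A ==> sat N (case_nat x (case_nat z e)) A ==> y = z"
  shows "\<exists>b. \<forall>y. N y b \<longleftrightarrow> (\<exists>x. N x a & sat N (case_nat x (case_nat y e)) A)"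
proof -
  let ?e = "%i. nm (e i)" and ?D = "prod (prod Gr (bs (sn (nm a)))) P"
  obtain B where B: "!!u. u \<E> ?D ==> \<exists>y. HS y & forces A (case_nat (fs u) (case_nat y ?e)) (sn u) ==>
      \<exists>y. y \<E> B & HS y & forces A (case_nat (fs u) (case_nat y ?e)) (sn u)"
    using collection[of "%u y. HS y & forces A (case_nat (fs u) (case_nat y ?e)) (sn u)" ?D] by auto
  let ?W = "Sep (Rep B sn) (%w. HS (pair one w))"
  let ?r = "%i::nat. if i < 2 then i else Suc i"
  let ?A = "Imp (Forall (Imp (Memb 0 2) (Imp (rename ?r A) Falsum))) Falsum"
  have W: "!!w. w \<E> ?W ==> HS (pair one w)" by auto
  obtain b where b: "!!z. N z b \<longleftrightarrow> (\<exists>g w. g \<E> Gr & w \<E> ?W & z = v (pair g w)) & sat N (case_nat z (case_nat a e)) ?A"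
    using comprehension[of ?W "case_nat a e" ?A, OF W] by blast
  have "case_nat x (case_nat y (case_nat a e)) \<circ> ?r = case_nat x (case_nat y e)" for x y
  proof
    fix i show "(case_nat x (case_nat y (case_nat a e)) \<circ> ?r) i = case_nat x (case_nat y e) i"
      by (cases i; cases "i - 1") auto
  qed
  then have sat: "sat N (case_nat y (case_nat a e)) ?A \<longleftrightarrow> (\<exists>x. N x a & sat N (case_nat x (case_nat y e)) A)" for y
    by (auto simp: sat_rename numeral_2_eq_2)
  have "\<exists>g w. g \<E> Gr & w \<E> ?W & y = v (pair g w)" if xy: "N x a" "sat N (case_nat x (case_nat y e)) A" for x y
  proof -
    obtain d w where d: "d \<E> Gr" "w \<E> bs (sn (nm a))" "x = v (pair d w)" using N_elem[OF HS_nm, of x a] xy by auto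
    have hd: "HS (pair d w)" using HS_retag[OF HS_bs[OF HS_nm d(2)] d(1)] .
    have h: "HS (case_nat (pair d w) (case_nat u ?e) i)" if "HS u" for u i
      by (rule case_nat_HS[OF case_nat_HS[OF HS_nm that] hd])
    have s: "sat N (case_nat x (case_nat (v u) e)) A \<longleftrightarrow> (\<exists>p\<in>G. forces A (case_nat (pair d w) (case_nat u ?e)) p)" if "HS u" for u
      using v_sat[of "case_nat (pair d w) (case_nat u ?e)" A, OF h[OF that]] d(3) by simp
    obtain p where p: "p \<in> G" "forces A (case_nat (pair d w) (case_nat (nm y) ?e)) p" using s[OF HS_nm, of y] xy(2) by auto
    have "pair (pair d w) p \<E> ?D" using d p G_P by simp
    from B[OF this, unfolded fs_pair sn_pair] p(2) obtain u where u: "u \<E> B" "HS u" "forces A (case_nat (pair d w) (case_nat u ?e)) p"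
      using HS_nm by blast
    have "sat N (case_nat x (case_nat (v u) e)) A" using s[OF u(2)] u(3) p(1) by blast
    then have "y = v u" using fun1[OF xy(1,2)] by blast
    moreover have up: "fs u \<E> Gr" "pair (fs u) (sn u) = u" using Nm_pair[OF HS_Nm[OF u(2)]] by auto
    moreover have "sn u \<E> ?W"
    proof -
      have "HS (pair (fs u) (sn u))" using up u(2) by simp
      then have "HS (pair one (sn u))" using HS_retag one(1) by blast
      then show ?thesis using u(1) by auto
    qed
    ultimately show ?thesis by metis
  qed
  then show ?thesis using b unfolding sat by blast
qed

lemma sat_ZF: assumes "A \<in> ZF" shows "sat N d A"
proof -
  consider F where "A = sentence F" "F \<in> {Extensionality, Foundation, Pairing, Union_Axiom, Power_Set_Axiom, Infinity}"
    | k \<phi> where "A = sentence (Separation k \<phi>)" "fv \<phi> \<subseteq> {..<k + 2}"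
    | k \<phi> where "A = sentence (Replacement k \<phi>)" "fv \<phi> \<subseteq> {..<k + 3}"
    using assms unfolding ZF_def by blast
  then show ?thesis
  proof cases
    case 1
    have "S N d 0 d Extensionality" unfolding Extensionality_def using N_extensional by (simp add: S_simps)
    moreover have "S N d 0 d Foundation" unfolding Foundation_def Nonempty_def using N_founded by (simp add: S_simps) blast
    moreover have "S N d 0 d Pairing" unfolding Pairing_def UPair_def using N_pairing by (simp add: S_simps)
    moreover have "S N d 0 d Union_Axiom" unfolding Union_Axiom_def BigUnion_def using N_union by (simp add: S_simps)
    moreover have "S N d 0 d Power_Set_Axiom" unfolding Power_Set_Axiom_def PowerSet_def Subset_def using N_power by (simp add: S_simps)
    moreover have "S N d 0 d Infinity" unfolding Infinity_def Inductive_def Succ_def Nonempty_def using N_infinity by (simp add: S_simps)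
    ultimately have "S N d 0 d F" using 1(2) by auto
    then show ?thesis using 1(1) S_sentence by metis
  next
    case 2
    have "\<exists>b. \<forall>x. N x b \<longleftrightarrow> N x a & sat N (%i. (x # a # ps) ! i) \<phi>" for a ps
    proof -
      have "(%i. (x # a # ps) ! i) = case_nat x (%i. (a # ps) ! i)" for x by (auto split: nat.split)
      then show ?thesis using N_separation[of a "%i. (a # ps) ! i" \<phi>] by simp
    qed
    then have "S N d 0 d (Separation k \<phi>)" unfolding S_Separation[OF 2(2)] by blast
    then show ?thesis using 2(1) S_sentence by metis
  next
    case 3
    have "\<exists>b. \<forall>y. N y b \<longleftrightarrow> (\<exists>x. N x a & sat N (%i. (x # y # a # ps) ! i) \<phi>)"
      if fn1: "\<forall>x. N x a --> (\<forall>y z. sat N (%i. (x # y # a # ps) ! i) \<phi> & sat N (%i. (x # z # a # ps) ! i) \<phi> --> y = z)" for a ps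
    proof -
      have "(%i. (x # y # a # ps) ! i) = case_nat x (case_nat y (%i. (a # ps) ! i))" for x y by (auto split: nat.split)
      then show ?thesis using N_replacement[of a "%i. (a # ps) ! i" \<phi>] fn1 by simp
    qed
    then have "S N d 0 d (Replacement k \<phi>)" unfolding S_Replacement[OF 3(2)] by blast
    then show ?thesis using 3(1) S_sentence by metis
  qed
qed

lemma zf_N: "zf N" by (rule zf_of_model[of _ undefined]) (rule sat_ZF)

end

section \<open>Filters and the ground model\<close>

context zf
begin

definition Dif where "Dif x y = Sep x (%z. \<not> z \<E> y)"
definition Cap where "Cap x y = Sep x (%z. z \<E> y)"
definition pfilter where "pfilter F s \<longleftrightarrow> (\<forall>x. x \<E> F --> x \<sqsubseteq> s) & s \<E> F & \<not> zero \<E> F &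
  (\<forall>x y. x \<E> F --> y \<E> F --> Cap x y \<E> F) & (\<forall>x y. x \<E> F --> x \<sqsubseteq> y --> y \<sqsubseteq> s --> y \<E> F)"
definition ultra where "ultra U s \<longleftrightarrow> pfilter U s & (\<forall>x. x \<sqsubseteq> s --> x \<E> U \<or> Dif s x \<E> U)"
definition complete where "complete k F \<longleftrightarrow> (\<forall>A. A \<sqsubseteq> F --> A \<noteq> zero --> (\<exists>a. a \<E> k & a \<approx> A) -->
  Sep (BU A) (%z. \<forall>x. x \<E> A --> z \<E> x) \<E> F)"
definition uniform where "uniform U k \<longleftrightarrow> ultra U k & (\<forall>x. x \<E> U --> x \<approx> k)"

lemma DF_Dif [D_intros, simp]: "DF f ==> DF g ==> DF (%e. Dif (f e) (g e))"
  by (rule DF_app2[where c=Dif]) (unfold Dif_def, intro D_intros)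
lemma DF_Cap [D_intros, simp]: "DF f ==> DF g ==> DF (%e. Cap (f e) (g e))"
  by (rule DF_app2[where c=Cap]) (unfold Cap_def, intro D_intros)
lemma Dif_iff [simp]: "z \<E> Dif x y \<longleftrightarrow> z \<E> x & \<not> z \<E> y" by (simp add: Dif_def)
lemma Cap_iff [simp]: "z \<E> Cap x y \<longleftrightarrow> z \<E> x & z \<E> y" by (simp add: Cap_def)

lemma pfilterD:
  assumes "pfilter F s" shows "x \<E> F ==> x \<sqsubseteq> s" "s \<E> F" "\<not> zero \<E> F" "x \<E> F ==> y \<E> F ==> Cap x y \<E> F"
    "x \<E> F ==> x \<sqsubseteq> y ==> y \<sqsubseteq> s ==> y \<E> F"
  using assms unfolding pfilter_def by blast+

lemma pfilter_disjoint: "pfilter F s ==> x \<E> F ==> y \<E> F ==> \<exists>z. z \<E> x & z \<E> y"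
  using pfilterD(3)[of F s] pfilterD(4)[of F s x y] eq_zero[of "Cap x y"] by auto

end

locale ground = zfc E for E :: "'a => 'a => bool" (infix "\<E>" 50) +
  fixes kap :: 'a
  assumes gch: "InfCard k ==> \<exists>m. InfCard m & k \<E> m & (\<forall>n. InfCard n --> k \<E> n --> m \<sqsubseteq> n) & Pw k \<approx> m"
    and kap: "InfCard kap" "omega \<E> kap"
    and compact: "pfilter F s ==> complete kap F ==> \<exists>U. F \<sqsubseteq> U & ultra U s & complete kap U"
begin

lemma Okap [simp]: "Ord kap" using kap InfCard_Ord by blast

lemma gch_succ: assumes k: "InfCard k"
  shows "\<exists>m. InfCard m & k \<E> m & (\<forall>n. InfCard n --> k \<E> n --> m \<sqsubseteq> n) & Pw k \<approx> m & (\<forall>x. x \<E> m --> x \<lesssim> k)"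
proof -
  obtain m where m: "InfCard m" "k \<E> m" "!!n. InfCard n ==> k \<E> n ==> m \<sqsubseteq> n" "Pw k \<approx> m"
    using gch[OF k] by blast
  have "x \<lesssim> k" if x: "x \<E> m" for x
  proof -
    have Ox: "Ord x" using Ord_mem[OF InfCard_Ord[OF m(1)] x] .
    obtain c where c: "Card c" "c \<sqsubseteq> x" "c \<approx> x" using ex_Card[OF Ox] by blast
    have "\<not> k \<E> c"
    proof
      assume kc: "k \<E> c"
      then have "k \<sqsubseteq> c" using Ord_memsub[OF Card_Ord[OF c(1)]] by blast
      then have "InfCard c" unfolding InfCard_def using c(1) InfCard_omega_sub[OF k] sub_trans by blast
      then have "x \<E> c" using m(3)[of c] kc subD x by blast
      then show False using c(2) subD mem_irrefl by blast
    qed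
    then have "c \<lesssim> k" using Ord_not_mem[OF InfCard_Ord[OF k] Card_Ord[OF c(1)]] le_sub by blast
    then show ?thesis using eqv_le[OF eqv_sym[OF c(3)]] le_trans by blast
  qed
  then show ?thesis using m by blast
qed

text \<open>The aleph function: the least infinite cardinal above all earlier values. The clause
  covers zero, successors and limits alike.\<close>

definition al where "al = rec (%x f. the_el (%k. InfCard k & (\<forall>y. y \<E> x --> app f y \<E> k) &
  (\<forall>l. l \<E> k --> \<not> (InfCard l & (\<forall>y. y \<E> x --> app f y \<E> l)))))"
lemma DF_al [D_intros, simp]: "DF f ==> DF (%e. al (f e))" unfolding al_def by (rule DF_rec) simp_all

lemma al_eq: "al x = the_el (%k. InfCard k & (\<forall>y. y \<E> x --> al y \<E> k) &
  (\<forall>l. l \<E> k --> \<not> (InfCard l & (\<forall>y. y \<E> x --> al y \<E> l))))"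
proof -
  have "al x = (%x f. the_el (%k. InfCard k & (\<forall>y. y \<E> x --> app f y \<E> k) &
    (\<forall>l. l \<E> k --> \<not> (InfCard l & (\<forall>y. y \<E> x --> app f y \<E> l))))) x (lam x al)"
    unfolding al_def by (rule rec_eq) simp
  moreover have "(\<forall>y. y \<E> x --> app (lam x al) y \<E> k) \<longleftrightarrow> (\<forall>y. y \<E> x --> al y \<E> k)" for k by simp
  ultimately show ?thesis by (simp only:)
qed

lemma InfCard_sup: "(!!k. k \<E> x ==> InfCard k) ==> k \<E> x ==> InfCard (BU x)"
  using Card_sup[of x] InfCard_Card InfCard_omega_sub[of k] unfolding InfCard_def sub_def by auto

lemma al_spec: "InfCard (al x) & (\<forall>y. y \<E> x --> al y \<E> al x) &
  (\<forall>l. InfCard l --> (\<forall>y. y \<E> x --> al y \<E> l) --> al x \<sqsubseteq> l)"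
proof -
  have "InfCard (al x) & (\<forall>y. y \<E> x --> al y \<E> al x) & (\<forall>l. l \<E> al x --> \<not> (InfCard l & (\<forall>y. y \<E> x --> al y \<E> l)))"
  proof (rule mem_induct[of "%x. InfCard (al x) & (\<forall>y. y \<E> x --> al y \<E> al x) &
      (\<forall>l. l \<E> al x --> \<not> (InfCard l & (\<forall>y. y \<E> x --> al y \<E> l)))"])
    fix x assume IH: "!!y. y \<E> x ==> InfCard (al y) & (\<forall>z. z \<E> y --> al z \<E> al y) &
      (\<forall>l. l \<E> al y --> \<not> (InfCard l & (\<forall>z. z \<E> y --> al z \<E> l)))"
    let ?X = "Un2 (upair omega omega) (Rep x al)"
    have X: "k \<E> ?X ==> InfCard k" for k using IH Card_omega by auto
    have IX: "InfCard (BU ?X)" by (rule InfCard_sup[of _ omega]) (use X in auto)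
    obtain m where m: "InfCard m" "BU ?X \<E> m" using gch[OF IX] by blast
    have "al y \<E> m" if y: "y \<E> x" for y
    proof -
      have "al y \<sqsubseteq> BU ?X" using y by (auto simp: sub_def)
      then have "al y \<E> BU ?X \<or> al y = BU ?X" using Ord_sub_iff IH[OF y] IX InfCard_Ord by blast
      then show ?thesis using m Ord_trans[OF InfCard_Ord[OF m(1)] m(2)] by auto
    qed
    then obtain k where k: "Ord k" "InfCard k & (\<forall>y. y \<E> x --> al y \<E> k)"
      "\<forall>l. l \<E> k --> \<not> (InfCard l & (\<forall>y. y \<E> x --> al y \<E> l))"
      using Ord_least[of "%k. InfCard k & (\<forall>y. y \<E> x --> al y \<E> k)" m] m InfCard_Ord by auto
    have "al x = k"
      unfolding al_eq[of x]
    proof (rule the_el_eq)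
      fix k' assume k': "InfCard k' & (\<forall>y. y \<E> x --> al y \<E> k') &
        (\<forall>l. l \<E> k' --> \<not> (InfCard l & (\<forall>y. y \<E> x --> al y \<E> l)))"
      then show "k' = k" using Ord_linear[of k' k] k InfCard_Ord by blast
    qed (use k in blast)
    then show "InfCard (al x) & (\<forall>y. y \<E> x --> al y \<E> al x) &
      (\<forall>l. l \<E> al x --> \<not> (InfCard l & (\<forall>y. y \<E> x --> al y \<E> l)))" using k by blast
  qed simp
  then show ?thesis using Ord_not_mem InfCard_Ord by blast
qed

lemma al_Inf [simp]: "InfCard (al x)" and al_mono: "y \<E> x ==> al y \<E> al x"
  and al_least: "InfCard l ==> (!!y. y \<E> x ==> al y \<E> l) ==> al x \<sqsubseteq> l"
  using al_spec by blast+

lemma al_Ord [simp]: "Ord (al x)" using al_Inf InfCard_Ord by blast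

lemma al_zero: "al zero = omega"
  using al_least[OF Card_omega, of zero] InfCard_omega_sub[OF al_Inf, of zero] sub_antisym by auto

lemma al_succ: assumes "Ord a"
  shows "Pw (al a) \<approx> al (succ a)" "x \<E> al (succ a) ==> x \<lesssim> al a"
    "InfCard n ==> al a \<E> n ==> al (succ a) \<sqsubseteq> n"
proof -
  obtain m where m: "InfCard m" "al a \<E> m" "\<forall>n. InfCard n --> al a \<E> n --> m \<sqsubseteq> n" "Pw (al a) \<approx> m"
      "\<forall>x. x \<E> m --> x \<lesssim> al a"
    using gch_succ[OF al_Inf] by blast
  have "al (succ a) \<sqsubseteq> m"
    by (rule al_least[OF m(1)]) (use m(2) al_mono Ord_trans[OF InfCard_Ord[OF m(1)] m(2)] in auto)
  moreover have "m \<sqsubseteq> al (succ a)" using m(3) al_Inf al_mono[of a "succ a"] by simp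
  ultimately have "al (succ a) = m" by (rule sub_antisym)
  then show "Pw (al a) \<approx> al (succ a)" "x \<E> al (succ a) ==> x \<lesssim> al a"
    "InfCard n ==> al a \<E> n ==> al (succ a) \<sqsubseteq> n" using m by auto
qed

text \<open>This is \<open>\<aleph>\<^sub>\<omega>\<close>; \<open>lamp\<close> is its successor
  \<open>\<aleph>\<^sub>\<omega>\<^sub>+\<^sub>1\<close>, on which the collapsing maps are
  defined.\<close>

abbreviation "lamb \<equiv> al omega"
abbreviation "lamp \<equiv> al (succ omega)"

lemma lamb_iff: "x \<E> lamb \<longleftrightarrow> (\<exists>n. n \<E> omega & x \<E> al n)"
proof -
  let ?c = "BU (Rep omega al)"
  have c: "x \<E> ?c \<longleftrightarrow> (\<exists>n. n \<E> omega & x \<E> al n)" for x by (rule BU_Rep) simp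
  have "al zero \<E> Rep omega al" by (simp, use zero_omega in blast)
  then have "InfCard ?c" by (rule InfCard_sup[rotated]) auto
  moreover have "al n \<E> ?c" if "n \<E> omega" for n
    unfolding c using al_mono[of n "succ n"] succ_omega[OF that] by auto
  ultimately have "lamb \<sqsubseteq> ?c" by (rule al_least)
  moreover have "?c \<sqsubseteq> lamb" unfolding sub_def c using al_mono Ord_trans[OF al_Ord] by blast
  ultimately show ?thesis using c sub_antisym by metis
qed

lemma InfCard_below_lamb: assumes "InfCard l" "l \<E> lamb" shows "\<exists>n. n \<E> omega & l = al n"
proof -
  have Ol: "Ord l" using assms InfCard_Ord by blast
  obtain k where "k \<E> omega" "l \<E> al k" using assms lamb_iff by blast
  then obtain n where n: "Ord n" "n \<E> omega & l \<E> al n" "\<forall>c. c \<E> n --> \<not> (c \<E> omega & l \<E> al c)"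
    using Ord_least[of "%n. n \<E> omega & l \<E> al n" k] omega_Ord_mem by auto
  have "n \<noteq> zero"
    using n(2) al_zero InfCard_omega_sub[OF assms(1)] subD[of omega l l] by auto
  then obtain m where m: "m \<E> omega" "n = succ m" using omega_cases n(2) by blast
  then have "\<not> l \<E> al m" using n(3) by auto
  moreover have "\<not> al m \<E> l"
    using al_succ(3)[OF omega_Ord_mem[OF m(1)] assms(1)] n(2) m(2) subD[of _ l l] by auto
  ultimately have "l = al m" using Ord_linear[OF Ol al_Ord] by blast
  then show ?thesis using m by blast
qed

subsection \<open>Measures from strong compactness\<close>

lemma complete_family:
  assumes c: "complete kap U" and p: "pfilter U a" and t: "t \<E> kap" and B: "DF (%e. B (e 0))"
    and BU: "!!x. x \<E> t ==> B x \<E> U"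
  shows "Sep a (%z. \<forall>x. x \<E> t --> z \<E> B x) \<E> U"
proof -
  note [simp] = DF_app1[OF B]
  have Ot: "Ord t" using Ord_mem[OF Okap t] .
  show ?thesis
  proof (cases "t = zero")
    case True
    then have "Sep a (%z. \<forall>x. x \<E> t --> z \<E> B x) = a" by (intro extensional) simp
    then show ?thesis using pfilterD(2)[OF p] by simp
  next
    case False
    then obtain y where y: "y \<E> t" using eq_zero by blast
    let ?A = "Rep t B"
    obtain k where k: "Card k" "k \<sqsubseteq> t" "?A \<approx> k" using le_Ord_Card[OF Ot Rep_le[OF B Ot]] by blast
    have "k \<E> kap" using Ord_sub_iff[OF Card_Ord[OF k(1)] Ot] k(2) t Ord_trans[OF Okap t] by blast
    moreover have "?A \<sqsubseteq> U" using BU by (auto simp: sub_def)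
    moreover have "?A \<noteq> zero" using y by (auto simp: eq_zero)
    ultimately have "Sep (BU ?A) (%z. \<forall>x. x \<E> ?A --> z \<E> x) \<E> U"
      using c eqv_sym[OF k(3)] unfolding complete_def by blast
    moreover have "Sep (BU ?A) (%z. \<forall>x. x \<E> ?A --> z \<E> x) = Sep a (%z. \<forall>x. x \<E> t --> z \<E> B x)"
      by (rule extensional) (use y pfilterD(1)[OF p BU[OF y]] in \<open>auto simp: sub_def\<close>)
    ultimately show ?thesis by simp
  qed
qed

text \<open>The sets whose complement has size at most \<open>b\<close> form a proper filter over
  \<open>a\<close>. It is \<open>kap\<close>-complete since fewer than \<open>kap\<close> sets
  number at most \<open>b\<close>. Strong compactness extends it to an ultrafilter, which then
  contains no set of size at most \<open>b\<close>.\<close>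

lemma ex_measure:
  assumes b: "InfCard b" and a: "InfCard a" "b \<E> a" and kb: "!!x. x \<E> kap ==> x \<lesssim> b"
  shows "\<exists>U. ultra U a & complete kap U & (\<forall>x. x \<sqsubseteq> a --> x \<lesssim> b --> \<not> x \<E> U)"
proof -
  define F where "F = Sep (Pw a) (%x. Dif a x \<lesssim> b)"
  have F: "x \<E> F \<longleftrightarrow> x \<sqsubseteq> a & Dif a x \<lesssim> b" for x unfolding F_def by simp
  have ab: "\<not> a \<lesssim> b" using Card_mem_le[OF InfCard_Card[OF a(1)] a(2)] by blast
  have pf: "pfilter F a"
    unfolding pfilter_def
  proof (intro conjI allI impI)
    have "Dif a a = zero" by (simp add: eq_zero)
    then show "a \<E> F" unfolding F using le_sub[of zero b] by (simp add: sub_def)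
    have "Dif a zero = a" by (rule extensional) simp
    then show "\<not> zero \<E> F" unfolding F using ab by simp
    fix x y assume x: "x \<E> F"
    show "x \<sqsubseteq> a" using x F by blast
    { assume y: "y \<E> F"
      have "Dif a (Cap x y) = Un2 (Dif a x) (Dif a y)" by (rule extensional) auto
      then show "Cap x y \<E> F" using x y Un2_le[OF b] unfolding F by (auto simp: sub_def) }
    assume y: "x \<sqsubseteq> y" "y \<sqsubseteq> a"
    have "Dif a y \<sqsubseteq> Dif a x" using y by (auto simp: sub_def)
    then show "y \<E> F" using x y le_sub le_trans unfolding F by blast
  qed
  have "complete kap F"
    unfolding complete_def
  proof (intro allI impI)
    fix A assume A: "A \<sqsubseteq> F" "A \<noteq> zero" and "\<exists>c. c \<E> kap & c \<approx> A"
    then have Ab: "A \<lesssim> b" using kb eqv_le[OF eqv_sym] le_trans by blast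
    obtain x0 where x0: "x0 \<E> A" using A(2) eq_zero by blast
    let ?I = "Sep (BU A) (%z. \<forall>x. x \<E> A --> z \<E> x)"
    have Aa: "x \<E> A ==> x \<sqsubseteq> a & Dif a x \<lesssim> b" for x using A(1) F subD by blast
    have Ia: "?I \<sqsubseteq> a" using Aa by (auto simp: sub_def)
    have "Dif a ?I \<sqsubseteq> BU (Rep A (Dif a))"
    proof (rule subI)
      fix z assume "z \<E> Dif a ?I"
      then have "z \<E> a" "\<not> z \<E> ?I" by simp_all
      then have "\<exists>x. x \<E> A & z \<E> Dif a x" using x0 by auto
      then show "z \<E> BU (Rep A (Dif a))" by (subst BU_Rep) simp_all
    qed
    moreover have "BU (Rep A (Dif a)) \<lesssim> b" by (rule union_le[OF b Ab]) (use Aa in auto)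
    ultimately have "Dif a ?I \<lesssim> b" using le_sub le_trans by blast
    then show "?I \<E> F" unfolding F using Ia by blast
  qed
  from compact[OF pf this] obtain U where U: "F \<sqsubseteq> U" "ultra U a" "complete kap U" by blast
  have "\<not> x \<E> U" if x: "x \<sqsubseteq> a" "x \<lesssim> b" for x
  proof
    assume xU: "x \<E> U"
    have "Dif a (Dif a x) = x" by (rule extensional) (use x(1) in \<open>auto simp: sub_def\<close>)
    then have "Dif a x \<E> F" unfolding F using x by (auto simp: sub_def)
    then have "Dif a x \<E> U" using U(1) subD by blast
    then show False using pfilter_disjoint[of U a x "Dif a x"] U(2) xU unfolding ultra_def by auto
  qed
  then show ?thesis using U by blast
qed

text \<open>Regard the points of \<open>a\<close> as subsets of \<open>b\<close> and let the
  ultrafilter decide each of the \<open>b\<close> coordinates. The intersection of the chosen sides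
  has at most one point, yet belongs to the ultrafilter by the assumed closure.\<close>

lemma no_measure:
  assumes b: "InfCard b" and e: "a \<lesssim> Pw b" and U: "ultra U a" "!!x. x \<sqsubseteq> a ==> x \<lesssim> b ==> \<not> x \<E> U"
    and cl: "!!B. DF (%e. B (e 0)) ==> (!!x. x \<E> b ==> B x \<E> U) ==> Sep a (%z. \<forall>x. x \<E> b --> z \<E> B x) \<E> U"
  shows False
proof -
  obtain f where f: "!!x. x \<E> a ==> app f x \<sqsubseteq> b" "!!x y. x \<E> a ==> y \<E> a ==> app f x = app f y ==> x = y"
    using leD[OF e] by auto
  define B where "B = (%x. if Sep a (%z. x \<E> app f z) \<E> U then Sep a (%z. x \<E> app f z) else Dif a (Sep a (%z. x \<E> app f z)))"
  have DB: "DF (%e. B (e 0))" unfolding B_def by simp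
  have "B x \<E> U" for x
  proof -
    have "Sep a (%z. x \<E> app f z) \<sqsubseteq> a" by (simp add: sub_def)
    then have "Sep a (%z. x \<E> app f z) \<E> U \<or> Dif a (Sep a (%z. x \<E> app f z)) \<E> U" using U(1) ultra_def by blast
    then show ?thesis unfolding B_def by auto
  qed
  then have I: "Sep a (%z. \<forall>x. x \<E> b --> z \<E> B x) \<E> U" (is "?I \<E> U") using cl[OF DB] by blast
  have I_iff: "z \<E> ?I \<longleftrightarrow> z \<E> a & (\<forall>x. x \<E> b --> z \<E> B x)" for z using DF_app1[OF DB] by simp
  have "z = w" if z: "z \<E> ?I" "w \<E> ?I" for z w
  proof (rule f(2))
    have "x \<E> app f z \<longleftrightarrow> x \<E> app f w" if "x \<E> b" for x
      using z that unfolding I_iff B_def by (auto split: if_splits)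
    then show "app f z = app f w" using f(1) z unfolding I_iff by (intro extensional) (metis subD)
  qed (use z I_iff in blast)+
  then have "?I \<lesssim> b" by (intro leI[of "%_. zero"]) (use subD[OF InfCard_omega_sub[OF b] zero_omega] in auto)
  moreover have "?I \<sqsubseteq> a" unfolding sub_def I_iff by blast
  ultimately show False using U(2) I by blast
qed

text \<open>Otherwise \<open>ex_measure\<close> gives a \<open>kap\<close>-complete ultrafilter over
  \<open>kap\<close> without sets of size at most \<open>b\<close>, while \<open>kap\<close> embeds
  into \<open>Pw b\<close> by GCH, so that \<open>no_measure\<close> applies. Thus
  \<open>kap\<close> is a limit cardinal, and by GCH a strong limit.\<close>

lemma kap_not_succ: assumes "InfCard b" "b \<E> kap" shows "\<exists>x. x \<E> kap & \<not> x \<lesssim> b"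
proof (rule ccontr)
  assume *: "\<not> ?thesis"
  then obtain U where U: "ultra U kap" "complete kap U" "\<forall>x. x \<sqsubseteq> kap --> x \<lesssim> b --> \<not> x \<E> U"
    using ex_measure[OF assms(1) kap(1) assms(2)] by blast
  obtain m where m: "b \<E> m" "\<forall>n. InfCard n --> b \<E> n --> m \<sqsubseteq> n" "Pw b \<approx> m" "InfCard m" using gch[OF assms(1)] by blast
  have "\<not> m \<E> kap" using * Card_mem_le[OF InfCard_Card[OF m(4)] m(1)] by blast
  then have "kap \<lesssim> m" using Ord_not_mem[OF InfCard_Ord[OF m(4)] Okap] le_sub by blast
  then have "kap \<lesssim> Pw b" using eqv_le[OF eqv_sym[OF m(3)]] le_trans by blast
  then show False
    by (rule no_measure[OF assms(1) _ U(1)])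
      (use U complete_family[OF U(2) _ assms(2)] in \<open>auto simp: ultra_def\<close>)
qed

text \<open>If \<open>kap\<close> were a countable limit, an intersection of \<open>kap\<close> sets
  would be a countable intersection of intersections of fewer than \<open>kap\<close> sets. A
  measure over the successor of \<open>kap\<close> would then be closed under \<open>kap\<close>
  intersections, contrary to \<open>no_measure\<close>.\<close>

lemma kap_not_cof_omega:
  assumes f: "DF (%e. f (e 0))" "!!n. n \<E> omega ==> f n \<E> kap" shows "\<exists>x. x \<E> kap & (\<forall>n. n \<E> omega --> \<not> x \<E> f n)"
proof (rule ccontr)
  assume *: "\<not> ?thesis"
  note [simp] = DF_app1[OF f(1)]
  obtain a where a: "InfCard a" "kap \<E> a" "Pw kap \<approx> a" using gch[OF kap(1)] by blast
  obtain U where U: "ultra U a" "complete kap U" "\<forall>x. x \<sqsubseteq> a --> x \<lesssim> kap --> \<not> x \<E> U"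
    using ex_measure[OF kap(1) a(1,2)] Ord_memsub[OF Okap] le_sub by blast
  have p: "pfilter U a" using U(1) ultra_def by blast
  show False
  proof (rule no_measure[OF kap(1) eqv_le[OF eqv_sym[OF a(3)]] U(1)])
    fix B assume B: "DF (%e. B (e 0))" "!!x. x \<E> kap ==> B x \<E> U"
    note [simp] = DF_app1[OF B(1)]
    let ?C = "%n. Sep a (%z. \<forall>x. x \<E> f n --> z \<E> B x)"
    have "?C n \<E> U" if n: "n \<E> omega" for n
      by (rule complete_family[OF U(2) p f(2)[OF n] B(1)]) (use B(2) Ord_trans[OF Okap f(2)[OF n]] in blast)
    then have "Sep a (%z. \<forall>n. n \<E> omega --> z \<E> ?C n) \<E> U" by (intro complete_family[OF U(2) p kap(2)]) simp_all
    moreover have "Sep a (%z. \<forall>n. n \<E> omega --> z \<E> ?C n) = Sep a (%z. \<forall>x. x \<E> kap --> z \<E> B x)"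
    proof (rule extensional)
      fix z
      have "(\<forall>n. n \<E> omega --> (\<forall>x. x \<E> f n --> z \<E> B x)) \<longleftrightarrow> (\<forall>x. x \<E> kap --> z \<E> B x)"
        using * Ord_trans[OF Okap f(2)] by blast
      then show "z \<E> Sep a (%z. \<forall>n. n \<E> omega --> z \<E> ?C n) \<longleftrightarrow> z \<E> Sep a (%z. \<forall>x. x \<E> kap --> z \<E> B x)"
        by auto
    qed
    ultimately show "Sep a (%z. \<forall>x. x \<E> kap --> z \<E> B x) \<E> U" by simp
  qed (use U(3) in blast)
qed

text \<open>Size below \<open>kap\<close>. The bound is an infinite cardinal, so that finite sets
  need no separate treatment in the closure under unions, products and power sets.\<close>

definition sm where "sm x \<longleftrightarrow> (\<exists>k. InfCard k & k \<E> kap & x \<lesssim> k)"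

lemma sm_le: "sm y ==> x \<lesssim> y ==> sm x" unfolding sm_def using le_trans by blast

lemma InfCard_next: assumes "InfCard k" "k \<E> kap" shows "\<exists>m. InfCard m & m \<E> kap & k \<E> m & Pw k \<approx> m & (\<forall>n. InfCard n --> k \<E> n --> m \<sqsubseteq> n)"
proof -
  obtain m where m: "InfCard m" "k \<E> m" "\<forall>n. InfCard n --> k \<E> n --> m \<sqsubseteq> n" "Pw k \<approx> m" using gch[OF assms(1)] by blast
  obtain x where x: "x \<E> kap" "\<not> x \<lesssim> k" using kap_not_succ[OF assms] by blast
  have Ox: "Ord x" using Ord_mem[OF Okap x(1)] .
  obtain c where c: "Card c" "c \<sqsubseteq> x" "c \<approx> x" using ex_Card[OF Ox] by blast
  have Oc: "Ord c" using c Card_Ord by blast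
  have kc: "k \<E> c" using Ord_not_mem[OF InfCard_Ord[OF assms(1)] Oc] x(2) le_sub[of c k] eqv_le[OF eqv_sym[OF c(3)]] le_trans by blast
  then have "InfCard c" unfolding InfCard_def using c(1) InfCard_omega_sub[OF assms(1)] Ord_memsub[OF Oc] sub_trans by blast
  then have "m \<sqsubseteq> x" using m(3) kc c(2) sub_trans by blast
  then have "m \<E> kap" using Ord_sub_iff[OF InfCard_Ord[OF m(1)] Ox] Ord_trans[OF Okap x(1)] x(1) by blast
  then show ?thesis using m by blast
qed

lemma sm_Pw: "sm x ==> sm (Pw x)"
  unfolding sm_def using InfCard_next Pw_le eqv_le le_trans by meson

lemma sm_common: "sm x ==> sm y ==> \<exists>k. InfCard k & k \<E> kap & x \<lesssim> k & y \<lesssim> k"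
proof -
  assume "sm x" "sm y"
  then obtain k l where *: "InfCard k" "k \<E> kap" "x \<lesssim> k" "InfCard l" "l \<E> kap" "y \<lesssim> l" unfolding sm_def by blast
  then have "k \<lesssim> l \<or> l \<lesssim> k" using Ord_linear[of k l] InfCard_Ord Ord_memsub le_sub le_refl by metis
  then show ?thesis using * le_trans by blast
qed

lemma sm_Un2: "sm x ==> sm y ==> sm (Un2 x y)" using sm_common Un2_le unfolding sm_def by meson
lemma sm_prod: "sm x ==> sm y ==> sm (prod x y)"
  using sm_common[of x y] prod_le InfCard_square le_trans unfolding sm_def by meson

lemma sm_mem: assumes "x \<E> kap" shows "sm x"
proof -
  have Ox: "Ord x" using Ord_mem[OF Okap assms] .
  obtain c where c: "Card c" "c \<sqsubseteq> x" "c \<approx> x" using ex_Card[OF Ox] by blast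
  have Oc: "Ord c" using c Card_Ord by blast
  show ?thesis
  proof (cases "c \<E> omega")
    case True
    then have "x \<lesssim> omega" using eqv_le[OF eqv_sym[OF c(3)]] le_sub[OF omega_trans] le_trans by blast
    then show ?thesis unfolding sm_def using Card_omega kap(2) by blast
  next
    case False
    then have "InfCard c" unfolding InfCard_def using c(1) Ord_not_mem[OF Oc Ord_omega] by blast
    moreover have "c \<E> kap" using c(2) Ord_sub_iff[OF Oc Ox] assms Ord_trans[OF Okap assms] by blast
    ultimately show ?thesis unfolding sm_def using eqv_le[OF eqv_sym[OF c(3)]] by blast
  qed
qed

text \<open>An infinite cardinal up to \<open>lamb\<close> is \<open>omega\<close>, a successor
  cardinal or \<open>lamb\<close> itself. The first is smaller than \<open>kap\<close>, the second
  is no limit and the third has countable cofinality.\<close>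

lemma lamb_kap: "lamb \<E> kap"
proof (rule ccontr)
  assume "\<not> lamb \<E> kap"
  then have "kap \<E> lamb \<or> kap = lamb" using Ord_linear[OF al_Ord Okap] by blast
  then show False
  proof
    assume "kap \<E> lamb"
    then obtain n where n: "n \<E> omega" "kap = al n" using InfCard_below_lamb kap(1) by blast
    have "n \<noteq> zero" using n(2) al_zero kap(2) by auto
    then obtain m where m: "m \<E> omega" "n = succ m" using omega_cases n(1) by blast
    have "al m \<E> kap" unfolding n(2) by (rule al_mono) (simp add: m)
    from kap_not_succ[OF al_Inf this] show False unfolding n(2) m(2) using al_succ(2)[OF omega_Ord_mem[OF m(1)]] by blast
  next
    assume k: "kap = lamb"
    then have "!!n. n \<E> omega ==> al n \<E> kap" using al_mono by simp
    from kap_not_cof_omega[of al, OF _ this] show False unfolding k using lamb_iff by auto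
  qed
qed

lemma lamp_kap: "lamp \<E> kap"
proof -
  obtain m where m: "InfCard m" "m \<E> kap" "lamb \<E> m" using InfCard_next[OF al_Inf lamb_kap] by blast
  then have "lamp \<sqsubseteq> m" using al_succ(3)[OF Ord_omega] by blast
  then show ?thesis using Ord_sub_iff[OF al_Ord InfCard_Ord[OF m(1)]] m(2) Ord_trans[OF Okap m(2)] by blast
qed

end

section \<open>The forcing conditions\<close>

context zf
begin

definition sd where "sd x y = Un2 (Dif x y) (Dif y x)"
lemma DF_sd [D_intros, simp]: "DF f ==> DF g ==> DF (%e. sd (f e) (g e))"
  by (rule DF_app2[where c=sd]) (unfold sd_def, intro D_intros)
lemma sd_iff [simp]: "z \<E> sd x y \<longleftrightarrow> \<not> (z \<E> x \<longleftrightarrow> z \<E> y)" unfolding sd_def by auto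
lemma sd_zero [simp]: "sd x zero = x" "sd zero x = x" "sd x x = zero" by (rule extensional; simp)+
lemma sd_sd [simp]: "sd x (sd x y) = y" and sd_assoc: "sd (sd x y) z = sd x (sd y z)"
  and sd_comm: "sd x y = sd y x" by (rule extensional; auto)+
lemma sd_sub: "x \<sqsubseteq> a ==> y \<sqsubseteq> a ==> sd x y \<sqsubseteq> a" by (auto simp: sub_def)

end

context zfc
begin

lemma isfn_app: "isfn p ==> pair i u \<E> p ==> app p i = u"
  unfolding app_def by (rule the_el_eq) (auto simp: isfn_def)
lemma isfn_sub: "isfn p ==> q \<sqsubseteq> p ==> isfn q" unfolding isfn_def sub_def by blast

end

context ground
begin

text \<open>Coordinates are \<open>(l, x)\<close> of level \<open>l < \<omega>\<close> and \<open>(\<omega>, (\<gamma>, x))\<close> of level \<open>\<omega>\<close>. A support \<open>(n, c)\<close> stands for the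
  levels below \<open>n\<close> and the coordinates \<open>(\<omega>, (\<gamma>, x))\<close> with \<open>\<gamma> < c\<close>.\<close>

definition coords where "coords = Un2 (prod omega lamb) (prod (upair omega omega) (prod kap lamp))"
text \<open>A condition assigns to \<open>i\<close> a subset of \<open>vl i\<close>, so symmetric
  difference acts on the values. Below level \<open>omega\<close> these are the two subsets of
  \<open>succ zero\<close>. A collapse coordinate for \<gamma> takes arbitrary subsets of \<gamma>;
  the singletons among them encode the values of the collapsing map.\<close>

definition vl where "vl i = (if fs i = omega then fs (sn i) else succ zero)"
definition Sig where "Sig = BU (Rep coords (%i. prod (upair i i) (Pw (vl i))))"
definition lev where "lev p l = Sep p (%z. fs (fs z) = l)"
definition PP where "PP = Sep (Pw Sig) (%p. isfn p & (\<forall>l. l \<E> succ omega --> lev p l \<lesssim> al l))"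
definition Gs where "Gs = Sep (Pw Sig) (%g. fn g coords)"
definition ml where "ml g h = lam coords (%i. sd (app g i) (app h i))"
definition idg where "idg = lam coords (%_. zero)"
definition ac where "ac g p = Rep p (%z. pair (fs z) (sd (sn z) (app g (fs z))))"
definition inS where "inS s i \<longleftrightarrow> fs i \<E> fs s \<or> fs i = omega & fs (sn i) \<E> sn s"
definition fx where "fx s g \<longleftrightarrow> (\<forall>i. i \<E> coords --> inS s i --> app g i = zero)"
definition rs where "rs s p = Sep p (%z. inS s (fs z))"

lemma DF_vl [D_intros, simp]: "DF f ==> DF (%e. vl (f e))"
  by (rule DF_app1[where c=vl]) (unfold vl_def, intro D_intros DF_If)
lemma DF_lev [D_intros, simp]: "DF f ==> DF g ==> DF (%e. lev (f e) (g e))"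
  by (rule DF_app2[where c=lev]) (unfold lev_def, intro D_intros)
lemma DF_ml [D_intros, simp]: "DF f ==> DF g ==> DF (%e. ml (f e) (g e))"
  by (rule DF_app2[where c=ml]) (unfold ml_def, intro D_intros)
lemma DF_ac [D_intros, simp]: "DF f ==> DF g ==> DF (%e. ac (f e) (g e))"
  by (rule DF_app2[where c=ac]) (unfold ac_def, intro D_intros)
lemma D_inS [D_intros, simp]: "DF f ==> DF g ==> D (%e. inS (f e) (g e))"
  by (rule D_app2[where R=inS]) (unfold inS_def, intro D_intros)
lemma D_fx [D_intros, simp]: "DF f ==> DF g ==> D (%e. fx (f e) (g e))"
  by (rule D_app2[where R=fx]) (unfold fx_def, intro D_intros)
lemma DF_rs [D_intros, simp]: "DF f ==> DF g ==> DF (%e. rs (f e) (g e))"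
  by (rule DF_app2[where c=rs]) (unfold rs_def, intro D_intros)

lemma coords_iff: "i \<E> coords \<longleftrightarrow> (\<exists>l x. l \<E> omega & x \<E> lamb & i = pair l x) \<or>
    (\<exists>c x. c \<E> kap & x \<E> lamp & i = pair omega (pair c x))"
  unfolding coords_def by (auto simp: prod_iff)
lemma Sig_iff: "z \<E> Sig \<longleftrightarrow> (\<exists>i u. i \<E> coords & u \<sqsubseteq> vl i & z = pair i u)"
  unfolding Sig_def by (subst BU_Rep) (auto simp: prod_iff)
lemma pair_Sig [simp]: "pair i u \<E> Sig \<longleftrightarrow> i \<E> coords & u \<sqsubseteq> vl i" by (auto simp: Sig_iff)
lemma lev_iff [simp]: "z \<E> lev p l \<longleftrightarrow> z \<E> p & fs (fs z) = l" by (simp add: lev_def)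
lemma rs_iff [simp]: "z \<E> rs s p \<longleftrightarrow> z \<E> p & inS s (fs z)" by (simp add: rs_def)
lemma rs_sub [simp]: "rs s p \<sqsubseteq> p" and rs_rs [simp]: "rs s (rs s p) = rs s p"
  and rs_mono: "p \<sqsubseteq> q ==> rs s p \<sqsubseteq> rs s q"
  by (auto simp: sub_def intro: extensional)
lemma PP_iff: "p \<E> PP \<longleftrightarrow> p \<sqsubseteq> Sig & isfn p & (\<forall>l. l \<E> succ omega --> lev p l \<lesssim> al l)"
  unfolding PP_def by simp
lemma PP_pair: "p \<E> PP ==> z \<E> p ==> z = pair (fs z) (sn z) & fs z \<E> coords & sn z \<sqsubseteq> vl (fs z)"
  unfolding PP_iff sub_def Sig_iff by force
lemma PP_isfn: "p \<E> PP ==> isfn p" unfolding PP_iff by blast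

lemma PP_sub: assumes "p \<E> PP" "q \<sqsubseteq> p" shows "q \<E> PP"
proof -
  have "lev q l \<sqsubseteq> lev p l" for l using assms(2) by (simp add: sub_def)
  then have "lev q l \<lesssim> lev p l" for l using le_sub by blast
  then show ?thesis using assms isfn_sub sub_trans le_trans unfolding PP_iff by blast
qed
lemma rs_PP [simp]: "p \<E> PP ==> rs s p \<E> PP" using PP_sub rs_sub by blast

lemma PP_Un2: assumes "p \<E> PP" "q \<E> PP" "isfn (Un2 p q)" shows "Un2 p q \<E> PP"
proof -
  have "lev (Un2 p q) l = Un2 (lev p l) (lev q l)" for l by (rule extensional) auto
  moreover have "lev p l \<lesssim> al l" "lev q l \<lesssim> al l" if "l \<E> succ omega" for l using assms(1,2) that unfolding PP_iff by blast+
  ultimately have "lev (Un2 p q) l \<lesssim> al l" if "l \<E> succ omega" for l using Un2_le[OF al_Inf] that by simp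
  moreover have "Un2 p q \<sqsubseteq> Sig" using assms(1,2) unfolding PP_iff sub_def by auto
  ultimately show ?thesis unfolding PP_iff using assms(3) by blast
qed

lemma PP_zero [simp]: "zero \<E> PP"
proof -
  have "lev zero l = zero" for l by (simp add: eq_zero)
  then show ?thesis unfolding PP_iff isfn_def using le_sub[of zero] by (simp add: sub_def)
qed

lemma PP_single:
  assumes "i \<E> coords" "u \<sqsubseteq> vl i" shows "upair (pair i u) (pair i u) \<E> PP" (is "?p \<E> _")
proof -
  have "lev ?p l \<lesssim> al l" for l
  proof -
    have "lev ?p l \<lesssim> omega" by (rule leI[of "%_. zero"]) auto
    then show ?thesis using le_sub[OF InfCard_omega_sub[OF al_Inf]] le_trans by blast
  qed
  then show ?thesis unfolding PP_iff isfn_def sub_def using assms by auto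
qed

section \<open>The group of flips and its action on conditions\<close>

lemma Gs_iff: "g \<E> Gs \<longleftrightarrow> fn g coords & (\<forall>i. i \<E> coords --> app g i \<sqsubseteq> vl i)"
proof
  assume "g \<E> Gs"
  then have g: "fn g coords" "g \<sqsubseteq> Sig" unfolding Gs_def by simp_all
  then show "fn g coords & (\<forall>i. i \<E> coords --> app g i \<sqsubseteq> vl i)" using fn_app[OF g(1)] subD[OF g(2)] pair_Sig by blast
next
  assume g: "fn g coords & (\<forall>i. i \<E> coords --> app g i \<sqsubseteq> vl i)"
  have "g \<sqsubseteq> Sig" by (rule subI) (use g fn_mem[of g coords] in auto)
  then show "g \<E> Gs" unfolding Gs_def using g by simp
qed
lemma Gs_lam: "DF (%e. F (e 0)) ==> (!!i. i \<E> coords ==> F i \<sqsubseteq> vl i) ==> lam coords F \<E> Gs"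
  unfolding Gs_iff by (simp add: fn_lam)
lemma Gs_ext: "g \<E> Gs ==> h \<E> Gs ==> (!!i. i \<E> coords ==> app g i = app h i) ==> g = h"
  unfolding Gs_iff using fn_ext by blast
lemma ml_Gs [simp]: "g \<E> Gs ==> h \<E> Gs ==> ml g h \<E> Gs"
  unfolding ml_def by (rule Gs_lam) (auto simp: Gs_iff intro!: sd_sub)
lemma idg_Gs [simp]: "idg \<E> Gs" unfolding idg_def by (rule Gs_lam) (auto simp: sub_def)
lemma app_ml [simp]: "i \<E> coords ==> app (ml g h) i = sd (app g i) (app h i)" by (simp add: ml_def)
lemma app_idg [simp]: "i \<E> coords ==> app idg i = zero" by (simp add: idg_def)

lemma ac_iff: assumes "p \<E> PP" shows "z \<E> ac g p \<longleftrightarrow> (\<exists>i u. pair i u \<E> p & i \<E> coords & z = pair i (sd u (app g i)))"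
proof -
  have "z \<E> ac g p \<longleftrightarrow> (\<exists>y. y \<E> p & z = pair (fs y) (sd (sn y) (app g (fs y))))" unfolding ac_def by simp
  also have "\<dots> \<longleftrightarrow> (\<exists>i u. pair i u \<E> p & i \<E> coords & z = pair i (sd u (app g i)))"
    using PP_pair[OF assms] fs_pair sn_pair by metis
  finally show ?thesis .
qed

lemma pair_ac: "p \<E> PP ==> pair i u \<E> ac g p \<longleftrightarrow> (\<exists>w. pair i w \<E> p & i \<E> coords & u = sd w (app g i))"
  unfolding ac_iff by auto

lemma ac_PP [simp]: assumes g: "g \<E> Gs" and p: "p \<E> PP" shows "ac g p \<E> PP"
proof -
  have "ac g p \<sqsubseteq> Sig" unfolding sub_def ac_iff[OF p] using PP_pair[OF p] g sd_sub unfolding Gs_iff by force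
  moreover have "isfn (ac g p)" using PP_isfn[OF p] unfolding isfn_def pair_ac[OF p] by blast
  moreover have "lev (ac g p) l \<lesssim> al l" if l: "l \<E> succ omega" for l
  proof -
    have "lev (ac g p) l = ac g (lev p l)" unfolding ac_def by (rule extensional) auto
    then have "lev (ac g p) l \<lesssim> lev p l" unfolding ac_def using Rep_le_any by simp
    then show ?thesis using p l le_trans unfolding PP_iff by blast
  qed
  ultimately show ?thesis unfolding PP_iff by blast
qed

lemma ac_ac: assumes "g \<E> Gs" "h \<E> Gs" "p \<E> PP" shows "ac g (ac h p) = ac (ml g h) p"
proof (rule extensional)
  fix z
  have e: "sd (sd u b) a = sd u (sd a b)" for u a b by (rule extensional) auto
  have "z \<E> ac g (ac h p) \<longleftrightarrow> (\<exists>i u. pair i u \<E> p & i \<E> coords & z = pair i (sd (sd u (app h i)) (app g i)))"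
    unfolding ac_iff[OF ac_PP[OF assms(2,3)]] pair_ac[OF assms(3)] by blast
  then show "z \<E> ac g (ac h p) \<longleftrightarrow> z \<E> ac (ml g h) p" unfolding ac_iff[OF assms(3)] e by auto
qed

lemma ac_fix: assumes "p \<E> PP" "!!i u. pair i u \<E> p ==> app g i = zero" shows "ac g p = p"
proof (rule extensional)
  fix z show "z \<E> ac g p \<longleftrightarrow> z \<E> p"
    unfolding ac_iff[OF assms(1)] using assms(2) PP_pair[OF assms(1)] by (metis sd_zero(1))
qed

lemma ac_rs: "p \<E> PP ==> rs s p = p ==> fx s g ==> ac g p = p"
  using ac_fix[of p g] rs_iff[of _ s p] PP_pair[of p] unfolding fx_def by (metis fs_pair)

definition Ss where "Ss = prod omega kap"

lemma Ss_iff: "s \<E> Ss \<longleftrightarrow> (\<exists>n c. n \<E> omega & c \<E> kap & s = pair n c)" unfolding Ss_def prod_iff ..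

lemma kap_zero [simp]: "zero \<E> kap" using Ord_trans[OF Okap kap(2) zero_omega] .

abbreviation "ext q p \<equiv> p \<sqsubseteq> q"

lemma forcing_PP: "forcing E PP Gs Ss zero idg ext fx ml ac"
proof (unfold_locales)
  show "D (%e. ext (e 0) (e 1))" "D (%e. fx (e 0) (e 1))" "DF (%e. ml (e 0) (e 1))" "DF (%e. ac (e 0) (e 1))" by simp_all
  show "ext p p" "zero \<E> PP" "p \<E> PP ==> ext p zero" "idg \<E> Gs" for p by (simp_all add: sub_def)
  show "ext p q ==> ext q r ==> ext p r" for p q r using sub_trans by blast
  show "g \<E> Gs ==> ml idg g = g" for g by (rule Gs_ext) simp_all
  show "g \<E> Gs ==> h \<E> Gs ==> ml g h \<E> Gs" for g h by simp
  show "g \<E> Gs ==> ml g g = idg" for g by (rule Gs_ext) simp_all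
  show "g \<E> Gs ==> h \<E> Gs ==> k \<E> Gs ==> ml (ml g h) k = ml g (ml h k)" for g h k
    by (rule Gs_ext) (simp_all add: sd_assoc)
  show "g \<E> Gs ==> h \<E> Gs ==> ml g h = ml h g" for g h by (rule Gs_ext) (simp_all add: sd_comm)
  show "g \<E> Gs ==> p \<E> PP ==> ac g p \<E> PP" for g p by simp
  show "p \<E> PP ==> ac idg p = p" for p
    by (rule ac_fix, assumption) (use PP_pair[of p] in fastforce)
  show "g \<E> Gs ==> ac g zero = zero" for g by (rule ac_fix) simp_all
  show "g \<E> Gs ==> h \<E> Gs ==> p \<E> PP ==> ac g (ac h p) = ac (ml g h) p" for g h p by (rule ac_ac)
  show "g \<E> Gs ==> p \<E> PP ==> q \<E> PP ==> ext q p ==> ext (ac g q) (ac g p)" for g p q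
    unfolding ac_def sub_def by auto
  show "\<exists>s. s \<E> Ss" using Ss_iff zero_omega kap_zero by blast
  fix s t assume "s \<E> Ss" "t \<E> Ss"
  then obtain n c m d where *: "n \<E> omega" "c \<E> kap" "m \<E> omega" "d \<E> kap" "s = pair n c" "t = pair m d"
    unfolding Ss_iff by blast
  let ?u = "pair (Un2 n m) (Un2 c d)"
  have "Un2 n m \<E> omega" using Ord_Un2_cases[OF omega_Ord_mem[OF *(1)] omega_Ord_mem[OF *(3)]] * by auto
  moreover have "Un2 c d \<E> kap" using Ord_Un2_cases[OF Ord_mem[OF Okap *(2)] Ord_mem[OF Okap *(4)]] * by auto
  moreover have "fx ?u g --> fx s g & fx t g" for g unfolding fx_def inS_def * by auto
  ultimately show "\<exists>u. u \<E> Ss & (\<forall>g. g \<E> Gs --> fx u g --> fx s g & fx t g)" using Ss_iff by blast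
qed

text \<open>Outside the support, \<open>p\<close> is flipped by the difference of the two values
  wherever both conditions are defined. Inside it the flip is trivial and \<open>q\<close> extends
  \<open>p\<close> by assumption.\<close>

lemma homogeneous:
  assumes p: "p \<E> PP" and q: "q \<E> PP" and pq: "rs s p \<sqsubseteq> q"
  shows "\<exists>g. g \<E> Gs & fx s g & Un2 (ac g p) q \<E> PP"
proof -
  define F where "F = (%i. if inS s i \<or> \<not> (\<exists>u. pair i u \<E> p) \<or> \<not> (\<exists>u. pair i u \<E> q) then zero else sd (app p i) (app q i))"
  have DF: "DF (%e. F (e 0))" unfolding F_def by (intro DF_If) simp_all
  define g where "g = lam coords F"
  have "F i \<sqsubseteq> vl i" for i
  proof (cases "inS s i \<or> \<not> (\<exists>u. pair i u \<E> p) \<or> \<not> (\<exists>u. pair i u \<E> q)")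
    case True then show ?thesis by (simp add: F_def sub_def)
  next
    case False
    then obtain u w where u: "pair i u \<E> p" "pair i w \<E> q" by blast
    have "F i = sd u w" using False u isfn_app[OF PP_isfn[OF p] u(1)] isfn_app[OF PP_isfn[OF q] u(2)] by (auto simp: F_def)
    then show ?thesis using PP_pair[OF p u(1)] PP_pair[OF q u(2)] sd_sub by simp
  qed
  then have g: "g \<E> Gs" unfolding g_def by (intro Gs_lam[OF DF])
  have gF: "app g i = F i" if "i \<E> coords" for i unfolding g_def using that DF by simp
  have "fx s g" unfolding fx_def using gF by (simp add: F_def)
  have cross: "u = w" if u: "pair i u \<E> ac g p" and w: "pair i w \<E> q" for i u w
  proof -
    obtain x where x: "pair i x \<E> p" "i \<E> coords" "u = sd x (F i)" using u pair_ac[OF p] gF by auto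
    show ?thesis
    proof (cases "inS s i")
      case True
      then have "pair i x \<E> q" using x(1) pq by (simp add: sub_def)
      then show ?thesis using True x(3) w PP_isfn[OF q] unfolding F_def isfn_def by auto
    next
      case False
      then have "F i = sd x w" unfolding F_def
        using x(1) w isfn_app[OF PP_isfn[OF p] x(1)] isfn_app[OF PP_isfn[OF q] w] by auto
      then show ?thesis using x(3) by simp
    qed
  qed
  have "isfn (Un2 (ac g p) q)"
    using cross PP_isfn[OF q] PP_isfn[OF ac_PP[OF g p]] unfolding isfn_def Un2_iff by blast
  then show ?thesis using PP_Un2[OF ac_PP[OF g p] q] g \<open>fx s g\<close> by blast
qed

definition Qs where "Qs s = Sep PP (%p. rs s p = p)"
lemma Qs_iff [simp]: "p \<E> Qs s \<longleftrightarrow> p \<E> PP & rs s p = p" by (simp add: Qs_def)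

lemma Qs_Un2: assumes q: "q \<E> Qs s" and p: "p \<E> PP" and pq: "rs s p \<sqsubseteq> q" shows "Un2 q p \<E> PP"
proof (rule PP_Un2)
  have qS: "pair i u \<E> q ==> inS s i" for i u using q by (metis Qs_iff rs_iff fs_pair)
  have pS: "pair i u \<E> p ==> inS s i ==> pair i u \<E> q" for i u using pq by (simp add: sub_def)
  have iq: "isfn q" "isfn p" using q p PP_isfn by simp_all
  have "u = w" if "pair i u \<E> q" "pair i w \<E> p" for i u w using qS[OF that(1)] pS[OF that(2)] that(1) iq(1) unfolding isfn_def by blast
  then show "isfn (Un2 q p)" using iq unfolding isfn_def Un2_iff by blast
qed (use p q in simp_all)

text \<open>A support leaves finitely many levels with \<open>lamb\<close> coordinates each and the
  collapses of fewer than \<open>kap\<close> ordinals with \<open>lamp\<close> coordinates each. All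
  these sizes are below \<open>kap\<close>, which is closed under power sets.\<close>

lemma sm_Qs: assumes "s \<E> Ss" shows "sm (Qs s)"
proof -
  obtain n c where s: "n \<E> omega" "c \<E> kap" "s = pair n c" using assms Ss_iff by blast
  have n: "n \<E> kap" "omega \<E> kap" using s(1) Ord_trans[OF Okap kap(2)] kap(2) by blast+
  have c1: "sm (succ zero)" by (rule sm_mem[OF Ord_trans[OF Okap kap(2)]]) simp
  have smo: "sm (upair omega omega)" by (rule sm_le[OF c1 leI[of "%_. zero"]]) auto
  let ?Y = "Un2 (prod n lamb) (prod (upair omega omega) (prod c lamp))"
  let ?V = "Pw (Un2 c (succ zero))"
  have "sm (Pw (prod ?Y ?V))"
    by (intro sm_Pw sm_prod sm_Un2 c1 smo) (use n s lamb_kap lamp_kap sm_mem in blast)+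
  moreover have "Qs s \<sqsubseteq> Pw (prod ?Y ?V)"
  proof (rule subI)
    fix p assume p: "p \<E> Qs s"
    have "z \<E> prod ?Y ?V" if z: "z \<E> p" for z
    proof -
      have "inS s (fs z)" using p z by (metis Qs_iff rs_iff)
      moreover have "z = pair (fs z) (sn z)" "fs z \<E> coords" "sn z \<sqsubseteq> vl (fs z)" using PP_pair[of p z] p z by simp_all
      moreover have "\<not> omega \<E> n" using s(1) mem_asym by blast
      ultimately have "fs z \<E> ?Y & sn z \<E> ?V"
        unfolding inS_def s coords_iff using Ord_trans[OF Ord_mem[OF Okap s(2)]]
        by (auto simp: vl_def sub_def split: if_splits)
      then show ?thesis using \<open>z = pair (fs z) (sn z)\<close> pair_prod by metis
    qed
    then show "p \<E> Pw (prod ?Y ?V)" by (simp add: sub_def)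
  qed
  ultimately show ?thesis using sm_le le_sub by blast
qed

end

section \<open>The Easton property\<close>

context ground
begin

text \<open>With second component \<open>zero\<close> the support contains no collapse coordinates;
  only the levels below \<open>n\<close> remain. Accordingly \<open>up\<close> keeps level
  \<open>omega\<close>.\<close>

definition lo where "lo n p = rs (pair n zero) p"
definition up where "up n p = Dif p (lo n p)"
lemma DF_lo [D_intros, simp]: "DF f ==> DF g ==> DF (%e. lo (f e) (g e))" unfolding lo_def by simp
lemma DF_up [D_intros, simp]: "DF f ==> DF g ==> DF (%e. up (f e) (g e))" unfolding up_def by simp
lemma lo_iff [simp]: "z \<E> lo n p \<longleftrightarrow> z \<E> p & fs (fs z) \<E> n" unfolding lo_def by (simp add: inS_def)
lemma up_iff [simp]: "z \<E> up n p \<longleftrightarrow> z \<E> p & \<not> fs (fs z) \<E> n" unfolding up_def by auto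
lemma lo_PP [simp]: "p \<E> PP ==> lo n p \<E> PP" unfolding lo_def by simp
lemma up_PP [simp]: "p \<E> PP ==> up n p \<E> PP" by (erule PP_sub) (simp add: sub_def)

lemma glue:
  assumes "r \<E> PP" "lo n r = r" "u \<E> PP" "lo n u = zero"
  shows "Un2 r u \<E> PP" "lo n (Un2 r u) = r" "up n (Un2 r u) = u"
proof -
  have r: "z \<E> r ==> fs (fs z) \<E> n" for z using assms(2) lo_iff by metis
  have u: "z \<E> u ==> \<not> fs (fs z) \<E> n" for z using assms(4) lo_iff not_zero by metis
  show "lo n (Un2 r u) = r" "up n (Un2 r u) = u" by (rule extensional; use r u in auto)+
  have "\<not> (pair i x \<E> r & pair i y \<E> u)" for i x y using r[of "pair i x"] u[of "pair i y"] by auto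
  then have "isfn (Un2 r u)" using PP_isfn[OF assms(1)] PP_isfn[OF assms(3)] unfolding isfn_def Un2_iff by blast
  then show "Un2 r u \<E> PP" by (rule PP_Un2[OF assms(1,3)])
qed

lemma lo_le: assumes m: "m \<E> omega" and p: "p \<E> PP" shows "lo (succ m) p \<lesssim> al m"
proof -
  have "lo (succ m) p \<sqsubseteq> BU (Rep (succ m) (lev p))" by (rule subI, subst BU_Rep) auto
  moreover have "BU (Rep (succ m) (lev p)) \<lesssim> al m"
  proof (rule union_le[OF al_Inf])
    show "succ m \<lesssim> al m" using omega_trans[OF succ_omega[OF m]] InfCard_omega_sub[OF al_Inf] sub_trans le_sub by blast
    fix l assume l: "l \<E> succ m"
    then have "l \<E> succ omega" using omega_trans[OF succ_omega[OF m]] subD by auto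
    then have "lev p l \<lesssim> al l" using p PP_iff by blast
    moreover have "al l \<sqsubseteq> al m" using l al_mono[of l m] Ord_memsub[OF al_Ord] by auto
    ultimately show "lev p l \<lesssim> al m" using le_sub le_trans by blast
  qed simp
  ultimately show ?thesis using le_sub le_trans by blast
qed

text \<open>For \<open>n = succ m\<close> the lower parts have size at most \<open>al m\<close>, and
  \<open>chain_condition\<close> applies to \<open>al m\<close>, \<open>al n\<close> and
  \<open>al (succ n)\<close> because GCH makes \<open>al n\<close> the power of
  \<open>al m\<close>.\<close>

lemma lo_cc:
  assumes n: "n \<E> omega" and p: "DF (%e. p (e 0))" "!!x. x \<E> al (succ n) ==> p x \<E> PP"
  shows "\<exists>x y. x \<E> al (succ n) & y \<E> al (succ n) & x \<noteq> y & isfn (Un2 (lo n (p x)) (lo n (p y)))"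
proof -
  have isfn: "isfn (Un2 (lo n (p x)) (lo n (p y)))" if xy: "x \<E> al (succ n)" "y \<E> al (succ n)"
    "\<forall>u v w. pair u v \<E> lo n (p x) --> pair u w \<E> lo n (p y) --> pair u v \<E> lo n (p y)" for x y
    using xy(3) PP_isfn[OF p(2)[OF xy(1)]] PP_isfn[OF p(2)[OF xy(2)]] unfolding isfn_def Un2_iff lo_iff by blast
  show ?thesis
  proof (cases "n = zero")
    \<comment> \<open>No level lies below \<open>zero\<close>, so all lower parts are empty and any
      two indices will do.\<close>
    case True
    have "zero \<E> al (succ n)" "succ zero \<E> al (succ n)" using subD[OF InfCard_omega_sub[OF al_Inf]] by simp_all
    then show ?thesis using isfn[of zero "succ zero"] True by fastforce
  next
    case False
    then obtain m where m: "m \<E> omega" "n = succ m" using omega_cases n by blast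
    have "lo n (p x) \<sqsubseteq> prod coords (Pw (succ zero))" if x: "x \<E> al (succ n)" for x
    proof (rule subI)
      fix z assume z: "z \<E> lo n (p x)"
      have "\<exists>i u. z = pair i u & i \<E> coords & u \<sqsubseteq> vl i" using z PP_pair[OF p(2)[OF x], of z] unfolding lo_iff by blast
      then obtain i u where iu: "z = pair i u" "i \<E> coords" "u \<sqsubseteq> vl i" by blast
      moreover have "fs i \<noteq> omega" using z n mem_asym iu(1) by auto
      ultimately show "z \<E> prod coords (Pw (succ zero))" unfolding vl_def by simp
    qed
    moreover have "Pw (succ zero) \<lesssim> al n"
    proof -
      have "Pw (succ zero) \<lesssim> omega"
      proof (rule leI[of "%x. if x = zero then zero else succ zero"])
        fix x y assume *: "x \<E> Pw (succ zero)" "y \<E> Pw (succ zero)"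
          "(if x = zero then zero else succ zero) = (if y = zero then zero else succ zero)"
        have "x = zero \<or> x = succ zero" "y = zero \<or> y = succ zero" using sub_one * by simp_all
        then show "x = y" using *(3) by (auto split: if_splits)
      qed (auto intro!: DF_If)
      then show ?thesis using le_sub[OF InfCard_omega_sub[OF al_Inf]] le_trans by blast
    qed
    moreover have "al n \<E> al (succ n)" by (rule al_mono) simp
    ultimately obtain x y where "x \<E> al (succ n)" "y \<E> al (succ n)" "x \<noteq> y"
      "\<forall>u v w. pair u v \<E> lo n (p x) --> pair u w \<E> lo n (p y) --> pair u v \<E> lo n (p y)"
      using chain_condition[OF al_Inf al_Inf al_Inf, of m n "succ n" "%x. lo n (p x)" coords "Pw (succ zero)"]
        al_succ(1,2)[OF omega_Ord_mem[OF m(1)]] al_succ(2)[OF omega_Ord_mem[OF n]] lo_le[OF m(1) p(2)] DF_lo[OF DF_const p(1)]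
      unfolding m(2) by blast
    then show ?thesis using isfn by blast
  qed
qed

definition upun where "upun n p x h = Un2 (up n p) (BU (Rep x (%y. up n (app h y))))"
lemma upun_iff: "z \<E> upun n p x h \<longleftrightarrow> z \<E> up n p \<or> (\<exists>y. y \<E> x & z \<E> up n (app h y))"
  unfolding upun_def Un2_iff by (subst BU_Rep) auto

text \<open>On a level \<open>l\<close> at or above \<open>n\<close> the bound \<open>al l\<close>
  absorbs a union of \<open>al n\<close> many pieces; the lower levels contribute nothing.
  Monotonicity makes the union single-valued.\<close>

lemma upun_PP:
  assumes n: "n \<E> omega" and p: "p \<E> PP" and x: "Ord x" "x \<lesssim> al n" and h: "!!y. y \<E> x ==> app h y \<E> PP & p \<sqsubseteq> app h y"
    and mono: "!!y z. y \<E> x ==> z \<E> y ==> up n (app h z) \<sqsubseteq> app h y"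
  shows "upun n p x h \<E> PP" "lo n (upun n p x h) = zero"
proof -
  let ?u = "upun n p x h"
  show "lo n ?u = zero" unfolding eq_zero lo_iff upun_iff by auto
  have "?u \<sqsubseteq> Sig" unfolding sub_def upun_iff using p h unfolding PP_iff sub_def by auto
  moreover have "isfn ?u"
    unfolding isfn_def
  proof (intro allI impI)
    fix i a b assume ab: "pair i a \<E> ?u" "pair i b \<E> ?u"
    have "(pair i a \<E> p & pair i b \<E> p) \<or> (\<exists>y. y \<E> x & pair i a \<E> app h y & pair i b \<E> app h y)"
    proof (cases "\<exists>y. y \<E> x & pair i a \<E> up n (app h y)")
      case True
      then obtain y where y: "y \<E> x" "pair i a \<E> up n (app h y)" by blast
      show ?thesis
      proof (cases "\<exists>z. z \<E> x & pair i b \<E> up n (app h z)")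
        case True
        then obtain z where z: "z \<E> x" "pair i b \<E> up n (app h z)" by blast
        consider "z \<E> y" | "z = y" | "y \<E> z" using Ord_linear[OF Ord_mem[OF x(1) y(1)] Ord_mem[OF x(1) z(1)]] by blast
        then show ?thesis
        proof cases
          case 1 then show ?thesis using subD[OF mono[OF y(1) 1] z(2)] y by auto
        next
          case 2 then show ?thesis using y z by auto
        next
          case 3 then show ?thesis using subD[OF mono[OF z(1) 3] y(2)] z by auto
        qed
      next
        case False
        then have "pair i b \<E> p" using ab(2) unfolding upun_iff by auto
        then show ?thesis using y h[OF y(1)] subD by auto
      qed
    next
      case False
      then have a: "pair i a \<E> p" using ab(1) unfolding upun_iff by auto
      then show ?thesis using ab(2) h subD unfolding upun_iff up_iff by blast
    qed
    then show "a = b" using PP_isfn[OF p] h PP_isfn unfolding isfn_def by blast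
  qed
  moreover have "lev ?u l \<lesssim> al l" if l: "l \<E> succ omega" for l
  proof (cases "l \<E> n")
    case True
    have "lev ?u l = zero" unfolding eq_zero lev_iff upun_iff using True by auto
    then show ?thesis using le_sub[of zero "al l"] by (simp add: sub_def)
  next
    case False
    have "Ord l" using l omega_Ord_mem by auto
    then have "n = l \<or> n \<E> l" using Ord_linear[OF omega_Ord_mem[OF n]] False by blast
    then have "al n \<sqsubseteq> al l" using al_mono[of n l] Ord_memsub[OF al_Ord] sub_refl by blast
    then have xl: "x \<lesssim> al l" using x(2) le_sub le_trans by blast
    have lh: "lev (app h y) l \<lesssim> al l" if "y \<E> x" for y using h[OF that] l PP_iff by blast
    have "lev p l \<lesssim> al l" using p l PP_iff by blast
    moreover have "BU (Rep x (%y. lev (app h y) l)) \<lesssim> al l" by (rule union_le[OF al_Inf xl _ lh]) simp_all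
    ultimately have "Un2 (lev p l) (BU (Rep x (%y. lev (app h y) l))) \<lesssim> al l" by (rule Un2_le[OF al_Inf])
    moreover have "lev ?u l \<sqsubseteq> Un2 (lev p l) (BU (Rep x (%y. lev (app h y) l)))"
      by (rule subI, unfold Un2_iff, subst BU_Rep) (auto simp: upun_iff)
    ultimately show ?thesis using le_sub le_trans by blast
  qed
  ultimately show "?u \<E> PP" unfolding PP_iff by blast
qed

text \<open>An antichain of lower parts is extended along \<open>\<aleph>\<^sub>n\<^sub>+\<^sub>1\<close> while the upper parts increase. The chain condition
  makes it maximal at a stage where the union of the upper parts still is a condition.\<close>

lemma decide_upper:
  assumes n: "n \<E> omega" and D: "D (%e. Dec (e 0))" and p0: "p0 \<E> PP"
    and mono: "!!p q. Dec p ==> p \<sqsubseteq> q ==> q \<E> PP ==> Dec q"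
    and dense: "!!p. p \<E> PP ==> p0 \<sqsubseteq> p ==> \<exists>q. q \<E> PP & p \<sqsubseteq> q & Dec q"
  shows "\<exists>p. p \<E> PP & p0 \<sqsubseteq> p & lo n p = lo n p0 & (\<forall>r. r \<E> PP --> lo n r = r --> lo n p0 \<sqsubseteq> r -->
    (\<exists>r'. r' \<E> PP & lo n r' = r' & r \<sqsubseteq> r' & Dec (Un2 r' (up n p))))"
proof -
  note [simp] = D_app1[OF D]
  let ?t = "al (succ n)"
  \<comment> \<open>The lower condition \<open>r\<close> can still be added to the antichain: it is
    incompatible with all lower parts reached before stage \<open>x\<close>.\<close>
  define ok where "ok = (%r x h. r \<E> PP & lo n r = r & lo n p0 \<sqsubseteq> r &
    (\<forall>y. y \<E> x --> \<not> isfn (Un2 r (lo n (app h y)))))"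
  have [simp]: "D (%e. ok (f e) (g e) (h e))" if "DF f" "DF g" "DF h" for f g h
    by (rule D_app3[where R=ok, OF _ that]) (unfold ok_def, simp)
  \<comment> \<open>As long as the antichain is not maximal, the next condition has to decide and
    its lower part has to enlarge the antichain. Afterwards only the upper parts have to
    grow.\<close>
  define B where "B = (%x h z. (\<forall>y. y \<E> x --> up n (app h y) \<sqsubseteq> z) &
    ((\<exists>r. ok r x h) --> Dec z & (\<forall>y. y \<E> x --> \<not> isfn (Un2 (lo n z) (lo n (app h y))))))"
  let ?X = "Sep PP (%p. p0 \<sqsubseteq> p)"
  have p0l: "Un2 (lo n p0) (upun n p0 x h) \<E> ?X" "lo n (Un2 (lo n p0) (upun n p0 x h)) = lo n p0"
      "up n (Un2 (lo n p0) (upun n p0 x h)) = upun n p0 x h"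
    if u: "upun n p0 x h \<E> PP" "lo n (upun n p0 x h) = zero" for x h
  proof -
    have ll: "lo n (lo n p0) = lo n p0" by (rule extensional) auto
    note * = glue[OF lo_PP[OF p0] ll u]
    have "p0 \<sqsubseteq> Un2 (lo n p0) (upun n p0 x h)" unfolding sub_def Un2_iff upun_iff by auto
    then show "Un2 (lo n p0) (upun n p0 x h) \<E> ?X" "lo n (Un2 (lo n p0) (upun n p0 x h)) = lo n p0"
      "up n (Un2 (lo n p0) (upun n p0 x h)) = upun n p0 x h" using * by simp_all
  qed
  have upn: "upun n p0 x h \<E> PP" "lo n (upun n p0 x h) = zero"
    if x: "x \<E> ?t" and h: "fn h x" "!!y. y \<E> x ==> app h y \<E> ?X & B y (restr h y) (app h y)" for x h
  proof -
    have Ox: "Ord x" using Ord_mem[OF al_Ord x] .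
    have "up n (app h z) \<sqsubseteq> app h y" if y: "y \<E> x" "z \<E> y" for y z
      using h(2)[OF y(1)] y(2) app_restr[OF h(1) Ord_memsub[OF Ox y(1)] y(2)] unfolding B_def by auto
    then show "upun n p0 x h \<E> PP" "lo n (upun n p0 x h) = zero"
      using upun_PP[OF n p0 Ox al_succ(2)[OF omega_Ord_mem[OF n] x], of h] h(2) by auto
  qed
  have "\<exists>F. fn F ?t & (\<forall>x. x \<E> ?t --> app F x \<E> ?X & B x (restr F x) (app F x))"
  proof (rule dependent_choice)
    show "D (%e. B (e 0) (e 1) (e 2))" unfolding B_def by simp
    fix x h assume x: "x \<E> ?t" and h: "fn h x" "!!y. y \<E> x ==> app h y \<E> ?X & B y (restr h y) (app h y)"
    let ?u = "upun n p0 x h"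
    note u = upn[OF x h]
    have uh: "up n (app h y) \<sqsubseteq> ?u" if "y \<E> x" for y unfolding sub_def upun_iff using that by blast
    have p0u: "p0 \<sqsubseteq> Un2 r ?u" if "lo n p0 \<sqsubseteq> r" for r using that unfolding sub_def Un2_iff upun_iff by auto
    show "\<exists>z. z \<E> ?X & B x h z"
    proof (cases "\<exists>r. ok r x h")
      case True
      then obtain r where r: "ok r x h" by blast
      have q: "Un2 r ?u \<E> PP" using glue(1)[OF _ _ u] r unfolding ok_def by blast
      have "p0 \<sqsubseteq> Un2 r ?u" using p0u r unfolding ok_def by blast
      then obtain z where z: "z \<E> PP" "Un2 r ?u \<sqsubseteq> z" "Dec z" "p0 \<sqsubseteq> z" using dense[OF q] sub_trans by blast
      have "up n (app h y) \<sqsubseteq> z" if "y \<E> x" for y using uh[OF that] z(2) unfolding sub_def Un2_iff by blast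
      moreover have "\<not> isfn (Un2 (lo n z) (lo n (app h y)))" if y: "y \<E> x" for y
      proof
        assume i: "isfn (Un2 (lo n z) (lo n (app h y)))"
        have "r \<sqsubseteq> lo n z" using r z(2) lo_iff[of _ n r] unfolding ok_def sub_def by auto
        then have "Un2 r (lo n (app h y)) \<sqsubseteq> Un2 (lo n z) (lo n (app h y))" unfolding sub_def by auto
        then show False using isfn_sub[OF i] r y unfolding ok_def by blast
      qed
      ultimately show ?thesis using z unfolding B_def by (intro exI[of _ z]) simp
    next
      case False
      have "up n (app h y) \<sqsubseteq> Un2 (lo n p0) ?u" if "y \<E> x" for y using uh[OF that] unfolding sub_def by auto
      then show ?thesis using p0l(1)[OF u] False unfolding B_def by blast
    qed
  qed simp
  then obtain F where F: "fn F ?t" "!!x. x \<E> ?t ==> app F x \<E> ?X & B x (restr F x) (app F x)" by blast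
  have FB: "app F x \<E> PP & p0 \<sqsubseteq> app F x & B x F (app F x)" if x: "x \<E> ?t" for x
  proof -
    have "app (restr F x) y = app F y" if "y \<E> x" for y using app_restr[OF F(1) Ord_memsub[OF al_Ord x] that] .
    then have "B x F (app F x) \<longleftrightarrow> B x (restr F x) (app F x)" unfolding B_def ok_def by simp
    then show ?thesis using F(2)[OF x] by simp
  qed
  \<comment> \<open>If the antichain never became maximal, the lower parts would be pairwise
    incompatible along all of \<open>al (succ n)\<close>.\<close>
  have "\<exists>x. x \<E> ?t & \<not> (\<exists>r. ok r x F)"
  proof (rule ccontr)
    assume "\<not> ?thesis"
    then have inc: "\<not> isfn (Un2 (lo n (app F x)) (lo n (app F y)))" if "x \<E> ?t" "y \<E> x" for x y
      using FB[OF that(1)] that unfolding B_def by blast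
    obtain x y where xy: "x \<E> ?t" "y \<E> ?t" "x \<noteq> y" "isfn (Un2 (lo n (app F x)) (lo n (app F y)))"
      using lo_cc[OF n, of "app F"] FB by auto
    have "Un2 (lo n (app F x)) (lo n (app F y)) = Un2 (lo n (app F y)) (lo n (app F x))" by (rule extensional) auto
    then show False using inc[of x y] inc[of y x] xy Ord_linear[OF Ord_mem[OF al_Ord xy(1)] Ord_mem[OF al_Ord xy(2)]] by auto
  qed
  then obtain x0 where x0: "x0 \<E> ?t & \<not> (\<exists>r. ok r x0 F)" by blast
  have "D (%e. e 0 \<E> ?t & \<not> (\<exists>r. ok r (e 0) F))" by simp
  \<comment> \<open>The least such stage is taken, so that at each earlier one the antichain was
    still extendible and the condition chosen there decides.\<close>
  from Ord_least[OF this _ x0] Ord_mem[OF al_Ord] x0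
  obtain x where x: "x \<E> ?t" "\<not> (\<exists>r. ok r x F)" "\<forall>y. y \<E> x --> \<not> (y \<E> ?t & \<not> (\<exists>r. ok r y F))" by blast
  have yt: "y \<E> ?t" if "y \<E> x" for y using Ord_trans[OF al_Ord x(1) that] .
  have "up n (app F z) \<sqsubseteq> app F y" if "y \<E> x" "z \<E> y" for y z using FB[OF yt[OF that(1)]] that(2) unfolding B_def by blast
  then have u: "upun n p0 x F \<E> PP" "lo n (upun n p0 x F) = zero"
    using upun_PP[OF n p0 Ord_mem[OF al_Ord x(1)] al_succ(2)[OF omega_Ord_mem[OF n] x(1)], of F] FB yt by auto
  let ?p = "Un2 (lo n p0) (upun n p0 x F)"
  have "\<exists>r'. r' \<E> PP & lo n r' = r' & r \<sqsubseteq> r' & Dec (Un2 r' (up n ?p))"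
    if r: "r \<E> PP" "lo n r = r" "lo n p0 \<sqsubseteq> r" for r
  proof -
    \<comment> \<open>By maximality \<open>r\<close> is compatible with the lower part of stage
      \<open>y\<close>. Together with the union of upper parts, their union extends the deciding
      condition of that stage.\<close>
    obtain y where y: "y \<E> x" "isfn (Un2 r (lo n (app F y)))" using x(2) r unfolding ok_def by blast
    let ?r = "Un2 r (lo n (app F y))"
    have rP: "?r \<E> PP" using PP_Un2[OF r(1) _ y(2)] FB[OF yt[OF y(1)]] by simp
    have rl: "lo n ?r = ?r" by (rule extensional) (use lo_iff[of _ n r] r(2) in auto)
    have "Dec (app F y)" using FB[OF yt[OF y(1)]] x(3) y(1) yt unfolding B_def by blast
    moreover have "app F y \<sqsubseteq> Un2 ?r (upun n p0 x F)" unfolding sub_def Un2_iff upun_iff using y(1) by auto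
    ultimately have "Dec (Un2 ?r (upun n p0 x F))" by (rule mono) (rule glue(1)[OF rP rl u])
    then show ?thesis using rP rl p0l(3)[OF u] by (intro exI[of _ ?r]) (simp add: sub_def)
  qed
  then show ?thesis using p0l(1,2)[OF u] by (intro exI[of _ ?p]) simp
qed

text \<open>\<open>decide_upper\<close> is repeated for \<open>al n\<close> many statements. Each
  step leaves the lower part of \<open>p0\<close> alone and only increases upper parts, so the whole
  sequence has an upper bound.\<close>

lemma easton:
  assumes n: "n \<E> omega" and D: "D (%e. Dec (e 0) (e 1))" and p0: "p0 \<E> PP"
    and mono: "!!x p q. Dec x p ==> p \<sqsubseteq> q ==> q \<E> PP ==> Dec x q"
    and dense: "!!x p. p \<E> PP ==> p0 \<sqsubseteq> p ==> \<exists>q. q \<E> PP & p \<sqsubseteq> q & Dec x q"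
  shows "\<exists>p. p \<E> PP & p0 \<sqsubseteq> p & (\<forall>x r. x \<E> al n --> r \<E> PP --> lo n r = r --> lo n p \<sqsubseteq> r -->
    (\<exists>r'. r' \<E> PP & lo n r' = r' & r \<sqsubseteq> r' & Dec x (Un2 r' (up n p))))"
proof -
  note [simp] = D_app2[OF D]
  let ?t = "al n"
  define Gd where "Gd = (%x p. \<forall>r. r \<E> PP --> lo n r = r --> lo n p0 \<sqsubseteq> r -->
    (\<exists>r'. r' \<E> PP & lo n r' = r' & r \<sqsubseteq> r' & Dec x (Un2 r' (up n p))))"
  have [simp]: "D (%e. Gd (f e) (g e))" if "DF f" "DF g" for f g
    by (rule D_app2[where R=Gd, OF _ that]) (unfold Gd_def, simp)
  define B where "B = (%x h z. lo n z = lo n p0 & (\<forall>y. y \<E> x --> up n (app h y) \<sqsubseteq> z) & Gd x z)"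
  let ?X = "Sep PP (%p. p0 \<sqsubseteq> p)"
  let ?q = "%x h. Un2 (lo n p0) (upun n p0 x h)"
  have ll: "lo n (lo n p0) = lo n p0" by (rule extensional) auto
  have q: "?q x h \<E> PP & p0 \<sqsubseteq> ?q x h & lo n (?q x h) = lo n p0 & up n (?q x h) = upun n p0 x h &
      (\<forall>y. y \<E> x --> up n (app h y) \<sqsubseteq> up n (?q x h))"
    if x: "Ord x" "x \<lesssim> al n" and h: "fn h x" "!!y. y \<E> x ==> app h y \<E> ?X & B y (restr h y) (app h y)" for x h
  proof -
    have "up n (app h z) \<sqsubseteq> app h y" if y: "y \<E> x" "z \<E> y" for y z
      using h(2)[OF y(1)] y(2) app_restr[OF h(1) Ord_memsub[OF x(1) y(1)] y(2)] unfolding B_def by auto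
    then have "upun n p0 x h \<E> PP" "lo n (upun n p0 x h) = zero" using upun_PP[OF n p0 x, of h] h(2) by auto
    note * = glue[OF lo_PP[OF p0] ll this]
    moreover have "p0 \<sqsubseteq> ?q x h" unfolding sub_def Un2_iff upun_iff by auto
    moreover have "up n (app h y) \<sqsubseteq> upun n p0 x h" if "y \<E> x" for y unfolding sub_def upun_iff using that by blast
    ultimately show ?thesis by simp
  qed
  have "\<exists>F. fn F ?t & (\<forall>x. x \<E> ?t --> app F x \<E> ?X & B x (restr F x) (app F x))"
  proof (rule dependent_choice)
    show "D (%e. B (e 0) (e 1) (e 2))" unfolding B_def by simp
    fix x h assume x: "x \<E> ?t" and h: "fn h x" "!!y. y \<E> x ==> app h y \<E> ?X & B y (restr h y) (app h y)"
    have xn: "x \<lesssim> al n" using le_sub[OF Ord_memsub[OF al_Ord x]] .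
    note q = q[OF Ord_mem[OF al_Ord x] xn h]
    have "\<exists>p. p \<E> PP & ?q x h \<sqsubseteq> p & lo n p = lo n (?q x h) & (\<forall>r. r \<E> PP --> lo n r = r --> lo n (?q x h) \<sqsubseteq> r -->
      (\<exists>r'. r' \<E> PP & lo n r' = r' & r \<sqsubseteq> r' & Dec x (Un2 r' (up n p))))"
    proof (rule decide_upper[OF n])
      show "D (%e. Dec x (e 0))" by simp
      show "?q x h \<E> PP" using q by blast
      fix p assume p: "p \<E> PP" "?q x h \<sqsubseteq> p"
      then have "p0 \<sqsubseteq> p" using q sub_trans by blast
      then show "\<exists>q. q \<E> PP & p \<sqsubseteq> q & Dec x q" using dense p by blast
    qed (rule mono)
    then obtain p where p: "p \<E> PP" "?q x h \<sqsubseteq> p" "lo n p = lo n p0" "Gd x p" using q unfolding Gd_def by auto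
    have "up n (app h y) \<sqsubseteq> p" if "y \<E> x" for y
    proof -
      have "up n (app h y) \<sqsubseteq> up n (?q x h)" using q that by blast
      then show ?thesis using p(2) unfolding sub_def up_iff by blast
    qed
    moreover have "p0 \<sqsubseteq> p" using p(2) q sub_trans by blast
    ultimately show "\<exists>z. z \<E> ?X & B x h z" using p unfolding B_def by (intro exI[of _ p]) simp
  qed simp
  then obtain F where F: "fn F ?t" "!!x. x \<E> ?t ==> app F x \<E> ?X & B x (restr F x) (app F x)" by blast
  note q = q[OF al_Ord le_refl F]
  have "Gd x (?q ?t F)" if x: "x \<E> ?t" for x
    unfolding Gd_def
  proof (intro allI impI)
    fix r assume r: "r \<E> PP" "lo n r = r" "lo n p0 \<sqsubseteq> r"
    have "Gd x (app F x)" using F(2)[OF x] unfolding B_def by blast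
    then obtain r' where r': "r' \<E> PP" "lo n r' = r'" "r \<sqsubseteq> r'" "Dec x (Un2 r' (up n (app F x)))" using r unfolding Gd_def by blast
    have "up n (app F x) \<sqsubseteq> up n (?q ?t F)" using q x by blast
    then have s: "Un2 r' (up n (app F x)) \<sqsubseteq> Un2 r' (up n (?q ?t F))" unfolding sub_def Un2_iff by blast
    have "lo n (up n (?q ?t F)) = zero" unfolding eq_zero by simp
    moreover have "up n (?q ?t F) \<E> PP" using q up_PP by blast
    ultimately have "Un2 r' (up n (?q ?t F)) \<E> PP" by (rule glue(1)[OF r'(1,2), rotated])
    from mono[OF r'(4) s this] show "\<exists>r'. r' \<E> PP & lo n r' = r' & r \<sqsubseteq> r' & Dec x (Un2 r' (up n (?q ?t F)))" using r' by blast
  qed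
  then show ?thesis using q unfolding Gd_def by (intro exI[of _ "?q ?t F"]) auto
qed

end

section \<open>Absoluteness\<close>

sublocale symext \<subseteq> N: zf N by (rule zf_N)

context symext
begin

lemma ck_eqI: "(!!y. N y b \<longleftrightarrow> (\<exists>z. z \<E> x & y = ck z)) ==> b = ck x"
  by (rule N.extensional) (simp add: N_ck)

lemma ck_zero [simp]: "N.zero = ck zero" and ck_upair [simp]: "N.upair (ck x) (ck y) = ck (upair x y)"
  and ck_Un2 [simp]: "N.Un2 (ck x) (ck y) = ck (Un2 x y)" and ck_Dif [simp]: "N.Dif (ck x) (ck y) = ck (Dif x y)"
  and ck_Cap [simp]: "N.Cap (ck x) (ck y) = ck (Cap x y)"
  by (rule ck_eqI; (unfold N.Dif_iff N.Cap_iff N.Un2_iff)?; auto simp: N_ck)+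
lemma ck_succ [simp]: "N.succ (ck x) = ck (succ x)" unfolding N.succ_def succ_def by simp
lemma ck_pair [simp]: "N.pair (ck x) (ck y) = ck (pair x y)" unfolding N.pair_def pair_def by simp
lemma ck_sub [simp]: "N.sub (ck x) (ck y) \<longleftrightarrow> x \<sqsubseteq> y" unfolding N.sub_def sub_def N_ck by auto
lemma ck_trans [simp]: "N.trans (ck x) \<longleftrightarrow> trans x" unfolding N.trans_def trans_def N_ck by auto
lemma ck_Ord [simp]: "N.Ord (ck x) \<longleftrightarrow> Ord x" unfolding N.Ord_def Ord_def N_ck by auto
lemma ck_inductv [simp]: "N.inductv (ck x) \<longleftrightarrow> inductv x" unfolding N.inductv_def inductv_def N_ck ck_zero by auto

text \<open>As \<open>ck omega\<close> is inductive, \<open>N.omega\<close> is at most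
  \<open>ck omega\<close>. A smaller value \<open>ck n\<close> would make the natural number
  \<open>n\<close> inductive in the ground model.\<close>

lemma ck_omega [simp]: "N.omega = ck omega"
proof -
  have i: "inductv omega" unfolding inductv_def by simp
  then have "N.sub N.omega (ck omega)" unfolding N.sub_def N.omega_iff by simp
  then have "N N.omega (ck omega) \<or> N.omega = ck omega" using N.Ord_sub_iff[OF N.Ord_omega, of "ck omega"] by simp
  moreover have "\<not> N N.omega (ck omega)"
  proof
    assume "N N.omega (ck omega)"
    then obtain n where n: "n \<E> omega" "N.omega = ck n" unfolding N_ck by blast
    have "N.inductv N.omega" unfolding N.inductv_def using N.zero_omega N.succ_omega by blast
    then have "inductv n" unfolding n(2) by simp
    then have "n \<E> n" using n(1) omega_iff by blast
    then show False by simp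
  qed
  ultimately show ?thesis by blast
qed

lemma ck_fn: assumes "fn f a" shows "N.fn (ck f) (ck a)" "x \<E> a ==> N.app (ck f) (ck x) = ck (app f x)"
proof -
  show 1: "N.fn (ck f) (ck a)"
    unfolding N.fn_def
  proof (intro conjI allI impI)
    fix p assume "N p (ck f)"
    then obtain z where z: "z \<E> f" "p = ck z" unfolding N_ck by blast
    then obtain x where "x \<E> a" "z = pair x (app f x)" using fn_mem[OF assms] by blast
    then show "\<exists>x y. N x (ck a) & p = N.pair x y"
      using z by (intro exI[of _ "ck x"] exI[of _ "ck (app f x)"]) simp
  next
    fix x assume "N x (ck a)"
    then obtain z where z: "z \<E> a" "x = ck z" unfolding N_ck by blast
    show "\<exists>y. N (N.pair x y) (ck f) & (\<forall>w. N (N.pair x w) (ck f) --> w = y)"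
    proof (rule exI[of _ "ck (app f z)"], intro conjI allI impI)
      show "N (N.pair x (ck (app f z))) (ck f)" using z fn_pair[OF assms] by simp
      fix w assume "N (N.pair x w) (ck f)"
      then obtain u where u: "u \<E> f" "N.pair x w = ck u" unfolding N_ck by blast
      then obtain i where "i \<E> a" "u = pair i (app f i)" using fn_mem[OF assms] by blast
      then show "w = ck (app f z)" using u z ck_pair N.pair_eq ck_inj by metis
    qed
  qed
  show "N.app (ck f) (ck x) = ck (app f x)" if x: "x \<E> a"
  proof -
    have "N (N.pair (ck x) (ck (app f x))) (ck f)" using fn_pair[OF assms] x by simp
    then show ?thesis using N.fn_app[OF 1, of "ck x" "ck (app f x)"] x N_ck_ck by blast
  qed
qed

lemma ck_le: assumes "a \<lesssim> b" shows "N.le (ck a) (ck b)"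
proof -
  obtain f where f: "fn f a" "\<forall>x. x \<E> a --> app f x \<E> b" "\<forall>x y. x \<E> a --> y \<E> a --> app f x = app f y --> x = y"
    using leD[OF assms] by blast
  have "N.inj (ck f) (ck a) (ck b)" unfolding N.inj_def N_ck using ck_fn[OF f(1)] f(2,3) by fastforce
  then show ?thesis unfolding N.le_def by blast
qed

lemma ck_Card: "N.Card (ck k) ==> Card k" unfolding N.Card_def Card_def N_ck using ck_le by auto
lemma ck_InfCard: "N.InfCard (ck k) ==> InfCard k" unfolding N.InfCard_def InfCard_def using ck_Card by simp

text \<open>An ordinal of another form would lie above every \<open>ck a\<close>. Each of its
  members has a candidate name in a set of the ground model, and a candidate together with a
  condition is forced equal to at most one canonical name. Replacement would then yield a set of all
  ordinals.\<close>

lemma N_Ord: assumes b: "N.Ord b" shows "\<exists>a. Ord a & b = ck a"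
proof (rule ccontr)
  assume *: "\<not> ?thesis"
  have cb: "N (ck a) b" if a: "Ord a" for a
  proof -
    have "\<not> N b (ck a)"
    proof
      assume "N b (ck a)"
      then obtain z where "z \<E> a" "b = ck z" unfolding N_ck by blast
      then show False using * Ord_mem[OF a] by blast
    qed
    then show ?thesis using N.Ord_linear[OF b, of "ck a"] a * by auto
  qed
  define F where "F = (%z. the_el (%a. Eq (fs z) (chk a) (sn z)))"
  let ?X = "Rep (prod (prod Gr (bs (sn (nm b)))) P) F"
  have DF: "DF (%e. F (e 0))" unfolding F_def by simp
  have "a \<E> ?X" if a: "Ord a" for a
  proof -
    have "N (ck a) (v (nm b))" using cb[OF a] by simp
    then obtain g w where gw: "g \<E> Gr" "w \<E> bs (sn (nm b))" "ck a = v (pair g w)" using N_elem[OF HS_nm] by blast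
    have h: "HS (pair g w)" using HS_retag[OF HS_bs[OF HS_nm gw(2)] gw(1)] .
    have "\<exists>p\<in>G. Eq (pair g w) (chk a) p" unfolding v_eq[OF h HS_chk, symmetric] using gw(3) ck_def by simp
    then obtain p where p: "p \<in> G" "Eq (pair g w) (chk a) p" by blast
    have "F (pair (pair g w) p) = a"
      unfolding F_def fs_pair sn_pair
    proof (rule the_el_eq)
      fix c assume "Eq (pair g w) (chk c) p"
      then have "Eq (chk c) (chk a) p"
        using Eq_trans[OF Nm_chk HS_Nm[OF h] Nm_chk G_P[OF p(1)] Eq_sym[OF HS_Nm[OF h] Nm_chk G_P[OF p(1)]] p(2)] by blast
      then show "c = a" using Eq_chk G_P[OF p(1)] by blast
    qed (rule p)
    then show ?thesis using gw p G_P DF by (subst Rep_iff[OF DF]) (auto intro!: exI[of _ "pair (pair g w) p"])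
  qed
  then show False using no_set_of_Ords by blast
qed

definition hn where "hn h = pair one (Rep h (%z. pair (chk (fs z)) (sn z)))"

text \<open>The entries are canonical and thus invariant, so a translation moves only the
  conditions. The name is symmetric as soon as a support fixes these, and the third clause evaluates
  every translate.\<close>

lemma check_name:
  assumes h: "!!z. z \<E> h ==> \<exists>x r. r \<E> P & z = pair x r" and s: "s \<E> Su"
    and inv: "!!g x r. g \<E> Gr ==> fixs s g ==> pair x r \<E> h ==> act g r = r"
  shows "HS (hn h)" "N y (v (hn h)) \<longleftrightarrow> (\<exists>x r. pair x r \<E> h & r \<in> G & y = ck x)"
    "g \<E> Gr ==> N y (v (tw g (hn h))) \<longleftrightarrow> (\<exists>x r. pair x r \<E> h & act g r \<in> G & y = ck x)"
proof -
  let ?n = "hn h"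
  have sn: "z \<E> sn ?n \<longleftrightarrow> (\<exists>x r. pair x r \<E> h & z = pair (chk x) r)" for z
  proof -
    have "z \<E> sn ?n \<longleftrightarrow> (\<exists>y. y \<E> h & z = pair (chk (fs y)) (sn y))" unfolding hn_def by simp
    then show ?thesis using h fs_pair sn_pair by metis
  qed
  have el: "el ?n b p \<longleftrightarrow> (\<exists>x. pair x p \<E> h & b = chk x)" for b p
  proof
    assume "el ?n b p"
    then obtain t w q where *: "pair (pair t w) q \<E> sn ?n" "b = pair (mul one t) w" "p = act one q"
      unfolding el_def hn_def fs_pair by blast
    then obtain x where x: "pair x q \<E> h" "pair t w = chk x" unfolding sn by auto
    have "q \<E> P" using h[OF x(1)] by auto
    moreover have "t = one" using fs_chk[of x] unfolding x(2)[symmetric] by simp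
    ultimately show "\<exists>x. pair x p \<E> h & b = chk x" using * x by auto
  next
    assume "\<exists>x. pair x p \<E> h & b = chk x"
    then obtain x where x: "pair x p \<E> h" "b = chk x" by blast
    have "p \<E> P" using h[OF x(1)] by auto
    moreover have "pair (pair one (sn (chk x))) p \<E> sn ?n" unfolding sn using x(1) chk_pair by auto
    ultimately show "el ?n b p" unfolding el_def using chk_pair[of x] x(2)
      by (intro exI[of _ one] exI[of _ "sn (chk x)"] exI[of _ p]) (simp add: hn_def)
  qed
  obtain t where t: "trans t" "dom h \<E> t" using ex_trans_superset by blast
  have ht: "pair x r \<E> h ==> x \<E> t" for x r using transD[OF t] dom_iff by blast
  let ?T = "Un2 (Rep t chk) (upair ?n ?n)"
  have "clo ?T"
  proof -
    have "\<exists>b q. b \<E> ?T & q \<E> P & x = pair b q" if xs: "x \<E> sn ?n" for x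
    proof -
      obtain y r where y: "pair y r \<E> h" "x = pair (chk y) r" using xs[unfolded sn] by blast
      have "chk y \<E> ?T" "r \<E> P" using ht[OF y(1)] h[OF y(1)] by auto
      then show ?thesis using y(2) by blast
    qed
    moreover have "fs ?n \<E> Gr & ?n = pair (fs ?n) (sn ?n)" unfolding hn_def by simp
    moreover have "a \<E> Rep t chk ==> fs a \<E> Gr & a = pair (fs a) (sn a) & (\<forall>x. x \<E> sn a --> (\<exists>b q. b \<E> ?T & q \<E> P & x = pair b q))" for a
      using clo_chk[OF t(1)] unfolding clo_def Un2_iff by blast
    ultimately show ?thesis unfolding clo_def[of ?T] by auto
  qed
  then have Nn: "Nm ?n" unfolding Nm_def by (intro exI[of _ ?T]) simp
  have elt: "el (tw g ?n) b p \<longleftrightarrow> (\<exists>x r. pair x r \<E> h & p = act g r & b = tw g (chk x))" if "g \<E> Gr" for g b p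
    unfolding el_tw_iff[OF Nn that] el by blast
  have "Eq (tw g ?n) ?n pt" if g: "g \<E> Gr" "fixs s g" for g
    unfolding Eq_iff[OF Nm_tw[OF Nn g(1)] Nn pt(1)] half_def
  proof (intro conjI allI impI)
    fix c r q assume c: "el (tw g ?n) c r" and q: "q \<E> P" "leq q pt" "leq q r"
    obtain x where x: "pair x r \<E> h" "c = tw g (chk x)" using c inv[OF g] unfolding elt[OF g(1)] by auto
    then show "\<exists>d t q'. el ?n d t & q' \<E> P & leq q' q & leq q' t & Eq c d q'"
      unfolding el using Eq_tw_chk[OF g(1) q(1)] q leq_refl by blast
  next
    fix c r q assume c: "el ?n c r" and q: "q \<E> P" "leq q pt" "leq q r"
    obtain x where x: "pair x r \<E> h" "c = chk x" using c unfolding el by blast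
    have "el (tw g ?n) (tw g (chk x)) r" unfolding elt[OF g(1)] using x(1) inv[OF g x(1)] by metis
    then show "\<exists>d t q'. el (tw g ?n) d t & q' \<E> P & leq q' q & leq q' t & Eq d c q'"
      using Eq_tw_chk[OF g(1) q(1)] q leq_refl x(2) by blast
  qed
  then have "symm ?n" unfolding symm_def using s by blast
  then show hs: "HS ?n" unfolding HS_def using \<open>clo ?T\<close> HS_symm[OF HS_chk] by (intro exI[of _ ?T]) auto
  show "N y (v ?n) \<longleftrightarrow> (\<exists>x r. pair x r \<E> h & r \<in> G & y = ck x)" unfolding mem_v[OF hs] el ck_def by blast
  assume g: "g \<E> Gr"
  have "v (tw g (chk x)) = ck x" for x
    unfolding ck_def v_eq[OF HS_tw[OF HS_chk g] HS_chk] using Eq_tw_chk[OF g pt(1)] pt_G by blast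
  moreover have "N y (v (tw g ?n)) \<longleftrightarrow> (\<exists>x r. pair x r \<E> h & act g r \<in> G & y = v (tw g (chk x)))"
    unfolding mem_v[OF HS_tw[OF hs g]] elt[OF g] by blast
  ultimately show "N y (v (tw g ?n)) \<longleftrightarrow> (\<exists>x r. pair x r \<E> h & act g r \<in> G & y = ck x)" by simp
qed

lemma G_decide: assumes \<Phi>: "D (%e. \<Phi> (e 0))"
  shows "(\<exists>p\<in>G. \<Phi> p) \<or> (\<exists>p\<in>G. \<forall>q. q \<E> P --> leq q p --> \<not> \<Phi> q)"
proof -
  note [simp] = D_app1[OF \<Phi>]
  have "\<exists>q\<in>G. leq q pt & (\<Phi> q \<or> (\<forall>r. r \<E> P --> leq r q --> \<not> \<Phi> r))"
    by (rule G_dense[OF _ pt_G]) (simp, use leq_refl in blast)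
  then show ?thesis by blast
qed

text \<open>If \<open>g\<close> fixes a condition forcing the statement, this condition also forces
  the translated statement. Since \<open>u\<close> is invariant under the support, only
  \<open>b\<close> changes.\<close>

lemma flip:
  assumes b: "HS b" and u: "HS u" and s: "!!g. g \<E> Gr ==> fixs s g ==> Eq (tw g u) u pt"
    and A: "sat N (case_nat (v b) (%_. v u)) A"
  shows "\<exists>p\<in>G. \<forall>g. g \<E> Gr --> fixs s g --> act g p = p --> sat N (case_nat (v (tw g b)) (%_. v u)) A"
proof -
  have c: "v \<circ> case_nat x (%_. u) = case_nat (v x) (%_. v u)" for x by (rule ext) (simp split: nat.split)
  have h: "HS (case_nat x (%_. u) i)" if "HS x" for x i using case_nat_HS[OF u that] .
  obtain p where p: "p \<in> G" "forces A (case_nat b (%_. u)) p" using A v_sat[of "case_nat b (%_. u)" A, OF h[OF b]] unfolding c by blast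
  have "sat N (case_nat (v (tw g b)) (%_. v u)) A" if g: "g \<E> Gr" "fixs s g" "act g p = p" for g
  proof -
    have pP: "p \<E> P" using G_P p(1) .
    have 1: "forces A (%i. tw g (case_nat b (%_. u) i)) p" using forces_act[OF h[OF b] pP g(1) p(2)] g(3) by simp
    have tb: "HS (tw g b)" using HS_tw[OF b g(1)] .
    have "forces A (case_nat (tw g b) (%_. u)) p"
    proof (rule forces_cong[OF _ h[OF tb] pP _ 1])
      show "HS (tw g (case_nat b (%_. u) i))" for i using HS_tw[OF h[OF b] g(1)] .
      fix i
      have "Eq (tw g u) u p" using Eq_mono[OF HS_Nm[OF HS_tw[OF u g(1)]] HS_Nm[OF u] pt(1) pP pt(2)[OF pP] s[OF g(1,2)]] .
      then show "Eq (tw g (case_nat b (%_. u) i)) (case_nat (tw g b) (%_. u) i) p"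
        using Eq_refl[OF HS_Nm[OF tb] pP] by (simp split: nat.split)
    qed
    then show ?thesis using v_sat[of "case_nat (tw g b) (%_. u)" A, OF h[OF tb]] p(1) unfolding c by blast
  qed
  then show ?thesis using p(1) by blast
qed

end

section \<open>Relations of the extension seen from the ground model\<close>

locale extension = ground E kap for E :: "'a => 'a => bool" (infix "\<E>" 50) and kap +
  fixes G :: "'a set" and v :: "'a => nat" and N :: "nat => nat => bool"
  assumes symext: "symext E PP Gs Ss zero idg ext fx ml ac G v N"

sublocale extension \<subseteq> symext E PP Gs Ss zero idg ext fx ml ac G v N by (rule symext)

context extension
begin

text \<open>\<open>V\<close> is the forcing relation for \<open>R\<close> on canonical names. The
  parameters have a common support \<open>s\<close>; any extension of \<open>rs s p\<close> is
  compatible with a flip of \<open>p\<close> that respects \<open>s\<close> and hence forces the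
  same, so \<open>rs s p\<close> forces it by density.\<close>

lemma relation:
  assumes R: "N.D (%e. R (e 0) (e 1))"
  shows "\<exists>V s. s \<E> Ss & D (%e. V (e 0) (e 1) (e 2)) & (\<forall>p x y. V p x y --> p \<E> PP) &
    (\<forall>p q x y. V p x y --> p \<sqsubseteq> q --> q \<E> PP --> V q x y) & (\<forall>x y. R (ck x) (ck y) \<longleftrightarrow> (\<exists>p\<in>G. V p x y)) &
    (\<forall>p x y. V p x y --> V (rs s p) x y)"
proof -
  obtain A c where A: "!!e. R (e 0) (e 1) \<longleftrightarrow> sat N (N.mix c e) A" using N.D_formula[OF R] by blast
  \<comment> \<open>The layout of \<open>mix\<close> again: the two arguments are the variables 0
    and 2, and the odd variables hold names of the parameters.\<close>
  define X where "X = (%x y i. if even i then if i = 0 then chk x else if i = 2 then chk y else chk zero else nm (c (i div 2)))"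
  have hX: "HS (X x y i)" for x y i unfolding X_def by (simp add: HS_chk)
  have vX: "v \<circ> X x y = N.mix c (%i. if i = 0 then ck x else if i = 1 then ck y else ck zero)" for x y
    by (rule ext) (auto simp: X_def N.mix_def ck_def)
  define V where "V = (%p x y. p \<E> PP & forces A (X x y) p)"
  have "DF (%e. X (e 1) (e 2) i)" for i unfolding X_def by simp
  then have D: "D (%e. V (e 0) (e 1) (e 2))" unfolding V_def using D_forces[of "%i e. X (e 1) (e 2) i" "%e. e 0" A] by simp
  have truth: "R (ck x) (ck y) \<longleftrightarrow> (\<exists>p\<in>G. V p x y)" for x y
    using A[of "%i. if i = 0 then ck x else if i = 1 then ck y else ck zero"] v_sat[of "X x y" A, OF hX] G_P
    unfolding vX V_def by auto
  obtain s where s: "s \<E> Ss" "!!g i. i \<in> fv A ==> g \<E> Gs ==> fx s g ==> Eq (tw g (X zero zero i)) (X zero zero i) zero"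
    using common_support[of "fv A" "X zero zero", OF finite_fv hX] by blast
  have sX: "Eq (tw g (X x y i)) (X x y i) zero" if "i \<in> fv A" "g \<E> Gs" "fx s g" for x y i g
  proof (cases "even i")
    case True
    then have "\<exists>z. X x y i = chk z" unfolding X_def by auto
    then obtain z where "X x y i = chk z" by blast
    then show ?thesis using Eq_tw_chk[OF that(2)] by simp
  next
    case False
    then show ?thesis using s(2)[OF that] unfolding X_def by simp
  qed
  have "V (rs s p) x y" if p: "V p x y" for p x y
  proof -
    have pP: "p \<E> PP" "forces A (X x y) p" using p unfolding V_def by blast+
    have "forces A (X x y) (rs s p)"
    proof (rule forces_dense[OF hX])
      fix q assume q: "q \<E> PP" "rs s p \<sqsubseteq> q"
      obtain g where g: "g \<E> Gs" "fx s g" "Un2 (ac g p) q \<E> PP" using homogeneous[OF pP(1) q] by blast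
      have f: "forces A (X x y) (ac g p)" by (rule forces_support[OF hX _ g(1) pP]) (use sX g in blast)
      have "forces A (X x y) (Un2 (ac g p) q)"
        by (rule forces_mono[OF hX ac_PP[OF g(1) pP(1)] g(3) _ f]) (simp add: sub_def)
      then show "\<exists>q'. q' \<E> PP & q \<sqsubseteq> q' & forces A (X x y) q'" using g(3) by (intro exI[of _ "Un2 (ac g p) q"]) (simp add: sub_def)
    qed (use pP in simp)
    then show ?thesis unfolding V_def using pP by simp
  qed
  moreover have "V q x y" if "V p x y" "p \<sqsubseteq> q" "q \<E> PP" for p q x y
    using that forces_mono[of "X x y" p q A, OF hX] unfolding V_def by blast
  moreover have "V p x y --> p \<E> PP" for p x y unfolding V_def by blast
  ultimately show ?thesis using D truth s(1) by (intro exI[of _ V] exI[of _ s]) blast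
qed

text \<open>No condition in \<open>G\<close> forces two different values, and genericity provides
  one in \<open>G\<close> below which this never happens.\<close>

lemma functional_guard:
  assumes V: "D (%e. V (e 0) (e 1) (e 2))" "!!x y. R (ck x) (ck y) \<longleftrightarrow> (\<exists>p\<in>G. V p x y)"
    and f: "!!x y z. R x y ==> R x z ==> y = z"
  shows "\<exists>p\<in>G. \<forall>q x y z. q \<E> PP --> p \<sqsubseteq> q --> V q x y --> V q x z --> y = z"
proof -
  note [simp] = D_app3[OF V(1)]
  have "\<not> (\<exists>x y z. V p x y & V p x z & y \<noteq> z)" if "p \<in> G" for p
    using f V(2) that ck_inj by metis
  then show ?thesis using G_decide[of "%p. \<exists>x y z. V p x y & V p x z & y \<noteq> z"] by auto
qed

text \<open>Each condition in \<open>Qs s\<close> determines at most one value, so a functional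
  relation of the extension is covered by fewer than \<open>kap\<close> partial functions of the
  ground model. Single-valuedness at \<open>q\<close> is tested at the union of \<open>q\<close>
  with the guard.\<close>

lemma relation_support:
  assumes R: "N.D (%e. R (e 0) (e 1))" and f: "!!x y z. R x y ==> R x z ==> y = z"
  shows "\<exists>V s. s \<E> Ss & D (%e. V (e 0) (e 1) (e 2)) & (\<forall>q x y. V q x y --> q \<E> Qs s) &
    (\<forall>x y. R (ck x) (ck y) \<longleftrightarrow> (\<exists>q\<in>G. V q x y)) & (\<forall>q x y z. V q x y --> V q x z --> y = z)"
proof -
  obtain V s where s: "s \<E> Ss" and V: "D (%e. V (e 0) (e 1) (e 2))" "!!p x y. V p x y ==> p \<E> PP"
    "!!p q x y. V p x y ==> p \<sqsubseteq> q ==> q \<E> PP ==> V q x y" "!!x y. R (ck x) (ck y) \<longleftrightarrow> (\<exists>p\<in>G. V p x y)"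
    "!!p x y. V p x y ==> V (rs s p) x y" using relation[OF R] by blast
  note [simp] = D_app3[OF V(1)]
  have "\<exists>p\<in>G. \<forall>q x y z. q \<E> PP --> p \<sqsubseteq> q --> V q x y --> V q x z --> y = z"
    by (rule functional_guard[OF V(1,4)]) (use f in blast)
  then obtain p0 where p0: "p0 \<in> G" "!!q x y z. q \<E> PP ==> p0 \<sqsubseteq> q ==> V q x y ==> V q x z ==> y = z"
    by blast
  define W where "W = (%q x y. V q x y & rs s q = q & rs s p0 \<sqsubseteq> q)"
  have "D (%e. W (e 0) (e 1) (e 2))" unfolding W_def by simp
  moreover have "W q x y ==> q \<E> Qs s" for q x y unfolding W_def Qs_iff using V(2) by blast
  moreover have "(\<exists>q\<in>G. W q x y) \<longleftrightarrow> R (ck x) (ck y)" for x y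
  proof
    assume "R (ck x) (ck y)"
    then obtain p where p: "p \<in> G" "V p x y" using V(4) by blast
    obtain r where r: "r \<in> G" "r \<E> PP" "p \<sqsubseteq> r" "p0 \<sqsubseteq> r" using G_join[OF p(1) p0(1)] by blast
    have "V (rs s r) x y" using V(3,5) p(2) r by blast
    then have "W (rs s r) x y" unfolding W_def using rs_mono[OF r(4)] by simp
    moreover have "rs s r \<in> G" using G_up[OF r(1) rs_PP[OF r(2)] rs_sub] .
    ultimately show "\<exists>q\<in>G. W q x y" by blast
  qed (use V(4) W_def in blast)
  moreover have "y = z" if "W q x y" "W q x z" for q x y z
  proof -
    have q: "q \<E> Qs s" "rs s p0 \<sqsubseteq> q" "V q x y" "V q x z" using that V(2) unfolding W_def by simp_all
    have *: "Un2 q p0 \<E> PP" "p0 \<sqsubseteq> Un2 q p0" "q \<sqsubseteq> Un2 q p0" using Qs_Un2[OF q(1) G_P[OF p0(1)] q(2)] by (simp_all add: sub_def)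
    show ?thesis using p0(2)[OF *(1,2)] V(3)[OF q(3) *(3,1)] V(3)[OF q(4) *(3,1)] by blast
  qed
  ultimately show ?thesis using s by (intro exI[of _ W] exI[of _ s]) blast
qed

text \<open>The Easton property puts into \<open>G\<close> a condition whose upper part reduces
  every decision about arguments in \<open>al n\<close> to lower parts. \<open>W r x y\<close> says
  that \<open>r\<close> together with this upper part forces the value \<open>y\<close>, hence
  compatible lower conditions agree.\<close>

lemma relation_lower:
  assumes R: "N.D (%e. R (e 0) (e 1))" and f: "!!x y z. R x y ==> R x z ==> y = z" and n: "n \<E> omega"
  shows "\<exists>W. D (%e. W (e 0) (e 1) (e 2)) & (\<forall>r x y. W r x y --> r \<E> PP & lo n r = r) &
    (\<forall>x y. x \<E> al n --> R (ck x) (ck y) \<longleftrightarrow> (\<exists>q\<in>G. W q x y)) &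
    (\<forall>q r x y z. W q x y --> W r x z --> isfn (Un2 q r) --> y = z)"
proof -
  obtain V s where s: "s \<E> Ss" and V: "D (%e. V (e 0) (e 1) (e 2))" "!!p x y. V p x y ==> p \<E> PP"
    "!!p q x y. V p x y ==> p \<sqsubseteq> q ==> q \<E> PP ==> V q x y" "!!x y. R (ck x) (ck y) \<longleftrightarrow> (\<exists>p\<in>G. V p x y)"
    using relation[OF R] by blast
  note [simp] = D_app3[OF V(1)]
  have "\<exists>p\<in>G. \<forall>q x y z. q \<E> PP --> p \<sqsubseteq> q --> V q x y --> V q x z --> y = z"
    by (rule functional_guard[OF V(1,4)]) (use f in blast)
  then obtain p0 where p0: "p0 \<in> G" "!!q x y z. q \<E> PP ==> p0 \<sqsubseteq> q ==> V q x y ==> V q x z ==> y = z"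
    by blast
  \<comment> \<open>A condition decides \<open>x\<close> by forcing a particular value or by
    excluding all values.\<close>
  define Dec where "Dec = (%x p. p \<E> PP & ((\<exists>y. V p x y) \<or> (\<forall>q y. p \<sqsubseteq> q --> \<not> V q x y)))"
  have DD: "D (%e. Dec (e 0) (e 1))" unfolding Dec_def by simp
  note [simp] = D_app2[OF DD]
  define Es where "Es = (%p. p \<E> PP & p0 \<sqsubseteq> p & (\<forall>x r. x \<E> al n --> r \<E> PP --> lo n r = r --> lo n p \<sqsubseteq> r -->
    (\<exists>r'. r' \<E> PP & lo n r' = r' & r \<sqsubseteq> r' & Dec x (Un2 r' (up n p)))))"
  have "\<exists>p\<in>G. p0 \<sqsubseteq> p & Es p"
  proof (rule G_dense[OF _ p0(1)])
    show "D (%e. Es (e 0))" unfolding Es_def by simp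
    fix q assume q: "q \<E> PP" "p0 \<sqsubseteq> q"
    have "\<exists>p. p \<E> PP & q \<sqsubseteq> p & (\<forall>x r. x \<E> al n --> r \<E> PP --> lo n r = r --> lo n p \<sqsubseteq> r -->
      (\<exists>r'. r' \<E> PP & lo n r' = r' & r \<sqsubseteq> r' & Dec x (Un2 r' (up n p))))"
    proof (rule easton[OF n DD q(1)])
      show "Dec x q" if "Dec x p" "p \<sqsubseteq> q" "q \<E> PP" for x p q
        using that V(3) sub_trans unfolding Dec_def by blast
      show "\<exists>q. q \<E> PP & p \<sqsubseteq> q & Dec x q" if "p \<E> PP" for x p
        using that V(2) sub_refl unfolding Dec_def by blast
    qed
    then show "\<exists>q'. q' \<E> PP & q \<sqsubseteq> q' & Es q'" unfolding Es_def using q(2) sub_trans by blast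
  qed
  then obtain p1 where p1: "p1 \<in> G" "p0 \<sqsubseteq> p1" "Es p1" by blast
  have up0: "lo n (up n p1) = zero" unfolding eq_zero by simp
  have upP: "up n p1 \<E> PP" using G_P[OF p1(1)] by simp
  note gl = glue[OF _ _ upP up0]
  define W where "W = (%r x y. r \<E> PP & lo n r = r & lo n p1 \<sqsubseteq> r & V (Un2 r (up n p1)) x y)"
  have "D (%e. W (e 0) (e 1) (e 2))" unfolding W_def by simp
  moreover have "W r x y ==> r \<E> PP & lo n r = r" for r x y unfolding W_def by blast
  moreover have "(\<exists>q\<in>G. W q x y) \<longleftrightarrow> R (ck x) (ck y)" if x: "x \<E> al n" for x y
  proof
    assume "\<exists>q\<in>G. W q x y"
    then obtain r where r: "r \<in> G" "W r x y" by blast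
    obtain u where u: "u \<in> G" "u \<E> PP" "r \<sqsubseteq> u" "p1 \<sqsubseteq> u" using G_join[OF r(1) p1(1)] by blast
    have "Un2 r (up n p1) \<sqsubseteq> u" using u(3,4) unfolding sub_def Un2_iff up_iff by blast
    then show "R (ck x) (ck y)" using V(3,4) u(1,2) r(2) unfolding W_def by blast
  next
    assume "R (ck x) (ck y)"
    then obtain p where p: "p \<in> G" "V p x y" using V(4) by blast
    have "\<exists>q\<in>G. p1 \<sqsubseteq> q & (\<exists>r. r \<E> PP & lo n r = r & lo n p1 \<sqsubseteq> r & r \<sqsubseteq> q & Dec x (Un2 r (up n p1)))"
    proof (rule G_dense[OF _ p1(1)])
      fix q assume q: "q \<E> PP" "p1 \<sqsubseteq> q"
      have ll: "lo n (lo n q) = lo n q" by (rule extensional) auto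
      have lq: "lo n p1 \<sqsubseteq> lo n q" using q(2) unfolding sub_def lo_iff by blast
      then obtain r where r: "r \<E> PP" "lo n r = r" "lo n q \<sqsubseteq> r" "Dec x (Un2 r (up n p1))"
        using p1(3) x lo_PP[OF q(1)] ll unfolding Es_def by blast
      have uq: "lo n (up n q) = zero" unfolding eq_zero by simp
      have "Un2 r (up n q) \<E> PP" using glue(1)[OF r(1,2) up_PP[OF q(1)] uq] .
      moreover have "q \<sqsubseteq> Un2 r (up n q)" using r(3) unfolding sub_def Un2_iff lo_iff up_iff by blast
      moreover have "r \<sqsubseteq> Un2 r (up n q)" by (simp add: sub_def)
      ultimately show "\<exists>q'. q' \<E> PP & q \<sqsubseteq> q' &
          (\<exists>r. r \<E> PP & lo n r = r & lo n p1 \<sqsubseteq> r & r \<sqsubseteq> q' & Dec x (Un2 r (up n p1)))"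
        using r lq sub_trans by blast
    qed simp
    then obtain q r where q: "q \<in> G" "p1 \<sqsubseteq> q" and r: "r \<E> PP" "lo n r = r" "lo n p1 \<sqsubseteq> r" "r \<sqsubseteq> q" "Dec x (Un2 r (up n p1))" by blast
    let ?t = "Un2 r (up n p1)"
    have tq: "?t \<sqsubseteq> q" using r(4) q(2) unfolding sub_def Un2_iff up_iff by blast
    have tG: "?t \<in> G" using G_up[OF q(1) gl(1)[OF r(1,2)] tq] .
    obtain u where u: "u \<in> G" "u \<E> PP" "?t \<sqsubseteq> u" "p \<sqsubseteq> u" using G_join[OF tG p(1)] by blast
    have "V u x y" using V(3) p(2) u by blast
    then obtain z where z: "V ?t x z" using r(5) u(3) unfolding Dec_def by blast
    then have "R (ck x) (ck z)" using V(4) tG by blast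
    then have "z = y" using f \<open>R (ck x) (ck y)\<close> ck_inj by blast
    moreover have "r \<in> G" using G_up[OF q(1) r(1,4)] .
    ultimately show "\<exists>q\<in>G. W q x y" unfolding W_def using r z by blast
  qed
  moreover have "y = z" if W: "W q x y" "W r x z" "isfn (Un2 q r)" for q r x y z
  proof -
    have q: "q \<E> PP" "lo n q = q" "lo n p1 \<sqsubseteq> q" "V (Un2 q (up n p1)) x y" and r: "r \<E> PP" "lo n r = r" "V (Un2 r (up n p1)) x z"
      using W(1,2) unfolding W_def by blast+
    have qr: "Un2 q r \<E> PP" using PP_Un2[OF q(1) r(1) W(3)] .
    have "lo n (Un2 q r) = Un2 (lo n q) (lo n r)" by (rule extensional) auto
    then have "Un2 (Un2 q r) (up n p1) \<E> PP" (is "?t \<E> _") using gl(1)[OF qr] q r by simp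
    moreover have "p1 \<sqsubseteq> ?t" using q(3) unfolding sub_def Un2_iff lo_iff up_iff by blast
    moreover have "Un2 q (up n p1) \<sqsubseteq> ?t" "Un2 r (up n p1) \<sqsubseteq> ?t" by (auto simp: sub_def)
    ultimately show ?thesis using p0(2)[of ?t x y z] V(3)[OF q(4)] V(3)[OF r(3)] p1(2) sub_trans by blast
  qed
  ultimately show ?thesis by (intro exI[of _ W]) blast
qed

end

section \<open>Uniform ultrafilters from well-ordered power sets\<close>

context zf
begin

definition small where "small m x \<longleftrightarrow> (\<exists>c. c \<E> m & x \<lesssim> c)"
lemma D_small [D_intros, simp]: "DF f ==> DF g ==> D (%e. small (f e) (g e))"
  by (rule D_app2[where R=small]) (unfold small_def, intro D_intros)
lemma small_le: "small m y ==> x \<lesssim> y ==> small m x" unfolding small_def using le_trans by blast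

lemma small_Un2: assumes m: "InfCard m" and xy: "small m x" "small m y" shows "small m (Un2 x y)"
proof -
  obtain c d where cd: "c \<E> m" "x \<lesssim> c" "d \<E> m" "y \<lesssim> d" using xy unfolding small_def by blast
  have O: "Ord c" "Ord d" using Ord_mem[OF InfCard_Ord[OF m]] cd by blast+
  let ?b = "Un2 c d"
  have b: "?b \<E> m" "Ord ?b" using Ord_Un2_cases[OF O] cd O by auto
  have "c \<sqsubseteq> ?b" "d \<sqsubseteq> ?b" by (simp_all add: sub_def)
  then have xb: "x \<lesssim> ?b" "y \<lesssim> ?b" using cd le_sub le_trans by blast+
  show ?thesis
  proof (cases "?b \<E> omega")
    case True
    then have "Fin (Un2 x y)" using Fin_Un2 xb unfolding Fin_def by blast
    then show ?thesis unfolding Fin_def small_def using subD[OF InfCard_omega_sub[OF m]] by blast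
  next
    case False
    obtain k where k: "Card k" "k \<sqsubseteq> ?b" "k \<approx> ?b" using ex_Card[OF b(2)] by blast
    have bk: "?b \<lesssim> k" using eqv_le[OF eqv_sym[OF k(3)]] .
    have "omega \<lesssim> k" using False Ord_not_mem[OF b(2) Ord_omega] le_sub bk le_trans by blast
    then have "InfCard k" unfolding InfCard_def using k(1) Card_le_sub[OF InfCard_Card[OF Card_omega] Card_Ord[OF k(1)]] by blast
    then have "Un2 x y \<lesssim> k" using Un2_le xb bk le_trans by blast
    then show ?thesis unfolding small_def using k(2) le_sub le_trans b(1) by blast
  qed
qed

lemma small_zero: "InfCard m ==> small m zero"
  unfolding small_def using subD[OF InfCard_omega_sub zero_omega] le_refl by blast

lemma small_full: "InfCard m ==> \<not> small m m"
  unfolding small_def using Card_mem_le[OF InfCard_Card] by blast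

lemma not_small_eqv: assumes m: "InfCard m" and x: "x \<sqsubseteq> m" "\<not> small m x" shows "x \<approx> m"
proof -
  obtain k where k: "Card k" "k \<sqsubseteq> m" "x \<approx> k" using le_Ord_Card[OF InfCard_Ord[OF m] le_sub[OF x(1)]] by blast
  have "\<not> k \<E> m" using x(2) eqv_le[OF k(3)] unfolding small_def by blast
  then show ?thesis using k Ord_sub_iff[OF Card_Ord[OF k(1)] InfCard_Ord[OF m]] by blast
qed

text \<open>A filter of large sets is extended along a well-ordering of the power set.\<close>

lemma uniform_exists:
  assumes m: "InfCard m" and d: "Ord d" "Pw m \<lesssim> d" shows "\<exists>U. uniform U m"
proof -
  obtain k where k: "Card k" "Pw m \<approx> k" using le_Ord_Card[OF d] by blast
  then obtain e where e: "!!x. x \<sqsubseteq> m ==> \<exists>i. i \<E> k & app e i = x"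
    using eqv_sym[OF k(2)] unfolding eqv_def bij_def by auto
  define good where "good = (%F. pfilter F m & (\<forall>x. x \<E> F --> \<not> small m x))"
  have goodD: "x \<sqsubseteq> m & \<not> small m x" "y \<E> F ==> Cap x y \<E> F" "x \<sqsubseteq> y ==> y \<sqsubseteq> m ==> y \<E> F" "m \<E> F"
    if "good F" "x \<E> F" for F x y using that pfilterD[of F m] unfolding good_def by blast+
  define F0 where "F0 = Sep (Pw m) (%x. small m (Dif m x))"
  define A where "A = (%i f. Un2 F0 (BU (Rep i (%j. app f j))))"
  \<comment> \<open>The set with number \<open>i\<close> is adjoined exactly if its traces on all
    members so far are large; otherwise the filter stays as it is. The start \<open>F0\<close>
    consists of the complements of small sets.\<close>
  define st where "st = (%i f. if (\<forall>y. y \<E> A i f --> \<not> small m (Cap y (app e i)))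
    then Sep (Pw m) (%z. \<exists>y. y \<E> A i f & Cap y (app e i) \<sqsubseteq> z) else A i f)"
  define H where "H = rec st"
  have DA: "DF (%e. A (e 0) (e 1))" unfolding A_def by simp
  note [simp] = DF_app2[OF DA]
  have Dst: "DF (%e. st (e 0) (e 1))" unfolding st_def by (intro DF_If) simp_all
  have DH [simp]: "DF f ==> DF (%e. H (f e))" for f unfolding H_def by (rule DF_rec[OF Dst])
  define B where "B = (%i. A i (lam i H))"
  have B: "x \<E> B i \<longleftrightarrow> x \<E> F0 \<or> (\<exists>j. j \<E> i & x \<E> H j)" for x i unfolding B_def A_def Un2_iff by (subst BU_Rep) auto
  have H: "H i = (if (\<forall>y. y \<E> B i --> \<not> small m (Cap y (app e i)))
    then Sep (Pw m) (%z. \<exists>y. y \<E> B i & Cap y (app e i) \<sqsubseteq> z) else B i)" for i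
    unfolding H_def rec_eq[OF Dst, of i] unfolding st_def B_def H_def ..
  have F0: "x \<E> F0 \<longleftrightarrow> x \<sqsubseteq> m & small m (Dif m x)" for x unfolding F0_def by simp
  have gF0: "good F0"
    unfolding good_def pfilter_def
  proof (intro conjI allI impI)
    have "Dif m m = zero" by (simp add: eq_zero)
    then show "m \<E> F0" unfolding F0 using small_zero[OF m] by simp
    fix x assume x: "x \<E> F0"
    show "x \<sqsubseteq> m" using x F0 by blast
    show ns: "\<not> small m x"
    proof
      assume "small m x"
      then have "small m (Un2 x (Dif m x))" using small_Un2[OF m] x F0 by blast
      moreover have "m \<sqsubseteq> Un2 x (Dif m x)" by (auto simp: sub_def)
      ultimately show False using small_le le_sub small_full[OF m] by blast
    qed
    fix y assume y: "x \<sqsubseteq> y" "y \<sqsubseteq> m"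
    have "Dif m y \<sqsubseteq> Dif m x" using y(1) by (auto simp: sub_def)
    then show "y \<E> F0" using x y(2) small_le le_sub unfolding F0 by blast
  next
    fix x y assume x: "x \<E> F0" and y: "y \<E> F0"
    have "Dif m (Cap x y) = Un2 (Dif m x) (Dif m y)" by (rule extensional) auto
    moreover have "Cap x y \<sqsubseteq> m" using x F0 by (auto simp: sub_def)
    ultimately show "Cap x y \<E> F0" using x y small_Un2[OF m] F0 by simp
  next
    have "Dif m zero = m" by (rule extensional) auto
    then show "\<not> zero \<E> F0" unfolding F0 using small_full[OF m] by simp
  qed
  have gB: "good (B i)" if i: "Ord i" "!!j. j \<E> i ==> good (H j) & F0 \<sqsubseteq> H j & (\<forall>l. l \<E> j --> H l \<sqsubseteq> H j)" for i
  proof -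
    have each: "\<exists>F. good F & x \<E> F & y \<E> F & F \<sqsubseteq> B i" if xy: "x \<E> B i" "y \<E> B i" for x y
    proof -
      have FB: "F0 \<sqsubseteq> B i" "!!j. j \<E> i ==> H j \<sqsubseteq> B i" unfolding sub_def B by blast+
      consider "x \<E> F0" "y \<E> F0" | j where "j \<E> i" "x \<E> H j" "y \<E> F0" | j where "j \<E> i" "y \<E> H j" "x \<E> F0"
        | j l where "j \<E> i" "l \<E> i" "x \<E> H j" "y \<E> H l" using xy unfolding B by blast
      then show ?thesis
      proof cases
        case 1 then show ?thesis using gF0 FB(1) by blast
      next
        case (2 j) then show ?thesis using i(2)[OF 2(1)] FB(2)[OF 2(1)] subD by blast
      next
        case (3 j) then show ?thesis using i(2)[OF 3(1)] FB(2)[OF 3(1)] subD by blast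
      next
        case (4 j l)
        have "j \<E> l \<or> j = l \<or> l \<E> j" using Ord_linear[OF Ord_mem[OF i(1) 4(1)] Ord_mem[OF i(1) 4(2)]] .
        then show ?thesis using i(2)[OF 4(1)] i(2)[OF 4(2)] FB(2)[OF 4(1)] FB(2)[OF 4(2)] 4(3,4) subD by blast
      qed
    qed
    have "m \<E> F0" using gF0 pfilterD(2) unfolding good_def by blast
    then have "m \<E> B i" unfolding B by blast
    moreover have "x \<sqsubseteq> m & \<not> small m x" if x: "x \<E> B i" for x using each[OF x x] goodD(1) by blast
    moreover have "Cap x y \<E> B i" if xy: "x \<E> B i" "y \<E> B i" for x y
    proof -
      obtain F where F: "good F" "x \<E> F" "y \<E> F" "F \<sqsubseteq> B i" using each[OF xy] by blast
      show ?thesis using subD[OF F(4) goodD(2)[OF F(1,2,3)]] .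
    qed
    moreover have "y \<E> B i" if x: "x \<E> B i" "x \<sqsubseteq> y" "y \<sqsubseteq> m" for x y
    proof -
      obtain F where F: "good F" "x \<E> F" "F \<sqsubseteq> B i" using each[OF x(1) x(1)] by blast
      show ?thesis using subD[OF F(3) goodD(3)[OF F(1,2) x(2,3)]] .
    qed
    ultimately show ?thesis using small_zero[OF m] unfolding good_def pfilter_def by blast
  qed
  have step: "good (H i) & F0 \<sqsubseteq> H i & (\<forall>l. l \<E> i --> H l \<sqsubseteq> H i)" if "Ord i" for i
  proof (rule Ord_induct[of "%i. good (H i) & F0 \<sqsubseteq> H i & (\<forall>l. l \<E> i --> H l \<sqsubseteq> H i)", OF _ _ that])
    show "D (%e. good (H (e 0)) & F0 \<sqsubseteq> H (e 0) & (\<forall>l. l \<E> e 0 --> H l \<sqsubseteq> H (e 0)))"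
      unfolding good_def pfilter_def by simp
    fix i assume i: "Ord i" "!!j. j \<E> i ==> good (H j) & F0 \<sqsubseteq> H j & (\<forall>l. l \<E> j --> H l \<sqsubseteq> H j)"
    have gB: "good (B i)" using gB[OF i] .
    have FB: "F0 \<sqsubseteq> B i" "!!j. j \<E> i ==> H j \<sqsubseteq> B i" unfolding sub_def B by blast+
    have "good (H i) & B i \<sqsubseteq> H i"
    proof (cases "\<forall>y. y \<E> B i --> \<not> small m (Cap y (app e i))")
      case False
      then have "H i = B i" unfolding H[of i] by (rule if_not_P)
      then show ?thesis using gB by simp
    next
      case True
      have "DF (%e. B (e 0))" unfolding B_def by simp
      note [simp] = DF_app1[OF this]
      have Hi: "z \<E> H i \<longleftrightarrow> z \<sqsubseteq> m & (\<exists>y. y \<E> B i & Cap y (app e i) \<sqsubseteq> z)" for z using True by (subst H) simp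
      have Bm: "y \<sqsubseteq> m" if "y \<E> B i" for y using goodD(1)[OF gB that] by blast
      have BH: "B i \<sqsubseteq> H i"
      proof (rule subI)
        fix y assume y: "y \<E> B i"
        have "Cap y (app e i) \<sqsubseteq> y" by (simp add: sub_def)
        then show "y \<E> H i" unfolding Hi using y Bm by blast
      qed
      have ns: "\<not> small m z" if "z \<E> H i" for z using that True small_le le_sub unfolding Hi by blast
      have "Cap z w \<E> H i" if zw: "z \<E> H i" "w \<E> H i" for z w
      proof -
        obtain x y where xy: "x \<E> B i" "Cap x (app e i) \<sqsubseteq> z" "y \<E> B i" "Cap y (app e i) \<sqsubseteq> w" using zw unfolding Hi by blast
        have "Cap x y \<E> B i" using goodD(2)[OF gB xy(1,3)] .
        moreover have "Cap (Cap x y) (app e i) \<sqsubseteq> Cap z w" using xy(2,4) by (auto simp: sub_def)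
        moreover have "Cap z w \<sqsubseteq> m" using zw(1) unfolding Hi sub_def by auto
        ultimately show ?thesis unfolding Hi by blast
      qed
      moreover have "w \<E> H i" if "z \<E> H i" "z \<sqsubseteq> w" "w \<sqsubseteq> m" for z w using that sub_trans unfolding Hi by blast
      moreover have "m \<E> H i" using gB BH subD pfilterD(2) unfolding good_def by blast
      moreover have "z \<sqsubseteq> m" if "z \<E> H i" for z using that Hi by blast
      moreover have "\<not> zero \<E> H i" using ns small_zero[OF m] by blast
      ultimately show ?thesis using ns BH unfolding good_def pfilter_def by blast
    qed
    then show "good (H i) & F0 \<sqsubseteq> H i & (\<forall>l. l \<E> i --> H l \<sqsubseteq> H i)" using FB sub_trans by blast
  qed
  have Ok: "Ord k" using k Card_Ord by blast
  have gU: "good (B k)" using gB[OF Ok] step Ord_mem[OF Ok] by blast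
  \<comment> \<open>A rejected set has a small trace on some member of the final filter. If a set
    and its complement were both rejected, the two members responsible would have a small
    intersection.\<close>
  have "x \<E> B k \<or> (\<exists>y. y \<E> B k & small m (Cap y x))" if x: "x \<sqsubseteq> m" for x
  proof -
    obtain i where i: "i \<E> k" "app e i = x" using e[OF x] by blast
    have Oi: "Ord i" using Ord_mem[OF Ok i(1)] .
    have Bi: "good (B i)" using gB[OF Oi] step Ord_mem[OF Oi] by blast
    have Bik: "B i \<sqsubseteq> B k" unfolding sub_def B using Ord_trans[OF Ok i(1)] by blast
    show ?thesis
    proof (cases "\<forall>y. y \<E> B i --> \<not> small m (Cap y x)")
      case True
      have "DF (%e. B (e 0))" unfolding B_def by simp
      note [simp] = DF_app1[OF this]
      have "m \<E> B i" using Bi pfilterD(2) unfolding good_def by blast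
      moreover have "Cap m x \<sqsubseteq> x" by (simp add: sub_def)
      ultimately have "x \<E> H i" using True x by (subst H) (auto simp: i(2))
      then show ?thesis using i(1) B by blast
    qed (use subD[OF Bik] in blast)
  qed note cases = this
  have "ultra (B k) m"
    unfolding ultra_def
  proof (intro conjI allI impI)
    show "pfilter (B k) m" using gU good_def by blast
    fix x assume x: "x \<sqsubseteq> m"
    have dm: "Dif m x \<sqsubseteq> m" by (simp add: sub_def)
    show "x \<E> B k \<or> Dif m x \<E> B k"
    proof (rule ccontr)
      assume *: "\<not> (x \<E> B k \<or> Dif m x \<E> B k)"
      obtain y where y: "y \<E> B k" "small m (Cap y x)" using cases[OF x] * by blast
      obtain z where z: "z \<E> B k" "small m (Cap z (Dif m x))" using cases[OF dm] * by blast
      have yz: "Cap y z \<E> B k" using goodD(2)[OF gU y(1) z(1)] .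
      have "y \<sqsubseteq> m" using goodD(1)[OF gU y(1)] by blast
      then have "Cap y z \<sqsubseteq> Un2 (Cap y x) (Cap z (Dif m x))" by (auto simp: sub_def)
      then have "small m (Cap y z)" using small_Un2[OF m y(2) z(2)] small_le le_sub by blast
      then show False using yz gU good_def by blast
    qed
  qed
  moreover have "x \<approx> m" if "x \<E> B k" for x
    using not_small_eqv[OF m] goodD(1)[OF gU that] by blast
  ultimately show ?thesis unfolding uniform_def by blast
qed

end

section \<open>Cardinals of the extension\<close>

context extension
begin

text \<open>The case \<open>n = zero\<close> of the reduction to lower parts: these are empty and
  \<open>al zero\<close> is \<open>omega\<close>, so a single condition in \<open>G\<close> decides
  the whole sequence.\<close>

lemma no_new_sequence:
  assumes f: "!!n. n \<E> omega ==> N (N.app f (ck n)) (ck m)"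
  shows "\<exists>F. DF (%e. F (e 0)) & (\<forall>n. n \<E> omega --> F n \<E> m & N.app f (ck n) = ck (F n))"
proof -
  have "\<exists>W. D (%e. W (e 0) (e 1) (e 2)) & (\<forall>r x y. W r x y --> r \<E> PP & lo zero r = r) &
    (\<forall>x y. x \<E> al zero --> (N.app f (ck x) = ck y) \<longleftrightarrow> (\<exists>q\<in>G. W q x y)) &
    (\<forall>q r x y z. W q x y --> W r x z --> isfn (Un2 q r) --> y = z)"
    by (rule relation_lower) simp_all
  then obtain W where W: "D (%e. W (e 0) (e 1) (e 2))" "!!r x y. W r x y ==> r \<E> PP & lo zero r = r"
    "!!x y. x \<E> al zero ==> (N.app f (ck x) = ck y) \<longleftrightarrow> (\<exists>q\<in>G. W q x y)" by blast
  note [simp] = D_app3[OF W(1)]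
  have W0: "q = zero" if "W q x y" for q x y
  proof -
    have "lo zero q = zero" by (simp add: eq_zero)
    then show ?thesis using W(2)[OF that] by simp
  qed
  let ?F = "%n. the_el (%y. W zero n y)"
  have "?F n \<E> m & N.app f (ck n) = ck (?F n)" if n: "n \<E> omega" for n
  proof -
    obtain y where y: "y \<E> m" "N.app f (ck n) = ck y" using f[OF n] unfolding N_ck by blast
    have "?F n = y"
    proof (rule the_el_eq)
      show "W zero n y" using W(3)[of n y] n al_zero y(2) W0 by auto
      fix z assume "W zero n z"
      then have "N.app f (ck n) = ck z" using W(3)[of n z] n al_zero pt_G by auto
      then show "z = y" using y(2) ck_inj by simp
    qed
    then show ?thesis using y by simp
  qed
  moreover have "DF (%e. ?F (e 0))" by simp
  ultimately show ?thesis by (intro exI[of _ ?F]) blast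
qed

text \<open>Invert the alleged injection. Distinct possible preimages of the same point are forced
  by incompatible lower conditions, so each point has at most \<open>al n\<close> of them by the
  chain condition, and \<open>al (succ n)\<close> would be a union of \<open>al n\<close> such
  sets.\<close>

lemma al_preserved: assumes n: "n \<E> omega" shows "\<not> N.le (ck (al (succ n))) (ck (al n))"
proof
  let ?t = "al (succ n)"
  assume "N.le (ck ?t) (ck (al n))"
  from N.leD[OF this] obtain f where f: "!!y. N y (ck ?t) ==> N (N.app f y) (ck (al n))"
    "!!y z. N y (ck ?t) ==> N z (ck ?t) ==> N.app f y = N.app f z ==> y = z" by blast
  have "\<exists>W. D (%e. W (e 0) (e 1) (e 2)) & (\<forall>r x y. W r x y --> r \<E> PP & lo n r = r) &
    (\<forall>x y. x \<E> al n --> (N (ck y) (ck ?t) & N.app f (ck y) = ck x) \<longleftrightarrow> (\<exists>q\<in>G. W q x y)) &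
    (\<forall>q r x y z. W q x y --> W r x z --> isfn (Un2 q r) --> y = z)"
    by (rule relation_lower[of "%x y. N y (ck ?t) & N.app f y = x", OF _ _ n]) (simp, use f(2) in blast)
  then obtain W where W: "D (%e. W (e 0) (e 1) (e 2))" "!!r x y. W r x y ==> r \<E> PP & lo n r = r"
    "!!x y. x \<E> al n ==> (N (ck y) (ck ?t) & N.app f (ck y) = ck x) \<longleftrightarrow> (\<exists>q\<in>G. W q x y)"
    "!!q r x y z. W q x y ==> W r x z ==> isfn (Un2 q r) ==> y = z" by blast
  note [simp] = D_app3[OF W(1)]
  define F where "F = (%x. Sep ?t (%y. \<exists>q. W q x y))"
  have DF: "DF (%e. F (e 0))" unfolding F_def by simp
  have Fle: "F x \<lesssim> al n" for x
  proof -
    have "F x \<sqsubseteq> ?t" unfolding F_def by (simp add: sub_def)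
    then obtain k where k: "Card k" "k \<sqsubseteq> ?t" "F x \<approx> k" using le_Ord_Card[OF al_Ord le_sub] by blast
    have "k \<noteq> ?t"
    proof
      assume "k = ?t"
      then obtain j where j: "!!y. y \<E> ?t ==> app j y \<E> F x" "!!y z. y \<E> ?t ==> z \<E> ?t ==> app j y = app j z ==> y = z"
        using leD[OF eqv_le[OF eqv_sym[OF k(3)]]] by blast
      have "\<exists>c. fn c ?t & (\<forall>y. y \<E> ?t --> app c y \<E> Sep PP (%q. W q x (app j y)))"
      proof (rule choice_fun)
        fix y assume "y \<E> ?t"
        then have "\<exists>q. W q x (app j y)" using j(1) unfolding F_def by simp
        then show "\<exists>z. z \<E> Sep PP (%q. W q x (app j y))" using W(2) by auto
      qed simp
      then obtain c where c: "!!y. y \<E> ?t ==> app c y \<E> PP & W (app c y) x (app j y)" by auto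
      obtain y z where yz: "y \<E> ?t" "z \<E> ?t" "y \<noteq> z" "isfn (Un2 (lo n (app c y)) (lo n (app c z)))"
        using lo_cc[OF n, of "app c"] c by auto
      then have "isfn (Un2 (app c y) (app c z))" using W(2) c by metis
      then have "app j y = app j z" using W(4) c yz(1,2) by blast
      then show False using j(2) yz by blast
    qed
    then have "k \<E> ?t" using k(2) Ord_sub_iff[OF Card_Ord[OF k(1)] al_Ord] by blast
    then show ?thesis using al_succ(2)[OF omega_Ord_mem[OF n]] eqv_le[OF k(3)] le_trans by blast
  qed
  have "?t \<sqsubseteq> BU (Rep (al n) F)"
  proof (rule subI)
    fix y assume y: "y \<E> ?t"
    obtain x where x: "x \<E> al n" "N.app f (ck y) = ck x" using f(1)[of "ck y"] y unfolding N_ck by auto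
    then have "\<exists>q\<in>G. W q x y" using W(3)[OF x(1), of y] y by simp
    then have "y \<E> F x" unfolding F_def using y by auto
    then show "y \<E> BU (Rep (al n) F)" by (subst BU_Rep[OF DF]) (use x(1) in blast)
  qed
  then have "?t \<lesssim> al n" using union_le[OF al_Inf le_refl DF Fle] le_sub le_trans by blast
  moreover have "al n \<E> ?t" by (rule al_mono) simp
  ultimately show False using Card_mem_le[OF InfCard_Card[OF al_Inf]] by blast
qed

lemma N_InfCard_al: assumes "n \<E> omega" shows "N.InfCard (ck (al n))"
proof -
  have "n = zero \<or> (\<exists>m. m \<E> omega & n = succ m)" using omega_cases assms by blast
  then show ?thesis
  proof
    assume "n = zero" then show ?thesis using N.Card_omega by (simp add: al_zero)
  next
    assume "\<exists>m. m \<E> omega & n = succ m"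
    then obtain m where m: "m \<E> omega" "n = succ m" by blast
    have "\<not> N.le (ck (al n)) a" if a: "N a (ck (al n))" for a
    proof
      assume *: "N.le (ck (al n)) a"
      obtain x where x: "x \<E> al n" "a = ck x" using a unfolding N_ck by blast
      then have "N.le a (ck (al m))" using ck_le al_succ(2)[OF omega_Ord_mem[OF m(1)]] m(2) by blast
      then show False using al_preserved[OF m(1)] N.le_trans[OF *] m(2) by blast
    qed
    then show ?thesis unfolding N.InfCard_def N.Card_def using InfCard_omega_sub[OF al_Inf] by simp
  qed
qed

lemma ck_BU [simp]: "N.BU (ck x) = ck (BU x)" by (rule ck_eqI) (auto simp: N_ck, blast)

lemma N_InfCard_lamb: "N.InfCard (ck lamb)"
proof -
  have "lamb = BU (Rep omega al)" by (rule extensional, subst BU_Rep) (simp_all add: lamb_iff)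
  then have "ck lamb = N.BU (ck (Rep omega al))" by simp
  moreover have "N.Card (N.BU (ck (Rep omega al)))"
    by (rule N.Card_sup) (use N_InfCard_al N.InfCard_Card in \<open>auto simp: N_ck\<close>)
  ultimately have "N.Card (ck lamb)" by (simp only:)
  moreover have "omega \<sqsubseteq> lamb" using InfCard_omega_sub[OF al_Inf] .
  ultimately show ?thesis unfolding N.InfCard_def by simp
qed

text \<open>The restriction to a support has a name whose conditions are fixed by all flips
  respecting that support, and so belongs to the extension.\<close>

lemma restricted_generic:
  assumes "s \<E> Ss" shows "\<exists>c. \<forall>y. N y c \<longleftrightarrow> (\<exists>r. r \<E> Qs s & r \<in> G & y = ck r)"
proof -
  let ?h = "Rep (Qs s) (%r. pair r r)"
  have h: "pair x r \<E> ?h \<longleftrightarrow> x = r & r \<E> Qs s" for x r by auto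
  have "N y (v (hn ?h)) \<longleftrightarrow> (\<exists>x r. pair x r \<E> ?h & r \<in> G & y = ck x)" for y
    by (rule check_name(2)[OF _ assms]) (auto intro: ac_rs)
  then show ?thesis unfolding h by (intro exI[of _ "v (hn ?h)"]) blast
qed

text \<open>The ground model well-orders the relations between \<open>al n\<close> and the lower
  conditions. Decoding such a relation by the restricted generic filter maps an ordinal onto the
  power set, and a surjection from an ordinal can be inverted without choice.\<close>

lemma N_power_wellorder:
  assumes n: "n \<E> omega" shows "\<exists>d. N.Ord d & N.le (N.Pw (ck (al n))) d"
proof -
  let ?s = "pair n zero"
  have sS: "?s \<E> Ss" using n Ss_iff kap_zero by blast
  obtain c where c: "!!y. N y c \<longleftrightarrow> (\<exists>r. r \<E> Qs ?s & r \<in> G & y = ck r)" using restricted_generic[OF sS] by blast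
  let ?Y = "Pw (prod (al n) (Qs ?s))"
  obtain k where k: "Card k" "?Y \<approx> k" using ex_card_eqv by blast
  obtain e where e: "fn e k" "!!y. y \<E> ?Y ==> \<exists>i. i \<E> k & app e i = y"
    using eqv_sym[OF k(2)] unfolding eqv_def bij_def inj_def by blast
  let ?F = "%i. N.Sep (ck (al n)) (%x. \<exists>r. N r c & N (N.pair x r) (N.app (ck e) i))"
  have "N.le (N.Pw (ck (al n))) (ck k)"
  proof (rule N.surj_le[of ?F])
    show "N.Ord (ck k)" using k Card_Ord by simp
    fix X assume X: "N X (N.Pw (ck (al n)))"
    \<comment> \<open>A set is treated as a functional relation by giving its members the only value
      \<open>zero\<close>.\<close>
    have "\<exists>W. D (%e. W (e 0) (e 1) (e 2)) & (\<forall>r x y. W r x y --> r \<E> PP & lo n r = r) &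
      (\<forall>x y. x \<E> al n --> (N (ck x) X & ck y = ck zero) \<longleftrightarrow> (\<exists>q\<in>G. W q x y)) &
      (\<forall>q r x y z. W q x y --> W r x z --> isfn (Un2 q r) --> y = z)"
      by (rule relation_lower[of "%x y. N x X & y = ck zero", OF _ _ n]) simp_all
    then obtain W where W: "D (%e. W (e 0) (e 1) (e 2))" "!!r x y. W r x y ==> r \<E> PP & lo n r = r"
      "!!x y. x \<E> al n ==> (N (ck x) X & ck y = ck zero) \<longleftrightarrow> (\<exists>q\<in>G. W q x y)" by blast
    note [simp] = D_app3[OF W(1)]
    let ?h = "Sep (prod (al n) (Qs ?s)) (%z. W (sn z) (fs z) zero)"
    have "?h \<E> ?Y" by (simp add: sub_def)
    then obtain i where i: "i \<E> k" "app e i = ?h" using e(2) by blast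
    have "?F (ck i) = X"
    proof (rule N.extensional)
      fix z
      have F: "N z (?F (ck i)) \<longleftrightarrow> N z (ck (al n)) & (\<exists>r. N r c & N (N.pair z r) (ck ?h))"
        unfolding ck_fn(2)[OF e(1) i(1), unfolded i(2), symmetric] by simp
      show "N z (?F (ck i)) \<longleftrightarrow> N z X"
      proof
        assume "N z (?F (ck i))"
        then have z: "N z (ck (al n))" "\<exists>r. N r c & N (N.pair z r) (ck ?h)" using F by blast+
        obtain w where w: "N w c" "N (N.pair z w) (ck ?h)" using z(2) by (elim exE conjE)
        obtain r where r: "r \<in> G" "w = ck r" using w(1) c by auto
        obtain x where "x \<E> al n" "z = ck x" using z(1) N_ck by auto
        note x = this r(1) w(2)[unfolded r(2)]
        then have "W r x zero" by simp
        then show "N z X" using W(3)[OF x(1), of zero] x(2,3) by blast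
      next
        assume z: "N z X"
        then obtain x where x: "x \<E> al n" "z = ck x" using X unfolding N.Pw_iff N.sub_def N_ck by blast
        then obtain r where r: "r \<in> G" "W r x zero" using W(3)[OF x(1), of zero] z by blast
        then have q: "r \<E> Qs ?s" using W(2)[of r x zero] unfolding lo_def by simp
        then have "N (N.pair z (ck r)) (ck ?h)" using x r by simp
        then show "N z (?F (ck i))" unfolding F using c q r(1) x by (auto simp: N_ck[of z])
      qed
    qed
    then show "\<exists>x. N x (ck k) & ?F x = X" using i(1) by (intro exI[of _ "ck i"]) simp
  qed simp
  then show ?thesis using k Card_Ord by (intro exI[of _ "ck k"]) simp
qed

lemma uniform_al: "n \<E> omega ==> \<exists>U. N.uniform U (ck (al n))"
  using N.uniform_exists[OF N_InfCard_al] N_power_wellorder by blast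

subsection \<open>No uniform ultrafilter on \<open>\<aleph>\<^sub>\<omega>\<close>\<close>

lemma not_uniform_lamb: "\<not> N.uniform U (ck lamb)"
proof
  assume U: "N.uniform U (ck lamb)"
  obtain s where s: "s \<E> Ss" "!!g. g \<E> Gs ==> fx s g ==> Eq (tw g (nm U)) (nm U) zero"
    using HS_symm[OF HS_nm] unfolding symm_def by blast
  obtain m c where m: "m \<E> omega" "s = pair m c" using s(1) Ss_iff by blast
  have mo: "m \<noteq> omega" using m(1) by auto
  \<comment> \<open>The coordinates of level \<open>m\<close>, the first level that the support of
    \<open>U\<close> leaves free.\<close>
  let ?i = "%x. pair m x"
  let ?r = "%x u. upair (pair (?i x) u) (pair (?i x) u)"
  have co: "?i x \<E> coords" if "x \<E> lamb" for x unfolding coords_iff using m(1) that by blast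
  have vl: "vl (?i x) = succ zero" for x unfolding vl_def using mo by simp
  have rP: "?r x zero \<E> PP" "?r x (succ zero) \<E> PP" if "x \<E> lamb" for x
    using PP_single[OF co[OF that]] by (simp_all add: vl sub_def)
  let ?h = "Rep lamb (%x. pair x (?r x (succ zero)))"
  \<comment> \<open>The name of the generic subset needs level \<open>m\<close> in its support, one
    level more than that of \<open>U\<close>.\<close>
  let ?s = "pair (succ m) zero"
  have sS: "?s \<E> Ss" unfolding Ss_iff using succ_omega[OF m(1)] kap_zero by blast
  have h: "pair x r \<E> ?h \<longleftrightarrow> x \<E> lamb & r = ?r x (succ zero)" for x r by auto
  have fixr: "ac g r = r" if "fx ?s g" "pair x r \<E> ?h" for g x r
  proof -
    have x: "x \<E> lamb" "r = ?r x (succ zero)" using that(2) h by blast+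
    have "app g (?i x) = zero" using that(1) co[OF x(1)] unfolding fx_def inS_def by simp
    then show ?thesis unfolding x(2) by (intro ac_fix[OF rP(2)[OF x(1)]]) simp
  qed
  have hP: "\<exists>x r. r \<E> PP & z = pair x r" if "z \<E> ?h" for z using that rP(2) by auto
  define b where "b = hn ?h"
  have b1: "HS b" unfolding b_def by (rule check_name(1)[OF _ sS]) (rule hP, assumption, rule fixr)
  have b2: "N y (v b) \<longleftrightarrow> (\<exists>x r. pair x r \<E> ?h & r \<in> G & y = ck x)" for y
    unfolding b_def by (rule check_name(2)[OF _ sS]) (rule hP, assumption, rule fixr)
  have b3: "N y (v (tw g b)) \<longleftrightarrow> (\<exists>x r. pair x r \<E> ?h & ac g r \<in> G & y = ck x)" if g: "g \<E> Gs" for g y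
    unfolding b_def by (rule check_name(3)[OF _ sS _ g]) (rule hP, assumption, rule fixr)
  note b = b1 b2 b3
  have Bx: "N (ck x) (v b) \<longleftrightarrow> ?r x (succ zero) \<in> G" if "x \<E> lamb" for x unfolding b(2) h using that by auto
  have Bsub: "N.sub (v b) (ck lamb)" unfolding N.sub_def b(2) h N_ck by blast
  have one: "?r x zero \<in> G \<or> ?r x (succ zero) \<in> G" "\<not> (?r x zero \<in> G & ?r x (succ zero) \<in> G)" if x: "x \<E> lamb" for x
  proof -
    have "\<exists>q\<in>G. zero \<sqsubseteq> q & (pair (?i x) zero \<E> q \<or> pair (?i x) (succ zero) \<E> q)"
    proof (rule G_dense[OF _ pt_G])
      fix q assume q: "q \<E> PP"
      show "\<exists>q'. q' \<E> PP & q \<sqsubseteq> q' & (pair (?i x) zero \<E> q' \<or> pair (?i x) (succ zero) \<E> q')"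
      proof (cases "\<exists>u. pair (?i x) u \<E> q")
        case True
        then obtain u where u: "pair (?i x) u \<E> q" by blast
        have us: "u \<sqsubseteq> succ zero" using PP_pair[OF q u] vl by simp
        have "u = zero \<or> u = succ zero" using sub_one[OF us] .
        then show ?thesis using u q sub_refl by blast
      next
        case False
        have "isfn (Un2 q (?r x zero))" using PP_isfn[OF q] False unfolding isfn_def by auto
        from PP_Un2[OF q rP(1)[OF x] this] show ?thesis
          by (intro exI[of _ "Un2 q (?r x zero)"]) (simp add: sub_def)
      qed
    qed simp
    then obtain q where q: "q \<in> G" "?r x zero \<sqsubseteq> q \<or> ?r x (succ zero) \<sqsubseteq> q" unfolding sub_def by auto
    then show "?r x zero \<in> G \<or> ?r x (succ zero) \<in> G" using G_up[OF q(1) rP(1)[OF x]] G_up[OF q(1) rP(2)[OF x]] by blast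
    show "\<not> (?r x zero \<in> G & ?r x (succ zero) \<in> G)"
    proof
      assume "?r x zero \<in> G & ?r x (succ zero) \<in> G"
      then obtain q where q: "q \<E> PP" "?r x zero \<sqsubseteq> q" "?r x (succ zero) \<sqsubseteq> q" using G_join by blast
      then have "pair (?i x) zero \<E> q" "pair (?i x) (succ zero) \<E> q" by (simp_all add: sub_def)
      then show False using PP_isfn[OF q(1)] succ_neq_zero unfolding isfn_def by blast
    qed
  qed
  \<comment> \<open>The flip of all coordinates of level \<open>m\<close> outside the domain of
    \<open>p\<close>. It fixes \<open>p\<close> and respects the support of
    \<open>U\<close>.\<close>
  let ?g = "%p. lam coords (%i. if fs i = m & \<not> (\<exists>u. pair i u \<E> p) then succ zero else zero)"
  have g: "?g p \<E> Gs" "fx s (?g p)" "p \<E> PP ==> ac (?g p) p = p"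
    "x \<E> lamb ==> \<not> (\<exists>u. pair (?i x) u \<E> p) ==> ac (?g p) (?r x (succ zero)) = ?r x zero" for p x
  proof -
    have DF: "DF (%e. if fs (e 0) = m & \<not> (\<exists>u. pair (e 0) u \<E> p) then succ zero else zero)" by (intro DF_If) simp_all
    have ag: "app (?g p) i = (if fs i = m & \<not> (\<exists>u. pair i u \<E> p) then succ zero else zero)" if "i \<E> coords" for i
      by (rule app_lam[OF DF that])
    show "?g p \<E> Gs" by (rule Gs_lam[OF DF]) (use mo in \<open>auto simp: vl_def sub_def\<close>)
    have "\<not> inS s i" if "i \<E> coords" "fs i = m" for i using that mo unfolding m(2) inS_def by simp
    then show "fx s (?g p)" unfolding fx_def using ag by auto
    show "ac (?g p) p = p" if "p \<E> PP"
    proof (rule ac_fix[OF that])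
      fix i u assume u: "pair i u \<E> p"
      then have "i \<E> coords" using PP_pair[OF that u] by simp
      then show "app (?g p) i = zero" using ag u by auto
    qed
    show "ac (?g p) (?r x (succ zero)) = ?r x zero" if x: "x \<E> lamb" "\<not> (\<exists>u. pair (?i x) u \<E> p)"
    proof -
      have a: "app (?g p) (?i x) = succ zero" using ag[OF co[OF x(1)]] x(2) by simp
      show ?thesis by (rule extensional, subst ac_iff[OF rP(2)[OF x(1)]]) (use a co[OF x(1)] in auto)
    qed
  qed
  define d where "d = (%p. Sep lamb (%x. \<exists>u. pair (?i x) u \<E> p))"
  have d: "x \<E> d p \<longleftrightarrow> x \<E> lamb & (\<exists>u. pair (?i x) u \<E> p)" for x p unfolding d_def by simp
  \<comment> \<open>The set \<open>d p\<close> has at most \<open>al m\<close> elements, whereas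
    members of \<open>U\<close> have size \<open>lamb\<close>, which is still a cardinal in the
    extension.\<close>
  have dsmall: "\<not> N C U" if p: "p \<in> G" and C: "N.sub C (ck (d p))" for p C
  proof
    assume "N C U"
    then have CL: "N.le (ck lamb) C" using U N.eqv_sym N.eqv_le unfolding N.uniform_def by blast
    have pP: "p \<E> PP" using G_P p .
    have "d p \<lesssim> lev p m"
    proof (rule leI[of "%x. pair (?i x) (app p (?i x))"])
      fix x assume "x \<E> d p"
      then obtain u where u: "pair (?i x) u \<E> p" unfolding d by blast
      then have "app p (?i x) = u" using isfn_app PP_isfn[OF pP] by blast
      then show "pair (?i x) (app p (?i x)) \<E> lev p m" using u by simp
    qed simp_all
    moreover have "lev p m \<lesssim> al m" using pP m(1) unfolding PP_iff by simp
    ultimately have "N.le (ck (d p)) (ck (al m))" using le_trans ck_le by blast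
    then have "N.le (ck lamb) (ck (al m))" using CL N.le_sub[OF C] N.le_trans by blast
    moreover have "N (ck (al m)) (ck lamb)" using al_mono[OF m(1)] by simp
    ultimately show False using N.Card_mem_le[OF N.InfCard_Card[OF N_InfCard_lamb]] by blast
  qed
  have gB: "N (ck x) (v (tw (?g p) b)) \<longleftrightarrow> \<not> N (ck x) (v b)" if x: "x \<E> lamb" "\<not> x \<E> d p" for x p
  proof -
    have "\<not> (\<exists>u. pair (?i x) u \<E> p)" using x d by blast
    then have "N (ck x) (v (tw (?g p) b)) \<longleftrightarrow> ?r x zero \<in> G" unfolding b(3)[OF g(1)] h using g(4)[OF x(1)] x(1) by auto
    then show ?thesis using Bx[OF x(1)] one[OF x(1)] by blast
  qed
  have gBsub: "N.sub (v (tw (?g p) b)) (ck lamb)" for p unfolding N.sub_def b(3)[OF g(1)] h N_ck by blast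
  have pf: "N.pfilter U (ck lamb)" and ul: "!!x. N.sub x (ck lamb) ==> N x U \<or> N (N.Dif (ck lamb) x) U"
    using U unfolding N.uniform_def N.ultra_def by blast+
  show False
  proof (cases "N (v b) U")
    case True
    then have "sat N (case_nat (v b) (%_. v (nm U))) (Memb 0 1)" by simp
    from flip[OF b(1) HS_nm s(2) this]
    obtain p where p: "p \<in> G" "!!g. g \<E> Gs ==> fx s g ==> ac g p = p ==> N (v (tw g b)) U" by auto
    have "N (v (tw (?g p) b)) U" using p(2)[OF g(1,2) g(3)[OF G_P[OF p(1)]]] .
    then have "N (N.Cap (v b) (v (tw (?g p) b))) U" using N.pfilterD(4)[OF pf True] by blast
    moreover have "N.sub (N.Cap (v b) (v (tw (?g p) b))) (ck (d p))"
    proof (rule N.subI)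
      fix y assume "N y (N.Cap (v b) (v (tw (?g p) b)))"
      then have y: "N y (v b)" "N y (v (tw (?g p) b))" by simp_all
      obtain x where x: "x \<E> lamb" "y = ck x" using N.subD[OF Bsub y(1)] unfolding N_ck by blast
      then have "x \<E> d p" using gB[OF x(1)] y by blast
      then show "N y (ck (d p))" using x(2) by simp
    qed
    ultimately show False using dsmall[OF p(1)] by blast
  next
    case False
    then have "sat N (case_nat (v b) (%_. v (nm U))) (Imp (Memb 0 1) Falsum)" by simp
    from flip[OF b(1) HS_nm s(2) this]
    obtain p where p: "p \<in> G" "!!g. g \<E> Gs ==> fx s g ==> ac g p = p ==> \<not> N (v (tw g b)) U" by auto
    have "\<not> N (v (tw (?g p) b)) U" using p(2)[OF g(1,2) g(3)[OF G_P[OF p(1)]]] .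
    \<comment> \<open>Now the complements of the generic set and of its flip both belong to
      \<open>U\<close>; they too can meet only inside \<open>d p\<close>.\<close>
    then have "N (N.Cap (N.Dif (ck lamb) (v b)) (N.Dif (ck lamb) (v (tw (?g p) b)))) U" (is "N ?C U")
      using N.pfilterD(4)[OF pf] ul[OF Bsub] ul[OF gBsub] False by blast
    moreover have "N.sub ?C (ck (d p))"
    proof (rule N.subI)
      fix y assume "N y ?C"
      then have y: "N y (ck lamb)" "\<not> N y (v b)" "\<not> N y (v (tw (?g p) b))" by simp_all
      obtain x where x: "x \<E> lamb" "y = ck x" using y(1) unfolding N_ck by blast
      then have "x \<E> d p" using gB[OF x(1)] y by blast
      then show "N y (ck (d p))" using x(2) by simp
    qed
    ultimately show False using dsmall[OF p(1)] by blast
  qed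
qed

subsection \<open>Cardinals above the strongly compact cardinal\<close>

text \<open>An injection of \<open>a\<close> into \<open>b\<close> would have at most one preimage
  for each pair of a condition in \<open>Qs s\<close> and a point of \<open>b\<close>. The
  conditions number fewer than \<open>kap\<close>, so \<open>a\<close> would have size at most
  \<open>b\<close> in the ground model.\<close>

lemma succ_preserved:
  assumes b: "InfCard b" "kap \<sqsubseteq> b" and a: "InfCard a" "b \<E> a" shows "\<not> N.le (ck a) (ck b)"
proof
  assume "N.le (ck a) (ck b)"
  from N.leD[OF this] obtain f where f: "!!y. N y (ck a) ==> N (N.app f y) (ck b)"
    "!!y z. N y (ck a) ==> N z (ck a) ==> N.app f y = N.app f z ==> y = z" by blast
  have "\<exists>V s. s \<E> Ss & D (%e. V (e 0) (e 1) (e 2)) & (\<forall>q x y. V q x y --> q \<E> Qs s) &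
    (\<forall>x y. (N (ck y) (ck a) & N.app f (ck y) = ck x) \<longleftrightarrow> (\<exists>q\<in>G. V q x y)) & (\<forall>q x y z. V q x y --> V q x z --> y = z)"
    by (rule relation_support[of "%x y. N y (ck a) & N.app f y = x"]) (simp, use f(2) in blast)
  then obtain V s where s: "s \<E> Ss" and V: "D (%e. V (e 0) (e 1) (e 2))" "!!q x y. V q x y ==> q \<E> Qs s"
    "!!x y. (N (ck y) (ck a) & N.app f (ck y) = ck x) \<longleftrightarrow> (\<exists>q\<in>G. V q x y)" "!!q x y z. V q x y ==> V q x z ==> y = z"
    by blast
  note [simp] = D_app3[OF V(1)]
  let ?F = "%z. the_el (%y. V (fs z) (sn z) y)"
  have "a \<lesssim> prod (Qs s) b"
  proof (rule surj_le_any[of ?F])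
    fix y assume y: "y \<E> a"
    obtain x where x: "x \<E> b" "N.app f (ck y) = ck x" using f(1)[of "ck y"] y unfolding N_ck by auto
    then obtain q where q: "V q x y" using V(3)[of y x] y by auto
    have "?F (pair q x) = y" unfolding fs_pair sn_pair by (rule the_el_eq[of "%y. V q x y"]) (use V(4) q in blast)+
    then show "\<exists>z. z \<E> prod (Qs s) b & ?F z = y" using V(2)[OF q] x(1) by (intro exI[of _ "pair q x"]) simp
  qed simp
  moreover obtain k where k: "k \<E> kap" "Qs s \<lesssim> k" using sm_Qs[OF s] unfolding sm_def by blast
  moreover have "k \<lesssim> b" using k(1) b(2) subD Ord_memsub[OF InfCard_Ord[OF b(1)]] le_sub by blast
  ultimately have "a \<lesssim> prod b b" using prod_le[OF _ le_refl] le_trans by blast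
  then have "a \<lesssim> b" using InfCard_square[OF b(1)] le_trans by blast
  then show False using Card_mem_le[OF InfCard_Card[OF a(1)] a(2)] by blast
qed

text \<open>Colour \<open>x\<close> by the set \<open>h x\<close> of conditions in
  \<open>Qs s\<close> that put it into \<open>X\<close>. There are fewer than \<open>kap\<close>
  colours, so \<open>kap\<close>-completeness yields a set in \<open>U\<close> of constant colour,
  and the colour together with \<open>G\<close> determines membership in \<open>X\<close>.\<close>

lemma measure_generates:
  assumes U: "ultra U a" "complete kap U" and X: "N.sub X (ck a)"
  shows "\<exists>z. z \<E> U & (N.sub (ck z) X \<or> N.sub (ck z) (N.Dif (ck a) X))"
proof -
  have p: "pfilter U a" using U(1) ultra_def by blast
  have "\<exists>V s. s \<E> Ss & D (%e. V (e 0) (e 1) (e 2)) & (\<forall>q x y. V q x y --> q \<E> Qs s) &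
    (\<forall>x y. (N (ck x) X & ck y = ck zero) \<longleftrightarrow> (\<exists>q\<in>G. V q x y)) & (\<forall>q x y z. V q x y --> V q x z --> y = z)"
    by (rule relation_support[of "%x y. N x X & y = ck zero"]) (simp, blast)
  then obtain V s where s: "s \<E> Ss" and V: "D (%e. V (e 0) (e 1) (e 2))" "!!q x y. V q x y ==> q \<E> Qs s"
    "!!x y. (N (ck x) X & ck y = ck zero) \<longleftrightarrow> (\<exists>q\<in>G. V q x y)" by blast
  note [simp] = D_app3[OF V(1)]
  define h where "h = (%x. Sep (Qs s) (%q. V q x zero))"
  have DFh: "DF (%e. h (e 0))" unfolding h_def by simp
  note [simp] = DF_app1[OF DFh]
  have hX: "N (ck x) X \<longleftrightarrow> (\<exists>q\<in>G. q \<E> h x)" for x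
    using V(3)[of x zero] V(2) unfolding h_def by auto
  obtain k where k: "k \<E> kap" "Pw (Qs s) \<lesssim> k" using sm_Pw[OF sm_Qs[OF s]] unfolding sm_def by blast
  obtain j where j: "!!x. x \<sqsubseteq> Qs s ==> app j x \<E> k" "!!x y. x \<sqsubseteq> Qs s ==> y \<sqsubseteq> Qs s ==> app j x = app j y ==> x = y"
    using leD[OF k(2)] by auto
  have hQ: "h x \<sqsubseteq> Qs s" for x unfolding h_def by (simp add: sub_def)
  let ?B = "%c. Sep a (%x. app j (h x) \<noteq> c)"
  have "\<exists>c. c \<E> k & \<not> ?B c \<E> U"
  proof (rule ccontr)
    assume "\<not> ?thesis"
    then have "Sep a (%z. \<forall>c. c \<E> k --> z \<E> ?B c) \<E> U" by (intro complete_family[OF U(2) p k(1)]) auto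
    moreover have "Sep a (%z. \<forall>c. c \<E> k --> z \<E> ?B c) = zero" unfolding eq_zero using j(1)[OF hQ] by simp
    ultimately show False using pfilterD(3)[OF p] by simp
  qed
  then obtain c where c: "\<not> ?B c \<E> U" by blast
  have "?B c \<sqsubseteq> a" by (simp add: sub_def)
  then have ZU: "Dif a (?B c) \<E> U" (is "?Z \<E> U") using U(1) c unfolding ultra_def by blast
  have Z: "x \<E> ?Z \<longleftrightarrow> x \<E> a & app j (h x) = c" for x by auto
  have same: "N (ck x) X \<longleftrightarrow> N (ck y) X" if "x \<E> ?Z" "y \<E> ?Z" for x y
  proof -
    have "app j (h x) = app j (h y)" using that Z by simp
    then have "h x = h y" using j(2)[OF hQ hQ] by blast
    then show ?thesis unfolding hX by simp
  qed
  have "N.sub (ck ?Z) X \<or> N.sub (ck ?Z) (N.Dif (ck a) X)"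
  proof (cases "\<exists>x. x \<E> ?Z & N (ck x) X")
    case True
    then have "N.sub (ck ?Z) X" unfolding N.sub_def N_ck using same by blast
    then show ?thesis ..
  next
    case False
    then have "N.sub (ck ?Z) (N.Dif (ck a) X)" unfolding N.sub_def N.Dif_iff N_ck using Z by blast
    then show ?thesis ..
  qed
  then show ?thesis using ZU by blast
qed

text \<open>A condition uses only \<open>lamb\<close> many coordinates of level
  \<open>omega\<close>, so it leaves some \<open>z\<close> in \<open>lamp\<close> free and can be
  extended to take the singleton of any given \<open>a\<close> in \<open>x\<close> there. By
  genericity, reading off singletons from the restricted filter is onto.\<close>

lemma collapse:
  assumes x: "x \<E> kap" shows "N.le (ck x) (ck lamp)"
proof -
  have sx: "succ x \<E> kap" using InfCard_succ[OF kap(1) x] .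
  \<comment> \<open>A support contains the collapses of ordinals strictly below its second
    component, hence \<open>succ x\<close>.\<close>
  let ?s = "pair zero (succ x)"
  have sS: "?s \<E> Ss" unfolding Ss_iff using zero_omega sx by blast
  obtain c where c: "!!y. N y c \<longleftrightarrow> (\<exists>r. r \<E> Qs ?s & r \<in> G & y = ck r)" using restricted_generic[OF sS] by blast
  let ?i = "%z. pair omega (pair x z)"
  have co: "?i z \<E> coords" if "z \<E> lamp" for z unfolding coords_iff using x that by blast
  have vl: "vl (?i z) = x" for z unfolding vl_def by simp
  let ?F = "%z. N.the_el (%y. \<exists>r. N r c & N (N.pair (N.pair (ck omega) (N.pair (ck x) z)) (N.upair y y)) r)"
  show ?thesis
  proof (rule N.surj_le[of ?F])
    fix y assume "N y (ck x)"
    then obtain a where a: "a \<E> x" "y = ck a" unfolding N_ck by blast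
    let ?u = "upair a a"
    have us: "?u \<sqsubseteq> vl (?i z)" for z unfolding vl using a(1) by (simp add: sub_def)
    have "\<exists>q\<in>G. zero \<sqsubseteq> q & (\<exists>z. z \<E> lamp & pair (?i z) ?u \<E> q)"
    proof (rule G_dense[OF _ pt_G])
      fix q assume q: "q \<E> PP"
      have "\<exists>z. z \<E> lamp & \<not> (\<exists>u. pair (?i z) u \<E> q)"
      proof (rule ccontr)
        assume *: "\<not> ?thesis"
        have "lamp \<lesssim> lev q omega"
        proof (rule leI[of "%z. pair (?i z) (app q (?i z))"])
          fix z assume "z \<E> lamp"
          then obtain u where u: "pair (?i z) u \<E> q" using * by blast
          then have "app q (?i z) = u" using isfn_app PP_isfn[OF q] by blast
          then show "pair (?i z) (app q (?i z)) \<E> lev q omega" using u by simp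
        qed simp_all
        moreover have "lev q omega \<lesssim> lamb" using q unfolding PP_iff by simp
        moreover have "lamb \<E> lamp" by (rule al_mono) simp
        ultimately show False using Card_mem_le[OF InfCard_Card[OF al_Inf]] le_trans by blast
      qed
      then obtain z where z: "z \<E> lamp" "\<not> (\<exists>u. pair (?i z) u \<E> q)" by blast
      let ?r = "upair (pair (?i z) ?u) (pair (?i z) ?u)"
      have "isfn (Un2 q ?r)" using PP_isfn[OF q] z(2) unfolding isfn_def by auto
      from PP_Un2[OF q PP_single[OF co[OF z(1)] us] this]
      show "\<exists>q'. q' \<E> PP & q \<sqsubseteq> q' & (\<exists>z. z \<E> lamp & pair (?i z) ?u \<E> q')"
        using z(1) by (intro exI[of _ "Un2 q ?r"]) (auto simp: sub_def)
    qed simp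
    then obtain q z where q: "q \<in> G" "z \<E> lamp" "pair (?i z) ?u \<E> q" by blast
    have qP: "q \<E> PP" using G_P q(1) .
    have r: "rs ?s q \<in> G" "rs ?s q \<E> Qs ?s" using G_up[OF q(1) rs_PP[OF qP] rs_sub] qP by simp_all
    have pr: "pair (?i z) ?u \<E> rs ?s q" using q(3) by (simp add: inS_def)
    have "?F (ck z) = y"
    proof (rule N.the_el_eq)
      have "N (N.pair (N.pair (ck omega) (N.pair (ck x) (ck z))) (N.upair y y)) (ck (rs ?s q))"
        unfolding a(2) using pr by simp
      then show "\<exists>r. N r c & N (N.pair (N.pair (ck omega) (N.pair (ck x) (ck z))) (N.upair y y)) r"
        using c r by blast
      fix w assume "\<exists>r. N r c & N (N.pair (N.pair (ck omega) (N.pair (ck x) (ck z))) (N.upair w w)) r"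
      then obtain t where t: "t \<E> PP" "t \<in> G" "N (N.pair (ck (?i z)) (N.upair w w)) (ck t)" unfolding c by auto
      obtain l where l: "l \<E> t" "N.pair (ck (?i z)) (N.upair w w) = ck l" using t(3) unfolding N_ck by blast
      have lp: "l = pair (fs l) (sn l)" using PP_pair[OF t(1) l(1)] by blast
      then have "N.pair (ck (fs l)) (ck (sn l)) = ck l" unfolding ck_pair by simp
      then have e: "ck (fs l) = ck (?i z)" "N.upair w w = ck (sn l)" using l(2) N.pair_eq by metis+
      have tl: "pair (?i z) (sn l) \<E> t" using l(1) lp e(1) ck_inj by metis
      obtain o' where o': "o' \<E> PP" "q \<sqsubseteq> o'" "t \<sqsubseteq> o'" using G_join[OF q(1) t(2)] by blast
      have "sn l = ?u" using PP_isfn[OF o'(1)] subD[OF o'(2) q(3)] subD[OF o'(3) tl] unfolding isfn_def by blast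
      then have "N.upair w w = N.upair y y" using e(2) a(2) by simp
      then show "w = y" unfolding N.upair_eq by blast
    qed
    then show "\<exists>z. N z (ck lamp) & ?F z = y" using q(2) by (intro exI[of _ "ck z"]) simp
  qed simp_all
qed

lemma lamp_not_cof_omega:
  assumes f: "DF (%e. f (e 0))" "!!n. n \<E> omega ==> f n \<E> lamp" shows "\<exists>x. x \<E> lamp & (\<forall>n. n \<E> omega --> \<not> x \<E> f n)"
proof (rule ccontr)
  assume "\<not> ?thesis"
  then have "lamp \<sqsubseteq> BU (Rep omega f)" by (intro subI, subst BU_Rep[OF f(1)]) blast
  moreover have "BU (Rep omega f) \<lesssim> lamb"
    by (rule union_le[OF al_Inf le_sub[OF InfCard_omega_sub[OF al_Inf]] f(1)]) (use al_succ(2)[OF Ord_omega] f(2) in blast)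
  moreover have "lamb \<E> lamp" by (rule al_mono) simp
  ultimately show False using Card_mem_le[OF InfCard_Card[OF al_Inf]] le_sub le_trans by blast
qed

text \<open>The measure is put on the successor \<open>a\<close> of the size of \<open>b\<close>. By
  GCH every smaller subset of \<open>a\<close> has size at most that of \<open>b\<close> and is
  avoided, so all members have full size.\<close>

lemma tall_measure:
  assumes b: "Ord b" "kap \<sqsubseteq> b" and m: "InfCard m" "b \<E> m"
  shows "\<exists>k a U. InfCard k & kap \<sqsubseteq> k & InfCard a & k \<E> a & a \<sqsubseteq> m & b \<lesssim> k & ultra U a & complete kap U &
    (\<forall>x. x \<E> U --> a \<lesssim> x)"
proof -
  obtain k where k: "Card k" "k \<sqsubseteq> b" "k \<approx> b" using ex_Card[OF b(1)] by blast
  have bk: "b \<lesssim> k" using eqv_le[OF eqv_sym[OF k(3)]] .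
  have kk: "kap \<sqsubseteq> k" using Card_le_sub[OF InfCard_Card[OF kap(1)] Card_Ord[OF k(1)]] le_sub[OF b(2)] bk le_trans by blast
  have ik: "InfCard k" unfolding InfCard_def using k(1) kk InfCard_omega_sub[OF kap(1)] sub_trans by blast
  have km: "k \<E> m" using k(2) Ord_sub_iff[OF Card_Ord[OF k(1)] b(1)] m(2) Ord_trans[OF InfCard_Ord[OF m(1)] m(2)] by blast
  obtain a where a: "InfCard a" "k \<E> a" "\<forall>n. InfCard n --> k \<E> n --> a \<sqsubseteq> n" "\<forall>x. x \<E> a --> x \<lesssim> k"
    using gch_succ[OF ik] by blast
  have am: "a \<sqsubseteq> m" using a(3) m(1) km by blast
  have "x \<lesssim> k" if "x \<E> kap" for x using Ord_memsub[OF Okap that] kk sub_trans le_sub by blast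
  then obtain U where U: "ultra U a" "complete kap U" "\<forall>x. x \<sqsubseteq> a --> x \<lesssim> k --> \<not> x \<E> U"
    using ex_measure[OF ik a(1,2)] by blast
  have "a \<lesssim> x" if x: "x \<E> U" for x
  proof -
    have xa: "x \<sqsubseteq> a" using U(1) pfilterD(1)[OF _ x] unfolding ultra_def by blast
    obtain c where c: "Card c" "c \<sqsubseteq> a" "x \<approx> c" using le_Ord_Card[OF InfCard_Ord[OF a(1)] le_sub[OF xa]] by blast
    have "\<not> c \<E> a" using a(4) U(3) x xa eqv_le[OF c(3)] le_trans by blast
    then have "c = a" using c(2) Ord_sub_iff[OF Card_Ord[OF c(1)] InfCard_Ord[OF a(1)]] by blast
    then show ?thesis using eqv_le[OF eqv_sym[OF c(3)]] by blast
  qed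
  then show ?thesis using ik kk a(1,2) am bk U(1,2) by blast
qed

text \<open>The sequence of measures is chosen in the ground model, so its canonical name gives it
  to the extension without any choice there. Each measure generates an ultrafilter by
  \<open>measure_generates\<close>, and these are summed along a uniform ultrafilter over
  \<open>omega\<close>.\<close>

lemma uniform_above_kap:
  assumes M: "N.InfCard (ck m)" and km: "kap \<E> m" and F: "DF (%e. F (e 0))" "!!n. n \<E> omega ==> F n \<E> m"
    and cof: "!!x. x \<E> m ==> \<exists>n. n \<E> omega & x \<sqsubseteq> F n"
  shows "\<exists>U. N.uniform U (ck m)"
proof -
  note [simp] = DF_app1[OF F(1)]
  have m: "InfCard m" "Ord m" using ck_InfCard[OF M] InfCard_Ord by blast+
  \<comment> \<open>A nondecreasing majorant of \<open>F\<close>, starting at \<open>kap\<close>, so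
    that every later measure is also tall enough for the earlier bounds.\<close>
  define b where "b = (%n. Un2 kap (BU (Rep (succ n) F)))"
  have Db: "DF (%e. b (e 0))" unfolding b_def by simp
  note [simp] = DF_app1[OF Db]
  have b: "x \<E> b n \<longleftrightarrow> x \<E> kap \<or> (\<exists>i. (i \<E> n \<or> i = n) & x \<E> F i)" for x n
    unfolding b_def Un2_iff by (subst BU_Rep[OF F(1)]) auto
  have bm: "b n \<E> m" if "n \<E> omega" for n
  proof (rule omega_induct[OF _ _ _ that, of "%n. b n \<E> m"])
    have e: "b zero = Un2 kap (F zero)" by (rule extensional) (simp add: b)
    show "b zero \<E> m" unfolding e using Ord_Un2_cases[OF Okap Ord_mem[OF m(2) F(2)[OF zero_omega]]] km F(2)[OF zero_omega] by auto
    fix n assume n: "n \<E> omega" "b n \<E> m"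
    have e: "b (succ n) = Un2 (b n) (F (succ n))" by (rule extensional) (auto simp: b)
    have "F (succ n) \<E> m" using F(2) succ_omega[OF n(1)] by blast
    then show "b (succ n) \<E> m" unfolding e using Ord_Un2_cases[OF Ord_mem[OF m(2) n(2)] Ord_mem[OF m(2)]] n(2) by fastforce
  qed simp
  define T where "T = (%n U. \<exists>k a. InfCard k & kap \<sqsubseteq> k & InfCard a & k \<E> a & a \<sqsubseteq> m & b n \<lesssim> k & ultra U a &
    complete kap U & (\<forall>x. x \<E> U --> a \<lesssim> x))"
  have DT: "D (%e. T (e 0) (e 1))" unfolding T_def ultra_def pfilter_def complete_def by simp
  note [simp] = D_app2[OF DT]
  have "\<exists>u. fn u omega & (\<forall>n. n \<E> omega --> app u n \<E> Sep (Pw (Pw m)) (T n))"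
  proof (rule choice_fun)
    fix n assume n: "n \<E> omega"
    have "kap \<sqsubseteq> b n" unfolding sub_def b by blast
    then obtain U where U: "T n U" unfolding T_def using tall_measure[OF Ord_mem[OF m(2) bm[OF n]] _ m(1) bm[OF n]] by blast
    have "U \<E> Pw (Pw m)"
    proof -
      obtain a where a: "a \<sqsubseteq> m" "pfilter U a" using U unfolding T_def ultra_def by blast
      have "x \<sqsubseteq> m" if "x \<E> U" for x using pfilterD(1)[OF a(2) that] a(1) sub_trans by blast
      then show ?thesis by (simp add: sub_def[of U])
    qed
    then show "\<exists>z. z \<E> Sep (Pw (Pw m)) (T n)" using U by auto
  qed simp
  then obtain u where u: "fn u omega" "!!n. n \<E> omega ==> T n (app u n)" by auto
  obtain U0 where U0: "N.uniform U0 (ck omega)" using uniform_al[OF zero_omega] unfolding al_zero by blast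
  have p0: "N.pfilter U0 (ck omega)" and ul0: "!!x. N.sub x (ck omega) ==> N x U0 \<or> N (N.Dif (ck omega) x) U0"
    using U0 unfolding N.uniform_def N.ultra_def by blast+
  \<comment> \<open>The indices at which \<open>X\<close> contains a set of the corresponding ground
    model measure; \<open>?W\<close> consists of the \<open>X\<close> for which these indices form a
    member of \<open>U0\<close>.\<close>
  define ix where "ix = (%X. N.Sep (ck omega) (%n. \<exists>z. N z (N.app (ck u) n) & N.sub z X))"
  have Dix: "N.DF (%e. ix (e 0))" unfolding ix_def by simp
  note [simp] = N.DF_app1[OF Dix]
  have ix: "N (ck n) (ix X) \<longleftrightarrow> n \<E> omega & (\<exists>z. z \<E> app u n & N.sub (ck z) X)" for n X
  proof -
    have "N (ck n) (ix X) \<longleftrightarrow> n \<E> omega & (\<exists>z. N z (N.app (ck u) (ck n)) & N.sub z X)" unfolding ix_def by simp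
    then show ?thesis using ck_fn(2)[OF u(1), of n] N_ck[of _ "app u n"] by (auto, blast)
  qed
  have ixs: "N.sub (ix X) (ck omega)" for X unfolding ix_def N.sub_def by simp
  have ixI: "N (ix Y) U0" if "N x U0" "!!n. n \<E> omega ==> N (ck n) x ==> \<exists>z. z \<E> app u n & N.sub (ck z) Y" for x Y
  proof (rule N.pfilterD(5)[OF p0 that(1) _ ixs])
    show "N.sub x (ix Y)"
    proof (rule N.subI)
      fix y assume y: "N y x"
      then have "N y (ck omega)" using N.pfilterD(1)[OF p0 that(1)] N.subD by blast
      then obtain n where "n \<E> omega" "y = ck n" unfolding N_ck by blast
      then show "N y (ix Y)" using ix that(2) y by blast
    qed
  qed
  have full: "N (ck omega) U0" using N.pfilterD(2)[OF p0] .
  let ?W = "N.Sep (N.Pw (ck m)) (%X. N (ix X) U0)"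
  have W: "N X ?W \<longleftrightarrow> N.sub X (ck m) & N (ix X) U0" for X by simp
  have ixD: "\<exists>z. z \<E> app u n & N.sub (ck z) X" if "N (ck n) (ix X)" for n X using that ix by blast
  have pu: "pfilter (app u n) (BU (app u n)) & BU (app u n) \<sqsubseteq> m" if n: "n \<E> omega" for n
  proof -
    obtain a where a: "a \<sqsubseteq> m" "pfilter (app u n) a" using u(2)[OF n] unfolding T_def ultra_def by blast
    have "BU (app u n) = a" by (rule extensional, unfold BU_iff) (use pfilterD(1,2)[OF a(2)] subD in blast)
    then show ?thesis using a by simp
  qed
  have "N (ix (ck m)) U0"
  proof (rule ixI[OF full])
    fix n assume n: "n \<E> omega"
    show "\<exists>z. z \<E> app u n & N.sub (ck z) (ck m)" using pu[OF n] pfilterD(2) unfolding ck_sub by blast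
  qed
  then have w2: "N (ck m) ?W" unfolding W by simp
  have w3: "\<not> N N.zero ?W"
  proof
    assume "N N.zero ?W"
    then have *: "N (ix N.zero) U0" unfolding W by blast
    have "\<not> N y (ix N.zero)" for y
    proof
      assume y: "N y (ix N.zero)"
      then obtain n where n: "n \<E> omega" "y = ck n" using N.subD[OF ixs y] unfolding N_ck by blast
      then obtain z where z: "z \<E> app u n" "N.sub (ck z) N.zero" using ixD y by blast
      then have "z \<sqsubseteq> zero" by simp
      then have "z = zero" unfolding eq_zero using subD not_zero by blast
      then show False using z(1) pu[OF n(1)] pfilterD(3) by blast
    qed
    then have "ix N.zero = N.zero" using N.eq_zero by blast
    then show False using * N.pfilterD(3)[OF p0] by simp
  qed
  have w4: "N (N.Cap X Y) ?W" if XY: "N X ?W" "N Y ?W" for X Y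
  proof -
    have XY: "N.sub X (ck m)" "N (ix X) U0" "N (ix Y) U0" using XY unfolding W by blast+
    have "N (ix (N.Cap X Y)) U0"
    proof (rule ixI[OF N.pfilterD(4)[OF p0 XY(2,3)]])
      fix n assume n: "n \<E> omega" "N (ck n) (N.Cap (ix X) (ix Y))"
      obtain z w where zw: "z \<E> app u n" "N.sub (ck z) X" "w \<E> app u n" "N.sub (ck w) Y" using n(2) ixD unfolding N.Cap_iff by blast
      have "Cap z w \<E> app u n" using pu[OF n(1)] pfilterD(4) zw by blast
      moreover have "N.sub (ck (Cap z w)) (N.Cap X Y)"
        using zw(2,4) unfolding N.sub_def N.Cap_iff N_ck Cap_iff by blast
      ultimately show "\<exists>z. z \<E> app u n & N.sub (ck z) (N.Cap X Y)" by blast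
    qed
    moreover have "N.sub (N.Cap X Y) (ck m)" using XY(1) unfolding N.sub_def N.Cap_iff by blast
    ultimately show ?thesis unfolding W by blast
  qed
  have w5: "N Y ?W" if XY: "N X ?W" "N.sub X Y" "N.sub Y (ck m)" for X Y
  proof -
    have X: "N (ix X) U0" using XY unfolding W by blast
    have "N (ix Y) U0" by (rule ixI[OF X]) (use ixD N.sub_trans XY(2) in blast)
    then show ?thesis unfolding W using XY(3) by blast
  qed
  have w6: "N X ?W \<or> N (N.Dif (ck m) X) ?W" if X: "N.sub X (ck m)" for X
  proof -
    have d: "N.sub (N.Dif (ck m) X) (ck m)" by (simp add: N.sub_def)
    have "N (ix X) U0 \<or> N (N.Dif (ck omega) (ix X)) U0" using ul0[OF ixs] .
    then show ?thesis
    proof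
      assume "N (N.Dif (ck omega) (ix X)) U0"
      then have "N (ix (N.Dif (ck m) X)) U0"
      proof (rule ixI)
        fix n assume n: "n \<E> omega" "N (ck n) (N.Dif (ck omega) (ix X))"
        then have nX: "\<not> (\<exists>z. z \<E> app u n & N.sub (ck z) X)" using ix by simp
        obtain a where a: "a \<sqsubseteq> m" "ultra (app u n) a" "complete kap (app u n)" using u(2)[OF n(1)] unfolding T_def by blast
        have pa: "pfilter (app u n) a" using a(2) unfolding ultra_def by blast
        have "N.sub (N.Cap X (ck a)) (ck a)" by (simp add: N.sub_def)
        then obtain z where z: "z \<E> app u n" "N.sub (ck z) (N.Cap X (ck a)) \<or> N.sub (ck z) (N.Dif (ck a) (N.Cap X (ck a)))"
          using measure_generates[OF a(2,3)] by blast
        have "\<not> N.sub (ck z) (N.Cap X (ck a))" using nX z(1) unfolding N.sub_def N.Cap_iff by blast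
        moreover have "N y (ck m)" if "N y (ck a)" for y using that a(1) ck_sub N.subD by blast
        ultimately have "N.sub (ck z) (N.Dif (ck m) X)" using z(2) unfolding N.sub_def N.Dif_iff N.Cap_iff by blast
        then show "\<exists>z. z \<E> app u n & N.sub (ck z) (N.Dif (ck m) X)" using z(1) by blast
      qed
      then show ?thesis unfolding W using d by blast
    qed (use X W in blast)
  qed
  have "N.pfilter ?W (ck m)" unfolding N.pfilter_def using w2 w3 w4 w5 W by blast
  then have uW: "N.ultra ?W (ck m)" unfolding N.ultra_def using w6 by blast
  have "N.eqv X (ck m)" if X: "N X ?W" for X
  proof -
    have X: "N.sub X (ck m)" "N (ix X) U0" using X unfolding W by blast+
    obtain c where c: "N.Card c" "N.sub c (ck m)" "N.eqv X c" using N.le_Ord_Card[OF N.InfCard_Ord[OF M] N.le_sub[OF X(1)]] by blast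
    have "\<not> N c (ck m)"
    proof
      assume "N c (ck m)"
      then obtain x where x: "x \<E> m" "c = ck x" unfolding N_ck by blast
      obtain n0 where n0: "n0 \<E> omega" "x \<sqsubseteq> F n0" using cof[OF x(1)] by blast
      \<comment> \<open>Uniformity over \<open>omega\<close> makes the index set infinite, so it
        contains some \<open>n\<close> not below \<open>n0\<close>. There \<open>X\<close> contains
        a measure-one set of size \<open>a\<close>, beyond the successor of the size of
        \<open>x\<close>, and this contradicts \<open>succ_preserved\<close>.\<close>
      have "N.eqv (ix X) (ck omega)" using U0 X(2) unfolding N.uniform_def by blast
      then have big: "N.le (ck omega) (ix X)" using N.eqv_sym N.eqv_le by blast
      have "\<not> N.sub (ix X) (ck n0)"
      proof
        assume "N.sub (ix X) (ck n0)"
        then have "N.le N.omega (ck n0)" using big N.le_sub N.le_trans by simp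
        then show False using N.omega_not_le n0(1) by simp
      qed
      then obtain y where y: "N y (ix X)" "\<not> N y (ck n0)" unfolding N.sub_def by blast
      obtain n where n: "n \<E> omega" "y = ck n" using N.subD[OF ixs y(1)] unfolding N_ck by blast
      obtain z where z: "z \<E> app u n" "N.sub (ck z) X" using y(1) n(2) ixD by blast
      obtain k a where k: "InfCard k" "kap \<sqsubseteq> k" "InfCard a" "k \<E> a" "b n \<lesssim> k" "\<forall>x. x \<E> app u n --> a \<lesssim> x"
        using u(2)[OF n(1)] unfolding T_def by blast
      have "n0 \<E> n \<or> n0 = n"
        using Ord_linear[OF omega_Ord_mem[OF n0(1)] omega_Ord_mem[OF n(1)]] y(2) n(2) by auto
      then have "x \<sqsubseteq> b n" unfolding sub_def b using subD[OF n0(2)] by blast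
      then have "x \<lesssim> k" using k(5) le_sub le_trans by blast
      then have 1: "N.le c (ck k)" unfolding x(2) by (rule ck_le)
      have 2: "N.le (ck a) (ck z)" using ck_le k(6) z(1) by blast
      have 3: "N.le (ck z) X" using N.le_sub[OF z(2)] .
      have "N.le X c" using N.eqv_le[OF c(3)] .
      from N.le_trans[OF 2 N.le_trans[OF 3 N.le_trans[OF this 1]]]
      show False using succ_preserved[OF k(1,2,3,4)] by blast
    qed
    then have "c = ck m" using c(2) N.Ord_sub_iff[OF N.Card_Ord[OF c(1)] N.InfCard_Ord[OF M]] by blast
    then show ?thesis using c(3) by simp
  qed
  then show ?thesis using uW unfolding N.uniform_def by blast
qed

text \<open>A cofinal \<omega>-sequence already lies in the ground model. This rules out
  \<open>lamp\<close> and \<open>kap\<close>, which have uncountable cofinality there, and no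
  ordinal strictly between them remains a cardinal. What is left lies above
  \<open>kap\<close>.\<close>

theorem uniform_cof_omega:
  assumes b: "N.InfCard b" "N (ck lamb) b" and f: "!!n. N n N.omega ==> N (N.app f n) b"
    and cof: "!!x. N x b ==> \<exists>n. N n N.omega & (x = N.app f n \<or> N x (N.app f n))"
  shows "\<exists>U. N.uniform U b"
proof -
  obtain m where m: "Ord m" "b = ck m" using N_Ord[OF N.InfCard_Ord[OF b(1)]] by blast
  have M: "N.InfCard (ck m)" using b m by simp
  have Im: "InfCard m" using ck_InfCard[OF M] .
  have lm: "lamb \<E> m" using b(2) m(2) by simp
  have fm: "N (N.app f (ck n)) (ck m)" if "n \<E> omega" for n using f[of "ck n"] that m(2) by simp
  obtain F where F: "DF (%e. F (e 0))" "!!n. n \<E> omega ==> F n \<E> m & N.app f (ck n) = ck (F n)"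
    using no_new_sequence[OF fm] by blast
  have cofm: "\<exists>n. n \<E> omega & (x = F n \<or> x \<E> F n)" if x: "x \<E> m" for x
  proof -
    have "N (ck x) b" using x m(2) by simp
    then obtain y where y: "N y N.omega" "ck x = N.app f y \<or> N (ck x) (N.app f y)" using cof by blast
    obtain n where n: "n \<E> omega" "y = ck n" using y(1) unfolding ck_omega N_ck by blast
    then show ?thesis using y(2) F(2)[OF n(1)] by auto
  qed
  note [simp] = DF_app1[OF F(1)]
  \<comment> \<open>Cofinality is meant non-strictly, as \<open>F n\<close> may equal
    \<open>x\<close>; passing to \<open>succ (F n)\<close> gives the strict form that the two
    cofinality lemmas refute.\<close>
  have sF: "\<not> (\<forall>n. n \<E> omega --> \<not> x \<E> succ (F n))" if "x \<E> m" for x using cofm[OF that] by auto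
  have sFm: "succ (F n) \<E> m" if "n \<E> omega" for n using InfCard_succ[OF Im] F(2)[OF that] by blast
  have "lamp \<sqsubseteq> m" using al_succ(3)[OF Ord_omega Im lm] .
  then have "lamp \<E> m \<or> lamp = m" using Ord_sub_iff[OF al_Ord m(1)] by blast
  moreover have "lamp \<noteq> m"
  proof
    assume e: "lamp = m"
    have "\<exists>x. x \<E> lamp & (\<forall>n. n \<E> omega --> \<not> x \<E> succ (F n))"
      by (rule lamp_not_cof_omega) (use sFm e in simp_all)
    then show False using sF e by blast
  qed
  ultimately have "lamp \<E> m" by blast
  then have "N (ck lamp) (ck m)" by simp
  then have "\<not> m \<E> kap" using collapse N.Card_mem_le[OF N.InfCard_Card[OF M]] by blast
  moreover have "kap \<noteq> m"
  proof
    assume e: "kap = m"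
    have "\<exists>x. x \<E> kap & (\<forall>n. n \<E> omega --> \<not> x \<E> succ (F n))"
      by (rule kap_not_cof_omega) (use sFm e in simp_all)
    then show False using sF e by blast
  qed
  ultimately have km: "kap \<E> m" using Ord_linear[OF m(1) Okap] by blast
  have "\<exists>n. n \<E> omega & x \<sqsubseteq> F n" if x: "x \<E> m" for x
    using cofm[OF x] F(2) Ord_memsub[OF Ord_mem[OF m(1)]] sub_refl by blast
  then show ?thesis unfolding m(2) using uniform_above_kap[OF M km F(1)] F(2) by blast
qed

end

section \<open>Meaning of the sentences\<close>

context zf
begin

lemma set_ext: "x = y \<longleftrightarrow> (\<forall>z. z \<E> x \<longleftrightarrow> z \<E> y)" using extensional by blast

lemma S_Subset [simp]: "x < n ==> y < n ==> S E d n e (x \<^bold>\<subseteq> y) \<longleftrightarrow> e x \<sqsubseteq> e y"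
  by (simp add: S_simps Subset_def sub_def)
lemma S_Nonempty [simp]: "x < n ==> S E d n e (Nonempty x) \<longleftrightarrow> e x \<noteq> zero"
  by (simp add: S_simps Nonempty_def eq_zero)
lemma S_UPair [simp]: "p < n ==> x < n ==> y < n ==> S E d n e (UPair p x y) \<longleftrightarrow> e p = upair (e x) (e y)"
  unfolding set_ext by (simp add: S_simps UPair_def)
lemma S_OPair [simp]: "p < n ==> x < n ==> y < n ==> S E d n e (OPair p x y) \<longleftrightarrow> e p = pair (e x) (e y)"
  by (simp add: S_simps OPair_def pair_def)
lemma S_BigInter [simp]: "i < n ==> a < n ==> S E d n e (BigInter i a) \<longleftrightarrow> (\<forall>z. z \<E> e i \<longleftrightarrow> (\<forall>x. x \<E> e a --> z \<E> x))"
  by (simp add: S_simps BigInter_def)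
lemma S_Inter2 [simp]: "i < n ==> x < n ==> y < n ==> S E d n e (Inter2 i x y) \<longleftrightarrow> e i = Cap (e x) (e y)"
  unfolding set_ext by (simp add: S_simps Inter2_def)
lemma S_SetDiff [simp]: "i < n ==> x < n ==> y < n ==> S E d n e (SetDiff i x y) \<longleftrightarrow> e i = Dif (e x) (e y)"
  unfolding set_ext by (simp add: S_simps SetDiff_def)
lemma S_PowerSet [simp]: "p < n ==> x < n ==> S E d n e (PowerSet p x) \<longleftrightarrow> e p = Pw (e x)"
  unfolding set_ext by (simp add: S_simps PowerSet_def)
lemma S_Succ [simp]: "s < n ==> x < n ==> S E d n e (Succ s x) \<longleftrightarrow> e s = succ (e x)"
  unfolding set_ext by (simp add: S_simps Succ_def)
lemma S_Maps [simp]: "f < n ==> x < n ==> y < n ==> S E d n e (Maps f x y) \<longleftrightarrow> pair (e x) (e y) \<E> e f"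
  by (simp add: S_simps Maps_def)
lemma S_FunOn [simp]: "f < n ==> a < n ==> S E d n e (FunOn f a) \<longleftrightarrow> fn (e f) (e a)"
proof -
  have "(\<forall>p. p \<E> f --> (\<exists>x y. x \<E> a & p = pair x y)) & (\<forall>x. x \<E> a --> (\<exists>y. pair x y \<E> f)) &
      (\<forall>x y z. pair x y \<E> f & pair x z \<E> f --> y = z) \<longleftrightarrow> fn f a" (is "?l \<longleftrightarrow> _") for f a
  proof
    assume f: "fn f a"
    have "y = z" if "pair x y \<E> f" "pair x z \<E> f" for x y z using fn_pair[OF f, of x y] fn_pair[OF f, of x z] that by simp
    then show ?l using f unfolding fn_def by blast
  next
    assume ?l
    then have 1: "\<forall>p. p \<E> f --> (\<exists>x y. x \<E> a & p = pair x y)" "!!x. x \<E> a ==> \<exists>y. pair x y \<E> f"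
      and 2: "!!x y z. pair x y \<E> f ==> pair x z \<E> f ==> z = y" by blast+
    have "\<exists>y. pair x y \<E> f & (\<forall>z. pair x z \<E> f --> z = y)" if x: "x \<E> a" for x
    proof -
      obtain y where "pair x y \<E> f" using 1(2)[OF x] by blast
      then show ?thesis using 2 by (intro exI[of _ y]) simp
    qed
    then show "fn f a" unfolding fn_def using 1(1) by blast
  qed
  then show "f < n ==> a < n ==> S E d n e (FunOn f a) \<longleftrightarrow> fn (e f) (e a)" by (simp add: S_simps FunOn_def)
qed
lemma S_FunTo [simp]: "f < n ==> a < n ==> b < n ==>
    S E d n e (FunTo f a b) \<longleftrightarrow> fn (e f) (e a) & (\<forall>x. x \<E> e a --> app (e f) x \<E> e b)"
  by (auto simp: S_simps FunTo_def fn_pair)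
lemma S_Bijection [simp]: "f < n ==> a < n ==> b < n ==> S E d n e (Bijection f a b) \<longleftrightarrow> bij (e f) (e a) (e b)"
  by (auto simp: S_simps Bijection_def bij_def inj_def fn_pair)
lemma S_Equinumerous [simp]: "a < n ==> b < n ==> S E d n e (Equinumerous a b) \<longleftrightarrow> e a \<approx> e b"
  by (simp add: S_simps Equinumerous_def eqv_def)

lemma S_Choice: "S E d 0 e Choice \<longleftrightarrow>
    (\<forall>a. (\<forall>x. x \<E> a --> x \<noteq> zero) --> (\<exists>f. fn f a & (\<forall>x. x \<E> a --> app f x \<E> x)))"
proof -
  have "fn f a & (\<forall>x y. pair x y \<E> f --> y \<E> x) \<longleftrightarrow> fn f a & (\<forall>x. x \<E> a --> app f x \<E> x)" for f a
    by (auto simp: fn_pair)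
  then show ?thesis by (simp add: S_simps Choice_def)
qed

lemma S_Inductive [simp]: "w < n ==> S E d n e (Inductive w) \<longleftrightarrow> inductv (e w)"
  by (simp add: S_simps Inductive_def inductv_def)
lemma S_Omega [simp]: "w < n ==> S E d n e (Omega w) \<longleftrightarrow> e w = omega"
proof -
  have i: "inductv omega" unfolding inductv_def by simp
  have "inductv w & (\<forall>v. inductv v --> w \<sqsubseteq> v) \<longleftrightarrow> w = omega" for w
  proof
    assume w: "inductv w & (\<forall>v. inductv v --> w \<sqsubseteq> v)"
    then have "omega \<sqsubseteq> w" using omega_iff unfolding sub_def by blast
    then show "w = omega" using w i sub_antisym by blast
  next
    assume "w = omega"
    then show "inductv w & (\<forall>v. inductv v --> w \<sqsubseteq> v)" using i omega_iff unfolding sub_def by blast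
  qed
  then show "w < n ==> S E d n e (Omega w) \<longleftrightarrow> e w = omega" by (simp add: S_simps Omega_def)
qed
lemma S_Ordinal [simp]: "x < n ==> S E d n e (Ordinal x) \<longleftrightarrow> Ord (e x)"
  by (simp add: S_simps Ordinal_def Transitive_def Ord_def trans_def)
text \<open>Cantor-Bernstein reconciles the two forms: an embedding of an ordinal into one of its
  members already makes them equinumerous.\<close>

lemma S_InitialOrdinal [simp]: "x < n ==> S E d n e (InitialOrdinal x) \<longleftrightarrow> Card (e x)"
proof -
  have "Ord k & (\<forall>a. a \<E> k --> \<not> a \<approx> k) \<longleftrightarrow> Card k" for k
    unfolding Card_def using cantor_bernstein[of _ k] le_sub Ord_memsub eqv_le eqv_sym by blast
  then show "x < n ==> S E d n e (InitialOrdinal x) \<longleftrightarrow> Card (e x)" by (simp add: S_simps InitialOrdinal_def)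
qed
lemma S_Cardinal [simp]: "x < n ==> S E d n e (Cardinal x) \<longleftrightarrow> InfCard (e x)"
proof -
  have "Card k & (omega = k \<or> omega \<E> k) \<longleftrightarrow> InfCard k" for k
    unfolding InfCard_def using Ord_sub_iff[OF Ord_omega Card_Ord] by blast
  then show "x < n ==> S E d n e (Cardinal x) \<longleftrightarrow> InfCard (e x)" by (simp add: S_simps Cardinal_def)
qed

definition succ_card where "succ_card m k \<longleftrightarrow> InfCard m & k \<E> m & (\<forall>n. InfCard n --> k \<E> n --> m \<sqsubseteq> n)"
lemma S_SuccCardinal [simp]: "x < n ==> y < n ==> S E d n e (SuccCardinal x y) \<longleftrightarrow> succ_card (e x) (e y)"
proof -
  have "InfCard m & k \<E> m & (\<forall>n. InfCard n & k \<E> n --> m = n \<or> m \<E> n) \<longleftrightarrow> succ_card m k" for m k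
    unfolding succ_card_def using Ord_sub_iff[OF InfCard_Ord InfCard_Ord] by blast
  then show "x < n ==> y < n ==> S E d n e (SuccCardinal x y) \<longleftrightarrow> succ_card (e x) (e y)"
    by (simp add: S_simps SuccCardinal_def)
qed

definition aleph_seq where "aleph_seq f \<longleftrightarrow> fn f omega & app f zero = omega & (\<forall>n. n \<E> omega --> succ_card (app f (succ n)) (app f n))"
lemma S_AlephOmega: "a < n ==> S E d n e (AlephOmega a) \<longleftrightarrow>
    (\<exists>f. aleph_seq f & (\<forall>z. z \<E> e a \<longleftrightarrow> (\<exists>n. n \<E> omega & z \<E> app f n)))"
proof -
  have "fn f omega & (\<forall>e. e = zero --> pair e omega \<E> f) &
    (\<forall>n s x y. n \<E> omega & s = succ n & pair n x \<E> f & pair s y \<E> f --> succ_card y x) &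
    (\<forall>z. z \<E> a \<longleftrightarrow> (\<exists>n x. pair n x \<E> f & z \<E> x)) \<longleftrightarrow>
    aleph_seq f & (\<forall>z. z \<E> a \<longleftrightarrow> (\<exists>n. n \<E> omega & z \<E> app f n))" for f a
    unfolding aleph_seq_def by (auto simp: fn_pair)
  then show "a < n ==> S E d n e (AlephOmega a) \<longleftrightarrow>
    (\<exists>f. aleph_seq f & (\<forall>z. z \<E> e a \<longleftrightarrow> (\<exists>n. n \<E> omega & z \<E> app f n)))"
    by (simp add: S_simps AlephOmega_def)
qed

lemma aleph_seq_unique: assumes f: "aleph_seq f" and g: "aleph_seq g" and n: "n \<E> omega" shows "app f n = app g n"
proof (rule omega_induct[OF _ _ _ n, of "%n. app f n = app g n"])
  fix n assume n: "n \<E> omega" "app f n = app g n"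
  then show "app f (succ n) = app g (succ n)"
    using f g sub_antisym unfolding aleph_seq_def succ_card_def by metis
qed (use f g in \<open>simp_all add: aleph_seq_def\<close>)

lemma S_GCH: "S E d 0 e GCH \<longleftrightarrow> (\<forall>k. InfCard k --> (\<exists>m. succ_card m k & Pw k \<approx> m))"
  by (simp add: S_simps GCH_def)

lemma S_ProperFilter [simp]: "x < n ==> s < n ==> S E d n e (ProperFilter x s) \<longleftrightarrow> pfilter (e x) (e s)"
proof -
  have "(\<forall>x. x \<E> F --> x \<noteq> zero) \<longleftrightarrow> \<not> zero \<E> F" for F by blast
  then show "x < n ==> s < n ==> S E d n e (ProperFilter x s) \<longleftrightarrow> pfilter (e x) (e s)"
    by (simp add: S_simps ProperFilter_def pfilter_def) blast
qed
lemma S_ProperUltrafilter [simp]: "x < n ==> s < n ==> S E d n e (ProperUltrafilter x s) \<longleftrightarrow> ultra (e x) (e s)"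
  by (simp add: S_simps ProperUltrafilter_def ultra_def)
text \<open>\<open>BigInter\<close> mentions no ambient set. For nonempty \<open>A\<close> the
  intersection is a subset of the union, so separation inside \<open>BU A\<close> defines the same
  set.\<close>

lemma S_Complete [simp]: "k < n ==> x < n ==> S E d n e (Complete k x) \<longleftrightarrow> complete (e k) (e x)"
proof -
  have i: "(\<forall>z. z \<E> i \<longleftrightarrow> (\<forall>x. x \<E> A --> z \<E> x)) \<longleftrightarrow> i = Sep (BU A) (%z. \<forall>x. x \<E> A --> z \<E> x)" if A: "A \<noteq> zero" for i A
  proof -
    obtain y where "y \<E> A" using A eq_zero by blast
    then have "z \<E> Sep (BU A) (%z. \<forall>x. x \<E> A --> z \<E> x) \<longleftrightarrow> (\<forall>x. x \<E> A --> z \<E> x)" for z by auto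
    then show ?thesis unfolding set_ext by simp
  qed
  have "(\<forall>A i. A \<sqsubseteq> F & A \<noteq> zero & (\<exists>a. a \<E> k & a \<approx> A) & (\<forall>z. z \<E> i \<longleftrightarrow> (\<forall>x. x \<E> A --> z \<E> x)) --> i \<E> F)
      \<longleftrightarrow> complete k F" (is "?l \<longleftrightarrow> _") for k F
  proof
    assume l: ?l
    show "complete k F"
      unfolding complete_def
    proof (intro allI impI)
      fix A assume A: "A \<sqsubseteq> F" "A \<noteq> zero" "\<exists>a. a \<E> k & a \<approx> A"
      from i[OF A(2), THEN iffD2, OF refl] l A show "Sep (BU A) (%z. \<forall>x. x \<E> A --> z \<E> x) \<E> F" by blast
    qed
  next
    assume c: "complete k F"
    show ?l
    proof (intro allI impI, elim conjE)
      fix A i assume A: "A \<sqsubseteq> F" "A \<noteq> zero" "\<exists>a. a \<E> k & a \<approx> A" "\<forall>z. z \<E> i \<longleftrightarrow> (\<forall>x. x \<E> A --> z \<E> x)"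
      from i[OF A(2), THEN iffD1, OF A(4)] c A(1-3) show "i \<E> F" unfolding complete_def by simp
    qed
  qed
  then show "k < n ==> x < n ==> S E d n e (Complete k x) \<longleftrightarrow> complete (e k) (e x)"
    by (simp add: S_simps Complete_def)
qed
lemma S_StronglyCompact: "S E d 0 e ExistsStronglyCompact \<longleftrightarrow> (\<exists>k. InfCard k & omega \<E> k &
    (\<forall>s F. pfilter F s & complete k F --> (\<exists>U. F \<sqsubseteq> U & ultra U s & complete k U)))"
  by (simp add: S_simps ExistsStronglyCompact_def StronglyCompact_def UncountableCardinal_def)
lemma S_InU [simp]: "k < n ==> S E d n e (InU k) \<longleftrightarrow> InfCard (e k) & (\<exists>U. uniform U (e k))"
  by (simp add: S_simps InU_def UniformUltrafilter_def uniform_def)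

lemma S_CountableCofinality: "k < n ==> S E d n e (CountableCofinality k) ==>
    \<exists>f. (\<forall>n. n \<E> omega --> app f n \<E> e k) & (\<forall>x. x \<E> e k --> (\<exists>n. n \<E> omega & (x = app f n \<or> x \<E> app f n)))"
  by (auto simp: S_simps CountableCofinality_def Cofinality_def CofinalMap_def fn_pair)

end

context extension
begin

section \<open>The two sentences hold in the extension\<close>

lemma N_succ_card: assumes "n \<E> omega" shows "N.succ_card (ck (al (succ n))) (ck (al n))"
  unfolding N.succ_card_def
proof (intro conjI allI impI)
  show "N.InfCard (ck (al (succ n)))" using N_InfCard_al succ_omega assms by blast
  show "N (ck (al n)) (ck (al (succ n)))" using al_mono[of n "succ n"] by simp
  fix k assume k: "N.InfCard k" "N (ck (al n)) k"
  obtain x where x: "k = ck x" using N_Ord N.InfCard_Ord[OF k(1)] by blast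
  then have "al (succ n) \<sqsubseteq> x" using al_succ(3)[OF omega_Ord_mem[OF assms]] ck_InfCard k by simp
  then show "N.sub (ck (al (succ n))) k" using x by simp
qed

text \<open>The extension keeps each \<open>al n\<close> a cardinal and has no cardinals that the
  ground model lacks, so the aleph sequence of the ground model below \<open>omega\<close> also
  satisfies the definition in the extension.\<close>

lemma N_aleph_seq: "N.aleph_seq (ck (lam omega al))" "n \<E> omega ==> N.app (ck (lam omega al)) (ck n) = ck (al n)"
proof -
  let ?f = "lam omega al"
  have f: "fn ?f omega" by (rule fn_lam) simp
  have app: "N.app (ck ?f) (ck n) = ck (al n)" if "n \<E> omega" for n using ck_fn(2)[OF f that] that by simp
  then show "n \<E> omega ==> N.app (ck ?f) (ck n) = ck (al n)" .
  have "N.succ_card (N.app (ck ?f) (N.succ y)) (N.app (ck ?f) y)" if y: "N y (ck omega)" for y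
  proof -
    obtain n where n: "n \<E> omega" "y = ck n" using y unfolding N_ck by blast
    then show ?thesis using app[OF n(1)] app[OF succ_omega[OF n(1)]] N_succ_card[OF n(1)] by simp
  qed
  then show "N.aleph_seq (ck ?f)" unfolding N.aleph_seq_def using ck_fn(1)[OF f] app[OF zero_omega] al_zero by simp
qed

lemma N_AlephOmega: assumes "a < n" shows "S N d n e (AlephOmega a) \<longleftrightarrow> e a = ck lamb"
proof -
  have lamb: "N z (ck lamb) \<longleftrightarrow> (\<exists>n. N n N.omega & N z (N.app (ck (lam omega al)) n))" for z
  proof -
    have "N z (ck lamb) \<longleftrightarrow> (\<exists>n. n \<E> omega & N z (ck (al n)))" unfolding N_ck lamb_iff by blast
    also have "\<dots> \<longleftrightarrow> (\<exists>n. n \<E> omega & N z (N.app (ck (lam omega al)) (ck n)))" by (rule ex_cong1) (use N_aleph_seq(2) in auto)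
    finally show ?thesis unfolding ck_omega N_ck[of _ omega] by blast
  qed
  have "(\<exists>n. N n N.omega & N z (N.app f n)) \<longleftrightarrow> N z (ck lamb)" if f: "N.aleph_seq f" for f z
    unfolding lamb using N.aleph_seq_unique[OF f N_aleph_seq(1)] by auto
  then have "(\<exists>f. N.aleph_seq f & (\<forall>z. N z b \<longleftrightarrow> (\<exists>n. N n N.omega & N z (N.app f n)))) \<longleftrightarrow> (\<forall>z. N z b \<longleftrightarrow> N z (ck lamb))" for b
    using N_aleph_seq(1) by blast
  then show ?thesis unfolding N.S_AlephOmega[OF assms] N.set_ext by blast
qed

theorem sat_AlephOmegaLeastNotInU: "sat N d (sentence AlephOmegaLeastNotInU)"
proof -
  have "\<exists>U. N.uniform U k" if k: "N.InfCard k" "N k (ck lamb)" for k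
  proof -
    obtain x where x: "x \<E> lamb" "k = ck x" using k(2) unfolding N_ck by blast
    then obtain n where "n \<E> omega" "x = al n" using InfCard_below_lamb[of x] ck_InfCard k(1) by blast
    then show ?thesis using uniform_al x(2) by blast
  qed
  then show ?thesis
    unfolding S_sentence[of N d _ d] AlephOmegaLeastNotInU_def LeastCardinalNotInU_def
    using N_InfCard_lamb not_uniform_lamb by (simp add: S_simps N_AlephOmega)
qed

theorem sat_SingularsAboveAlephOmegaInU: "sat N d (sentence SingularsAboveAlephOmegaInU)"
  unfolding S_sentence[of N d _ d] SingularsAboveAlephOmegaInU_def SingularCardinal_def S_simps
proof (intro allI impI, elim conjE)
  fix a k :: nat and e
  let ?e = "d(0 := a, Suc 0 := k)"
  assume a: "S N d (Suc (Suc 0)) ?e (AlephOmega 0)" "S N d (Suc (Suc 0)) ?e (0 \<^bold>\<in> Suc 0)"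
    and k: "S N d (Suc (Suc 0)) ?e (Cardinal (Suc 0))" "S N d (Suc (Suc 0)) ?e (CountableCofinality (Suc 0))"
  have "a = ck lamb" "N a k" "N.InfCard k" using a k(1) by (simp_all add: N_AlephOmega S_mem)
  moreover obtain f where "!!n. N n N.omega ==> N (N.app f n) k"
      "!!x. N x k ==> \<exists>n. N n N.omega & (x = N.app f n \<or> N x (N.app f n))"
    using N.S_CountableCofinality[OF _ k(2)] by auto
  ultimately show "S N d (Suc (Suc 0)) ?e (InU (Suc 0))" using uniform_cof_omega[of k f] by simp
qed

end

theorem theorem1p5:
  assumes "consistent (ZFC \<union> {sentence GCH, sentence ExistsStronglyCompact})"
  shows "consistent (ZF \<union> {sentence AlephOmegaLeastNotInU, sentence SingularsAboveAlephOmegaInU})"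
proof -
  let ?T = "ZFC \<union> {sentence GCH, sentence ExistsStronglyCompact}"
  have "infinite_theory ?T" by (rule infinite_theory_ZF) (auto simp: ZFC_def)
  then obtain E :: "nat => nat => bool" and e where E: "!!A. A \<in> ?T ==> sat E e A" using model_existence assms by blast
  have "zf E" by (rule zf_of_model[of E e]) (use E in \<open>auto simp: ZFC_def\<close>)
  then interpret zf E .
  have S: "S E e 0 e Choice" "S E e 0 e GCH" "S E e 0 e ExistsStronglyCompact"
    using E unfolding S_sentence[symmetric] ZFC_def by blast+
  obtain k where k: "InfCard k" "E omega k"
    "\<forall>s F. pfilter F s & complete k F --> (\<exists>U. sub F U & ultra U s & complete k U)"
    using S(3) unfolding S_StronglyCompact by blast
  have g: "ground E k"
  proof unfold_locales
    fix a assume "!!x. E x a ==> \<exists>z. E z x"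
    then have "\<forall>x. E x a --> x \<noteq> zero" using eq_zero by blast
    then show "\<exists>f. fn f a & (\<forall>x. E x a --> E (app f x) x)" using S(1) unfolding S_Choice by blast
  next
    fix k assume "InfCard k"
    then show "\<exists>m. InfCard m & E k m & (\<forall>n. InfCard n --> E k n --> sub m n) & eqv (Pw k) m"
      using S(2) unfolding S_GCH succ_card_def by blast
  qed (use k in blast)+
  then interpret ground E k .
  \<comment> \<open>The model lives on the natural numbers, so the identity enumerates it and a
    generic filter exists.\<close>
  obtain G v N where "symext E PP Gs Ss zero idg (%q p. sub p q) fx ml ac G v N"
    using forcing.symext_exists[OF forcing_PP, of id] by auto
  then have "extension E k G v N" by (rule extension.intro[OF g extension_axioms.intro])
  then interpret extension E k G v N .
  show ?thesis
    by (rule modelD_consistent[of _ N undefined])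
      (use sat_ZF sat_AlephOmegaLeastNotInU sat_SingularsAboveAlephOmegaInU in blast)
qed

end
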